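(* Let $R$ be a noetherian ring which is a finite module over its centre $Z(R)$. Let $P$ be a prime ideal of $R$ and let $\mathfrak{p}=P\cap Z(R)$. (i) $G(\mathfrak{p},R)\leq\min\{j_R^\ell(R/P),j_R^r(R/P)\}$. (ii) Suppose that $P$ is a maximal ideal of $R$. There exists a maximal ideal $Q$ of $R$ with $Q\cap Z(R)=\mathfrak{p}$ and $G(\mathfrak{p},R)=j_R^\ell(R/Q)$. Similarly, there exists a maximal ideal $Q'$ of $R$ with $Q'\cap Z(R)=\mathfrak{p}$ and $G(\mathfrak{p},R)=j_R^r(R/Q')$. For the remainder, assume that $R$ is $Z(R)$-Macaulay. (iii) There exists a prime ideal $Q$ of $R$ with $Q\cap Z(R)=\mathfrak{p}$ and $G(\mathfrak{p},R)=j_R^\ell(R/Q)$. Similarly, there exists a prime ideal $Q'$ of $R$ with $Q'\cap Z(R)=\mathfrak{p}$ and $G(\mathfrak{p},R)=j_R^r(R/Q')$. (iv) Let $Q$ be any prime ideal of $R$, with $\mathfrak{q}:=Q\cap Z(R)$, for which $t:=G(\mathfrak{q},R)=j_R^\ell(R/Q)$. Then $\mathrm{Ext}^t_R(R/Q,R)$ (Ext of left modules) is a torsion-free $Z(R)/\mathfrak{q}$-module. (v) Let $Q$ be a prime ideal of $R$, with $\mathfrak{q}:=Q\cap Z(R)$, and $t:=G(\mathfrak{q},R)$. Let $B$ be a non-zero finitely generated torsion-free left $R/Q$-module. Then $j_R^\ell(B)=t$ if and only if $j_R^\ell(R/Q)=t$. A similar statement applies to $j_R^r$ when $B$ is a right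 module.
   Context: Rings are associative with $1$. Let $R$ be a noetherian ring that is a finite module over its centre $Z(R)$. For a right $R$-module $M$, $j_R^r(M)=\min\{i:\mathrm{Ext}^i_R(M,R_R)\neq 0\}$, or $\infty$ if no such $i$ exists; $j_R^\ell$ is defined analogously for left modules. A $Z(R)$-sequence on $R$ is a sequence $x_1,\dots,x_t$ in $Z(R)$ with $\sum_i x_iR\neq R$ such that $x_i$ is a non-zero-divisor on $R/\sum_{j<i}x_jR$ for each $i$. For an ideal $\mathfrak{i}$ of $Z(R)$, $G(\mathfrak{i},R)=G_{Z(R)}(\mathfrak{i},R)$ is the length of a maximal $Z(R)$-sequence on $R$ contained in $\mathfrak{i}$. $R$ is $Z(R)$-Macaulay if it is a maximal Cohen-Macaulay $Z(R)$-module, i.e. $G_{Z(R)}(\mathfrak{m},R)=\mathrm{Kdim}(R_{\mathfrak{m}})=\mathrm{Kdim}(Z(R)_{\mathfrak{m}})$ for every maximal ideal $\mathfrak{m}$ of $Z(R)$ ($\mathrm{Kdim}$ is Krull dimension). *)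

theory Defs
  imports "HOL-Algebra.Module" "HOL-Algebra.QuotRing" "HOL-Algebra.Ideal_Product"
    "HOL-Library.FSet" "HOL-Library.Extended_Nat"
begin

section \<open>Modules over noncommutative rings\<close>

text \<open>The library locale \<^locale>\<open>module\<close> demands a commutative ring of scalars; here the scalars
  form an arbitrary ring.  The record \<^type>\<open>module\<close> extends the ring record, so modules carry
  dummy fields \<open>mult\<close> and \<open>one\<close>; these play no role.\<close>

locale left_module = R?: ring R + M?: abelian_group M
  for R :: "('a, 'm) ring_scheme" (structure) and M :: "('a, 'b, 'n) module_scheme" (structure) +
  assumes smult_closed [simp, intro]:
      "\<lbrakk>a \<in> carrier R; x \<in> carrier M\<rbrakk> \<Longrightarrow> a \<odot>\<^bsub>M\<^esub> x \<in> carrier M"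
    and smult_l_distr:
      "\<lbrakk>a \<in> carrier R; b \<in> carrier R; x \<in> carrier M\<rbrakk> \<Longrightarrow>
        (a \<oplus>\<^bsub>R\<^esub> b) \<odot>\<^bsub>M\<^esub> x = a \<odot>\<^bsub>M\<^esub> x \<oplus>\<^bsub>M\<^esub> b \<odot>\<^bsub>M\<^esub> x"
    and smult_r_distr:
      "\<lbrakk>a \<in> carrier R; x \<in> carrier M; y \<in> carrier M\<rbrakk> \<Longrightarrow>
        a \<odot>\<^bsub>M\<^esub> (x \<oplus>\<^bsub>M\<^esub> y) = a \<odot>\<^bsub>M\<^esub> x \<oplus>\<^bsub>M\<^esub> a \<odot>\<^bsub>M\<^esub> y"
    and smult_assoc1:
      "\<lbrakk>a \<in> carrier R; b \<in> carrier R; x \<in> carrier M\<rbrakk> \<Longrightarrow>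
        (a \<otimes>\<^bsub>R\<^esub> b) \<odot>\<^bsub>M\<^esub> x = a \<odot>\<^bsub>M\<^esub> (b \<odot>\<^bsub>M\<^esub> x)"
    and smult_one [simp]:
      "x \<in> carrier M \<Longrightarrow> \<one>\<^bsub>R\<^esub> \<odot>\<^bsub>M\<^esub> x = x"

text \<open>Right \<open>R\<close>-modules are treated throughout as left modules over the opposite ring:
  \<open>r \<odot> x\<close> then stands for \<open>x \<cdot> r\<close>.\<close>

definition opp_ring :: "('a, 'm) ring_scheme \<Rightarrow> ('a, 'm) ring_scheme" where
  "opp_ring R = R\<lparr>mult := (\<lambda>x y. y \<otimes>\<^bsub>R\<^esub> x)\<rparr>"

definition reg_module :: "('a, 'm) ring_scheme \<Rightarrow> ('a, 'a) module" where
  "reg_module R = \<lparr>carrier = carrier R, mult = mult R, one = \<one>\<^bsub>R\<^esub>,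
     zero = \<zero>\<^bsub>R\<^esub>, add = add R, smult = mult R\<rparr>"

definition quot_module :: "('a, 'b) module \<Rightarrow> 'b set \<Rightarrow> ('a, 'b set) module" where
  "quot_module M N = \<lparr>carrier = a_rcosets\<^bsub>M\<^esub> N, mult = undefined, one = undefined,
     zero = N, add = set_add M, smult = (\<lambda>r A. \<Union>a\<in>A. N +>\<^bsub>M\<^esub> (r \<odot>\<^bsub>M\<^esub> a))\<rparr>"

definition restrict_scalars :: "('r \<Rightarrow> 's) \<Rightarrow> ('s, 'b) module \<Rightarrow> ('r, 'b) module" where
  "restrict_scalars \<phi> M = \<lparr>carrier = carrier M, mult = mult M, one = \<one>\<^bsub>M\<^esub>,
     zero = \<zero>\<^bsub>M\<^esub>, add = add M, smult = (\<lambda>r. smult M (\<phi> r))\<rparr>"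

text \<open>A module annihilated by an ideal \<open>I\<close>, as a module over the quotient by \<open>I\<close>: a coset acts through
  any of its representatives (all of which act alike).\<close>

definition descend_scalars :: "('a, 'b) module \<Rightarrow> ('a set, 'b) module" where
  "descend_scalars M = \<lparr>carrier = carrier M, mult = mult M, one = \<one>\<^bsub>M\<^esub>,
     zero = \<zero>\<^bsub>M\<^esub>, add = add M, smult = (\<lambda>A x. the_elem ((\<lambda>a. a \<odot>\<^bsub>M\<^esub> x) ` A))\<rparr>"

definition module_span :: "('a, 'm) ring_scheme \<Rightarrow> ('a, 'b) module \<Rightarrow> 'b set \<Rightarrow> 'b set" where
  "module_span R M A = \<Inter>{N. submodule N R M \<and> A \<subseteq> N}"

definition finitely_generated :: "('a, 'm) ring_scheme \<Rightarrow> ('a, 'b) module \<Rightarrow> bool" where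
  "finitely_generated R M \<longleftrightarrow> (\<exists>A \<subseteq> carrier M. finite A \<and> module_span R M A = carrier M)"

definition noetherian_module :: "('a, 'm) ring_scheme \<Rightarrow> ('a, 'b) module \<Rightarrow> bool" where
  "noetherian_module R M \<longleftrightarrow> left_module R M \<and>
     (\<forall>N. submodule N R M \<longrightarrow> (\<exists>A \<subseteq> N. finite A \<and> module_span R M A = N))"

definition regular_element :: "('a, 'm) ring_scheme \<Rightarrow> 'a \<Rightarrow> bool" where
  "regular_element R s \<longleftrightarrow> s \<in> carrier R \<and>
     (\<forall>r\<in>carrier R. (s \<otimes>\<^bsub>R\<^esub> r = \<zero>\<^bsub>R\<^esub> \<longrightarrow> r = \<zero>\<^bsub>R\<^esub>) \<and> (r \<otimes>\<^bsub>R\<^esub> s = \<zero>\<^bsub>R\<^esub> \<longrightarrow> r = \<zero>\<^bsub>R\<^esub>))"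

definition torsion_free_module :: "('a, 'm) ring_scheme \<Rightarrow> ('a, 'b) module \<Rightarrow> bool" where
  "torsion_free_module R M \<longleftrightarrow> left_module R M \<and>
     (\<forall>s x. regular_element R s \<longrightarrow> x \<in> carrier M \<longrightarrow> s \<odot>\<^bsub>M\<^esub> x = \<zero>\<^bsub>M\<^esub> \<longrightarrow> x = \<zero>\<^bsub>M\<^esub>)"


section \<open>Noetherian rings, centre, prime ideals\<close>

text \<open>The library locale \<open>noetherian_ring\<close> is about two-sided ideals only, which is too weak for
  noncommutative rings.\<close>

definition noetherian :: "('a, 'm) ring_scheme \<Rightarrow> bool" where
  "noetherian R \<longleftrightarrow> noetherian_module R (reg_module R)
     \<and> noetherian_module (opp_ring R) (reg_module (opp_ring R))"

definition centre :: "('a, 'm) ring_scheme \<Rightarrow> 'a set" where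
  "centre R = {z \<in> carrier R. \<forall>x\<in>carrier R. z \<otimes>\<^bsub>R\<^esub> x = x \<otimes>\<^bsub>R\<^esub> z}"

definition centre_ring :: "('a, 'm) ring_scheme \<Rightarrow> ('a, 'm) ring_scheme" where
  "centre_ring R = R\<lparr>carrier := centre R\<rparr>"

definition finite_over_centre :: "('a, 'm) ring_scheme \<Rightarrow> bool" where
  "finite_over_centre R \<longleftrightarrow> finitely_generated (centre_ring R) (reg_module R)"

text \<open>The library locale \<^locale>\<open>primeideal\<close> is for commutative rings.  In contrast,
  \<^locale>\<open>maximalideal\<close> is about two-sided ideals of arbitrary rings and is used as it stands.\<close>

definition prime_ideal :: "'a set \<Rightarrow> ('a, 'm) ring_scheme \<Rightarrow> bool" where
  "prime_ideal P R \<longleftrightarrow> ideal P R \<and> P \<noteq> carrier R \<and>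
     (\<forall>I J. ideal I R \<longrightarrow> ideal J R \<longrightarrow> ideal_prod R I J \<subseteq> P \<longrightarrow> I \<subseteq> P \<or> J \<subseteq> P)"

definition Kdim :: "('a, 'm) ring_scheme \<Rightarrow> enat" where
  "Kdim R = Sup {enat n | n. \<exists>C :: nat \<Rightarrow> 'a set.
     (\<forall>i\<le>n. prime_ideal (C i) R) \<and> (\<forall>i<n. C i \<subset> C (Suc i))}"


section \<open>Central localisation\<close>

text \<open>Here \<open>S\<close> is a multiplicatively closed set of central elements; \<open>fraction R S a s\<close> is the fraction
  \<open>s\<^sup>-\<^sup>1 a\<close>, a class of pairs.\<close>

definition fraction :: "('a, 'm) ring_scheme \<Rightarrow> 'a set \<Rightarrow> 'a \<Rightarrow> 'a \<Rightarrow> ('a \<times> 'a) set" where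
  "fraction R S a s = {(b, t). b \<in> carrier R \<and> t \<in> S \<and>
     (\<exists>u\<in>S. u \<otimes>\<^bsub>R\<^esub> (t \<otimes>\<^bsub>R\<^esub> a) = u \<otimes>\<^bsub>R\<^esub> (s \<otimes>\<^bsub>R\<^esub> b))}"

definition localisation :: "('a, 'm) ring_scheme \<Rightarrow> 'a set \<Rightarrow> ('a \<times> 'a) set ring" where
  "localisation R S = \<lparr>carrier = {fraction R S a s | a s. a \<in> carrier R \<and> s \<in> S},
     mult = (\<lambda>X Y. \<Union>(a, s)\<in>X. \<Union>(b, t)\<in>Y. fraction R S (a \<otimes>\<^bsub>R\<^esub> b) (s \<otimes>\<^bsub>R\<^esub> t)),
     one = fraction R S \<one>\<^bsub>R\<^esub> \<one>\<^bsub>R\<^esub>,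
     zero = fraction R S \<zero>\<^bsub>R\<^esub> \<one>\<^bsub>R\<^esub>,
     add = (\<lambda>X Y. \<Union>(a, s)\<in>X. \<Union>(b, t)\<in>Y.
       fraction R S ((t \<otimes>\<^bsub>R\<^esub> a) \<oplus>\<^bsub>R\<^esub> (s \<otimes>\<^bsub>R\<^esub> b)) (s \<otimes>\<^bsub>R\<^esub> t))\<rparr>"


section \<open>Central sequences and the Macaulay property\<close>

fun sum_xR :: "('a, 'm) ring_scheme \<Rightarrow> 'a list \<Rightarrow> 'a set" where
  "sum_xR R [] = {\<zero>\<^bsub>R\<^esub>}"
| "sum_xR R (x # xs) = {x \<otimes>\<^bsub>R\<^esub> r \<oplus>\<^bsub>R\<^esub> y | r y. r \<in> carrier R \<and> y \<in> sum_xR R xs}"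

definition centre_sequence :: "('a, 'm) ring_scheme \<Rightarrow> 'a list \<Rightarrow> bool" where
  "centre_sequence R xs \<longleftrightarrow> set xs \<subseteq> centre R \<and> sum_xR R xs \<noteq> carrier R \<and>
     (\<forall>i<length xs. \<forall>r\<in>carrier R.
        xs ! i \<otimes>\<^bsub>R\<^esub> r \<in> sum_xR R (take i xs) \<longrightarrow> r \<in> sum_xR R (take i xs))"

definition maximal_centre_sequence :: "('a, 'm) ring_scheme \<Rightarrow> 'a set \<Rightarrow> 'a list \<Rightarrow> bool" where
  "maximal_centre_sequence R I xs \<longleftrightarrow> centre_sequence R xs \<and> set xs \<subseteq> I \<and>
     (\<forall>x\<in>I. \<not> centre_sequence R (xs @ [x]))"

text \<open>Well defined when \<open>R\<close> is noetherian and finite over its centre and \<open>I\<close> is a proper ideal of the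
  centre: maximal sequences in \<open>I\<close> then exist and all have the same length.\<close>

definition centre_grade :: "'a set \<Rightarrow> ('a, 'm) ring_scheme \<Rightarrow> nat" where
  "centre_grade I R = (THE n. \<exists>xs. maximal_centre_sequence R I xs \<and> length xs = n)"

definition centre_Macaulay :: "('a, 'm) ring_scheme \<Rightarrow> bool" where
  "centre_Macaulay R \<longleftrightarrow> (\<forall>m. maximalideal m (centre_ring R) \<longrightarrow>
     enat (centre_grade m R) = Kdim (localisation R (centre R - m)) \<and>
     enat (centre_grade m R) = Kdim (localisation (centre_ring R) (centre R - m)))"


section \<open>Ext and grade\<close>

definition free_module :: "('a, 'm) ring_scheme \<Rightarrow> 'g set \<Rightarrow> ('a, 'g \<Rightarrow> 'a) module" where
  "free_module R X = \<lparr>carrier = {f. finite {g. f g \<noteq> \<zero>\<^bsub>R\<^esub>} \<and> {g. f g \<noteq> \<zero>\<^bsub>R\<^esub>} \<subseteq> X \<and> range f \<subseteq> carrier R},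
     mult = undefined, one = undefined, zero = (\<lambda>_. \<zero>\<^bsub>R\<^esub>),
     add = (\<lambda>f h g. f g \<oplus>\<^bsub>R\<^esub> h g), smult = (\<lambda>r f g. r \<otimes>\<^bsub>R\<^esub> f g)\<rparr>"

definition lin_ext ::
    "('a, 'm) ring_scheme \<Rightarrow> ('a, 'b) module \<Rightarrow> ('g \<Rightarrow> 'b) \<Rightarrow> ('g \<Rightarrow> 'a) \<Rightarrow> 'b" where
  "lin_ext R M \<phi> f = (\<Oplus>\<^bsub>M\<^esub>g\<in>{g. f g \<noteq> \<zero>\<^bsub>R\<^esub>}. f g \<odot>\<^bsub>M\<^esub> \<phi> g)"

text \<open>The standard free resolution \<open>\<dots> \<rightarrow> F 1 \<rightarrow> F 0 \<rightarrow> M \<rightarrow> 0\<close>: \<open>F 0\<close> is free on the set of all elements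
  of \<open>M\<close>, and \<open>F (n + 1)\<close> is free on the set of all elements of the kernel of the map leaving \<open>F n\<close>.
  The recursive datatype only serves to have the bases of all \<open>F n\<close> in a single type: \<open>Elem\<close>
  labels elements of \<open>M\<close>, and \<open>Syz\<close> labels a finitely supported function by its finite graph.\<close>

datatype ('a, 'b) gen = Elem (elem_of: 'b) | Syz "(('a, 'b) gen \<times> 'a) fset"

definition encode :: "('a, 'm) ring_scheme \<Rightarrow> (('a, 'b) gen \<Rightarrow> 'a) \<Rightarrow> ('a, 'b) gen" where
  "encode R f = Syz (Abs_fset {(g, f g) | g. f g \<noteq> \<zero>\<^bsub>R\<^esub>})"

definition decode :: "('a, 'm) ring_scheme \<Rightarrow> ('a, 'b) gen \<Rightarrow> ('a, 'b) gen \<Rightarrow> 'a" where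
  "decode R = the_inv_into {f. finite {g. f g \<noteq> \<zero>\<^bsub>R\<^esub>}} (encode R)"

fun std_basis :: "('a, 'm) ring_scheme \<Rightarrow> ('a, 'b) module \<Rightarrow> nat \<Rightarrow> ('a, 'b) gen set" where
  "std_basis R M 0 = Elem ` carrier M"
| "std_basis R M (Suc 0) = encode R ` {f \<in> carrier (free_module R (std_basis R M 0)).
     lin_ext R M elem_of f = \<zero>\<^bsub>M\<^esub>}"
| "std_basis R M (Suc (Suc n)) = encode R ` {f \<in> carrier (free_module R (std_basis R M (Suc n))).
     lin_ext R (free_module R (std_basis R M n)) (decode R) f = (\<lambda>_. \<zero>\<^bsub>R\<^esub>)}"

definition std_res ::
    "('a, 'm) ring_scheme \<Rightarrow> ('a, 'b) module \<Rightarrow> nat \<Rightarrow> ('a, ('a, 'b) gen \<Rightarrow> 'a) module" where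
  "std_res R M n = free_module R (std_basis R M n)"

definition std_diff :: "('a, 'm) ring_scheme \<Rightarrow> ('a, 'b) module \<Rightarrow> nat \<Rightarrow>
    (('a, 'b) gen \<Rightarrow> 'a) \<Rightarrow> (('a, 'b) gen \<Rightarrow> 'a)" where
  "std_diff R M n = lin_ext R (std_res R M n) (decode R)"

definition std_aug :: "('a, 'm) ring_scheme \<Rightarrow> ('a, 'b) module \<Rightarrow> (('a, 'b) gen \<Rightarrow> 'a) \<Rightarrow> 'b" where
  "std_aug R M = lin_ext R M elem_of"

text \<open>Homomorphisms are taken extensional, so that equality in the Hom-group is equality on the
  source module.  The scalar action on values is an action of the centre of \<open>R\<close>.\<close>

definition hom_module ::
    "('a, 'm) ring_scheme \<Rightarrow> ('a, 'b) module \<Rightarrow> ('a, 'c) module \<Rightarrow> ('a, 'b \<Rightarrow> 'c) module" where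
  "hom_module R M N = \<lparr>carrier = {f \<in> carrier M \<rightarrow>\<^sub>E carrier N.
       (\<forall>x\<in>carrier M. \<forall>y\<in>carrier M. f (x \<oplus>\<^bsub>M\<^esub> y) = f x \<oplus>\<^bsub>N\<^esub> f y) \<and>
       (\<forall>r\<in>carrier R. \<forall>x\<in>carrier M. f (r \<odot>\<^bsub>M\<^esub> x) = r \<odot>\<^bsub>N\<^esub> f x)},
     mult = undefined, one = undefined, zero = (\<lambda>x\<in>carrier M. \<zero>\<^bsub>N\<^esub>),
     add = (\<lambda>f g. \<lambda>x\<in>carrier M. f x \<oplus>\<^bsub>N\<^esub> g x),
     smult = (\<lambda>z f. \<lambda>x\<in>carrier M. z \<odot>\<^bsub>N\<^esub> f x)\<rparr>"

text \<open>Cohomology of \<open>Hom\<^sub>R(F, N)\<close> in degree \<open>n\<close>, for a complex with maps \<open>d n : F (n + 1) \<rightarrow> F n\<close>.\<close>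

definition cocycles :: "('a, 'm) ring_scheme \<Rightarrow> (nat \<Rightarrow> ('a, 'b) module) \<Rightarrow> (nat \<Rightarrow> 'b \<Rightarrow> 'b) \<Rightarrow>
    ('a, 'c) module \<Rightarrow> nat \<Rightarrow> ('b \<Rightarrow> 'c) set" where
  "cocycles R F d N n =
     {f \<in> carrier (hom_module R (F n) N). \<forall>x\<in>carrier (F (Suc n)). f (d n x) = \<zero>\<^bsub>N\<^esub>}"

fun coboundaries :: "('a, 'm) ring_scheme \<Rightarrow> (nat \<Rightarrow> ('a, 'b) module) \<Rightarrow> (nat \<Rightarrow> 'b \<Rightarrow> 'b) \<Rightarrow>
    ('a, 'c) module \<Rightarrow> nat \<Rightarrow> ('b \<Rightarrow> 'c) set" where
  "coboundaries R F d N 0 = {\<zero>\<^bsub>hom_module R (F 0) N\<^esub>}"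
| "coboundaries R F d N (Suc n) =
     (\<lambda>g. \<lambda>x\<in>carrier (F (Suc n)). g (d n x)) ` carrier (hom_module R (F n) N)"

definition hom_cohomology :: "('a, 'm) ring_scheme \<Rightarrow> (nat \<Rightarrow> ('a, 'b) module) \<Rightarrow> (nat \<Rightarrow> 'b \<Rightarrow> 'b) \<Rightarrow>
    ('a, 'c) module \<Rightarrow> nat \<Rightarrow> ('a, ('b \<Rightarrow> 'c) set) module" where
  "hom_cohomology R F d N n =
     quot_module ((hom_module R (F n) N)\<lparr>carrier := cocycles R F d N n\<rparr>) (coboundaries R F d N n)"

text \<open>\<open>Ext\<^sup>n\<^sub>R(M, N)\<close>, a module over the centre of \<open>R\<close>.\<close>

definition Ext :: "('a, 'm) ring_scheme \<Rightarrow> ('a, 'b) module \<Rightarrow> ('a, 'c) module \<Rightarrow> nat \<Rightarrow>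
    ('a, ((('a, 'b) gen \<Rightarrow> 'a) \<Rightarrow> 'c) set) module" where
  "Ext R M N n = hom_cohomology R (std_res R M) (std_diff R M) N n"

text \<open>The infimum of the empty set in \<^typ>\<open>enat\<close> is \<open>\<infinity>\<close>.\<close>

definition left_grade :: "('a, 'm) ring_scheme \<Rightarrow> ('a, 'b) module \<Rightarrow> enat" where
  "left_grade R M = Inf {enat i | i.
     carrier (Ext R M (reg_module R) i) \<noteq> {\<zero>\<^bsub>Ext R M (reg_module R) i\<^esub>}}"

definition right_grade :: "('a, 'm) ring_scheme \<Rightarrow> ('a, 'b) module \<Rightarrow> enat" where
  "right_grade R M = left_grade (opp_ring R) M"

definition left_quot :: "('a, 'm) ring_scheme \<Rightarrow> 'a set \<Rightarrow> ('a, 'a set) module" where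
  "left_quot R P = quot_module (reg_module R) P"

definition right_quot :: "('a, 'm) ring_scheme \<Rightarrow> 'a set \<Rightarrow> ('a, 'a set) module" where
  "right_quot R P = quot_module (reg_module (opp_ring R)) P"


section \<open>Exactness of the standard resolution\<close>

lemma ring_opp_ring: fixes R (structure) assumes "ring R" shows "ring (opp_ring R)"
proof -
  interpret ring R by fact
  show ?thesis
  proof (rule ringI)
    show "abelian_group (opp_ring R)"
    proof (rule abelian_groupI)
      fix x assume "x \<in> carrier (opp_ring R)"
      then show "\<exists>y\<in>carrier (opp_ring R). y \<oplus>\<^bsub>opp_ring R\<^esub> x = \<zero>\<^bsub>opp_ring R\<^esub>"
        by (intro bexI[of _ "\<ominus> x"]) (auto simp: opp_ring_def l_neg)
    qed (auto simp: opp_ring_def a_ac)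
    show "Group.monoid (opp_ring R)"
      by (rule monoidI) (auto simp: opp_ring_def m_assoc)
  qed (auto simp: opp_ring_def l_distr r_distr)
qed

lemma left_moduleI:
  fixes R (structure) and M (structure)
  assumes "ring R" "abelian_group M"
    and "\<And>a x. \<lbrakk>a \<in> carrier R; x \<in> carrier M\<rbrakk> \<Longrightarrow> a \<odot>\<^bsub>M\<^esub> x \<in> carrier M"
    "\<And>a b x. \<lbrakk>a \<in> carrier R; b \<in> carrier R; x \<in> carrier M\<rbrakk> \<Longrightarrow>
        (a \<oplus>\<^bsub>R\<^esub> b) \<odot>\<^bsub>M\<^esub> x = a \<odot>\<^bsub>M\<^esub> x \<oplus>\<^bsub>M\<^esub> b \<odot>\<^bsub>M\<^esub> x"
    "\<And>a x y. \<lbrakk>a \<in> carrier R; x \<in> carrier M; y \<in> carrier M\<rbrakk> \<Longrightarrow>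
        a \<odot>\<^bsub>M\<^esub> (x \<oplus>\<^bsub>M\<^esub> y) = a \<odot>\<^bsub>M\<^esub> x \<oplus>\<^bsub>M\<^esub> a \<odot>\<^bsub>M\<^esub> y"
    "\<And>a b x. \<lbrakk>a \<in> carrier R; b \<in> carrier R; x \<in> carrier M\<rbrakk> \<Longrightarrow>
        (a \<otimes>\<^bsub>R\<^esub> b) \<odot>\<^bsub>M\<^esub> x = a \<odot>\<^bsub>M\<^esub> (b \<odot>\<^bsub>M\<^esub> x)"
    "\<And>x. x \<in> carrier M \<Longrightarrow> \<one>\<^bsub>R\<^esub> \<odot>\<^bsub>M\<^esub> x = x"
  shows "left_module R M"
  using assms by (auto simp: left_module_def left_module_axioms_def)

lemma reg_module_left_module: fixes R (structure) assumes "ring R" shows "left_module R (reg_module R)"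
proof -
  interpret ring R by fact
  have "abelian_group (reg_module R)"
  proof (rule abelian_groupI)
    fix x assume "x \<in> carrier (reg_module R)"
    then show "\<exists>y\<in>carrier (reg_module R). y \<oplus>\<^bsub>reg_module R\<^esub> x = \<zero>\<^bsub>reg_module R\<^esub>"
      by (intro bexI[of _ "\<ominus> x"]) (auto simp: reg_module_def l_neg)
  qed (auto simp: reg_module_def a_ac)
  then show ?thesis
    by (rule left_moduleI[OF ring_axioms]) (auto simp: reg_module_def l_distr r_distr m_assoc)
qed

lemma quot_module_left_module:
  assumes "left_module R M" "submodule N R M"
  shows "left_module R (quot_module M N)"
proof -
  interpret M: left_module R M by fact
  interpret N: submodule N R M by fact
  have add_sub: "additive_subgroup N M"
    by (simp add: N.subgroup_axioms additive_subgroup.intro)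
  interpret A: abelian_subgroup N M
    by (rule abelian_subgroupI3[OF add_sub]) (rule M.M.abelian_group_axioms)
  have NM: "N \<subseteq> carrier M" using N.subset by simp
  have n: "N \<lhd> add_monoid M" by (simp add: A.a_normal)
  have smul: "(\<Union>a\<in>N +>\<^bsub>M\<^esub> x. N +>\<^bsub>M\<^esub> (r \<odot>\<^bsub>M\<^esub> a)) = N +>\<^bsub>M\<^esub> (r \<odot>\<^bsub>M\<^esub> x)"
    if "r \<in> carrier R" "x \<in> carrier M" for r x
  proof -
    have "N +>\<^bsub>M\<^esub> (r \<odot>\<^bsub>M\<^esub> a) = N +>\<^bsub>M\<^esub> (r \<odot>\<^bsub>M\<^esub> x)" if a: "a \<in> N +>\<^bsub>M\<^esub> x" for a
    proof -
      from a obtain n where n: "n \<in> N" "a = n \<oplus>\<^bsub>M\<^esub> x" by (auto simp: a_r_coset_def')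
      then have "r \<odot>\<^bsub>M\<^esub> a = r \<odot>\<^bsub>M\<^esub> n \<oplus>\<^bsub>M\<^esub> r \<odot>\<^bsub>M\<^esub> x"
        using that NM \<open>r \<in> carrier R\<close> \<open>x \<in> carrier M\<close> by (simp add: M.smult_r_distr subsetD)
      then have "r \<odot>\<^bsub>M\<^esub> a \<in> N +>\<^bsub>M\<^esub> (r \<odot>\<^bsub>M\<^esub> x)"
        using N.smult_closed n(1) \<open>r \<in> carrier R\<close> by (auto simp: a_r_coset_def')
      then show ?thesis
        by (metis A.a_repr_independence' M.smult_closed \<open>r \<in> carrier R\<close> \<open>x \<in> carrier M\<close>)
    qed
    moreover have "x \<in> N +>\<^bsub>M\<^esub> x" using that by (simp add: A.a_rcos_self)
    ultimately show ?thesis by blast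
  qed
  have addc: "(N +>\<^bsub>M\<^esub> x) <+>\<^bsub>M\<^esub> (N +>\<^bsub>M\<^esub> y) = N +>\<^bsub>M\<^esub> (x \<oplus>\<^bsub>M\<^esub> y)"
    if "x \<in> carrier M" "y \<in> carrier M" for x y
    using that by (simp add: A.a_rcos_sum)
  have car: "A \<in> a_rcosets\<^bsub>M\<^esub> N \<longleftrightarrow> (\<exists>x\<in>carrier M. A = N +>\<^bsub>M\<^esub> x)" for A
    by (auto simp: A_RCOSETS_def' a_r_coset_def')
  have z: "N = N +>\<^bsub>M\<^esub> \<zero>\<^bsub>M\<^esub>"
    using NM by (simp add: A.a_rcos_const)
  have ab: "abelian_group (quot_module M N)"
  proof (rule abelian_groupI)
    fix x assume "x \<in> carrier (quot_module M N)"
    then obtain a where "a \<in> carrier M" "x = N +>\<^bsub>M\<^esub> a" by (auto simp: quot_module_def car)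
    then show "\<exists>y\<in>carrier (quot_module M N). y \<oplus>\<^bsub>quot_module M N\<^esub> x = \<zero>\<^bsub>quot_module M N\<^esub>"
      by (intro bexI[of _ "N +>\<^bsub>M\<^esub> (\<ominus>\<^bsub>M\<^esub> a)"]) (auto simp: quot_module_def car addc M.M.l_neg z[symmetric])
    show "\<zero>\<^bsub>quot_module M N\<^esub> \<oplus>\<^bsub>quot_module M N\<^esub> x = x"
      using \<open>a \<in> carrier M\<close> \<open>x = _\<close> 
      by (simp add: quot_module_def) (metis M.M.l_zero M.M.zero_closed addc z)
  next
    show "\<zero>\<^bsub>quot_module M N\<^esub> \<in> carrier (quot_module M N)"
      using z by (auto simp: quot_module_def car)
  qed (auto simp: quot_module_def car addc M.M.a_ac)
  have c: "x \<in> carrier (quot_module M N) \<longleftrightarrow> (\<exists>a\<in>carrier M. x = N +>\<^bsub>M\<^esub> a)" for x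
    by (auto simp: quot_module_def car)
  have sm: "r \<odot>\<^bsub>quot_module M N\<^esub> (N +>\<^bsub>M\<^esub> x) = N +>\<^bsub>M\<^esub> (r \<odot>\<^bsub>M\<^esub> x)"
    if "r \<in> carrier R" "x \<in> carrier M" for r x
    using smul[OF that] by (simp add: quot_module_def)
  have ad: "(N +>\<^bsub>M\<^esub> x) \<oplus>\<^bsub>quot_module M N\<^esub> (N +>\<^bsub>M\<^esub> y) = N +>\<^bsub>M\<^esub> (x \<oplus>\<^bsub>M\<^esub> y)"
    if "x \<in> carrier M" "y \<in> carrier M" for x y
    using addc[OF that] by (simp add: quot_module_def)
  show ?thesis
    apply (rule left_moduleI[OF M.R.ring_axioms ab])
    unfolding c
    by (auto simp: sm ad M.smult_l_distr M.smult_r_distr M.smult_assoc1)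
qed

lemma free_module_left_module:
  fixes R :: "('a,'m) ring_scheme" (structure) and X :: "'g set"
  assumes "ring R" shows "left_module R (free_module R X)"
proof -
  interpret ring R by fact
  have fin2: "finite {g. f g \<oplus> h g \<noteq> \<zero>}"
    if "finite {g. f g \<noteq> \<zero>}" "finite {g. h g \<noteq> \<zero>}" for f h :: "'g \<Rightarrow> 'a"
    by (rule finite_subset[of _ "{g. f g \<noteq> \<zero>} \<union> {g. h g \<noteq> \<zero>}"]) (use that in auto)
  have fin1: "finite {g. r \<otimes> f g \<noteq> \<zero>}"
    if "finite {g. f g \<noteq> \<zero>}" "r \<in> carrier R" for r and f :: "'g \<Rightarrow> 'a"
    by (rule finite_subset[of _ "{g. f g \<noteq> \<zero>}"]) (use that in auto)
  have inv: "{g. \<ominus> f g \<noteq> \<zero>} = {g. f g \<noteq> \<zero>}" if "range f \<subseteq> carrier R" for f :: "'g \<Rightarrow> 'a"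
  proof -
    have "f g \<in> carrier R" for g using that by auto
    then have "\<ominus> f g = \<zero> \<longleftrightarrow> f g = \<zero>" for g by (metis local.minus_minus minus_zero)
    then show ?thesis by simp
  qed
  have ab: "abelian_group (free_module R X)"
  proof (rule abelian_groupI)
    fix x assume x: "x \<in> carrier (free_module R X)"
    show "\<exists>y\<in>carrier (free_module R X). y \<oplus>\<^bsub>free_module R X\<^esub> x = \<zero>\<^bsub>free_module R X\<^esub>"
      by (rule bexI[of _ "\<lambda>g. \<ominus> x g"])
        (use x in \<open>auto simp: free_module_def inv l_neg image_subset_iff subset_iff\<close>)
  next
    fix x y assume "x \<in> carrier (free_module R X)" "y \<in> carrier (free_module R X)"
    then show "x \<oplus>\<^bsub>free_module R X\<^esub> y \<in> carrier (free_module R X)"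
    proof -
      assume "x \<in> carrier (free_module R X)" "y \<in> carrier (free_module R X)"
      then show ?thesis
        apply (simp add: free_module_def)
        apply (intro conjI)
          apply (rule fin2) apply simp apply simp
         apply (intro subsetI, rule ccontr)
         apply (subgoal_tac "x xa = \<zero> \<and> y xa = \<zero>")
          apply simp
         apply blast
        apply (simp add: image_subset_iff)
        done
    qed
  qed (auto simp: free_module_def image_subset_iff fun_eq_iff a_ac)
  show ?thesis
    apply (rule left_moduleI[OF ring_axioms ab])
    apply (auto simp: free_module_def fin1 image_subset_iff fun_eq_iff l_distr r_distr m_assoc)
    done
qed

lemma smult_zero_r:
  assumes "left_module R M" "r \<in> carrier R" shows "r \<odot>\<^bsub>M\<^esub> \<zero>\<^bsub>M\<^esub> = \<zero>\<^bsub>M\<^esub>"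
proof -
  interpret left_module R M by fact
  show ?thesis
    by (metis M.add.l_cancel_one M.l_zero M.zero_closed assms(2) smult_closed smult_r_distr)
qed

lemma lin_ext_superset:
  assumes "left_module R M" "\<phi> \<in> X \<rightarrow> carrier M" "f \<in> carrier (free_module R X)"
    "finite A" "{g. f g \<noteq> \<zero>\<^bsub>R\<^esub>} \<subseteq> A" "A \<subseteq> X"
  shows "lin_ext R M \<phi> f = (\<Oplus>\<^bsub>M\<^esub>g\<in>A. f g \<odot>\<^bsub>M\<^esub> \<phi> g)"
proof -
  interpret left_module R M by fact
  have z: "\<zero>\<^bsub>R\<^esub> \<odot>\<^bsub>M\<^esub> x = \<zero>\<^bsub>M\<^esub>" if "x \<in> carrier M" for x
  proof -
    have "\<zero>\<^bsub>R\<^esub> \<odot>\<^bsub>M\<^esub> x \<oplus>\<^bsub>M\<^esub> \<zero>\<^bsub>R\<^esub> \<odot>\<^bsub>M\<^esub> x = \<zero>\<^bsub>R\<^esub> \<odot>\<^bsub>M\<^esub> x"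
      using smult_l_distr[of "\<zero>\<^bsub>R\<^esub>" "\<zero>\<^bsub>R\<^esub>" x] that by simp
    then show ?thesis using that by (metis M.add.l_cancel_one R.zero_closed smult_closed)
  qed
  show ?thesis unfolding lin_ext_def
    apply (rule M.add.finprod_mono_neutral_cong_left)
    using assms by (auto simp: free_module_def z subset_iff Pi_iff)
qed

lemma lin_ext_closed:
  assumes "left_module R M" "\<phi> \<in> X \<rightarrow> carrier M" "f \<in> carrier (free_module R X)"
  shows "lin_ext R M \<phi> f \<in> carrier M"
proof -
  interpret left_module R M by fact
  show ?thesis unfolding lin_ext_def
    by (rule M.finsum_closed) (use assms in \<open>auto simp: free_module_def Pi_iff image_subset_iff subset_iff\<close>)
qed

lemma lin_ext_add:
  assumes "left_module R M" "\<phi> \<in> X \<rightarrow> carrier M" "f \<in> carrier (free_module R X)" "h \<in> carrier (free_module R X)"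
  shows "lin_ext R M \<phi> (f \<oplus>\<^bsub>free_module R X\<^esub> h) = lin_ext R M \<phi> f \<oplus>\<^bsub>M\<^esub> lin_ext R M \<phi> h"
proof -
  interpret left_module R M by fact
  interpret F: left_module R "free_module R X" by (rule free_module_left_module) unfold_locales
  let ?A = "{g. f g \<noteq> \<zero>\<^bsub>R\<^esub>} \<union> {g. h g \<noteq> \<zero>\<^bsub>R\<^esub>}"
  have A: "finite ?A" "?A \<subseteq> X" using assms by (auto simp: free_module_def)
  have fh: "f \<oplus>\<^bsub>free_module R X\<^esub> h \<in> carrier (free_module R X)" using assms by simp
  have s: "{g. (f \<oplus>\<^bsub>free_module R X\<^esub> h) g \<noteq> \<zero>\<^bsub>R\<^esub>} \<subseteq> ?A"
    by (auto simp: free_module_def)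
  show ?thesis
    apply (subst (1 2 3) lin_ext_superset[OF assms(1,2) _ A(1) _ A(2)])
    using assms fh s A apply (auto simp: )
    apply (subst M.finsum_addf[symmetric])
      apply (auto simp: free_module_def image_subset_iff Pi_iff subset_iff)
    apply (rule M.finsum_cong')
      apply (auto simp: smult_l_distr)
    done
qed

lemma lin_ext_smult:
  assumes "left_module R M" "\<phi> \<in> X \<rightarrow> carrier M" "f \<in> carrier (free_module R X)" "r \<in> carrier R"
  shows "lin_ext R M \<phi> (r \<odot>\<^bsub>free_module R X\<^esub> f) = r \<odot>\<^bsub>M\<^esub> lin_ext R M \<phi> f"
proof -
  interpret left_module R M by fact
  interpret F: left_module R "free_module R X" by (rule free_module_left_module) unfold_locales
  let ?A = "{g. f g \<noteq> \<zero>\<^bsub>R\<^esub>}"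
  have A: "finite ?A" "?A \<subseteq> X" using assms by (auto simp: free_module_def)
  have fh: "r \<odot>\<^bsub>free_module R X\<^esub> f \<in> carrier (free_module R X)" using assms by simp
  have s: "{g. (r \<odot>\<^bsub>free_module R X\<^esub> f) g \<noteq> \<zero>\<^bsub>R\<^esub>} \<subseteq> ?A"
    using assms by (auto simp: free_module_def)
  have zz: "r \<odot>\<^bsub>M\<^esub> \<zero>\<^bsub>M\<^esub> = \<zero>\<^bsub>M\<^esub>"
    by (metis M.add.l_cancel_one M.l_zero M.zero_closed assms(4) smult_closed smult_r_distr)
  have gen: "r \<odot>\<^bsub>M\<^esub> (\<Oplus>\<^bsub>M\<^esub>i\<in>B. k i) = (\<Oplus>\<^bsub>M\<^esub>i\<in>B. r \<odot>\<^bsub>M\<^esub> k i)" if "finite B" "k \<in> B \<rightarrow> carrier M" for B and k :: "'d \<Rightarrow> 'c"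
    using that by (induction B) (auto simp: zz Pi_iff smult_r_distr assms)
  show ?thesis
    apply (subst (1 2) lin_ext_superset[OF assms(1,2) _ A(1) _ A(2)])
    using assms fh s A apply auto
    apply (subst gen)
      apply (auto simp: free_module_def image_subset_iff Pi_iff subset_iff)
    apply (rule M.finsum_cong')
      apply (auto simp: smult_assoc1)
    done
qed

lemma lin_ext_single:
  assumes "left_module R M" "x \<in> X" "\<phi> x \<in> carrier M" "\<phi> \<in> X \<rightarrow> carrier M"
  shows "(\<lambda>g. if g = x then \<one>\<^bsub>R\<^esub> else \<zero>\<^bsub>R\<^esub>) \<in> carrier (free_module R X)"
    "lin_ext R M \<phi> (\<lambda>g. if g = x then \<one>\<^bsub>R\<^esub> else \<zero>\<^bsub>R\<^esub>) = \<phi> x"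
proof -
  interpret left_module R M by fact
  have "finite {g. (if g = x then \<one>\<^bsub>R\<^esub> else \<zero>\<^bsub>R\<^esub>) \<noteq> \<zero>\<^bsub>R\<^esub>}"
    by (rule finite_subset[of _ "{x}"]) auto
  then show a: "(\<lambda>g. if g = x then \<one>\<^bsub>R\<^esub> else \<zero>\<^bsub>R\<^esub>) \<in> carrier (free_module R X)"
    using assms by (auto simp: free_module_def)
  show "lin_ext R M \<phi> (\<lambda>g. if g = x then \<one>\<^bsub>R\<^esub> else \<zero>\<^bsub>R\<^esub>) = \<phi> x"
    by (subst lin_ext_superset[OF assms(1,4) a, of "{x}"]) (use assms in auto)
qed

lemma encode_inj: "inj_on (encode R) {f. finite {g. f g \<noteq> \<zero>\<^bsub>R\<^esub>}}"
proof (rule inj_onI)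
  fix f h assume a: "f \<in> {f. finite {g. f g \<noteq> \<zero>\<^bsub>R\<^esub>}}" "h \<in> {f. finite {g. f g \<noteq> \<zero>\<^bsub>R\<^esub>}}" "encode R f = encode R h"
  have "finite {(g, f g) | g. f g \<noteq> \<zero>\<^bsub>R\<^esub>}" "finite {(g, h g) | g. h g \<noteq> \<zero>\<^bsub>R\<^esub>}"
    using a(1,2) by (simp_all add: setcompr_eq_image)
  then have "{(g, f g) | g. f g \<noteq> \<zero>\<^bsub>R\<^esub>} = {(g, h g) | g. h g \<noteq> \<zero>\<^bsub>R\<^esub>}"
    using a(3) unfolding encode_def by (metis (no_types, lifting) Abs_fset_inverse gen.inject(2) mem_Collect_eq)
  then show "f = h" by (auto simp: fun_eq_iff set_eq_iff) metis
qed

lemma decode_encode: "finite {g. f g \<noteq> \<zero>\<^bsub>R\<^esub>} \<Longrightarrow> decode R (encode R f) = f"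
  unfolding decode_def by (rule the_inv_into_f_f[OF encode_inj]) auto

theorem std_res_exact:
  assumes "left_module R M"
  shows "std_aug R M ` carrier (std_res R M 0) = carrier M"
    "std_diff R M 0 ` carrier (std_res R M 1) = {f \<in> carrier (std_res R M 0). std_aug R M f = \<zero>\<^bsub>M\<^esub>}"
    "std_diff R M (Suc n) ` carrier (std_res R M (Suc (Suc n))) =
      {f \<in> carrier (std_res R M (Suc n)). std_diff R M n f = \<zero>\<^bsub>std_res R M n\<^esub>}"
proof -
  interpret M: left_module R M by fact
  have F: "left_module R (free_module R X)" for X :: "'d set" by (rule free_module_left_module) unfold_locales
  have e: "elem_of \<in> std_basis R M 0 \<rightarrow> carrier M" by auto
  show "std_aug R M ` carrier (std_res R M 0) = carrier M"
  proof safe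
    fix f assume "f \<in> carrier (std_res R M 0)"
    then show "std_aug R M f \<in> carrier M" unfolding std_aug_def std_res_def
      by (rule lin_ext_closed[OF assms e])
  next
    fix x assume "x \<in> carrier M"
    then show "x \<in> std_aug R M ` carrier (std_res R M 0)"
      using lin_ext_single[OF assms, of "Elem x" "std_basis R M 0" elem_of] e
      unfolding std_aug_def std_res_def by force
  qed
  have main: "lin_ext R (free_module R X) (decode R) ` carrier (free_module R (encode R ` {f\<in>carrier (free_module R X). lin_ext R N \<psi> f = \<zero>\<^bsub>N\<^esub>}))
     = {f\<in>carrier (free_module R X). lin_ext R N \<psi> f = \<zero>\<^bsub>N\<^esub>}" (is "?d ` carrier (free_module R ?K') = ?K")
    if N: "left_module R N" and psi: "\<psi> \<in> X \<rightarrow> carrier N" for X :: "('a,'c) gen set" and N :: "('a,'e) module" and \<psi>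
  proof -
    interpret N: left_module R N by fact
    interpret X: left_module R "free_module R X" by (rule F)
    have dK: "decode R k \<in> ?K" if "k \<in> ?K'" for k
      using that by (auto simp: free_module_def decode_encode)
    then have d: "decode R \<in> ?K' \<rightarrow> carrier (free_module R X)" by blast
    have s0: "\<zero>\<^bsub>free_module R X\<^esub> \<in> ?K"
      using N.M.finsum_empty by (simp add: lin_ext_def) (simp add: free_module_def)
    have sub: "(\<Oplus>\<^bsub>free_module R X\<^esub>g\<in>B. f g \<odot>\<^bsub>free_module R X\<^esub> decode R g) \<in> ?K"
      if "finite B" "B \<subseteq> ?K'" "\<And>g. f g \<in> carrier R" for B f
      using that
    proof (induction B)
      case empty then show ?case using s0 by simp
    next
      case (insert b B)
      have *: "decode R b \<in> ?K" using dK insert.prems by blast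
      then have **: "f b \<odot>\<^bsub>free_module R X\<^esub> decode R b \<in> ?K"
        using insert.prems(2) lin_ext_smult[OF N psi, of "decode R b" "f b"] smult_zero_r[OF N, of "f b"] X.smult_closed[of "f b" "decode R b"]
        by simp
      have IH: "(\<Oplus>\<^bsub>free_module R X\<^esub>g\<in>B. f g \<odot>\<^bsub>free_module R X\<^esub> decode R g) \<in> ?K"
        using insert by blast
      have "(\<Oplus>\<^bsub>free_module R X\<^esub>g\<in>insert b B. f g \<odot>\<^bsub>free_module R X\<^esub> decode R g) =
         f b \<odot>\<^bsub>free_module R X\<^esub> decode R b \<oplus>\<^bsub>free_module R X\<^esub> (\<Oplus>\<^bsub>free_module R X\<^esub>g\<in>B. f g \<odot>\<^bsub>free_module R X\<^esub> decode R g)"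
        using insert d by (intro X.M.finsum_insert) (auto intro!: X.smult_closed) 
      then show ?case using IH ** lin_ext_add[OF N psi] by simp
    qed
    show ?thesis
    proof (intro equalityI subsetI)
      fix y assume "y \<in> ?d ` carrier (free_module R ?K')"
      then obtain f where f: "f \<in> carrier (free_module R ?K')" "y = ?d f" by blast
      show "y \<in> ?K" unfolding f(2) lin_ext_def[of _ _ "decode R"]
        by (rule sub) (use f(1) in \<open>auto simp: free_module_def\<close>)
    next
      fix y assume y: "y \<in> ?K"
      have yf: "finite {g. y g \<noteq> \<zero>\<^bsub>R\<^esub>}" using y by (auto simp: free_module_def)
      have i: "encode R y \<in> ?K'" using y by blast
      show "y \<in> ?d ` carrier (free_module R ?K')"
      proof (rule image_eqI)
        have dy: "decode R (encode R y) = y" by (rule decode_encode[OF yf])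
        have yc: "decode R (encode R y) \<in> carrier (free_module R X)" using y dy by simp
        show "y = ?d (\<lambda>g. if g = encode R y then \<one>\<^bsub>R\<^esub> else \<zero>\<^bsub>R\<^esub>)"
          using lin_ext_single(2)[OF F i yc d] dy by simp
        show "(\<lambda>g. if g = encode R y then \<one>\<^bsub>R\<^esub> else \<zero>\<^bsub>R\<^esub>) \<in> carrier (free_module R ?K')"
          by (rule lin_ext_single(1)[OF F i yc d])
      qed
    qed
  qed
  have b1: "std_basis R M 1 = encode R ` {f\<in>carrier (free_module R (std_basis R M 0)). lin_ext R M elem_of f = \<zero>\<^bsub>M\<^esub>}"
    by simp
  have d0: "decode R \<in> std_basis R M (Suc n) \<rightarrow> carrier (free_module R (std_basis R M n))" for n
  proof
    fix x assume "x \<in> std_basis R M (Suc n)"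
    then show "decode R x \<in> carrier (free_module R (std_basis R M n))"
    proof (cases n)
      case 0
      then obtain f where f: "f \<in> carrier (free_module R (std_basis R M 0))" "x = encode R f"
        using \<open>x \<in> _\<close> by auto
      moreover have "finite {g. f g \<noteq> \<zero>\<^bsub>R\<^esub>}" using f by (simp add: free_module_def)
      ultimately show ?thesis using 0 by (simp only: decode_encode)
    next
      case (Suc k)
      then obtain f where f: "f \<in> carrier (free_module R (std_basis R M (Suc k)))" "x = encode R f"
        using \<open>x \<in> _\<close> by auto
      moreover have "finite {g. f g \<noteq> \<zero>\<^bsub>R\<^esub>}" using f by (simp add: free_module_def)
      ultimately show ?thesis using Suc by (simp only: decode_encode)
    qed
  qed
  show "std_diff R M 0 ` carrier (std_res R M 1) = {f \<in> carrier (std_res R M 0). std_aug R M f = \<zero>\<^bsub>M\<^esub>}"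
    unfolding std_diff_def std_res_def std_aug_def b1 using main[OF assms e] by simp
  have z: "(\<lambda>_. \<zero>\<^bsub>R\<^esub>) = \<zero>\<^bsub>free_module R (std_basis R M n)\<^esub>" by (simp add: free_module_def)
  show "std_diff R M (Suc n) ` carrier (std_res R M (Suc (Suc n))) =
      {f \<in> carrier (std_res R M (Suc n)). std_diff R M n f = \<zero>\<^bsub>std_res R M n\<^esub>}"
    unfolding std_diff_def std_res_def std_basis.simps(3) z by (rule main[OF F d0])
qed

end

theory Submission
  imports Defs
begin

text \<open>Write \<open>Z\<close> for the centre and let \<open>x\<^sub>1, \<dots>, x\<^sub>t\<close> be a maximal regular sequence in \<open>\<pp>\<close>, generating the
  ideal \<open>I\<close>.  If \<open>\<pp>\<close> annihilates a left module \<open>M\<close>, then dimension shifting along the sequence gives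
  \<open>Ext\<^sup>i(M, R) = 0\<close> for \<open>i < t\<close> and \<open>Ext\<^sup>t(M, R) \<cong> Hom(M, R/I)\<close>, so all statements concern \<open>Hom(M, R/I)\<close>.
  By maximality some nonzero element of \<open>R/I\<close> is annihilated by \<open>\<pp>\<close>, and a multiple of it generates a submodule
  whose annihilator in \<open>R\<close> is a prime \<open>Q\<close> containing \<open>\<pp>\<close>.  If \<open>R\<close> is Macaulay, then \<open>Q \<inter> Z = \<pp>\<close>: for
  \<open>\<pp> \<subset> Q \<inter> Z \<subseteq> m\<close> the sequence yields \<open>t\<close> primes of \<open>Z\<close> strictly below \<open>\<pp>\<close>, and a continuation of it to a
  maximal sequence in \<open>m\<close> yields as many primes between \<open>Q \<inter> Z\<close> and \<open>m\<close> as there are new terms, so that the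
  chain is longer than the Krull dimension of \<open>Z\<close> at \<open>m\<close> permits.  Hence the elements of \<open>R/I\<close> annihilated by a
  prime \<open>P\<close> over \<open>\<pp>\<close> form a torsion-free \<open>Z/\<pp>\<close>-module.  The passage between different torsion-free
  \<open>R/P\<close>-modules, and the fact that primes over maximal ideals of \<open>Z\<close> are maximal, rest on Goldie's theorem: an
  essential left ideal of \<open>R/P\<close> contains a nonzero central element.

  Homomorphisms into \<open>R/I\<close> are represented by relations modulo \<open>I\<close>.  The annihilators in \<open>Z\<close> of elements of
  \<open>R/I\<close> are traces of two-sided ideals of \<open>R\<close>; their ascending chains are therefore stationary, and the theorem
  that \<open>Z\<close> is noetherian is not needed.\<close>

section \<open>Linear maps out of free modules\<close>

text \<open>The grade statements and (iv) are read off from one predicate, injectivity of a central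
  \<open>z\<close> on Ext(M, R/I). For \<open>z = 0\<close> it says that the group vanishes, for
  \<open>z\<close> outside \<open>\<pp>\<close> it is torsion-freeness; carrying \<open>z\<close>
  through the dimension shift lets one induction along the sequence serve both. The same computation
  for R/pR shows that all maximal sequences have equal length, so that the definite description in
  \<open>centre_grade\<close> denotes.

  Modules are never localised. That an element survives at a prime \<open>m\<close> of the centre is
  expressed by its central annihilator lying inside \<open>m\<close>, and Nakayama's lemma and the
  existence of associated primes are proved in that form.

  The hard half of (v) needs a nonzero map from a torsion-free module into R/I. Modulo a saturated
  submodule that is as large as possible, a central multiple of the module embeds in a left ideal
  D/P of R/P, and D/P is mapped on by multiplication with an element of R/I that \<open>P\<close>
  annihilates.

  Statements on the right are those on the left for the opposite ring, which has the same centre,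
  prime ideals and grades.\<close>

definition left_ideal :: "('a, 'm) ring_scheme \<Rightarrow> 'a set \<Rightarrow> bool" where
  "left_ideal R L \<longleftrightarrow> L \<subseteq> carrier R \<and> \<zero>\<^bsub>R\<^esub> \<in> L \<and> (\<forall>a\<in>L. \<forall>b\<in>L. a \<oplus>\<^bsub>R\<^esub> b \<in> L) \<and>
     (\<forall>r\<in>carrier R. \<forall>a\<in>L. r \<otimes>\<^bsub>R\<^esub> a \<in> L)"

lemma left_idealD:
  assumes "left_ideal R L"
  shows "a \<in> L \<Longrightarrow> a \<in> carrier R" "\<zero>\<^bsub>R\<^esub> \<in> L" "a \<in> L \<Longrightarrow> b \<in> L \<Longrightarrow> a \<oplus>\<^bsub>R\<^esub> b \<in> L"
    "r \<in> carrier R \<Longrightarrow> a \<in> L \<Longrightarrow> r \<otimes>\<^bsub>R\<^esub> a \<in> L"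
  using assms by (auto simp: left_ideal_def)

lemma (in ring) left_ideal_uminus:
  assumes "left_ideal R L" "a \<in> L" shows "\<ominus> a \<in> L"
proof -
  have "\<ominus> a = (\<ominus> \<one>) \<otimes> a" using left_idealD(1)[OF assms(1)] assms(2) by (simp add: l_minus)
  then show ?thesis using left_idealD(4)[OF assms(1), of "\<ominus> \<one>"] assms(2) by simp
qed

lemma (in ring) left_ideal_minus:
  assumes "left_ideal R L" "a \<in> L" "b \<in> L" shows "a \<ominus> b \<in> L"
  using left_idealD(3)[OF assms(1,2) left_ideal_uminus[OF assms(1,3)]] by (simp add: a_minus_def)

lemma (in ring) left_ideal_cancel:
  assumes "left_ideal R L" "a \<ominus> b \<in> L" "a \<in> carrier R" "b \<in> carrier R"
  shows "a \<in> L \<longleftrightarrow> b \<in> L"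
proof
  assume "b \<in> L"
  then have "(a \<ominus> b) \<oplus> b \<in> L" using left_idealD(3)[OF assms(1,2)] by simp
  moreover have "(a \<ominus> b) \<oplus> b = a" using assms by algebra
  ultimately show "a \<in> L" by simp
next
  assume "a \<in> L"
  then have "a \<ominus> (a \<ominus> b) \<in> L" using left_ideal_minus[OF assms(1) _ assms(2)] by simp
  moreover have "a \<ominus> (a \<ominus> b) = b" using assms by algebra
  ultimately show "b \<in> L" by simp
qed

lemma centreD:
  assumes "z \<in> centre R"
  shows "z \<in> carrier R" "x \<in> carrier R \<Longrightarrow> z \<otimes>\<^bsub>R\<^esub> x = x \<otimes>\<^bsub>R\<^esub> z"
  using assms by (auto simp: centre_def)

section \<open>Linear maps and functionals\<close>

definition linear_map ::
    "('a, 'm) ring_scheme \<Rightarrow> ('a, 'b) module \<Rightarrow> ('a, 'c) module \<Rightarrow> ('b \<Rightarrow> 'c) \<Rightarrow> bool" where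
  "linear_map R M N f \<longleftrightarrow> f \<in> carrier M \<rightarrow> carrier N \<and>
     (\<forall>x\<in>carrier M. \<forall>y\<in>carrier M. f (x \<oplus>\<^bsub>M\<^esub> y) = f x \<oplus>\<^bsub>N\<^esub> f y) \<and>
     (\<forall>r\<in>carrier R. \<forall>x\<in>carrier M. f (r \<odot>\<^bsub>M\<^esub> x) = r \<odot>\<^bsub>N\<^esub> f x)"

lemma linear_mapD:
  assumes "linear_map R M N f"
  shows "x \<in> carrier M \<Longrightarrow> f x \<in> carrier N"
    "x \<in> carrier M \<Longrightarrow> y \<in> carrier M \<Longrightarrow> f (x \<oplus>\<^bsub>M\<^esub> y) = f x \<oplus>\<^bsub>N\<^esub> f y"
    "r \<in> carrier R \<Longrightarrow> x \<in> carrier M \<Longrightarrow> f (r \<odot>\<^bsub>M\<^esub> x) = r \<odot>\<^bsub>N\<^esub> f x"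
  using assms by (auto simp: linear_map_def)

text \<open>A linear map into \<open>reg_module R\<close>, restated with the operations of
  \<open>R\<close> itself so that computations with values take place in the ring.\<close>

definition functional :: "('a, 'm) ring_scheme \<Rightarrow> ('a, 'b) module \<Rightarrow> ('b \<Rightarrow> 'a) \<Rightarrow> bool" where
  "functional R M f \<longleftrightarrow> f \<in> carrier M \<rightarrow> carrier R \<and>
     (\<forall>x\<in>carrier M. \<forall>y\<in>carrier M. f (x \<oplus>\<^bsub>M\<^esub> y) = f x \<oplus>\<^bsub>R\<^esub> f y) \<and>
     (\<forall>r\<in>carrier R. \<forall>x\<in>carrier M. f (r \<odot>\<^bsub>M\<^esub> x) = r \<otimes>\<^bsub>R\<^esub> f x)"

lemma functional_linear_map: "functional R M f \<longleftrightarrow> linear_map R M (reg_module R) f"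
  by (simp add: functional_def linear_map_def reg_module_def)

lemma functionalD:
  assumes "functional R M f"
  shows "x \<in> carrier M \<Longrightarrow> f x \<in> carrier R"
    "x \<in> carrier M \<Longrightarrow> y \<in> carrier M \<Longrightarrow> f (x \<oplus>\<^bsub>M\<^esub> y) = f x \<oplus>\<^bsub>R\<^esub> f y"
    "r \<in> carrier R \<Longrightarrow> x \<in> carrier M \<Longrightarrow> f (r \<odot>\<^bsub>M\<^esub> x) = r \<otimes>\<^bsub>R\<^esub> f x"
  using assms by (auto simp: functional_def)

lemma smult_zero_l:
  assumes "left_module R M" "x \<in> carrier M" shows "\<zero>\<^bsub>R\<^esub> \<odot>\<^bsub>M\<^esub> x = \<zero>\<^bsub>M\<^esub>"
proof -
  interpret left_module R M by fact
  have "\<zero>\<^bsub>R\<^esub> \<odot>\<^bsub>M\<^esub> x \<oplus>\<^bsub>M\<^esub> \<zero>\<^bsub>R\<^esub> \<odot>\<^bsub>M\<^esub> x = \<zero>\<^bsub>R\<^esub> \<odot>\<^bsub>M\<^esub> x"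
    using smult_l_distr[of "\<zero>\<^bsub>R\<^esub>" "\<zero>\<^bsub>R\<^esub>" x] assms by simp
  then show ?thesis using assms by (metis M.add.l_cancel_one R.zero_closed smult_closed)
qed

lemma smult_minus_one:
  assumes "left_module R M" "x \<in> carrier M" shows "(\<ominus>\<^bsub>R\<^esub> \<one>\<^bsub>R\<^esub>) \<odot>\<^bsub>M\<^esub> x = \<ominus>\<^bsub>M\<^esub> x"
proof -
  interpret left_module R M by fact
  have "(\<ominus>\<^bsub>R\<^esub> \<one>\<^bsub>R\<^esub>) \<odot>\<^bsub>M\<^esub> x \<oplus>\<^bsub>M\<^esub> x = (\<ominus>\<^bsub>R\<^esub> \<one>\<^bsub>R\<^esub> \<oplus>\<^bsub>R\<^esub> \<one>\<^bsub>R\<^esub>) \<odot>\<^bsub>M\<^esub> x"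
    using assms smult_l_distr[of "\<ominus>\<^bsub>R\<^esub> \<one>\<^bsub>R\<^esub>" "\<one>\<^bsub>R\<^esub>" x] by simp
  also have "\<dots> = \<zero>\<^bsub>M\<^esub>" using smult_zero_l[OF assms] by (simp add: R.l_neg)
  finally show ?thesis
    using assms(2) M.minus_equality[of "(\<ominus>\<^bsub>R\<^esub> \<one>\<^bsub>R\<^esub>) \<odot>\<^bsub>M\<^esub> x" x] by simp
qed

lemma linear_map_zero:
  assumes "left_module R M" "left_module R N" "linear_map R M N f"
  shows "f \<zero>\<^bsub>M\<^esub> = \<zero>\<^bsub>N\<^esub>"
proof -
  interpret M: left_module R M by fact
  have "f (\<zero>\<^bsub>R\<^esub> \<odot>\<^bsub>M\<^esub> \<zero>\<^bsub>M\<^esub>) = \<zero>\<^bsub>R\<^esub> \<odot>\<^bsub>N\<^esub> f \<zero>\<^bsub>M\<^esub>"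
    using linear_mapD(3)[OF assms(3), of "\<zero>\<^bsub>R\<^esub>" "\<zero>\<^bsub>M\<^esub>"] by simp
  then show ?thesis
    using smult_zero_l[OF assms(1), of "\<zero>\<^bsub>M\<^esub>"] smult_zero_l[OF assms(2), of "f \<zero>\<^bsub>M\<^esub>"]
      linear_mapD(1)[OF assms(3)] by simp
qed

lemma linear_map_minus:
  assumes "left_module R M" "left_module R N" "linear_map R M N f" "x \<in> carrier M" "y \<in> carrier M"
  shows "f (x \<ominus>\<^bsub>M\<^esub> y) = f x \<ominus>\<^bsub>N\<^esub> f y"
proof -
  interpret M: left_module R M by fact
  have "f (\<ominus>\<^bsub>M\<^esub> y) = \<ominus>\<^bsub>N\<^esub> f y"
    using smult_minus_one[OF assms(1,5)] smult_minus_one[OF assms(2), of "f y"]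
      linear_mapD(1,3)[OF assms(3)] assms(5)
    by (metis M.R.a_inv_closed M.R.one_closed)
  then show ?thesis
    using linear_mapD(2)[OF assms(3), of x "\<ominus>\<^bsub>M\<^esub> y"] assms(4,5) by (simp add: a_minus_def)
qed

lemma linear_map_comp:
  "linear_map R M N f \<Longrightarrow> linear_map R N K g \<Longrightarrow> linear_map R M K (\<lambda>x. g (f x))"
  unfolding linear_map_def by (auto simp: Pi_iff)

lemma functional_comp:
  "linear_map R M N f \<Longrightarrow> functional R N g \<Longrightarrow> functional R M (\<lambda>x. g (f x))"
  unfolding functional_linear_map by (rule linear_map_comp)

lemma linear_map_diff:
  assumes M: "left_module R M" and N: "left_module R N"
    and f: "linear_map R M N f" and g: "linear_map R M N g"
  shows "linear_map R M N (\<lambda>x. f x \<ominus>\<^bsub>N\<^esub> g x)"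
proof -
  interpret M: left_module R M by fact
  interpret N: left_module R N by fact
  have sm: "r \<odot>\<^bsub>N\<^esub> (\<ominus>\<^bsub>N\<^esub> y) = \<ominus>\<^bsub>N\<^esub> (r \<odot>\<^bsub>N\<^esub> y)" if "r \<in> carrier R" "y \<in> carrier N" for r y
  proof -
    have "r \<odot>\<^bsub>N\<^esub> (\<ominus>\<^bsub>N\<^esub> y) \<oplus>\<^bsub>N\<^esub> r \<odot>\<^bsub>N\<^esub> y = \<zero>\<^bsub>N\<^esub>"
      using that N.smult_r_distr[of r "\<ominus>\<^bsub>N\<^esub> y" y] smult_zero_r[OF N] by (simp add: N.M.l_neg)
    then show ?thesis
      using that N.M.minus_equality[of "r \<odot>\<^bsub>N\<^esub> (\<ominus>\<^bsub>N\<^esub> y)" "r \<odot>\<^bsub>N\<^esub> y"] by simp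
  qed
  show ?thesis
    unfolding linear_map_def
  proof (intro conjI ballI)
    show "(\<lambda>x. f x \<ominus>\<^bsub>N\<^esub> g x) \<in> carrier M \<rightarrow> carrier N"
      using linear_mapD(1)[OF f] linear_mapD(1)[OF g] by auto
  next
    fix x y assume xy: "x \<in> carrier M" "y \<in> carrier M"
    then have c: "f x \<in> carrier N" "f y \<in> carrier N" "g x \<in> carrier N" "g y \<in> carrier N"
      using linear_mapD(1)[OF f] linear_mapD(1)[OF g] by auto
    show "f (x \<oplus>\<^bsub>M\<^esub> y) \<ominus>\<^bsub>N\<^esub> g (x \<oplus>\<^bsub>M\<^esub> y) = f x \<ominus>\<^bsub>N\<^esub> g x \<oplus>\<^bsub>N\<^esub> (f y \<ominus>\<^bsub>N\<^esub> g y)"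
      using linear_mapD(2)[OF f xy] linear_mapD(2)[OF g xy] c
      by (simp add: a_minus_def N.M.minus_add N.M.a_ac)
  next
    fix r x assume rx: "r \<in> carrier R" "x \<in> carrier M"
    then have c: "f x \<in> carrier N" "g x \<in> carrier N"
      using linear_mapD(1)[OF f] linear_mapD(1)[OF g] by auto
    show "f (r \<odot>\<^bsub>M\<^esub> x) \<ominus>\<^bsub>N\<^esub> g (r \<odot>\<^bsub>M\<^esub> x) = r \<odot>\<^bsub>N\<^esub> (f x \<ominus>\<^bsub>N\<^esub> g x)"
      using linear_mapD(3)[OF f rx] linear_mapD(3)[OF g rx] c rx
      by (simp add: a_minus_def sm N.smult_r_distr)
  qed
qed

lemma linear_map_central_smult:
  assumes "left_module R M" "z \<in> centre R" shows "linear_map R M M (\<lambda>y. z \<odot>\<^bsub>M\<^esub> y)"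
proof -
  interpret left_module R M by fact
  note z = centreD[OF assms(2)]
  show ?thesis unfolding linear_map_def
    by (auto simp: z(1) smult_r_distr smult_assoc1[symmetric] z(2))
qed

lemma reg_module_minus: "ring R \<Longrightarrow> x \<in> carrier R \<Longrightarrow> y \<in> carrier R \<Longrightarrow> x \<ominus>\<^bsub>reg_module R\<^esub> y = x \<ominus>\<^bsub>R\<^esub> y"
proof -
  assume a: "ring R" "x \<in> carrier R" "y \<in> carrier R"
  interpret ring R by fact
  interpret N: left_module R "reg_module R" by (rule reg_module_left_module) fact
  have "\<ominus>\<^bsub>R\<^esub> y \<oplus>\<^bsub>R\<^esub> y = \<zero>\<^bsub>R\<^esub>" using a by (simp add: l_neg)
  then have "\<ominus>\<^bsub>reg_module R\<^esub> y = \<ominus>\<^bsub>R\<^esub> y"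
    using N.M.minus_equality[of "\<ominus>\<^bsub>R\<^esub> y" y] a by (simp add: reg_module_def)
  then show ?thesis using a by (simp add: a_minus_def) (simp add: reg_module_def)
qed

lemma functional_diff:
  assumes "left_module R M" "functional R M f" "functional R M g"
  shows "functional R M (\<lambda>x. f x \<ominus>\<^bsub>R\<^esub> g x)"
proof -
  interpret left_module R M by fact
  have "linear_map R M (reg_module R) (\<lambda>x. f x \<ominus>\<^bsub>reg_module R\<^esub> g x)"
    using linear_map_diff[OF assms(1) reg_module_left_module] assms(2,3) R.ring_axioms
    by (simp add: functional_linear_map)
  then have "functional R M (\<lambda>x. f x \<ominus>\<^bsub>reg_module R\<^esub> g x)" by (simp add: functional_linear_map)
  then show ?thesis
    unfolding functional_def
    using assms functionalD(1)[OF assms(2)] functionalD(1)[OF assms(3)] reg_module_minus[OF R.ring_axioms]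
    by (auto simp: Pi_iff)
qed

lemma functional_minus:
  assumes "left_module R M" "functional R M f" "x \<in> carrier M" "y \<in> carrier M"
  shows "f (x \<ominus>\<^bsub>M\<^esub> y) = f x \<ominus>\<^bsub>R\<^esub> f y"
proof -
  interpret left_module R M by fact
  show ?thesis
    using linear_map_minus[OF assms(1) reg_module_left_module[OF R.ring_axioms] _ assms(3,4), of f] assms(2)
      reg_module_minus[OF R.ring_axioms functionalD(1)[OF assms(2,3)] functionalD(1)[OF assms(2,4)]]
    by (simp add: functional_linear_map)
qed

lemma functional_zero:
  assumes "left_module R M" "functional R M f" shows "f \<zero>\<^bsub>M\<^esub> = \<zero>\<^bsub>R\<^esub>"
proof -
  interpret left_module R M by fact
  show ?thesis
    using linear_map_zero[OF assms(1) reg_module_left_module] assms(2) R.ring_axioms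
    by (simp add: functional_linear_map) (simp add: reg_module_def)
qed

lemma functional_central_mult:
  assumes "left_module R M" "functional R M f" "z \<in> centre R"
  shows "functional R M (\<lambda>x. z \<otimes>\<^bsub>R\<^esub> f x)"
proof -
  interpret left_module R M by fact
  note z = centreD[OF assms(3)]
  show ?thesis using functionalD[OF assms(2)] unfolding functional_def
    by (auto simp: z(1) R.r_distr) (metis R.m_assoc z(1,2))
qed

text \<open>Freeness is only used in this form: a total relation that is closed under the module
  operations contains a linear map.\<close>

lemma free_module_linear_selection:
  fixes R :: "('a, 'm) ring_scheme" and X :: "'g set" and A :: "('a, 'c) module"
  assumes "left_module R A"
    and ex: "\<And>y. y \<in> carrier (free_module R X) \<Longrightarrow> \<exists>a\<in>carrier A. Rel y a"
    and add: "\<And>y y' a a'. \<lbrakk>y \<in> carrier (free_module R X); y' \<in> carrier (free_module R X);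
        a \<in> carrier A; a' \<in> carrier A; Rel y a; Rel y' a'\<rbrakk>
        \<Longrightarrow> Rel (y \<oplus>\<^bsub>free_module R X\<^esub> y') (a \<oplus>\<^bsub>A\<^esub> a')"
    and smult: "\<And>r y a. \<lbrakk>r \<in> carrier R; y \<in> carrier (free_module R X); a \<in> carrier A; Rel y a\<rbrakk>
        \<Longrightarrow> Rel (r \<odot>\<^bsub>free_module R X\<^esub> y) (r \<odot>\<^bsub>A\<^esub> a)"
  obtains s where "linear_map R (free_module R X) A s"
    "\<And>y. y \<in> carrier (free_module R X) \<Longrightarrow> Rel y (s y)"
proof -
  interpret A: left_module R A by fact
  let ?F = "free_module R X"
  interpret F: left_module R ?F by (rule free_module_left_module) unfold_locales
  define \<delta> :: "'g \<Rightarrow> 'g \<Rightarrow> 'a" where "\<delta> x = (\<lambda>g. if g = x then \<one>\<^bsub>R\<^esub> else \<zero>\<^bsub>R\<^esub>)" for x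
  have \<delta>F: "\<delta> x \<in> carrier ?F" if "x \<in> X" for x
  proof -
    have "finite {g. \<delta> x g \<noteq> \<zero>\<^bsub>R\<^esub>}"
      by (rule finite_subset[of _ "{x}"]) (auto simp: \<delta>_def)
    then show ?thesis using that by (auto simp: free_module_def \<delta>_def)
  qed
  have "\<exists>a. a \<in> carrier A \<and> Rel (\<delta> x) a" if "x \<in> X" for x
    using ex[OF \<delta>F[OF that]] by blast
  then obtain \<phi> where \<phi>: "\<And>x. x \<in> X \<Longrightarrow> \<phi> x \<in> carrier A" "\<And>x. x \<in> X \<Longrightarrow> Rel (\<delta> x) (\<phi> x)"
    by metis
  have \<phi>': "\<phi> \<in> X \<rightarrow> carrier A" using \<phi> by auto
  have lin: "linear_map R ?F A (lin_ext R A \<phi>)"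
    unfolding linear_map_def
    using lin_ext_closed[OF assms(1) \<phi>'] lin_ext_add[OF assms(1) \<phi>'] lin_ext_smult[OF assms(1) \<phi>']
    by blast
  have "Rel y (lin_ext R A \<phi> y)" if "finite B" "B \<subseteq> X" "y \<in> carrier ?F" "{g. y g \<noteq> \<zero>\<^bsub>R\<^esub>} \<subseteq> B" for B y
    using that
  proof (induction B arbitrary: y)
    case empty
    then have y: "y = \<zero>\<^bsub>?F\<^esub>" by (auto simp: free_module_def)
    obtain a where a: "a \<in> carrier A" "Rel \<zero>\<^bsub>?F\<^esub> a" using ex[of "\<zero>\<^bsub>?F\<^esub>"] by auto
    \<comment> \<open>Scaling an arbitrary value at zero by zero puts the pair of zeros into the
      relation.\<close>
    have "Rel (\<zero>\<^bsub>R\<^esub> \<odot>\<^bsub>?F\<^esub> \<zero>\<^bsub>?F\<^esub>) (\<zero>\<^bsub>R\<^esub> \<odot>\<^bsub>A\<^esub> a)" by (rule smult) (use a in auto)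
    then have "Rel \<zero>\<^bsub>?F\<^esub> \<zero>\<^bsub>A\<^esub>"
      using smult_zero_l[OF assms(1) a(1)] smult_zero_r[OF F.left_module_axioms] by simp
    then show ?case using linear_map_zero[OF F.left_module_axioms assms(1) lin] y by simp
  next
    case (insert b B)
    define y' where "y' = (\<lambda>g. if g = b then \<zero>\<^bsub>R\<^esub> else y g)"
    have bX: "b \<in> X" and yb: "y b \<in> carrier R" using insert.prems by (auto simp: free_module_def)
    have yc: "y g \<in> carrier R" for g using insert.prems(2) by (auto simp: free_module_def)
    have "{g. y' g \<noteq> \<zero>\<^bsub>R\<^esub>} \<subseteq> {g. y g \<noteq> \<zero>\<^bsub>R\<^esub>}" by (auto simp: y'_def)
    moreover from this have "finite {g. y' g \<noteq> \<zero>\<^bsub>R\<^esub>}"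
      by (rule finite_subset) (use insert.prems(2) in \<open>simp add: free_module_def\<close>)
    moreover have "range y' \<subseteq> carrier R"
      using insert.prems(2) by (auto simp: free_module_def y'_def)
    ultimately have y'F: "y' \<in> carrier ?F"
      using insert.prems(2) unfolding free_module_def by (simp, blast)
    have y: "y = y' \<oplus>\<^bsub>?F\<^esub> (y b \<odot>\<^bsub>?F\<^esub> \<delta> b)"
      using yc by (auto simp: free_module_def y'_def \<delta>_def fun_eq_iff)
    have s: "lin_ext R A \<phi> (\<delta> b) = \<phi> b"
      unfolding \<delta>_def by (rule lin_ext_single(2)[OF assms(1) bX \<phi>(1)[OF bX] \<phi>'])
    have "lin_ext R A \<phi> y = lin_ext R A \<phi> y' \<oplus>\<^bsub>A\<^esub> (y b \<odot>\<^bsub>A\<^esub> \<phi> b)"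
      using y linear_mapD(2,3)[OF lin] y'F \<delta>F[OF bX] yb s F.smult_closed by metis
    moreover have "Rel y' (lin_ext R A \<phi> y')"
      using insert.prems y'F by (intro insert.IH) (auto simp: y'_def)
    ultimately show ?case
      using add[OF y'F _ _ _ _ smult[OF yb \<delta>F[OF bX] \<phi>(1)[OF bX] \<phi>(2)[OF bX]]]
        y'F yb \<delta>F[OF bX] \<phi>(1)[OF bX] linear_mapD(1)[OF lin y'F] y by simp
  qed
  then have "Rel y (lin_ext R A \<phi> y)" if "y \<in> carrier ?F" for y
    using that by (auto simp: free_module_def)
  then show ?thesis using that lin by blast
qed

section \<open>The ideal I + xR and congruences modulo I\<close>

definition add_multiples :: "('a, 'm) ring_scheme \<Rightarrow> 'a set \<Rightarrow> 'a \<Rightarrow> 'a set" where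
  "add_multiples R I x = {i \<oplus>\<^bsub>R\<^esub> x \<otimes>\<^bsub>R\<^esub> r | i r. i \<in> I \<and> r \<in> carrier R}"

context ring
begin

lemma central_lcomm:
  assumes "z \<in> centre R" "a \<in> carrier R" "b \<in> carrier R"
  shows "a \<otimes> (z \<otimes> b) = z \<otimes> (a \<otimes> b)"
  using centreD[OF assms(1)] assms(2,3) by (metis m_assoc)

lemma add_multiplesI1:
  "left_ideal R I \<Longrightarrow> x \<in> carrier R \<Longrightarrow> i \<in> I \<Longrightarrow> i \<in> add_multiples R I x"
  unfolding add_multiples_def mem_Collect_eq
  by (rule exI[of _ i], rule exI[of _ \<zero>]) (auto dest: left_idealD(1))

lemma add_multiplesI2:
  "left_ideal R I \<Longrightarrow> x \<in> carrier R \<Longrightarrow> r \<in> carrier R \<Longrightarrow> x \<otimes> r \<in> add_multiples R I x"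
  unfolding add_multiples_def mem_Collect_eq
  by (rule exI[of _ \<zero>], rule exI[of _ r]) (auto dest: left_idealD(2))

lemma left_ideal_add_multiples:
  assumes I: "left_ideal R I" and x: "x \<in> centre R" shows "left_ideal R (add_multiples R I x)"
proof -
  note xc = centreD[OF x]
  note Id = left_idealD[OF I]
  have "(i \<oplus> x \<otimes> r) \<oplus> (j \<oplus> x \<otimes> s) = (i \<oplus> j) \<oplus> x \<otimes> (r \<oplus> s)"
    if "i \<in> I" "j \<in> I" "r \<in> carrier R" "s \<in> carrier R" for i j r s
    using that Id(1) xc(1) by (simp add: r_distr a_ac)
  moreover have "t \<otimes> (i \<oplus> x \<otimes> r) = t \<otimes> i \<oplus> x \<otimes> (t \<otimes> r)" if "i \<in> I" "r \<in> carrier R" "t \<in> carrier R" for i r t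
    using that Id(1) xc(1) by (simp add: r_distr central_lcomm[OF x])
  ultimately show ?thesis
    using Id xc(1) add_multiplesI1[OF I xc(1), of \<zero>]
    unfolding left_ideal_def add_multiples_def
    by auto (metis a_closed m_closed)+
qed

lemma diff_cong_sym:
  assumes "left_ideal R I" "a \<in> carrier R" "b \<in> carrier R" "a \<ominus> b \<in> I" shows "b \<ominus> a \<in> I"
proof -
  have "b \<ominus> a = \<ominus> (a \<ominus> b)" using assms by algebra
  then show ?thesis using left_ideal_uminus assms by metis
qed

lemma diff_cong_trans:
  assumes "left_ideal R I" "a \<in> carrier R" "b \<in> carrier R" "c \<in> carrier R" "a \<ominus> b \<in> I" "b \<ominus> c \<in> I"
  shows "a \<ominus> c \<in> I"
proof -
  have "a \<ominus> c = (a \<ominus> b) \<oplus> (b \<ominus> c)" using assms by algebra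
  then show ?thesis using left_idealD(3) assms by metis
qed

lemma diff_cong_mult:
  assumes "left_ideal R I" "a \<in> carrier R" "b \<in> carrier R" "z \<in> carrier R" "a \<ominus> b \<in> I"
  shows "z \<otimes> a \<ominus> z \<otimes> b \<in> I"
proof -
  have "z \<otimes> a \<ominus> z \<otimes> b = z \<otimes> (a \<ominus> b)" using assms by algebra
  then show ?thesis using left_idealD(4) assms by metis
qed

end

section \<open>Homotopies and dimension shifting for Ext\<close>

locale resolved_module = left_module R M
  for R :: "('a, 'm) ring_scheme" (structure) and M :: "('a, 'b) module"
begin

abbreviation "F n \<equiv> std_res R M n"
abbreviation "d n \<equiv> std_diff R M n"
abbreviation "\<epsilon> \<equiv> std_aug R M"

lemma F_module: "left_module R (F n)"
  unfolding std_res_def by (rule free_module_left_module) unfold_locales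

lemma decode_closed: "decode R \<in> std_basis R M (Suc n) \<rightarrow> carrier (F n)"
proof
  fix x assume x: "x \<in> std_basis R M (Suc n)"
  obtain f where f: "f \<in> carrier (F n)" "x = encode R f"
    using x by (cases n) (auto simp: std_res_def)
  moreover have "finite {g. f g \<noteq> \<zero>}" using f by (simp add: std_res_def free_module_def)
  ultimately show "decode R x \<in> carrier (F n)" by (simp add: decode_encode)
qed

lemma d_linear: "linear_map R (F (Suc n)) (F n) (d n)"
  unfolding linear_map_def std_diff_def
  using lin_ext_closed[OF F_module decode_closed] lin_ext_add[OF F_module decode_closed]
    lin_ext_smult[OF F_module decode_closed]
  by (auto simp: std_res_def)

lemma aug_linear: "linear_map R (F 0) M \<epsilon>"
proof -
  have e: "elem_of \<in> std_basis R M 0 \<rightarrow> carrier M" by auto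
  show ?thesis
    unfolding linear_map_def std_aug_def
    using lin_ext_closed[OF left_module_axioms e] lin_ext_add[OF left_module_axioms e]
      lin_ext_smult[OF left_module_axioms e]
    by (auto simp: std_res_def)
qed

lemma aug_surj: "x \<in> carrier M \<Longrightarrow> \<exists>y\<in>carrier (F 0). \<epsilon> y = x"
  using std_res_exact(1)[OF left_module_axioms] by (metis imageE)

lemma d_closed: "y \<in> carrier (F (Suc n)) \<Longrightarrow> d n y \<in> carrier (F n)"
  using linear_mapD(1)[OF d_linear] .

lemma ker_aug:
  assumes "y \<in> carrier (F 0)" "\<epsilon> y = \<zero>\<^bsub>M\<^esub>" shows "\<exists>w\<in>carrier (F (Suc 0)). d 0 w = y"
  using std_res_exact(2)[OF left_module_axioms] assms
  by (metis (mono_tags, lifting) One_nat_def image_iff mem_Collect_eq)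

lemma aug_d: "y \<in> carrier (F (Suc 0)) \<Longrightarrow> \<epsilon> (d 0 y) = \<zero>\<^bsub>M\<^esub>"
  using std_res_exact(2)[OF left_module_axioms] by auto

lemma ker_d:
  assumes "y \<in> carrier (F (Suc n))" "d n y = \<zero>\<^bsub>F n\<^esub>"
  shows "\<exists>w\<in>carrier (F (Suc (Suc n))). d (Suc n) w = y"
  using std_res_exact(3)[OF left_module_axioms, of n] assms
  by (metis (mono_tags, lifting) image_iff mem_Collect_eq)

lemma d_d: "y \<in> carrier (F (Suc (Suc n))) \<Longrightarrow> d n (d (Suc n) y) = \<zero>\<^bsub>F n\<^esub>"
  using std_res_exact(3)[OF left_module_axioms, of n] by auto

text \<open>Projectivity of \<open>F n\<close> in the form that homotopies use: the relation
  \<open>u a = h y\<close> respects the module operations, so it contains a linear map as soon as it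
  is total.\<close>

lemma F_linear_lift:
  fixes A :: "('a, 'c) module" and B :: "('a, 'e) module"
  assumes "left_module R A" "left_module R B" "linear_map R A B u" "linear_map R (F n) B h"
    and "\<And>y. y \<in> carrier (F n) \<Longrightarrow> \<exists>a\<in>carrier A. u a = h y"
  obtains s where "linear_map R (F n) A s" "\<And>y. y \<in> carrier (F n) \<Longrightarrow> u (s y) = h y"
  using assms(5) unfolding std_res_def
proof (rule free_module_linear_selection[OF assms(1)])
  fix y y' a a' assume y: "y \<in> carrier (free_module R (std_basis R M n))" "y' \<in> carrier (free_module R (std_basis R M n))"
    "a \<in> carrier A" "a' \<in> carrier A" "u a = h y" "u a' = h y'"
  then show "u (a \<oplus>\<^bsub>A\<^esub> a') = h (y \<oplus>\<^bsub>free_module R (std_basis R M n)\<^esub> y')"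
    using linear_mapD(2)[OF assms(3)] linear_mapD(2)[OF assms(4)] by (simp add: std_res_def)
next
  fix r y a assume "r \<in> carrier R" "y \<in> carrier (free_module R (std_basis R M n))" "a \<in> carrier A" "u a = h y"
  then show "u (r \<odot>\<^bsub>A\<^esub> a) = h (r \<odot>\<^bsub>free_module R (std_basis R M n)\<^esub> y)"
    using linear_mapD(3)[OF assms(3)] linear_mapD(3)[OF assms(4)] by (simp add: std_res_def)
qed (auto simp: std_res_def)

text \<open>A central element annihilating \<open>M\<close> acts null-homotopically on the resolution.\<close>

lemma contracting_homotopy:
  assumes z: "z \<in> centre R" and zM: "\<And>m. m \<in> carrier M \<Longrightarrow> z \<odot>\<^bsub>M\<^esub> m = \<zero>\<^bsub>M\<^esub>"
  shows "\<exists>s s'. linear_map R (F n) (F (Suc n)) s \<and> linear_map R (F (Suc n)) (F (Suc (Suc n))) s' \<and>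
    (\<forall>y\<in>carrier (F (Suc n)). d n (s (d n y)) = z \<odot>\<^bsub>F n\<^esub> d n y) \<and>
    (\<forall>y\<in>carrier (F (Suc n)). d (Suc n) (s' y) = z \<odot>\<^bsub>F (Suc n)\<^esub> y \<ominus>\<^bsub>F (Suc n)\<^esub> s (d n y))"
proof (induction n)
  case 0
  interpret F0: left_module R "F 0" by (rule F_module)
  interpret F1: left_module R "F (Suc 0)" by (rule F_module)
  note zc = centreD(1)[OF z]
  \<comment> \<open>As \<open>z\<close> annihilates \<open>M\<close>, multiplication by
    \<open>z\<close> carries \<open>F 0\<close> into the kernel of the augmentation, so it lifts
    through \<open>d 0\<close>.\<close>
  obtain s where s: "linear_map R (F 0) (F (Suc 0)) s"
    "\<And>y. y \<in> carrier (F 0) \<Longrightarrow> d 0 (s y) = z \<odot>\<^bsub>F 0\<^esub> y"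
  proof (rule F_linear_lift[OF F_module F_module d_linear linear_map_central_smult[OF F_module z]])
    fix y assume y: "y \<in> carrier (F 0)"
    have "\<epsilon> (z \<odot>\<^bsub>F 0\<^esub> y) = \<zero>\<^bsub>M\<^esub>"
      using linear_mapD(1,3)[OF aug_linear] zM y zc by simp
    then show "\<exists>a\<in>carrier (F (Suc 0)). d 0 a = z \<odot>\<^bsub>F 0\<^esub> y"
      using ker_aug y zc by simp
  qed blast
  \<comment> \<open>The difference of multiplication by \<open>z\<close> and \<open>s d\<close> is
    killed by \<open>d 0\<close>, by the choice of \<open>s\<close>; exactness then gives the second
    homotopy.\<close>
  have l: "linear_map R (F (Suc 0)) (F (Suc 0)) (\<lambda>y. z \<odot>\<^bsub>F (Suc 0)\<^esub> y \<ominus>\<^bsub>F (Suc 0)\<^esub> s (d 0 y))"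
    by (intro linear_map_diff F_module linear_map_central_smult z linear_map_comp[OF d_linear s(1)])
  obtain s' where s': "linear_map R (F (Suc 0)) (F (Suc (Suc 0))) s'"
    "\<And>y. y \<in> carrier (F (Suc 0)) \<Longrightarrow> d (Suc 0) (s' y) = z \<odot>\<^bsub>F (Suc 0)\<^esub> y \<ominus>\<^bsub>F (Suc 0)\<^esub> s (d 0 y)"
  proof (rule F_linear_lift[OF F_module F_module d_linear l])
    fix y assume y: "y \<in> carrier (F (Suc 0))"
    have c: "z \<odot>\<^bsub>F (Suc 0)\<^esub> y \<in> carrier (F (Suc 0))" "s (d 0 y) \<in> carrier (F (Suc 0))"
      using y zc linear_mapD(1)[OF s(1)] d_closed by auto
    have "d 0 (z \<odot>\<^bsub>F (Suc 0)\<^esub> y \<ominus>\<^bsub>F (Suc 0)\<^esub> s (d 0 y)) = z \<odot>\<^bsub>F 0\<^esub> d 0 y \<ominus>\<^bsub>F 0\<^esub> z \<odot>\<^bsub>F 0\<^esub> d 0 y"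
      using linear_map_minus[OF F_module F_module d_linear c] linear_mapD(3)[OF d_linear zc y]
        s(2)[OF d_closed[OF y]] by simp
    also have "\<dots> = \<zero>\<^bsub>F 0\<^esub>" using d_closed[OF y] zc by (simp add: a_minus_def F0.M.r_neg)
    finally show "\<exists>a\<in>carrier (F (Suc (Suc 0))). d (Suc 0) a = z \<odot>\<^bsub>F (Suc 0)\<^esub> y \<ominus>\<^bsub>F (Suc 0)\<^esub> s (d 0 y)"
      using ker_d[of _ 0] c by simp
  qed blast
  show ?case using s s' d_closed by blast
next
  case (Suc n)
  then obtain s s' where s: "linear_map R (F n) (F (Suc n)) s" and
    s': "linear_map R (F (Suc n)) (F (Suc (Suc n))) s'" and
    sd: "\<And>y. y \<in> carrier (F (Suc n)) \<Longrightarrow> d (Suc n) (s' y) = z \<odot>\<^bsub>F (Suc n)\<^esub> y \<ominus>\<^bsub>F (Suc n)\<^esub> s (d n y)"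
    by blast
  interpret F1: left_module R "F (Suc n)" by (rule F_module)
  interpret F2: left_module R "F (Suc (Suc n))" by (rule F_module)
  note zc = centreD(1)[OF z]
  \<comment> \<open>On a boundary the term with \<open>s\<close> disappears from the homotopy
    formula. What remains is the first equation of the induction statement one degree higher, and it
    makes the next lift possible.\<close>
  have 1: "d (Suc n) (s' (d (Suc n) y)) = z \<odot>\<^bsub>F (Suc n)\<^esub> d (Suc n) y"
    if y: "y \<in> carrier (F (Suc (Suc n)))" for y
    using sd[OF d_closed[OF y]] d_d[OF y] linear_map_zero[OF F_module F_module s] d_closed[OF y] zc
    by (simp add: a_minus_def)
  let ?h = "\<lambda>y. z \<odot>\<^bsub>F (Suc (Suc n))\<^esub> y \<ominus>\<^bsub>F (Suc (Suc n))\<^esub> s' (d (Suc n) y)"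
  have l: "linear_map R (F (Suc (Suc n))) (F (Suc (Suc n))) ?h"
    by (intro linear_map_diff F_module linear_map_central_smult z linear_map_comp[OF d_linear s'])
  obtain s'' where s'': "linear_map R (F (Suc (Suc n))) (F (Suc (Suc (Suc n)))) s''"
    "\<And>y. y \<in> carrier (F (Suc (Suc n))) \<Longrightarrow> d (Suc (Suc n)) (s'' y) = ?h y"
  proof (rule F_linear_lift[OF F_module F_module d_linear l])
    fix y assume y: "y \<in> carrier (F (Suc (Suc n)))"
    have c: "z \<odot>\<^bsub>F (Suc (Suc n))\<^esub> y \<in> carrier (F (Suc (Suc n)))" "s' (d (Suc n) y) \<in> carrier (F (Suc (Suc n)))"
      using y zc linear_mapD(1)[OF s'] d_closed by auto
    have "d (Suc n) (?h y) = z \<odot>\<^bsub>F (Suc n)\<^esub> d (Suc n) y \<ominus>\<^bsub>F (Suc n)\<^esub> z \<odot>\<^bsub>F (Suc n)\<^esub> d (Suc n) y"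
      using linear_map_minus[OF F_module F_module d_linear c] linear_mapD(3)[OF d_linear zc y] 1[OF y]
      by simp
    also have "\<dots> = \<zero>\<^bsub>F (Suc n)\<^esub>" using d_closed[OF y] zc by (simp add: a_minus_def F1.M.r_neg)
    finally show "\<exists>a\<in>carrier (F (Suc (Suc (Suc n)))). d (Suc (Suc n)) a = ?h y"
      using ker_d[of "?h y"] c by simp
  qed blast
  show ?case using s' s'' 1 by blast
qed

section \<open>Cohomology with coefficients in R/I\<close>

definition cocycle_mod :: "'a set \<Rightarrow> nat \<Rightarrow> ((('a, 'b) gen \<Rightarrow> 'a) \<Rightarrow> 'a) \<Rightarrow> bool" where
  "cocycle_mod I n f \<longleftrightarrow> functional R (F n) f \<and> (\<forall>y\<in>carrier (F (Suc n)). f (d n y) \<in> I)"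

text \<open>No differential arrives in degree 0, so a coboundary there is a map that is zero modulo
  \<open>I\<close>. In higher degrees the bounding cochain is kept as a lift to
  \<open>R\<close>.\<close>

fun coboundary_mod :: "'a set \<Rightarrow> nat \<Rightarrow> ((('a, 'b) gen \<Rightarrow> 'a) \<Rightarrow> 'a) \<Rightarrow> bool" where
  "coboundary_mod I 0 f \<longleftrightarrow> (\<forall>y\<in>carrier (F 0). f y \<in> I)"
| "coboundary_mod I (Suc n) f \<longleftrightarrow>
    (\<exists>g. functional R (F n) g \<and> (\<forall>y\<in>carrier (F (Suc n)). f y \<ominus> g (d n y) \<in> I))"

text \<open>Multiplication by \<open>z\<close> is injective on the degree \<open>n\<close> cohomology of
  \<open>Hom(F, R/I)\<close>, that is, on \<open>Ext\<^sup>n(M, R/I)\<close>; as the \<open>F n\<close> are free, the cochains lift to \<open>R\<close>.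
  The case \<open>z = \<zero>\<close> says that this group vanishes.\<close>

definition Ext_injective :: "nat \<Rightarrow> 'a set \<Rightarrow> 'a \<Rightarrow> bool" where
  "Ext_injective n I z \<longleftrightarrow>
    (\<forall>f. cocycle_mod I n f \<longrightarrow> coboundary_mod I n (\<lambda>y. z \<otimes> f y) \<longrightarrow> coboundary_mod I n f)"

text \<open>A quotient by \<open>x\<close> exists for every single value; freeness of
  \<open>F n\<close> allows the quotients to be chosen linearly.\<close>

lemma divide_functional:
  assumes I: "left_ideal R I" and x: "x \<in> centre R" and h: "functional R (F n) h"
    and ex: "\<And>y. y \<in> carrier (F n) \<Longrightarrow> h y \<in> add_multiples R I x"
  obtains l where "functional R (F n) l" "\<And>y. y \<in> carrier (F n) \<Longrightarrow> h y \<ominus> x \<otimes> l y \<in> I"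
proof -
  note xc = centreD[OF x]
  have N: "left_module R (reg_module R)" by (rule reg_module_left_module) unfold_locales
  note Id = left_idealD[OF I]
  obtain l where "linear_map R (F n) (reg_module R) l" "\<And>y. y \<in> carrier (F n) \<Longrightarrow> h y \<ominus> x \<otimes> l y \<in> I"
  proof (rule free_module_linear_selection[OF N, of "std_basis R M n" "\<lambda>y a. h y \<ominus> x \<otimes> a \<in> I", folded std_res_def])
    fix y assume "y \<in> carrier (F n)"
    then obtain i r where "i \<in> I" "r \<in> carrier R" "h y = i \<oplus> x \<otimes> r" using ex unfolding add_multiples_def by blast
    moreover from this have "h y \<ominus> x \<otimes> r = i" using Id(1) xc(1) by (simp add: a_minus_def R.a_assoc R.r_neg)
    ultimately have "h y \<ominus> x \<otimes> r \<in> I" "r \<in> carrier (reg_module R)" by (simp_all add: reg_module_def)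
    then show "\<exists>a\<in>carrier (reg_module R). h y \<ominus> x \<otimes> a \<in> I" by blast
  next
    fix y y' a a' assume a: "y \<in> carrier (F n)" "y' \<in> carrier (F n)" "a \<in> carrier (reg_module R)" "a' \<in> carrier (reg_module R)"
      "h y \<ominus> x \<otimes> a \<in> I" "h y' \<ominus> x \<otimes> a' \<in> I"
    then have c: "a \<in> carrier R" "a' \<in> carrier R" "h y \<in> carrier R" "h y' \<in> carrier R" "h (y \<oplus>\<^bsub>F n\<^esub> y') = h y \<oplus> h y'"
      using functionalD[OF h] by (auto simp: reg_module_def)
    then have "h (y \<oplus>\<^bsub>F n\<^esub> y') \<ominus> x \<otimes> (a \<oplus> a') = (h y \<ominus> x \<otimes> a) \<oplus> (h y' \<ominus> x \<otimes> a')"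
      using xc(1) by (simp add: a_minus_def R.r_distr R.minus_add R.a_ac)
    then show "h (y \<oplus>\<^bsub>F n\<^esub> y') \<ominus> x \<otimes> (a \<oplus>\<^bsub>reg_module R\<^esub> a') \<in> I" using Id(3) a by (simp add: reg_module_def)
  next
    fix r y a assume a: "r \<in> carrier R" "y \<in> carrier (F n)" "a \<in> carrier (reg_module R)" "h y \<ominus> x \<otimes> a \<in> I"
    then have c: "a \<in> carrier R" "h y \<in> carrier R" "h (r \<odot>\<^bsub>F n\<^esub> y) = r \<otimes> h y"
      using functionalD[OF h] by (auto simp: reg_module_def)
    have "x \<otimes> (r \<otimes> a) = r \<otimes> (x \<otimes> a)" using a(1) c(1) xc by (metis R.m_assoc)
    then have "h (r \<odot>\<^bsub>F n\<^esub> y) \<ominus> x \<otimes> (r \<otimes> a) = r \<otimes> (h y \<ominus> x \<otimes> a)"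
      using a(1) c xc(1) by (simp add: a_minus_def R.r_distr R.r_minus)
    then show "h (r \<odot>\<^bsub>F n\<^esub> y) \<ominus> x \<otimes> (r \<odot>\<^bsub>reg_module R\<^esub> a) \<in> I" using Id(4) a by (simp add: reg_module_def)
  qed blast
  then show ?thesis using that by (simp add: functional_linear_map)
qed

text \<open>A coboundary modulo \<open>I\<close> is corrected by a cochain that vanishes exactly,
  and not only modulo \<open>I\<close>, on boundaries: zero in degree 0, the true coboundary of the
  bounding cochain above. This removes the distinction of degrees from the long exact
  sequence.\<close>

lemma coboundary_modE:
  assumes I: "left_ideal R I" and g: "functional R (F n) g" and cob: "coboundary_mod I n g"
  obtains u where "functional R (F n) u" "\<And>y. y \<in> carrier (F n) \<Longrightarrow> g y \<ominus> u y \<in> I"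
    "\<And>y. y \<in> carrier (F (Suc n)) \<Longrightarrow> u (d n y) = \<zero>"
proof (cases n)
  case 0
  have "functional R (F 0) (\<lambda>_. \<zero>)" by (simp add: functional_def)
  moreover have "g y \<ominus> \<zero> \<in> I" if "y \<in> carrier (F 0)" for y
    using cob that left_idealD(1)[OF I] 0 by (simp add: a_minus_def)
  ultimately show ?thesis using that[of "\<lambda>_. \<zero>"] 0 by blast
next
  case (Suc m)
  obtain w where w: "functional R (F m) w" "\<And>y. y \<in> carrier (F n) \<Longrightarrow> g y \<ominus> w (d m y) \<in> I"
    using cob Suc by auto
  have "functional R (F n) (\<lambda>y. w (d m y))" unfolding Suc by (rule functional_comp[OF d_linear w(1)])
  moreover have "w (d m (d n y)) = \<zero>" if "y \<in> carrier (F (Suc n))" for y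
    using d_d[of y m] that functional_zero[OF F_module w(1)] Suc by simp
  ultimately show ?thesis using that w(2) by blast
qed

lemma coboundary_mod_cong:
  assumes I: "left_ideal R I" and f: "functional R (F n) f" and k: "functional R (F n) k"
    and fk: "\<And>y. y \<in> carrier (F n) \<Longrightarrow> f y \<ominus> k y \<in> I" and cob: "coboundary_mod I n k"
  shows "coboundary_mod I n f"
proof (cases n)
  case 0
  have "f y \<in> I" if y: "y \<in> carrier (F n)" for y
    using R.left_ideal_cancel[OF I fk[OF y] functionalD(1)[OF f y] functionalD(1)[OF k y]] cob y 0 by simp
  then show ?thesis using 0 by simp
next
  case (Suc m)
  then obtain g where g: "functional R (F m) g" "\<And>y. y \<in> carrier (F n) \<Longrightarrow> k y \<ominus> g (d m y) \<in> I"
    using cob by auto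
  have "f y \<ominus> g (d m y) \<in> I" if y: "y \<in> carrier (F n)" for y
    using R.diff_cong_trans[OF I _ _ _ fk[OF y] g(2)[OF y]]
      functionalD(1)[OF f y] functionalD(1)[OF k y] functionalD(1)[OF g(1)] d_closed[of y m] y Suc by blast
  then show ?thesis using g(1) Suc by auto
qed

lemma coboundary_mod_mono: "coboundary_mod I n f \<Longrightarrow> I \<subseteq> J \<Longrightarrow> coboundary_mod J n f"
  by (cases n) (simp; blast)+

lemma Ext_injective_zero_iff:
  assumes I: "left_ideal R I"
  shows "Ext_injective n I \<zero> \<longleftrightarrow> (\<forall>f. cocycle_mod I n f \<longrightarrow> coboundary_mod I n f)"
proof -
  have "coboundary_mod I n (\<lambda>y. \<zero> \<otimes> f y)" if "cocycle_mod I n f" for f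
  proof -
    have f: "functional R (F n) f" using that by (simp add: cocycle_mod_def)
    have z: "\<zero> \<in> I" using left_idealD(2)[OF I] .
    show ?thesis
    proof (cases n)
      case 0 then show ?thesis using functionalD(1)[OF f] z by simp
    next
      case (Suc m)
      have "functional R (F m) (\<lambda>_. \<zero>)" by (simp add: functional_def)
      then show ?thesis using functionalD(1)[OF f] z Suc by (auto simp: a_minus_def)
    qed
  qed
  then show ?thesis unfolding Ext_injective_def by blast
qed

text \<open>The long exact sequence of \<open>\<zero> \<rightarrow> R/I \<rightarrow> R/I \<rightarrow> R/(I + xR) \<rightarrow> \<zero>\<close>, in which multiplication by \<open>x\<close>
  induces the zero map on \<open>Ext(M, R/I)\<close>.\<close>

lemma Ext_injective_shift:
  assumes I: "left_ideal R I" and x: "x \<in> centre R"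
    and reg: "\<And>r. r \<in> carrier R \<Longrightarrow> x \<otimes> r \<in> I \<Longrightarrow> r \<in> I"
    and xM: "\<And>m. m \<in> carrier M \<Longrightarrow> x \<odot>\<^bsub>M\<^esub> m = \<zero>\<^bsub>M\<^esub>"
    and van: "Ext_injective n I \<zero>" and z: "z \<in> centre R"
  shows "Ext_injective (Suc n) I z \<longleftrightarrow> Ext_injective n (add_multiples R I x) z"
proof
  let ?J = "add_multiples R I x"
  note xc = centreD[OF x] and zc = centreD[OF z]
  note J = R.left_ideal_add_multiples[OF I x]
  note IJ = R.add_multiplesI1[OF I xc(1)] and xJ = R.add_multiplesI2[OF I xc(1)]
  note Id = left_idealD[OF I] and Jd = left_idealD[OF J]
  have van': "cocycle_mod I n f \<Longrightarrow> coboundary_mod I n f" for f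
    using van Ext_injective_zero_iff[OF I] by blast
  have reg': "a \<ominus> b \<in> I" if "a \<in> carrier R" "b \<in> carrier R" "x \<otimes> a \<ominus> x \<otimes> b \<in> I" for a b
  proof -
    have "x \<otimes> (a \<ominus> b) = x \<otimes> a \<ominus> x \<otimes> b" using that xc(1) by algebra
    then show ?thesis using reg[of "a \<ominus> b"] that by simp
  qed
  have subJ: "a \<in> ?J" if "a \<ominus> x \<otimes> b \<in> I" "a \<in> carrier R" "b \<in> carrier R" for a b
  proof -
    have "a = (a \<ominus> x \<otimes> b) \<oplus> x \<otimes> b" using that xc(1) by algebra
    then show ?thesis using that(1,3) unfolding add_multiples_def by blast
  qed
  {
    assume V: "Ext_injective n ?J z"
    show "Ext_injective (Suc n) I z" unfolding Ext_injective_def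
    proof (intro allI impI)
      fix f assume "cocycle_mod I (Suc n) f" and cob: "coboundary_mod I (Suc n) (\<lambda>y. z \<otimes> f y)"
      then have f: "functional R (F (Suc n)) f" and fd: "\<And>y. y \<in> carrier (F (Suc (Suc n))) \<Longrightarrow> f (d (Suc n) y) \<in> I"
        by (auto simp: cocycle_mod_def)
      obtain h where h: "functional R (F n) h" "\<And>y. y \<in> carrier (F (Suc n)) \<Longrightarrow> z \<otimes> f y \<ominus> h (d n y) \<in> I"
        using cob by auto
      obtain s s' where s: "linear_map R (F n) (F (Suc n)) s" and s': "linear_map R (F (Suc n)) (F (Suc (Suc n))) s'"
        and hs: "\<And>y. y \<in> carrier (F (Suc n)) \<Longrightarrow> d (Suc n) (s' y) = x \<odot>\<^bsub>F (Suc n)\<^esub> y \<ominus>\<^bsub>F (Suc n)\<^esub> s (d n y)"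
        using contracting_homotopy[OF x xM, of n] by blast
      interpret F1: left_module R "F (Suc n)" by (rule F_module)
      \<comment> \<open>A preimage of \<open>f\<close> under the connecting map: by the homotopy
        formula, \<open>x f\<close> and \<open>g d\<close> agree modulo \<open>I\<close>.\<close>
      define g where "g y = f (s y)" for y
      have g: "functional R (F n) g" unfolding g_def by (rule functional_comp[OF s f])
      note fc = functionalD(1)[OF f] and gc = functionalD(1)[OF g] and hc = functionalD(1)[OF h(1)]
      have fg: "x \<otimes> f y \<ominus> g (d n y) \<in> I" if y: "y \<in> carrier (F (Suc n))" for y
      proof -
        have "s (d n y) \<in> carrier (F (Suc n))" using linear_mapD(1)[OF s d_closed[OF y]] .
        then have "f (d (Suc n) (s' y)) = x \<otimes> f y \<ominus> g (d n y)"
          using hs[OF y] functional_minus[OF F_module f] functionalD(3)[OF f xc(1) y] y xc(1)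
          by (simp add: g_def)
        then show ?thesis using fd[OF linear_mapD(1)[OF s' y]] by simp
      qed
      have gJ: "g (d n y) \<in> ?J" if y: "y \<in> carrier (F (Suc n))" for y
        using subJ[OF R.diff_cong_sym[OF I _ _ fg[OF y]]] fc[OF y] gc[OF d_closed[OF y]] xc(1) by simp
      \<comment> \<open>This combination is a cocycle modulo \<open>I\<close>, since
        \<open>z g d\<close>, \<open>z x f\<close> and \<open>x h d\<close> are congruent. Vanishing
        in degree \<open>n\<close> makes it a coboundary, and modulo \<open>I + xR\<close> it equals
        \<open>z g\<close>.\<close>
      have k: "functional R (F n) (\<lambda>y. z \<otimes> g y \<ominus> x \<otimes> h y)"
        by (intro functional_diff functional_central_mult F_module g h z x)
      have kd: "z \<otimes> g (d n y) \<ominus> x \<otimes> h (d n y) \<in> I" if y: "y \<in> carrier (F (Suc n))" for y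
      proof -
        note c = fc[OF y] gc[OF d_closed[OF y]] hc[OF d_closed[OF y]]
        have 1: "z \<otimes> g (d n y) \<ominus> z \<otimes> (x \<otimes> f y) \<in> I"
          using R.diff_cong_mult[OF I _ _ zc(1) R.diff_cong_sym[OF I _ _ fg[OF y]]] c xc(1) by simp
        have 2: "x \<otimes> (z \<otimes> f y) \<ominus> x \<otimes> h (d n y) \<in> I"
          using R.diff_cong_mult[OF I _ _ xc(1) h(2)[OF y]] c zc(1) by simp
        have "z \<otimes> (x \<otimes> f y) = x \<otimes> (z \<otimes> f y)" using R.central_lcomm[OF x] c zc(1) by simp
        then show ?thesis using R.diff_cong_trans[OF I _ _ _ 1] 2 c xc(1) zc(1) by simp
      qed
      have "coboundary_mod I n (\<lambda>y. z \<otimes> g y \<ominus> x \<otimes> h y)"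
        using van' k kd by (simp add: cocycle_mod_def)
      then have "coboundary_mod ?J n (\<lambda>y. z \<otimes> g y \<ominus> x \<otimes> h y)"
        by (rule coboundary_mod_mono) (use IJ in blast)
      then have "coboundary_mod ?J n (\<lambda>y. z \<otimes> g y)"
      proof (rule coboundary_mod_cong[OF J _ k, rotated 2])
        show "functional R (F n) (\<lambda>y. z \<otimes> g y)" by (intro functional_central_mult F_module g z)
        fix y assume y: "y \<in> carrier (F n)"
        have "z \<otimes> g y \<ominus> (z \<otimes> g y \<ominus> x \<otimes> h y) = x \<otimes> h y"
          using gc[OF y] hc[OF y] xc(1) zc(1) by algebra
        then show "z \<otimes> g y \<ominus> (z \<otimes> g y \<ominus> x \<otimes> h y) \<in> ?J" using xJ hc[OF y] by simp
      qed
      then have "coboundary_mod ?J n g" using V g gJ unfolding Ext_injective_def cocycle_mod_def by blast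
      then obtain u where u: "functional R (F n) u" "\<And>y. y \<in> carrier (F n) \<Longrightarrow> g y \<ominus> u y \<in> ?J"
        "\<And>y. y \<in> carrier (F (Suc n)) \<Longrightarrow> u (d n y) = \<zero>"
        using coboundary_modE[OF J g] by blast
      \<comment> \<open>Modulo \<open>I\<close> the maps \<open>x f\<close>, \<open>g d\<close> and
        \<open>x l d\<close> agree on \<open>F (Suc n)\<close>, because \<open>u d\<close> is zero.
        Cancelling the regular \<open>x\<close> exhibits \<open>f\<close> as the coboundary of
        \<open>l\<close>.\<close>
      obtain l where l: "functional R (F n) l" "\<And>y. y \<in> carrier (F n) \<Longrightarrow> (g y \<ominus> u y) \<ominus> x \<otimes> l y \<in> I"
        using divide_functional[OF I x functional_diff[OF F_module g u(1)] u(2)] by blast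
      have "f y \<ominus> l (d n y) \<in> I" if y: "y \<in> carrier (F (Suc n))" for y
      proof -
        note c = fc[OF y] gc[OF d_closed[OF y]] functionalD(1)[OF l(1) d_closed[OF y]]
        have "g (d n y) \<ominus> x \<otimes> l (d n y) \<in> I"
          using l(2)[OF d_closed[OF y]] u(3)[OF y] c by (simp add: a_minus_def)
        then show ?thesis using R.diff_cong_trans[OF I _ _ _ fg[OF y]] c xc(1) by (intro reg'[of "f y" "l (d n y)"]) auto
      qed
      then show "coboundary_mod I (Suc n) f" using l(1) by auto
    qed
  next
    assume V: "Ext_injective (Suc n) I z"
    show "Ext_injective n ?J z" unfolding Ext_injective_def
    proof (intro allI impI)
      fix g assume "cocycle_mod ?J n g" and cob: "coboundary_mod ?J n (\<lambda>y. z \<otimes> g y)"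
      then have g: "functional R (F n) g" and gd: "\<And>y. y \<in> carrier (F (Suc n)) \<Longrightarrow> g (d n y) \<in> ?J"
        by (auto simp: cocycle_mod_def)
      note gc = functionalD(1)[OF g]
      \<comment> \<open>The image of \<open>g\<close> under the connecting map: \<open>g d\<close>
        takes values in \<open>I + xR\<close> and is divided by \<open>x\<close>.\<close>
      obtain f where f: "functional R (F (Suc n)) f" "\<And>y. y \<in> carrier (F (Suc n)) \<Longrightarrow> g (d n y) \<ominus> x \<otimes> f y \<in> I"
        using divide_functional[OF I x functional_comp[OF d_linear g] gd] by blast
      note fc = functionalD(1)[OF f(1)]
      have fd: "f (d (Suc n) y) \<in> I" if y: "y \<in> carrier (F (Suc (Suc n)))" for y
      proof -
        have "\<zero> \<ominus> x \<otimes> f (d (Suc n) y) \<in> I"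
          using f(2)[OF d_closed[OF y]] d_d[OF y] functional_zero[OF F_module g] by simp
        then have "x \<otimes> f (d (Suc n) y) \<in> I"
          using R.left_ideal_cancel[OF I, of \<zero> "x \<otimes> f (d (Suc n) y)"] Id(2) fc[OF d_closed[OF y]] xc(1) by simp
        then show ?thesis using reg fc[OF d_closed[OF y]] by simp
      qed
      have zg: "functional R (F n) (\<lambda>y. z \<otimes> g y)" by (intro functional_central_mult F_module g z)
      obtain u where u: "functional R (F n) u" "\<And>y. y \<in> carrier (F n) \<Longrightarrow> z \<otimes> g y \<ominus> u y \<in> ?J"
        "\<And>y. y \<in> carrier (F (Suc n)) \<Longrightarrow> u (d n y) = \<zero>"
        using coboundary_modE[OF J zg cob] by blast
      obtain h where h: "functional R (F n) h" "\<And>y. y \<in> carrier (F n) \<Longrightarrow> (z \<otimes> g y \<ominus> u y) \<ominus> x \<otimes> h y \<in> I"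
        using divide_functional[OF I x functional_diff[OF F_module zg u(1)] u(2)] by blast
      have "z \<otimes> f y \<ominus> h (d n y) \<in> I" if y: "y \<in> carrier (F (Suc n))" for y
      proof -
        note c = fc[OF y] gc[OF d_closed[OF y]] functionalD(1)[OF h(1) d_closed[OF y]]
        have 1: "z \<otimes> (x \<otimes> f y) \<ominus> z \<otimes> g (d n y) \<in> I"
          using R.diff_cong_mult[OF I _ _ zc(1) R.diff_cong_sym[OF I _ _ f(2)[OF y]]] c xc(1) by simp
        have 2: "z \<otimes> g (d n y) \<ominus> x \<otimes> h (d n y) \<in> I"
          using h(2)[OF d_closed[OF y]] u(3)[OF y] c zc(1) by (simp add: a_minus_def)
        have "z \<otimes> (x \<otimes> f y) = x \<otimes> (z \<otimes> f y)" using R.central_lcomm[OF x] c zc(1) by simp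
        then show ?thesis using R.diff_cong_trans[OF I _ _ _ 1 2] c xc(1) zc(1) by (intro reg'[of "z \<otimes> f y" "h (d n y)"]) auto
      qed
      then have "coboundary_mod I (Suc n) (\<lambda>y. z \<otimes> f y)" using h(1) by auto
      then have "coboundary_mod I (Suc n) f" using V f(1) fd unfolding Ext_injective_def cocycle_mod_def by blast
      then obtain l where l: "functional R (F n) l" "\<And>y. y \<in> carrier (F (Suc n)) \<Longrightarrow> f y \<ominus> l (d n y) \<in> I" by auto
      note lc = functionalD(1)[OF l(1)]
      \<comment> \<open>If \<open>f\<close> bounds \<open>l\<close>, then \<open>g\<close> minus
        \<open>x l\<close> is a cocycle modulo \<open>I\<close>, hence a coboundary by vanishing in
        degree \<open>n\<close>; modulo \<open>I + xR\<close> it is \<open>g\<close>.\<close>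
      have k: "functional R (F n) (\<lambda>y. g y \<ominus> x \<otimes> l y)"
        by (intro functional_diff functional_central_mult F_module g l x)
      have "g (d n y) \<ominus> x \<otimes> l (d n y) \<in> I" if y: "y \<in> carrier (F (Suc n))" for y
        using R.diff_cong_trans[OF I _ _ _ f(2)[OF y] R.diff_cong_mult[OF I _ _ xc(1) l(2)[OF y]]]
          fc[OF y] gc[OF d_closed[OF y]] lc[OF d_closed[OF y]] xc(1) by simp
      then have "coboundary_mod I n (\<lambda>y. g y \<ominus> x \<otimes> l y)" using van' k by (simp add: cocycle_mod_def)
      then have "coboundary_mod ?J n (\<lambda>y. g y \<ominus> x \<otimes> l y)"
        by (rule coboundary_mod_mono) (use IJ in blast)
      then show "coboundary_mod ?J n g"
      proof (rule coboundary_mod_cong[OF J g k, rotated])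
        fix y assume y: "y \<in> carrier (F n)"
        have "g y \<ominus> (g y \<ominus> x \<otimes> l y) = x \<otimes> l y"
          using gc[OF y] lc[OF y] xc(1) by algebra
        then show "g y \<ominus> (g y \<ominus> x \<otimes> l y) \<in> ?J" using xJ lc[OF y] by simp
      qed
    qed
  }
qed

end

section \<open>Ext as a module over the centre\<close>

lemma submodule_of_left_moduleI:
  assumes "left_module R M" "N \<subseteq> carrier M" "\<zero>\<^bsub>M\<^esub> \<in> N"
    and "\<And>a b. a \<in> N \<Longrightarrow> b \<in> N \<Longrightarrow> a \<oplus>\<^bsub>M\<^esub> b \<in> N"
    and sm: "\<And>r a. r \<in> carrier R \<Longrightarrow> a \<in> N \<Longrightarrow> r \<odot>\<^bsub>M\<^esub> a \<in> N"
  shows "submodule N R M"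
proof -
  interpret left_module R M by fact
  have inv: "\<ominus>\<^bsub>M\<^esub> a \<in> N" if "a \<in> N" for a
    using sm[of "\<ominus>\<^bsub>R\<^esub> \<one>\<^bsub>R\<^esub>" a] smult_minus_one[OF assms(1), of a] that assms(2) by auto
  then have "inv\<^bsub>add_monoid M\<^esub> a \<in> N" if "a \<in> N" for a
    using that by (simp add: a_inv_def)
  then show ?thesis
    using assms by (intro submodule.intro subgroup.intro submodule_axioms.intro) auto
qed

lemma submodule_abelian_subgroup:
  assumes "left_module R M" "submodule N R M" shows "abelian_subgroup N M"
proof -
  interpret M: left_module R M by fact
  interpret N: submodule N R M by fact
  have "additive_subgroup N M" by (simp add: N.subgroup_axioms additive_subgroup.intro)
  then show ?thesis by (rule abelian_subgroupI3) (rule M.M.abelian_group_axioms)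
qed

lemma quot_module_carrier:
  "X \<in> carrier (quot_module M N) \<longleftrightarrow> (\<exists>x\<in>carrier M. X = N +>\<^bsub>M\<^esub> x)"
  by (auto simp: quot_module_def A_RCOSETS_def' a_r_coset_def')

lemma quot_module_zero_iff:
  assumes "left_module R M" "submodule N R M" "x \<in> carrier M"
  shows "N +>\<^bsub>M\<^esub> x = \<zero>\<^bsub>quot_module M N\<^esub> \<longleftrightarrow> x \<in> N"
proof -
  interpret abelian_subgroup N M by (rule submodule_abelian_subgroup[OF assms(1,2)])
  show ?thesis using a_rcos_const[of x] a_rcos_self[OF assms(3)] by (auto simp: quot_module_def)
qed

lemma quot_module_smult:
  assumes "left_module R M" "submodule N R M" "x \<in> carrier M" "r \<in> carrier R"
  shows "r \<odot>\<^bsub>quot_module M N\<^esub> (N +>\<^bsub>M\<^esub> x) = N +>\<^bsub>M\<^esub> (r \<odot>\<^bsub>M\<^esub> x)"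
proof -
  interpret M: left_module R M by fact
  interpret N: submodule N R M by fact
  interpret A: abelian_subgroup N M by (rule submodule_abelian_subgroup[OF assms(1,2)])
  have "N +>\<^bsub>M\<^esub> (r \<odot>\<^bsub>M\<^esub> a) = N +>\<^bsub>M\<^esub> (r \<odot>\<^bsub>M\<^esub> x)" if a: "a \<in> N +>\<^bsub>M\<^esub> x" for a
  proof -
    from a obtain n where n: "n \<in> N" "a = n \<oplus>\<^bsub>M\<^esub> x" by (auto simp: a_r_coset_def')
    then have "r \<odot>\<^bsub>M\<^esub> a = r \<odot>\<^bsub>M\<^esub> n \<oplus>\<^bsub>M\<^esub> r \<odot>\<^bsub>M\<^esub> x"
      using assms(3,4) N.subset by (simp add: M.smult_r_distr subsetD)
    then have "r \<odot>\<^bsub>M\<^esub> a \<in> N +>\<^bsub>M\<^esub> (r \<odot>\<^bsub>M\<^esub> x)"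
      using n(1) assms(4) by (auto simp: a_r_coset_def')
    from A.a_repr_independence'[OF this M.smult_closed[OF assms(4,3)]] show ?thesis by simp
  qed
  then have "(\<Union>a\<in>N +>\<^bsub>M\<^esub> x. N +>\<^bsub>M\<^esub> (r \<odot>\<^bsub>M\<^esub> a)) = N +>\<^bsub>M\<^esub> (r \<odot>\<^bsub>M\<^esub> x)"
    using A.a_rcos_self[OF assms(3)] by blast
  then show ?thesis by (simp add: quot_module_def)
qed

lemma restrict_carrier_left_module:
  assumes "left_module R M" "submodule N R M"
  shows "left_module R (M\<lparr>carrier := N\<rparr>)"
proof -
  interpret M: left_module R M by fact
  interpret N: submodule N R M by fact
  have sub: "x \<in> N \<Longrightarrow> x \<in> carrier M" for x using N.subset by auto
  have "abelian_group (M\<lparr>carrier := N\<rparr>)"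
  proof (rule abelian_groupI)
    fix x assume "x \<in> carrier (M\<lparr>carrier := N\<rparr>)"
    moreover from this have "\<ominus>\<^bsub>M\<^esub> x \<in> N"
      using N.m_inv_closed[of x] by (simp add: a_inv_def)
    ultimately show "\<exists>y\<in>carrier (M\<lparr>carrier := N\<rparr>). y \<oplus>\<^bsub>M\<lparr>carrier := N\<rparr>\<^esub> x = \<zero>\<^bsub>M\<lparr>carrier := N\<rparr>\<^esub>"
      using M.M.l_neg sub by auto
  qed (use N.m_closed N.one_closed in \<open>auto simp: sub M.M.a_ac\<close>)
  then show ?thesis
    by (rule left_moduleI[OF M.R.ring_axioms])
      (auto simp: sub M.smult_l_distr M.smult_r_distr M.smult_assoc1)
qed

lemma (in ring) centre_subset: "centre R \<subseteq> carrier R" by (auto simp: centre_def)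

lemma (in ring) centre_zero [simp]: "\<zero> \<in> centre R" by (simp add: centre_def)

lemma (in ring) centre_one [simp]: "\<one> \<in> centre R" by (simp add: centre_def)

lemma (in ring) centre_add: "a \<in> centre R \<Longrightarrow> b \<in> centre R \<Longrightarrow> a \<oplus> b \<in> centre R"
  by (auto simp: centre_def l_distr r_distr)

lemma (in ring) centre_mult: "a \<in> centre R \<Longrightarrow> b \<in> centre R \<Longrightarrow> a \<otimes> b \<in> centre R"
proof -
  assume a: "a \<in> centre R" and b: "b \<in> centre R"
  have "a \<otimes> b \<otimes> x = x \<otimes> (a \<otimes> b)" if "x \<in> carrier R" for x
  proof -
    note c = centreD(1)[OF a] centreD(1)[OF b]
    have "a \<otimes> b \<otimes> x = a \<otimes> (x \<otimes> b)" using that c centreD(2)[OF b that] by (simp add: m_assoc)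
    also have "\<dots> = x \<otimes> (a \<otimes> b)" using that c m_assoc[of a x b] m_assoc[of x a b] centreD(2)[OF a that] by metis
    finally show ?thesis .
  qed
  then show ?thesis using centreD(1)[OF a] centreD(1)[OF b] by (simp add: centre_def)
qed

lemma (in ring) centre_uminus: "a \<in> centre R \<Longrightarrow> \<ominus> a \<in> centre R"
  by (auto simp: centre_def l_minus r_minus)

lemma (in ring) centre_ring_ring: "ring (centre_ring R)"
proof (rule ringI)
  show "abelian_group (centre_ring R)"
  proof (rule abelian_groupI)
    fix x assume "x \<in> carrier (centre_ring R)"
    then show "\<exists>y\<in>carrier (centre_ring R). y \<oplus>\<^bsub>centre_ring R\<^esub> x = \<zero>\<^bsub>centre_ring R\<^esub>"
      using centre_uminus[of x] centreD(1)[of x R] l_neg by (auto simp: centre_ring_def)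
  qed (auto simp: centre_ring_def centreD(1) centre_add a_ac)
  show "Group.monoid (centre_ring R)"
    by (rule monoidI) (auto simp: centre_ring_def centreD(1) centre_mult m_assoc)
qed (auto simp: centre_ring_def centreD(1) l_distr r_distr)

text \<open>Representatives of a coset differ by elements of \<open>q\<close>, which kill
  \<open>E\<close>; hence \<open>the_elem\<close> is applied to a singleton.\<close>

lemma descend_scalars_smult:
  assumes E: "left_module Z E" and q: "ideal q Z"
    and ann: "\<And>c e. c \<in> q \<Longrightarrow> e \<in> carrier E \<Longrightarrow> c \<odot>\<^bsub>E\<^esub> e = \<zero>\<^bsub>E\<^esub>"
    and A: "A \<in> carrier (Z Quot q)" "a \<in> A" and e: "e \<in> carrier E"
  shows "A \<odot>\<^bsub>descend_scalars E\<^esub> e = a \<odot>\<^bsub>E\<^esub> e"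
proof -
  interpret left_module Z E by fact
  interpret q: ideal q Z by fact
  obtain z where z: "z \<in> carrier Z" "A = q +>\<^bsub>Z\<^esub> z"
    using A(1) by (auto simp: FactRing_def A_RCOSETS_def' a_r_coset_def')
  have "b \<odot>\<^bsub>E\<^esub> e = z \<odot>\<^bsub>E\<^esub> e" if "b \<in> A" for b
  proof -
    obtain c where c: "c \<in> q" "b = c \<oplus>\<^bsub>Z\<^esub> z" using \<open>b \<in> A\<close> z(2) by (auto simp: a_r_coset_def')
    then show ?thesis using smult_l_distr[of c z e] ann[OF c(1) e] z(1) e q.Icarr[OF c(1)] by simp
  qed
  then have "(\<lambda>b. b \<odot>\<^bsub>E\<^esub> e) ` A = {a \<odot>\<^bsub>E\<^esub> e}" using A(2) by force
  then show ?thesis by (simp add: descend_scalars_def)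
qed

lemma Quot_carrier_mem:
  assumes "ideal q Z" "A \<in> carrier (Z Quot q)"
  obtains a where "a \<in> A" "a \<in> carrier Z" "A = q +>\<^bsub>Z\<^esub> a"
proof -
  interpret q: ideal q Z by fact
  obtain a where "a \<in> carrier Z" "A = q +>\<^bsub>Z\<^esub> a"
    using assms(2) by (auto simp: FactRing_def A_RCOSETS_def' a_r_coset_def')
  then show ?thesis using that q.a_rcos_self by blast
qed

lemma descend_scalars_left_module:
  assumes E: "left_module Z E" and q: "ideal q Z"
    and ann: "\<And>c e. c \<in> q \<Longrightarrow> e \<in> carrier E \<Longrightarrow> c \<odot>\<^bsub>E\<^esub> e = \<zero>\<^bsub>E\<^esub>"
  shows "left_module (Z Quot q) (descend_scalars E)"
proof -
  interpret E: left_module Z E by fact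
  interpret q: ideal q Z by fact
  interpret Q: ring "Z Quot q" by (rule q.quotient_is_ring)
  let ?D = "descend_scalars E"
  have sm: "A \<odot>\<^bsub>?D\<^esub> x = a \<odot>\<^bsub>E\<^esub> x" if "A \<in> carrier (Z Quot q)" "a \<in> A" "x \<in> carrier E" for A a x
    by (rule descend_scalars_smult[OF E q _ that]) (rule ann)
  have c: "carrier ?D = carrier E" "add ?D = add E" by (simp_all add: descend_scalars_def)
  have "abelian_group ?D"
  proof (rule abelian_groupI)
    fix x assume "x \<in> carrier ?D"
    then show "\<exists>y\<in>carrier ?D. y \<oplus>\<^bsub>?D\<^esub> x = \<zero>\<^bsub>?D\<^esub>"
      by (intro bexI[of _ "\<ominus>\<^bsub>E\<^esub> x"]) (auto simp: descend_scalars_def E.M.l_neg)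
  qed (auto simp: descend_scalars_def E.M.a_ac)
  then show ?thesis
  proof (rule left_moduleI[OF Q.ring_axioms], unfold c)
    fix A x assume "A \<in> carrier (Z Quot q)" "x \<in> carrier E"
    then show "A \<odot>\<^bsub>?D\<^esub> x \<in> carrier E"
      using Quot_carrier_mem[OF q] sm by (metis E.smult_closed)
  next
    fix A B x assume AB: "A \<in> carrier (Z Quot q)" "B \<in> carrier (Z Quot q)" "x \<in> carrier E"
    obtain a where a: "a \<in> A" "a \<in> carrier Z" "A = q +>\<^bsub>Z\<^esub> a" using Quot_carrier_mem[OF q AB(1)] .
    obtain b where b: "b \<in> B" "b \<in> carrier Z" "B = q +>\<^bsub>Z\<^esub> b" using Quot_carrier_mem[OF q AB(2)] .
    have "a \<oplus>\<^bsub>Z\<^esub> b \<in> A \<oplus>\<^bsub>Z Quot q\<^esub> B"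
      using a b by (auto simp: FactRing_def set_add_def')
    then show "(A \<oplus>\<^bsub>Z Quot q\<^esub> B) \<odot>\<^bsub>?D\<^esub> x = A \<odot>\<^bsub>?D\<^esub> x \<oplus>\<^bsub>E\<^esub> B \<odot>\<^bsub>?D\<^esub> x"
      using sm[OF AB(1) a(1) AB(3)] sm[OF AB(2) b(1) AB(3)] sm[OF Q.a_closed[OF AB(1,2)] _ AB(3)]
        E.smult_l_distr[OF a(2) b(2) AB(3)] by simp
    have "a \<otimes>\<^bsub>Z\<^esub> b \<in> q +>\<^bsub>Z\<^esub> (a \<otimes>\<^bsub>Z\<^esub> b)" using a b by (simp add: q.a_rcos_self)
    then have "a \<otimes>\<^bsub>Z\<^esub> b \<in> A \<otimes>\<^bsub>Z Quot q\<^esub> B"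
      using a(1) b(1) by (auto simp: FactRing_def rcoset_mult_def)
    then show "(A \<otimes>\<^bsub>Z Quot q\<^esub> B) \<odot>\<^bsub>?D\<^esub> x = A \<odot>\<^bsub>?D\<^esub> (B \<odot>\<^bsub>?D\<^esub> x)"
      using sm[OF AB(1) a(1)] sm[OF AB(2) b(1) AB(3)] sm[OF Q.m_closed[OF AB(1,2)] _ AB(3)]
        E.smult_assoc1[OF a(2) b(2) AB(3)] b(2) AB(3) by simp
  next
    fix A x y assume A: "A \<in> carrier (Z Quot q)" "x \<in> carrier E" "y \<in> carrier E"
    obtain a where a: "a \<in> A" "a \<in> carrier Z" "A = q +>\<^bsub>Z\<^esub> a" using Quot_carrier_mem[OF q A(1)] .
    show "A \<odot>\<^bsub>?D\<^esub> (x \<oplus>\<^bsub>E\<^esub> y) = A \<odot>\<^bsub>?D\<^esub> x \<oplus>\<^bsub>E\<^esub> A \<odot>\<^bsub>?D\<^esub> y"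
      using sm[OF A(1) a(1)] A(2,3) E.smult_r_distr[OF a(2)] by simp
  next
    fix x assume x: "x \<in> carrier E"
    have "\<one>\<^bsub>Z\<^esub> \<in> \<one>\<^bsub>Z Quot q\<^esub>" by (simp add: FactRing_def q.a_rcos_self)
    then show "\<one>\<^bsub>Z Quot q\<^esub> \<odot>\<^bsub>?D\<^esub> x = x" using sm[OF Q.one_closed _ x] x by simp
  qed
qed

section \<open>The cochain complex of functionals and its cohomology\<close>

context resolved_module
begin

abbreviation "C n \<equiv> hom_module R (F n) (reg_module R)"
abbreviation "cocyc n \<equiv> cocycles R F d (reg_module R) n"
abbreviation "cobound n \<equiv> coboundaries R F d (reg_module R) n"

lemma C_carrier: "f \<in> carrier (C n) \<longleftrightarrow> functional R (F n) f \<and> f \<in> extensional (carrier (F n))"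
  by (auto simp: hom_module_def functional_def reg_module_def PiE_def)

lemma functional_restrict:
  assumes "functional R (F n) f" shows "functional R (F n) (restrict f (carrier (F n)))"
proof -
  interpret left_module R "F n" by (rule F_module)
  show ?thesis using assms by (auto simp: functional_def)
qed

lemma functional_add:
  assumes "functional R (F n) f" "functional R (F n) g"
  shows "functional R (F n) (\<lambda>x. f x \<oplus> g x)"
  using functionalD[OF assms(1)] functionalD[OF assms(2)]
  by (auto simp: functional_def R.a_ac R.r_distr)

lemma C_ops:
  "\<zero>\<^bsub>C n\<^esub> = (\<lambda>x\<in>carrier (F n). \<zero>)"
  "f \<oplus>\<^bsub>C n\<^esub> g = (\<lambda>x\<in>carrier (F n). f x \<oplus> g x)"
  "z \<odot>\<^bsub>C n\<^esub> f = (\<lambda>x\<in>carrier (F n). z \<otimes> f x)"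
  by (simp_all add: hom_module_def reg_module_def)

text \<open>The scalars are central because \<open>z f\<close> is again linear only if
  \<open>z\<close> commutes with the ring elements that are pulled out of \<open>f\<close>.\<close>

lemma C_left_module: "left_module (centre_ring R) (C n)"
proof -
  have cr: "carrier (centre_ring R) = centre R" "add (centre_ring R) = add R" "mult (centre_ring R) = mult R"
    "one (centre_ring R) = one R"
    by (simp_all add: centre_ring_def)
  have fc: "functional R (F n) f" "f \<in> extensional (carrier (F n))" "\<And>y. y \<in> carrier (F n) \<Longrightarrow> f y \<in> carrier R"
    if "f \<in> carrier (C n)" for f
    using that functionalD(1)[of R "F n" f] by (auto simp: C_carrier)
  have "abelian_group (C n)"
  proof (rule abelian_groupI)
    fix f g assume fg: "f \<in> carrier (C n)" "g \<in> carrier (C n)"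
    show "f \<oplus>\<^bsub>C n\<^esub> g \<in> carrier (C n)"
      unfolding C_ops C_carrier using functional_restrict[OF functional_add] fc(1)[OF fg(1)] fc(1)[OF fg(2)] by simp
    show "f \<oplus>\<^bsub>C n\<^esub> g = g \<oplus>\<^bsub>C n\<^esub> f"
      unfolding C_ops using fc(3)[OF fg(1)] fc(3)[OF fg(2)] by (auto simp: fun_eq_iff R.a_comm)
  next
    show "\<zero>\<^bsub>C n\<^esub> \<in> carrier (C n)"
      unfolding C_ops C_carrier
      using functional_restrict[of n "\<lambda>_. \<zero>"] by (simp add: functional_def)
  next
    fix f g h assume fg: "f \<in> carrier (C n)" "g \<in> carrier (C n)" "h \<in> carrier (C n)"
    show "f \<oplus>\<^bsub>C n\<^esub> g \<oplus>\<^bsub>C n\<^esub> h = f \<oplus>\<^bsub>C n\<^esub> (g \<oplus>\<^bsub>C n\<^esub> h)"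
      unfolding C_ops using fc(3)[OF fg(1)] fc(3)[OF fg(2)] fc(3)[OF fg(3)] by (auto simp: fun_eq_iff R.a_assoc)
  next
    fix f assume f: "f \<in> carrier (C n)"
    show "\<zero>\<^bsub>C n\<^esub> \<oplus>\<^bsub>C n\<^esub> f = f"
      unfolding C_ops using fc(2,3)[OF f] by (auto simp: fun_eq_iff extensional_def)
    show "\<exists>g\<in>carrier (C n). g \<oplus>\<^bsub>C n\<^esub> f = \<zero>\<^bsub>C n\<^esub>"
    proof (rule bexI)
      let ?g = "\<lambda>x\<in>carrier (F n). \<ominus> \<one> \<otimes> f x"
      show "?g \<in> carrier (C n)"
        unfolding C_carrier using functional_restrict[OF functional_central_mult[OF F_module fc(1)[OF f] R.centre_uminus[OF R.centre_one]]]
        by simp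
      show "?g \<oplus>\<^bsub>C n\<^esub> f = \<zero>\<^bsub>C n\<^esub>"
        unfolding C_ops using fc(3)[OF f] by (auto simp: fun_eq_iff R.l_minus R.l_neg)
    qed
  qed
  then show ?thesis
  proof (rule left_moduleI[OF R.centre_ring_ring], unfold cr)
    fix z f assume z: "z \<in> centre R" and f: "f \<in> carrier (C n)"
    show "z \<odot>\<^bsub>C n\<^esub> f \<in> carrier (C n)"
      unfolding C_ops C_carrier using functional_restrict[OF functional_central_mult[OF F_module fc(1)[OF f] z]] by simp
  next
    fix f assume f: "f \<in> carrier (C n)"
    show "\<one> \<odot>\<^bsub>C n\<^esub> f = f" unfolding C_ops using fc(2,3)[OF f] by (auto simp: fun_eq_iff extensional_def)
  next
    fix z w f assume zw: "z \<in> centre R" "w \<in> centre R" and f: "f \<in> carrier (C n)"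
    note c = centreD(1)[OF zw(1)] centreD(1)[OF zw(2)] fc(3)[OF f]
    show "(z \<oplus> w) \<odot>\<^bsub>C n\<^esub> f = z \<odot>\<^bsub>C n\<^esub> f \<oplus>\<^bsub>C n\<^esub> w \<odot>\<^bsub>C n\<^esub> f"
      unfolding C_ops using c by (auto simp: fun_eq_iff R.l_distr)
    show "(z \<otimes> w) \<odot>\<^bsub>C n\<^esub> f = z \<odot>\<^bsub>C n\<^esub> (w \<odot>\<^bsub>C n\<^esub> f)"
      unfolding C_ops using c by (auto simp: fun_eq_iff R.m_assoc)
  next
    fix z f g assume z: "z \<in> centre R" and fg: "f \<in> carrier (C n)" "g \<in> carrier (C n)"
    note c = centreD(1)[OF z] fc(3)[OF fg(1)] fc(3)[OF fg(2)]
    show "z \<odot>\<^bsub>C n\<^esub> (f \<oplus>\<^bsub>C n\<^esub> g) = z \<odot>\<^bsub>C n\<^esub> f \<oplus>\<^bsub>C n\<^esub> z \<odot>\<^bsub>C n\<^esub> g"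
      unfolding C_ops using c by (auto simp: fun_eq_iff R.r_distr)
  qed
qed

lemma left_ideal_zero: "left_ideal R {\<zero>}"
  by (simp add: left_ideal_def)

lemma cocyc_iff: "f \<in> cocyc n \<longleftrightarrow> cocycle_mod {\<zero>} n f \<and> f \<in> extensional (carrier (F n))"
  unfolding cocycles_def by (auto simp: C_carrier cocycle_mod_def) (auto simp: reg_module_def)

lemma diff_eq_zero:
  assumes "a \<in> carrier R" "b \<in> carrier R" shows "a \<ominus> b = \<zero> \<longleftrightarrow> a = b"
proof
  assume "a \<ominus> b = \<zero>"
  then have "(a \<ominus> b) \<oplus> b = \<zero> \<oplus> b" by simp
  moreover have "(a \<ominus> b) \<oplus> b = a" using assms by algebra
  ultimately show "a = b" using assms by simp
qed (use assms in \<open>simp add: a_minus_def R.r_neg\<close>)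

text \<open>Elements of the cochain groups are extensional, whereas \<open>coboundary_mod\<close>
  allows arbitrary functions; restriction of the bounding cochain to its domain reconciles the
  two.\<close>

lemma cobound_iff:
  assumes "f \<in> carrier (C n)"
  shows "f \<in> cobound n \<longleftrightarrow> coboundary_mod {\<zero>} n f"
proof (cases n)
  case 0
  then show ?thesis using assms
    by (auto simp: C_ops C_carrier fun_eq_iff extensional_def)
next
  case (Suc m)
  have f: "functional R (F (Suc m)) f" "f \<in> extensional (carrier (F (Suc m)))" using assms Suc by (auto simp: C_carrier)
  show ?thesis
  proof
    assume "f \<in> cobound n"
    then obtain g where g: "g \<in> carrier (C m)" "f = (\<lambda>x\<in>carrier (F (Suc m)). g (d m x))" using Suc by auto
    then have "functional R (F m) g" by (simp add: C_carrier)
    moreover from this have "f y \<ominus> g (d m y) \<in> {\<zero>}" if "y \<in> carrier (F (Suc m))" for y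
      using that g(2) functionalD(1)[of R "F m" g] d_closed[OF that] diff_eq_zero by simp
    ultimately show "coboundary_mod {\<zero>} n f" using Suc by auto
  next
    assume "coboundary_mod {\<zero>} n f"
    then obtain g where g: "functional R (F m) g" "\<And>y. y \<in> carrier (F (Suc m)) \<Longrightarrow> f y \<ominus> g (d m y) = \<zero>"
      using Suc by auto
    have "f = (\<lambda>x\<in>carrier (F (Suc m)). restrict g (carrier (F m)) (d m x))"
    proof
      fix y show "f y = (\<lambda>x\<in>carrier (F (Suc m)). restrict g (carrier (F m)) (d m x)) y"
        using f(2) g(2)[of y] diff_eq_zero functionalD(1)[OF f(1), of y] functionalD(1)[OF g(1)] d_closed[of y m]
        by (cases "y \<in> carrier (F (Suc m))") (auto simp: extensional_def)
    qed
    moreover have "restrict g (carrier (F m)) \<in> carrier (C m)"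
      using functional_restrict[OF g(1)] by (simp add: C_carrier)
    ultimately have "f \<in> (\<lambda>g. \<lambda>x\<in>carrier (F (Suc m)). g (d m x)) ` carrier (C m)" by (rule image_eqI)
    then show "f \<in> cobound n" using Suc by simp
  qed
qed

lemma cobound_subset: "cobound n \<subseteq> cocyc n"
proof (cases n)
  case 0
  have "(\<lambda>x\<in>carrier (F 0). \<zero>) \<in> cocyc 0"
    using functional_restrict[of 0 "\<lambda>_. \<zero>"] d_closed
    by (auto simp: cocyc_iff cocycle_mod_def functional_def)
  then show ?thesis using 0 by (simp add: C_ops)
next
  case (Suc m)
  have "(\<lambda>x\<in>carrier (F (Suc m)). g (d m x)) \<in> cocyc (Suc m)" if "g \<in> carrier (C m)" for g
  proof -
    have g: "functional R (F m) g" using that by (simp add: C_carrier)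
    show ?thesis
      using functional_restrict[OF functional_comp[OF d_linear g]] d_closed d_d functional_zero[OF F_module g]
      by (auto simp: cocyc_iff cocycle_mod_def)
  qed
  then show ?thesis using Suc by auto
qed

lemma coboundary_mod_add:
  assumes "functional R (F n) f" "functional R (F n) g" "coboundary_mod {\<zero>} n f" "coboundary_mod {\<zero>} n g"
  shows "coboundary_mod {\<zero>} n (\<lambda>x. f x \<oplus> g x)"
proof (cases n)
  case 0 then show ?thesis using assms by simp
next
  case (Suc m)
  then obtain u v where u: "functional R (F m) u" "\<And>y. y \<in> carrier (F n) \<Longrightarrow> f y \<ominus> u (d m y) = \<zero>"
    and v: "functional R (F m) v" "\<And>y. y \<in> carrier (F n) \<Longrightarrow> g y \<ominus> v (d m y) = \<zero>" using assms(3,4) by auto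
  have "(f y \<oplus> g y) \<ominus> (u (d m y) \<oplus> v (d m y)) = \<zero>" if y: "y \<in> carrier (F n)" for y
  proof -
    have "d m y \<in> carrier (F m)" using d_closed y Suc by simp
    then have c: "f y \<in> carrier R" "g y \<in> carrier R" "u (d m y) \<in> carrier R" "v (d m y) \<in> carrier R"
      using functionalD(1)[OF assms(1) y] functionalD(1)[OF assms(2) y] functionalD(1)[OF u(1)] functionalD(1)[OF v(1)] by auto
    then have "(f y \<oplus> g y) \<ominus> (u (d m y) \<oplus> v (d m y)) = (f y \<ominus> u (d m y)) \<oplus> (g y \<ominus> v (d m y))"
      by (simp add: a_minus_def R.minus_add R.a_ac)
    then show ?thesis using u(2)[OF y] v(2)[OF y] by simp
  qed
  then show ?thesis using functional_add[OF u(1) v(1)] Suc by auto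
qed

lemma coboundary_mod_smult:
  assumes "functional R (F n) f" "z \<in> centre R" "coboundary_mod {\<zero>} n f"
  shows "coboundary_mod {\<zero>} n (\<lambda>x. z \<otimes> f x)"
proof (cases n)
  case 0 then show ?thesis using assms centreD(1)[OF assms(2)] by simp
next
  case (Suc m)
  then obtain u where u: "functional R (F m) u" "\<And>y. y \<in> carrier (F n) \<Longrightarrow> f y \<ominus> u (d m y) = \<zero>"
    using assms(3) by auto
  have "z \<otimes> f y \<ominus> z \<otimes> u (d m y) = \<zero>" if y: "y \<in> carrier (F n)" for y
  proof -
    have "f y = u (d m y)"
      using u(2)[OF y] diff_eq_zero functionalD(1)[OF assms(1) y] functionalD(1)[OF u(1)] d_closed[of y m] y Suc by blast
    then show ?thesis using functionalD(1)[OF assms(1) y] centreD(1)[OF assms(2)] by (simp add: a_minus_def R.r_neg)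
  qed
  then show ?thesis using functional_central_mult[OF F_module u(1) assms(2)] Suc by auto
qed

lemma coboundary_mod_ext:
  "(\<And>y. y \<in> carrier (F n) \<Longrightarrow> f y = g y) \<Longrightarrow> coboundary_mod I n f = coboundary_mod I n g"
  by (cases n) auto

lemma cocyc_submodule: "submodule (cocyc n) (centre_ring R) (C n)"
proof (rule submodule_of_left_moduleI[OF C_left_module])
  show "cocyc n \<subseteq> carrier (C n)" by (auto simp: cocycles_def)
  show "\<zero>\<^bsub>C n\<^esub> \<in> cocyc n"
    using functional_restrict[of n "\<lambda>_. \<zero>"] d_closed
    by (auto simp: C_ops cocyc_iff cocycle_mod_def functional_def)
  fix f assume f: "f \<in> cocyc n"
  then have f': "functional R (F n) f" "\<And>y. y \<in> carrier (F (Suc n)) \<Longrightarrow> f (d n y) = \<zero>"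
    by (auto simp: cocyc_iff cocycle_mod_def)
  {
    fix g assume "g \<in> cocyc n"
    then have g': "functional R (F n) g" "\<And>y. y \<in> carrier (F (Suc n)) \<Longrightarrow> g (d n y) = \<zero>"
      by (auto simp: cocyc_iff cocycle_mod_def)
    show "f \<oplus>\<^bsub>C n\<^esub> g \<in> cocyc n"
      using functional_restrict[OF functional_add[OF f'(1) g'(1)]] f'(2) g'(2) d_closed
      by (auto simp: C_ops cocyc_iff cocycle_mod_def)
  next
    fix z assume "z \<in> carrier (centre_ring R)"
    then have z: "z \<in> centre R" by (simp add: centre_ring_def)
    show "z \<odot>\<^bsub>C n\<^esub> f \<in> cocyc n"
      using functional_restrict[OF functional_central_mult[OF F_module f'(1) z]] f'(2) d_closed centreD(1)[OF z]
      by (auto simp: C_ops cocyc_iff cocycle_mod_def)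
  }
qed

abbreviation "Zn n \<equiv> (C n)\<lparr>carrier := cocyc n\<rparr>"

lemma Zn_left_module: "left_module (centre_ring R) (Zn n)"
  by (rule restrict_carrier_left_module[OF C_left_module cocyc_submodule])

lemma cobound_submodule: "submodule (cobound n) (centre_ring R) (Zn n)"
proof (rule submodule_of_left_moduleI[OF Zn_left_module])
  interpret Z: left_module "centre_ring R" "Zn n" by (rule Zn_left_module)
  show "cobound n \<subseteq> carrier (Zn n)" using cobound_subset by simp
  have inC: "f \<in> carrier (C n)" if "f \<in> cocyc n" for f using that by (auto simp: cocycles_def)
  have z: "\<zero>\<^bsub>Zn n\<^esub> \<in> cocyc n" using Z.M.zero_closed by simp
  have "coboundary_mod {\<zero>} n \<zero>\<^bsub>Zn n\<^esub>"
  proof (cases n)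
    case (Suc m)
    have "functional R (F m) (\<lambda>_. \<zero>)" by (simp add: functional_def)
    then show ?thesis using Suc by (auto simp: C_ops a_minus_def)
  qed (simp add: C_ops)
  then show "\<zero>\<^bsub>Zn n\<^esub> \<in> cobound n" using cobound_iff[OF inC[OF z]] by simp
  fix f assume f: "f \<in> cobound n"
  then have fz: "f \<in> cocyc n" using cobound_subset by auto
  then have f': "functional R (F n) f" "coboundary_mod {\<zero>} n f"
    using inC C_carrier f cobound_iff by auto
  {
    fix g assume g: "g \<in> cobound n"
    then have gz: "g \<in> cocyc n" using cobound_subset by auto
    then have g': "functional R (F n) g" "coboundary_mod {\<zero>} n g"
      using inC C_carrier g cobound_iff by auto
    have "f \<oplus>\<^bsub>Zn n\<^esub> g \<in> cocyc n" using Z.M.a_closed[of f g] fz gz by simp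
    moreover have "coboundary_mod {\<zero>} n (f \<oplus>\<^bsub>Zn n\<^esub> g)"
      using coboundary_mod_add[OF f'(1) g'(1) f'(2) g'(2)]
        coboundary_mod_ext[of n "f \<oplus>\<^bsub>Zn n\<^esub> g" "\<lambda>x. f x \<oplus> g x"] by (simp add: C_ops)
    ultimately show "f \<oplus>\<^bsub>Zn n\<^esub> g \<in> cobound n" using cobound_iff[OF inC] by simp
  next
    fix z assume zc: "z \<in> carrier (centre_ring R)"
    then have z: "z \<in> centre R" by (simp add: centre_ring_def)
    have "z \<odot>\<^bsub>Zn n\<^esub> f \<in> cocyc n" using Z.smult_closed[of z f] fz zc by simp
    moreover have "coboundary_mod {\<zero>} n (z \<odot>\<^bsub>Zn n\<^esub> f)"
      using coboundary_mod_smult[OF f'(1) z f'(2)]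
        coboundary_mod_ext[of n "z \<odot>\<^bsub>Zn n\<^esub> f" "\<lambda>x. z \<otimes> f x"] by (simp add: C_ops)
    ultimately show "z \<odot>\<^bsub>Zn n\<^esub> f \<in> cobound n" using cobound_iff[OF inC] by simp
  }
qed

lemma Ext_quot: "Ext R M (reg_module R) n = quot_module (Zn n) (cobound n)"
  by (simp add: Ext_def hom_cohomology_def)

lemma Ext_left_module: "left_module (centre_ring R) (Ext R M (reg_module R) n)"
  unfolding Ext_quot by (rule quot_module_left_module[OF Zn_left_module cobound_submodule])

text \<open>Exchanges a class for a cocycle that represents it, so that cosets need not be handled
  when scalars act on Ext.\<close>

lemma Ext_elem:
  assumes "e \<in> carrier (Ext R M (reg_module R) n)"
  obtains f where "cocycle_mod {\<zero>} n f"
    "\<And>z. z \<in> centre R \<Longrightarrow> z \<odot>\<^bsub>Ext R M (reg_module R) n\<^esub> e = \<zero>\<^bsub>Ext R M (reg_module R) n\<^esub>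
       \<longleftrightarrow> coboundary_mod {\<zero>} n (\<lambda>y. z \<otimes> f y)"
    "e = \<zero>\<^bsub>Ext R M (reg_module R) n\<^esub> \<longleftrightarrow> coboundary_mod {\<zero>} n f"
proof -
  interpret Z: left_module "centre_ring R" "Zn n" by (rule Zn_left_module)
  have inC: "f \<in> carrier (C n)" if "f \<in> cocyc n" for f using that by (auto simp: cocycles_def)
  obtain f where f: "f \<in> carrier (Zn n)" "e = cobound n +>\<^bsub>Zn n\<^esub> f"
    using assms unfolding Ext_quot quot_module_carrier by blast
  have fz: "f \<in> cocyc n" using f(1) by simp
  have 3: "e = \<zero>\<^bsub>Ext R M (reg_module R) n\<^esub> \<longleftrightarrow> coboundary_mod {\<zero>} n f"
    using quot_module_zero_iff[OF Zn_left_module cobound_submodule f(1)] cobound_iff[OF inC[OF fz]] f(2)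
    by (simp add: Ext_quot)
  have 2: "z \<odot>\<^bsub>Ext R M (reg_module R) n\<^esub> e = \<zero>\<^bsub>Ext R M (reg_module R) n\<^esub>
       \<longleftrightarrow> coboundary_mod {\<zero>} n (\<lambda>y. z \<otimes> f y)" if z: "z \<in> centre R" for z
  proof -
    have zc: "z \<in> carrier (centre_ring R)" using z by (simp add: centre_ring_def)
    have zf: "z \<odot>\<^bsub>Zn n\<^esub> f \<in> carrier (Zn n)" by (rule Z.smult_closed[OF zc f(1)])
    have "z \<odot>\<^bsub>Ext R M (reg_module R) n\<^esub> e = cobound n +>\<^bsub>Zn n\<^esub> (z \<odot>\<^bsub>Zn n\<^esub> f)"
      unfolding Ext_quot f(2) by (rule quot_module_smult[OF Zn_left_module cobound_submodule f(1) zc])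
    then have "z \<odot>\<^bsub>Ext R M (reg_module R) n\<^esub> e = \<zero>\<^bsub>Ext R M (reg_module R) n\<^esub> \<longleftrightarrow> z \<odot>\<^bsub>Zn n\<^esub> f \<in> cobound n"
      using quot_module_zero_iff[OF Zn_left_module cobound_submodule zf] by (simp add: Ext_quot)
    also have "\<dots> \<longleftrightarrow> coboundary_mod {\<zero>} n (z \<odot>\<^bsub>Zn n\<^esub> f)" using cobound_iff[OF inC] zf by simp
    also have "\<dots> \<longleftrightarrow> coboundary_mod {\<zero>} n (\<lambda>y. z \<otimes> f y)" by (rule coboundary_mod_ext) (simp add: C_ops)
    finally show ?thesis .
  qed
  show ?thesis using that[of f] 2 3 fz by (simp add: cocyc_iff)
qed

lemma Ext_trivial_iff:
  "carrier (Ext R M (reg_module R) n) = {\<zero>\<^bsub>Ext R M (reg_module R) n\<^esub>} \<longleftrightarrow> Ext_injective n {\<zero>} \<zero>"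
proof
  interpret E: left_module "centre_ring R" "Ext R M (reg_module R) n" by (rule Ext_left_module)
  {
    assume V: "Ext_injective n {\<zero>} \<zero>"
    have "e = \<zero>\<^bsub>Ext R M (reg_module R) n\<^esub>" if "e \<in> carrier (Ext R M (reg_module R) n)" for e
      using Ext_elem[OF that] V Ext_injective_zero_iff[OF left_ideal_zero] by metis
    then show "carrier (Ext R M (reg_module R) n) = {\<zero>\<^bsub>Ext R M (reg_module R) n\<^esub>}"
      using E.M.zero_closed by blast
  next
    assume triv: "carrier (Ext R M (reg_module R) n) = {\<zero>\<^bsub>Ext R M (reg_module R) n\<^esub>}"
    have "coboundary_mod {\<zero>} n f" if f: "cocycle_mod {\<zero>} n f" for f
    proof -
      let ?f = "restrict f (carrier (F n))"
      have "?f \<in> cocyc n" using f functional_restrict d_closed by (auto simp: cocyc_iff cocycle_mod_def)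
      then have "cobound n +>\<^bsub>Zn n\<^esub> ?f \<in> carrier (Ext R M (reg_module R) n)"
        unfolding Ext_quot quot_module_carrier by auto
      then have "?f \<in> cobound n"
        using triv quot_module_zero_iff[OF Zn_left_module cobound_submodule, of ?f] \<open>?f \<in> cocyc n\<close>
        by (simp add: Ext_quot)
      then have "coboundary_mod {\<zero>} n ?f" using cobound_iff[of ?f n] \<open>?f \<in> cocyc n\<close> by (simp add: cocycles_def)
      then show ?thesis using coboundary_mod_ext[of n ?f f] by simp
    qed
    then show "Ext_injective n {\<zero>} \<zero>" using Ext_injective_zero_iff[OF left_ideal_zero] by blast
  }
qed

lemma Ext_injective_smult:
  assumes "Ext_injective n {\<zero>} z" "z \<in> centre R" "e \<in> carrier (Ext R M (reg_module R) n)"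
    "z \<odot>\<^bsub>Ext R M (reg_module R) n\<^esub> e = \<zero>\<^bsub>Ext R M (reg_module R) n\<^esub>"
  shows "e = \<zero>\<^bsub>Ext R M (reg_module R) n\<^esub>"
  using Ext_elem[OF assms(3)] assms(1,2,4) unfolding Ext_injective_def by metis

text \<open>Multiplication by \<open>x\<close> on the resolution is null-homotopic, so for a cocycle
  \<open>f\<close> the map \<open>x f\<close> is the coboundary of \<open>f s\<close>. In degree 0
  the multiples \<open>x y\<close> are boundaries, on which \<open>f\<close> vanishes.\<close>

lemma annihilator_kills_Ext:
  assumes x: "x \<in> centre R" and xM: "\<And>m. m \<in> carrier M \<Longrightarrow> x \<odot>\<^bsub>M\<^esub> m = \<zero>\<^bsub>M\<^esub>"
    and e: "e \<in> carrier (Ext R M (reg_module R) n)"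
  shows "x \<odot>\<^bsub>Ext R M (reg_module R) n\<^esub> e = \<zero>\<^bsub>Ext R M (reg_module R) n\<^esub>"
proof -
  note xc = centreD(1)[OF x]
  obtain f where f: "cocycle_mod {\<zero>} n f" and iff:
    "x \<odot>\<^bsub>Ext R M (reg_module R) n\<^esub> e = \<zero>\<^bsub>Ext R M (reg_module R) n\<^esub> \<longleftrightarrow> coboundary_mod {\<zero>} n (\<lambda>y. x \<otimes> f y)"
    using Ext_elem[OF e] x by metis
  have f1: "functional R (F n) f" and f2: "\<And>y. y \<in> carrier (F (Suc n)) \<Longrightarrow> f (d n y) = \<zero>"
    using f by (auto simp: cocycle_mod_def)
  interpret Fn: left_module R "F n" by (rule F_module)
  have "coboundary_mod {\<zero>} n (\<lambda>y. x \<otimes> f y)"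
  proof (cases n)
    case 0
    have "x \<otimes> f y = \<zero>" if y: "y \<in> carrier (F 0)" for y
    proof -
      have "\<epsilon> (x \<odot>\<^bsub>F 0\<^esub> y) = \<zero>\<^bsub>M\<^esub>" using linear_mapD(1,3)[OF aug_linear] xM y xc by simp
      moreover have "x \<odot>\<^bsub>F 0\<^esub> y \<in> carrier (F 0)" using y xc Fn.smult_closed 0 by simp
      ultimately obtain w where "w \<in> carrier (F (Suc 0))" "d 0 w = x \<odot>\<^bsub>F 0\<^esub> y" using ker_aug by blast
      then have "f (x \<odot>\<^bsub>F 0\<^esub> y) = \<zero>" using f2[of w] 0 by simp
      then show ?thesis using functionalD(3)[OF f1 xc, of y] y 0 by simp
    qed
    then show ?thesis using 0 by simp
  next
    case (Suc m)
    obtain s s' where s: "linear_map R (F m) (F (Suc m)) s" and s': "linear_map R (F (Suc m)) (F (Suc (Suc m))) s'"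
        and hs: "\<And>y. y \<in> carrier (F (Suc m)) \<Longrightarrow> d (Suc m) (s' y) = x \<odot>\<^bsub>F (Suc m)\<^esub> y \<ominus>\<^bsub>F (Suc m)\<^esub> s (d m y)"
      using contracting_homotopy[OF x xM, of m] by blast
    have "x \<otimes> f y \<ominus> f (s (d m y)) = \<zero>" if y: "y \<in> carrier (F (Suc m))" for y
    proof -
      have "s (d m y) \<in> carrier (F n)" using linear_mapD(1)[OF s d_closed[OF y]] Suc by simp
      then have "f (d (Suc m) (s' y)) = x \<otimes> f y \<ominus> f (s (d m y))"
        using hs[OF y] functional_minus[OF F_module f1] functionalD(3)[OF f1 xc] y xc Fn.smult_closed Suc by simp
      then show ?thesis using f2[of "s' y"] linear_mapD(1)[OF s' y] Suc by simp
    qed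
    moreover have "functional R (F m) (\<lambda>y. f (s y))" using functional_comp[OF s] f1 Suc by simp
    ultimately show ?thesis using Suc by auto
  qed
  then show ?thesis using iff by simp
qed

end

section \<open>Regular sequences and the grade\<close>

text \<open>Relative to a starting ideal and peeled off from the front, which is how dimension
  shifting and the chains of primes recurse. Properness of the generated ideal is left out here; it
  follows whenever the sequence lies in a proper left ideal.\<close>

fun regular_sequence :: "('a, 'm) ring_scheme \<Rightarrow> 'a set \<Rightarrow> 'a list \<Rightarrow> bool" where
  "regular_sequence R I [] \<longleftrightarrow> True"
| "regular_sequence R I (x # xs) \<longleftrightarrow> x \<in> centre R \<and> (\<forall>r\<in>carrier R. x \<otimes>\<^bsub>R\<^esub> r \<in> I \<longrightarrow> r \<in> I) \<and>
     regular_sequence R (add_multiples R I x) xs"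

fun seq_ideal :: "('a, 'm) ring_scheme \<Rightarrow> 'a set \<Rightarrow> 'a list \<Rightarrow> 'a set" where
  "seq_ideal R I [] = I"
| "seq_ideal R I (x # xs) = seq_ideal R (add_multiples R I x) xs"

lemma seq_ideal_append: "seq_ideal R I (xs @ ys) = seq_ideal R (seq_ideal R I xs) ys"
  by (induction xs arbitrary: I) auto

lemma regular_sequence_append:
  "regular_sequence R I (xs @ ys) \<longleftrightarrow> regular_sequence R I xs \<and> regular_sequence R (seq_ideal R I xs) ys"
  by (induction xs arbitrary: I) auto

lemma regular_sequence_centre: "regular_sequence R I xs \<Longrightarrow> set xs \<subseteq> centre R"
  by (induction xs arbitrary: I) auto

lemma (in ring) left_ideal_seq_ideal:
  "left_ideal R I \<Longrightarrow> set xs \<subseteq> centre R \<Longrightarrow> left_ideal R (seq_ideal R I xs)"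
  by (induction xs arbitrary: I) (auto intro: left_ideal_add_multiples)

lemma (in ring) seq_ideal_superset:
  "left_ideal R I \<Longrightarrow> set xs \<subseteq> centre R \<Longrightarrow> I \<subseteq> seq_ideal R I xs"
proof (induction xs arbitrary: I)
  case (Cons x xs)
  then have x: "x \<in> centre R" by simp
  have "I \<subseteq> add_multiples R I x" using add_multiplesI1[OF Cons.prems(1) centreD(1)[OF x]] by auto
  then show ?case using Cons.IH[OF left_ideal_add_multiples[OF Cons.prems(1) x]] Cons.prems(2) by auto
qed simp

section \<open>Grades computed along a regular sequence\<close>

context resolved_module
begin

text \<open>A map from \<open>M\<close> to R/I has values killed by \<open>x\<close>, and
  \<open>x\<close> is injective on R/I.\<close>

lemma Ext_injective_0_of_regular:
  assumes I: "left_ideal R I" and x: "x \<in> centre R"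
    and reg: "\<And>r. r \<in> carrier R \<Longrightarrow> x \<otimes> r \<in> I \<Longrightarrow> r \<in> I"
    and xM: "\<And>m. m \<in> carrier M \<Longrightarrow> x \<odot>\<^bsub>M\<^esub> m = \<zero>\<^bsub>M\<^esub>"
  shows "Ext_injective 0 I \<zero>"
proof -
  interpret F0: left_module R "F 0" by (rule F_module)
  note xc = centreD(1)[OF x]
  have "f y \<in> I" if f: "functional R (F 0) f" "\<And>w. w \<in> carrier (F (Suc 0)) \<Longrightarrow> f (d 0 w) \<in> I" and y: "y \<in> carrier (F 0)" for f y
  proof -
    have "\<epsilon> (x \<odot>\<^bsub>F 0\<^esub> y) = \<zero>\<^bsub>M\<^esub>" using linear_mapD(1,3)[OF aug_linear] xM y xc by simp
    then obtain w where "w \<in> carrier (F (Suc 0))" "d 0 w = x \<odot>\<^bsub>F 0\<^esub> y" using ker_aug y xc by blast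
    then have "x \<otimes> f y \<in> I" using f(2)[of w] functionalD(3)[OF f(1) xc y] by simp
    then show ?thesis using reg functionalD(1)[OF f(1) y] by simp
  qed
  then show ?thesis unfolding Ext_injective_zero_iff[OF I] cocycle_mod_def by simp
qed

text \<open>The two claims are proved together because each shift by one degree presupposes
  vanishing in the degree below.\<close>

lemma Ext_injective_regular_sequence:
  assumes "left_ideal R I" "regular_sequence R I xs" "z \<in> centre R"
    and "\<And>x m. x \<in> set xs \<Longrightarrow> m \<in> carrier M \<Longrightarrow> x \<odot>\<^bsub>M\<^esub> m = \<zero>\<^bsub>M\<^esub>"
  shows "(\<forall>i<length xs. Ext_injective i I \<zero>) \<and>
    (Ext_injective (length xs) I z \<longleftrightarrow> Ext_injective 0 (seq_ideal R I xs) z)"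
  using assms(1,2,4)
proof (induction xs arbitrary: I)
  case (Cons x xs)
  have x: "x \<in> centre R" and reg: "\<And>r. r \<in> carrier R \<Longrightarrow> x \<otimes> r \<in> I \<Longrightarrow> r \<in> I"
    using Cons.prems(2) by auto
  have xM: "\<And>m. m \<in> carrier M \<Longrightarrow> x \<odot>\<^bsub>M\<^esub> m = \<zero>\<^bsub>M\<^esub>" using Cons.prems(3) by simp
  let ?J = "add_multiples R I x"
  have J: "left_ideal R ?J" by (rule R.left_ideal_add_multiples[OF Cons.prems(1) x])
  have IH: "\<forall>i<length xs. Ext_injective i ?J \<zero>"
    "Ext_injective (length xs) ?J z \<longleftrightarrow> Ext_injective 0 (seq_ideal R ?J xs) z"
    using Cons.IH[OF J] Cons.prems(2,3) by auto
  note shift = Ext_injective_shift[OF Cons.prems(1) x reg xM]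
  \<comment> \<open>An inner induction on the degree: vanishing in degree \<open>i\<close> over
    \<open>I\<close> allows the shift, which turns degree \<open>Suc i\<close> over \<open>I\<close>
    into degree \<open>i\<close> over the larger ideal.\<close>
  have van: "i < Suc (length xs) \<longrightarrow> Ext_injective i I \<zero>" for i
  proof (induction i)
    case 0
    then show ?case using Ext_injective_0_of_regular[OF Cons.prems(1) x reg xM] by simp
  next
    case (Suc i)
    then show ?case using shift[of i \<zero>] IH(1) R.centre_zero by simp
  qed
  then show ?case using shift[of "length xs" z] IH(2) assms(3) by simp
qed simp

text \<open>In degree 0 a class is a homomorphism from \<open>M\<close> to R/I. One that is nonzero
  and killed by \<open>z\<close> has a value \<open>n\<close> outside \<open>I\<close>, and
  everything that annihilates \<open>M\<close> annihilates this value.\<close>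

lemma not_Ext_injective_0E:
  assumes I: "left_ideal R I" and "\<not> Ext_injective 0 I z" and z: "z \<in> centre R"
  obtains n where "n \<in> carrier R" "n \<notin> I" "z \<otimes> n \<in> I"
    "\<And>c. c \<in> carrier R \<Longrightarrow> (\<And>m. m \<in> carrier M \<Longrightarrow> c \<odot>\<^bsub>M\<^esub> m = \<zero>\<^bsub>M\<^esub>) \<Longrightarrow> c \<otimes> n \<in> I"
proof -
  interpret F0: left_module R "F 0" by (rule F_module)
  obtain f y where f: "functional R (F 0) f" "\<And>w. w \<in> carrier (F (Suc 0)) \<Longrightarrow> f (d 0 w) \<in> I"
    and zf: "\<And>y. y \<in> carrier (F 0) \<Longrightarrow> z \<otimes> f y \<in> I" and y: "y \<in> carrier (F 0)" "f y \<notin> I"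
    using assms(2) unfolding Ext_injective_def cocycle_mod_def by auto
  have "c \<otimes> f y \<in> I" if c: "c \<in> carrier R" "\<And>m. m \<in> carrier M \<Longrightarrow> c \<odot>\<^bsub>M\<^esub> m = \<zero>\<^bsub>M\<^esub>" for c
  proof -
    have "\<epsilon> (c \<odot>\<^bsub>F 0\<^esub> y) = \<zero>\<^bsub>M\<^esub>" using linear_mapD(1,3)[OF aug_linear] c y by simp
    then obtain w where "w \<in> carrier (F (Suc 0))" "d 0 w = c \<odot>\<^bsub>F 0\<^esub> y" using ker_aug y c by blast
    then show ?thesis using f(2)[of w] functionalD(3)[OF f(1) c(1) y(1)] by simp
  qed
  then show ?thesis using that y zf functionalD(1)[OF f(1)] by blast
qed

text \<open>A homomorphism from \<open>M\<close> to R/I is presented by a relation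
  \<open>Rel\<close> between elements of \<open>M\<close> and representatives in \<open>R\<close>;
  \<open>zero\<close> makes it single-valued modulo \<open>I\<close>. A linear map on
  \<open>F 0\<close> is selected from it, so that R/I is never formed.\<close>

lemma not_Ext_injective_0I:
  assumes I: "left_ideal R I"
    and total: "\<And>m. m \<in> carrier M \<Longrightarrow> \<exists>a\<in>carrier R. Rel m a"
    and add: "\<And>m m' a a'. \<lbrakk>m \<in> carrier M; m' \<in> carrier M; a \<in> carrier R; a' \<in> carrier R; Rel m a; Rel m' a'\<rbrakk>
        \<Longrightarrow> Rel (m \<oplus>\<^bsub>M\<^esub> m') (a \<oplus> a')"
    and smult: "\<And>r m a. \<lbrakk>r \<in> carrier R; m \<in> carrier M; a \<in> carrier R; Rel m a\<rbrakk> \<Longrightarrow> Rel (r \<odot>\<^bsub>M\<^esub> m) (r \<otimes> a)"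
    and zero: "\<And>a. a \<in> carrier R \<Longrightarrow> Rel \<zero>\<^bsub>M\<^esub> a \<Longrightarrow> a \<in> I"
    and nonzero: "m0 \<in> carrier M" "a0 \<in> carrier R" "Rel m0 a0" "a0 \<notin> I"
    and z: "\<And>m a. m \<in> carrier M \<Longrightarrow> a \<in> carrier R \<Longrightarrow> Rel m a \<Longrightarrow> z \<otimes> a \<in> I"
  shows "\<not> Ext_injective 0 I z"
proof -
  have N: "left_module R (reg_module R)" by (rule reg_module_left_module) unfold_locales
  have ec: "y \<in> carrier (F 0) \<Longrightarrow> \<epsilon> y \<in> carrier M" for y using linear_mapD(1)[OF aug_linear] .
  obtain f where "linear_map R (F 0) (reg_module R) f" and Rf: "\<And>y. y \<in> carrier (F 0) \<Longrightarrow> Rel (\<epsilon> y) (f y)"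
  proof (rule free_module_linear_selection[OF N, of "std_basis R M 0" "\<lambda>y a. Rel (\<epsilon> y) a", folded std_res_def])
    fix y assume "y \<in> carrier (F 0)"
    then show "\<exists>a\<in>carrier (reg_module R). Rel (\<epsilon> y) a" using total ec by (simp add: reg_module_def)
  next
    fix y y' a a' assume "y \<in> carrier (F 0)" "y' \<in> carrier (F 0)" "a \<in> carrier (reg_module R)" "a' \<in> carrier (reg_module R)"
      "Rel (\<epsilon> y) a" "Rel (\<epsilon> y') a'"
    then show "Rel (\<epsilon> (y \<oplus>\<^bsub>F 0\<^esub> y')) (a \<oplus>\<^bsub>reg_module R\<^esub> a')"
      using add ec linear_mapD(2)[OF aug_linear] by (simp add: reg_module_def)
  next
    fix r y a assume "r \<in> carrier R" "y \<in> carrier (F 0)" "a \<in> carrier (reg_module R)" "Rel (\<epsilon> y) a"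
    then show "Rel (\<epsilon> (r \<odot>\<^bsub>F 0\<^esub> y)) (r \<odot>\<^bsub>reg_module R\<^esub> a)"
      using smult ec linear_mapD(3)[OF aug_linear] by (simp add: reg_module_def)
  qed blast
  then have f: "functional R (F 0) f" by (simp add: functional_linear_map)
  note fc = functionalD(1)[OF f]
  have "f (d 0 w) \<in> I" if "w \<in> carrier (F (Suc 0))" for w
    using zero fc[OF d_closed[OF that]] Rf[OF d_closed[OF that]] aug_d[OF that] by simp
  then have 1: "cocycle_mod I 0 f" using f by (simp add: cocycle_mod_def)
  have 2: "coboundary_mod I 0 (\<lambda>y. z \<otimes> f y)"
    using z[OF ec fc Rf] by simp
  obtain y0 where y0: "y0 \<in> carrier (F 0)" "\<epsilon> y0 = m0" using aug_surj nonzero(1) by blast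
  have c: "f y0 \<in> carrier R" "Rel m0 (f y0)" using fc Rf y0 by auto
  \<comment> \<open>Both \<open>a0\<close> and the selected value are related to \<open>m0\<close>;
    subtracting shows that they agree modulo \<open>I\<close>, so the selected value is outside
    \<open>I\<close> as well.\<close>
  have "Rel (m0 \<oplus>\<^bsub>M\<^esub> (\<ominus> \<one>) \<odot>\<^bsub>M\<^esub> m0) (a0 \<oplus> (\<ominus> \<one>) \<otimes> f y0)"
    using c nonzero by (intro add smult) auto
  moreover have "m0 \<oplus>\<^bsub>M\<^esub> (\<ominus> \<one>) \<odot>\<^bsub>M\<^esub> m0 = \<zero>\<^bsub>M\<^esub>"
    using smult_minus_one[OF left_module_axioms nonzero(1)] nonzero(1) by (simp add: M.r_neg)
  moreover have "a0 \<oplus> (\<ominus> \<one>) \<otimes> f y0 = a0 \<ominus> f y0" using c nonzero by algebra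
  ultimately have "a0 \<ominus> f y0 \<in> I" using zero c nonzero by auto
  then have "f y0 \<notin> I" using R.left_ideal_cancel[OF I] c nonzero by blast
  then have "\<not> coboundary_mod I 0 f" using y0 by auto
  then show ?thesis using 1 2 unfolding Ext_injective_def by blast
qed

lemma left_grade_ge:
  assumes "\<forall>i<t. Ext_injective i {\<zero>} \<zero>" shows "enat t \<le> left_grade R M"
  unfolding left_grade_def
  by (rule Inf_greatest) (use assms in \<open>auto simp: Ext_trivial_iff intro: leI\<close>)

lemma left_grade_eq_iff:
  assumes "\<forall>i<t. Ext_injective i {\<zero>} \<zero>"
  shows "left_grade R M = enat t \<longleftrightarrow> \<not> Ext_injective t {\<zero>} \<zero>"
proof
  assume "\<not> Ext_injective t {\<zero>} \<zero>"
  then have "left_grade R M \<le> enat t"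
    unfolding left_grade_def by (intro Inf_lower) (auto simp: Ext_trivial_iff)
  then show "left_grade R M = enat t" using left_grade_ge[OF assms] by simp
next
  assume eq: "left_grade R M = enat t"
  show "\<not> Ext_injective t {\<zero>} \<zero>"
  proof
    assume "Ext_injective t {\<zero>} \<zero>"
    then have "\<forall>i<Suc t. Ext_injective i {\<zero>} \<zero>" using assms less_Suc_eq by auto
    then show False using left_grade_ge[of "Suc t"] eq by simp
  qed
qed

lemma left_grade_regular_sequence:
  assumes "regular_sequence R {\<zero>} xs"
    and "\<And>x m. x \<in> set xs \<Longrightarrow> m \<in> carrier M \<Longrightarrow> x \<odot>\<^bsub>M\<^esub> m = \<zero>\<^bsub>M\<^esub>"
  shows "enat (length xs) \<le> left_grade R M"
    "left_grade R M = enat (length xs) \<longleftrightarrow> \<not> Ext_injective 0 (seq_ideal R {\<zero>} xs) \<zero>"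
proof -
  note T = Ext_injective_regular_sequence[OF left_ideal_zero assms(1) R.centre_zero assms(2)]
  show "enat (length xs) \<le> left_grade R M" using T by (intro left_grade_ge) blast
  show "left_grade R M = enat (length xs) \<longleftrightarrow> \<not> Ext_injective 0 (seq_ideal R {\<zero>} xs) \<zero>"
    using T left_grade_eq_iff[of "length xs"] by blast
qed

end

section \<open>Two-sided ideals and the modules R/J\<close>

definition two_sided :: "('a, 'm) ring_scheme \<Rightarrow> 'a set \<Rightarrow> bool" where
  "two_sided R I \<longleftrightarrow> left_ideal R I \<and> (\<forall>a\<in>I. \<forall>r\<in>carrier R. a \<otimes>\<^bsub>R\<^esub> r \<in> I)"

lemma (in ring) ideal_iff_two_sided: "ideal I R \<longleftrightarrow> two_sided R I"
proof
  assume "ideal I R"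
  then interpret ideal I R .
  show "two_sided R I" using I_l_closed I_r_closed a_closed a_subset
    by (auto simp: two_sided_def left_ideal_def)
next
  assume I: "two_sided R I"
  then have L: "left_ideal R I" by (simp add: two_sided_def)
  have "inv\<^bsub>add_monoid R\<^esub> a \<in> I" if "a \<in> I" for a
    using left_ideal_uminus[OF L that] by (simp add: a_inv_def)
  then have "subgroup I (add_monoid R)"
    using left_idealD[OF L] by (intro subgroup.intro) auto
  then show "ideal I R"
    using left_idealD[OF L] I by (intro idealI[OF ring_axioms]) (auto simp: two_sided_def)
qed

context ring
begin

lemma left_ideal_submodule:
  assumes "left_ideal R L" shows "submodule L R (reg_module R)"
  by (rule submodule_of_left_moduleI[OF reg_module_left_module[OF ring_axioms]])
    (use left_idealD[OF assms] in \<open>auto simp: reg_module_def\<close>)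

lemma left_quot_resolved: "left_ideal R J \<Longrightarrow> resolved_module R (left_quot R J)"
  unfolding left_quot_def resolved_module_def
  by (rule quot_module_left_module[OF reg_module_left_module[OF ring_axioms] left_ideal_submodule])

lemma left_quot_carrier:
  "X \<in> carrier (left_quot R J) \<longleftrightarrow> (\<exists>x\<in>carrier R. X = {j \<oplus> x | j. j \<in> J})"
  unfolding left_quot_def quot_module_carrier
  by (auto simp: reg_module_def a_r_coset_def')

lemma left_quot_annihilated:
  assumes J: "two_sided R J" and c: "c \<in> J" and X: "X \<in> carrier (left_quot R J)"
  shows "c \<odot>\<^bsub>left_quot R J\<^esub> X = \<zero>\<^bsub>left_quot R J\<^esub>"
proof -
  have L: "left_ideal R J" using J by (simp add: two_sided_def)
  note N = reg_module_left_module[OF ring_axioms]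
  obtain x where x: "x \<in> carrier (reg_module R)" "X = J +>\<^bsub>reg_module R\<^esub> x"
    using X unfolding left_quot_def quot_module_carrier by blast
  have "c \<odot>\<^bsub>left_quot R J\<^esub> X = J +>\<^bsub>reg_module R\<^esub> (c \<odot>\<^bsub>reg_module R\<^esub> x)"
    unfolding x(2) left_quot_def
    by (rule quot_module_smult[OF N left_ideal_submodule[OF L] x(1)]) (use left_idealD(1)[OF L c] in auto)
  moreover have "c \<otimes> x \<in> J" using J c x(1) by (simp add: two_sided_def reg_module_def)
  moreover have "c \<odot>\<^bsub>reg_module R\<^esub> x = c \<otimes> x" by (simp add: reg_module_def)
  moreover have "c \<otimes> x \<in> carrier (reg_module R)"
    using left_idealD(1)[OF L] \<open>c \<otimes> x \<in> J\<close> by (simp add: reg_module_def)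
  ultimately show ?thesis
    using quot_module_zero_iff[OF N left_ideal_submodule[OF L]] by (simp add: left_quot_def)
qed

lemma diff_add_diff:
  assumes "a \<in> carrier R" "b \<in> carrier R" "c \<in> carrier R" "d \<in> carrier R"
  shows "(a \<oplus> b) \<ominus> (c \<oplus> d) = (a \<ominus> c) \<oplus> (b \<ominus> d)"
  using assms by (simp add: a_minus_def minus_add a_ac)

lemma minus_self: "a \<in> carrier R \<Longrightarrow> a \<ominus> a = \<zero>"
  by (simp add: a_minus_def r_neg)

text \<open>The witness is the map from R/J to R/I that sends the class of \<open>x\<close> to the
  class of \<open>x n\<close>. It is well defined because \<open>J n\<close> lies in
  \<open>I\<close>, nonzero at the class of 1, and killed by \<open>z\<close>.\<close>

lemma left_quot_not_Ext_injective:
  assumes J: "two_sided R J" and I: "left_ideal R I" and n: "n \<in> carrier R" "n \<notin> I"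
    and Jn: "\<And>j. j \<in> J \<Longrightarrow> j \<otimes> n \<in> I" and z: "z \<in> centre R" "z \<otimes> n \<in> I"
  shows "\<not> resolved_module.Ext_injective R (left_quot R J) 0 I z"
proof -
  have L: "left_ideal R J" using J by (simp add: two_sided_def)
  interpret resolved_module R "left_quot R J" by (rule left_quot_resolved[OF L])
  note Id = left_idealD[OF I] and Jd = left_idealD[OF L]
  define Rel where "Rel X a \<longleftrightarrow> (\<exists>x\<in>X. a \<ominus> x \<otimes> n \<in> I)" for X a
  have Xc: "x \<in> carrier R" if "X \<in> carrier (left_quot R J)" "x \<in> X" for X x
    using that unfolding left_quot_carrier by (auto intro: Jd(1))
  show ?thesis
  proof (rule not_Ext_injective_0I[OF I, of Rel])
    fix X assume "X \<in> carrier (left_quot R J)"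
    then obtain x where x: "x \<in> carrier R" "x \<in> X"
      unfolding left_quot_carrier using Jd(2) by force
    have "x \<otimes> n \<ominus> x \<otimes> n = \<zero>" using x(1) n(1) by (simp add: minus_self)
    then have "Rel X (x \<otimes> n)" unfolding Rel_def using x(2) Id(2) by (intro bexI[of _ x]) simp_all
    then show "\<exists>a\<in>carrier R. Rel X a" using x n by blast
  next
    fix X Y a b assume XY: "X \<in> carrier (left_quot R J)" "Y \<in> carrier (left_quot R J)" "a \<in> carrier R" "b \<in> carrier R"
      and "Rel X a" "Rel Y b"
    then obtain x y where xy: "x \<in> X" "y \<in> Y" "a \<ominus> x \<otimes> n \<in> I" "b \<ominus> y \<otimes> n \<in> I" by (auto simp: Rel_def)
    have "(a \<oplus> b) \<ominus> (x \<oplus> y) \<otimes> n = (a \<ominus> x \<otimes> n) \<oplus> (b \<ominus> y \<otimes> n)"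
      using XY xy Xc n diff_add_diff[of a b "x \<otimes> n" "y \<otimes> n"] by (simp add: l_distr)
    then have "(a \<oplus> b) \<ominus> (x \<oplus> y) \<otimes> n \<in> I" using xy Id(3) by simp
    moreover have "x \<oplus> y \<in> X \<oplus>\<^bsub>left_quot R J\<^esub> Y"
      using xy by (auto simp: left_quot_def quot_module_def set_add_def' reg_module_def)
    ultimately show "Rel (X \<oplus>\<^bsub>left_quot R J\<^esub> Y) (a \<oplus> b)" by (auto simp: Rel_def)
  next
    fix r X a assume rX: "r \<in> carrier R" "X \<in> carrier (left_quot R J)" "a \<in> carrier R" and "Rel X a"
    then obtain x where x: "x \<in> X" "a \<ominus> x \<otimes> n \<in> I" by (auto simp: Rel_def)
    have xc: "x \<in> carrier R" using Xc rX x by blast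
    have "r \<otimes> a \<ominus> (r \<otimes> x) \<otimes> n \<in> I"
      using diff_cong_mult[OF I rX(3) _ rX(1) x(2)] xc n rX by (simp add: m_assoc)
    moreover have "r \<otimes> x \<in> r \<odot>\<^bsub>left_quot R J\<^esub> X"
    proof -
      have "\<zero> \<oplus> r \<otimes> x \<in> J +>\<^bsub>reg_module R\<^esub> (r \<otimes> x)" using Jd(2) by (auto simp: a_r_coset_def' reg_module_def)
      then show ?thesis using x(1) xc rX(1) by (auto simp: left_quot_def quot_module_def) (auto simp: reg_module_def)
    qed
    ultimately show "Rel (r \<odot>\<^bsub>left_quot R J\<^esub> X) (r \<otimes> a)" by (auto simp: Rel_def)
  next
    fix a assume a: "a \<in> carrier R" "Rel \<zero>\<^bsub>left_quot R J\<^esub> a"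
    then obtain x where "x \<in> J" "a \<ominus> x \<otimes> n \<in> I" by (auto simp: Rel_def left_quot_def quot_module_def)
    then show "a \<in> I" using left_ideal_cancel[OF I, of a "x \<otimes> n"] Jn[of x] a(1) Jd(1) n by simp
  next
    show "{j \<oplus> \<one> | j. j \<in> J} \<in> carrier (left_quot R J)" unfolding left_quot_carrier by blast
    have "\<one> \<in> {j \<oplus> \<one> | j. j \<in> J}" using Jd(2) by force
    moreover have "n \<ominus> \<one> \<otimes> n \<in> I" using n Id(2) minus_self[OF n(1)] by simp
    ultimately show "Rel {j \<oplus> \<one> | j. j \<in> J} n" unfolding Rel_def by blast
  next
    fix X a assume X: "X \<in> carrier (left_quot R J)" "a \<in> carrier R" "Rel X a"
    then obtain x where x: "x \<in> X" "a \<ominus> x \<otimes> n \<in> I" by (auto simp: Rel_def)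
    have xc: "x \<in> carrier R" using Xc X x by blast
    note zc = centreD(1)[OF z(1)]
    have "z \<otimes> (x \<otimes> n) = x \<otimes> (z \<otimes> n)" using central_lcomm[OF z(1) xc n(1)] by simp
    then have "z \<otimes> (x \<otimes> n) \<in> I" using Id(4) xc z(2) by simp
    then show "z \<otimes> a \<in> I"
      using left_ideal_cancel[OF I diff_cong_mult[OF I X(2) _ zc x(2)]] X(2) xc n zc by simp
  qed (use n in auto)
qed

end

section \<open>Maximal elements in noetherian modules\<close>

lemma submodule_Union_chain:
  assumes M: "left_module R M" and C: "\<C> \<noteq> {}" "\<And>A B. A \<in> \<C> \<Longrightarrow> B \<in> \<C> \<Longrightarrow> A \<subseteq> B \<or> B \<subseteq> A"
    and sub: "\<And>L. L \<in> \<C> \<Longrightarrow> submodule L R M"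
  shows "submodule (\<Union>\<C>) R M"
proof (rule submodule_of_left_moduleI[OF M])
  note subm = submodule.axioms(1)[OF sub]
  show "\<Union>\<C> \<subseteq> carrier M" using subgroup.subset[OF subm] by auto
  show "\<zero>\<^bsub>M\<^esub> \<in> \<Union>\<C>" using C(1) subgroup.one_closed[OF subm] by auto
  fix a b assume "a \<in> \<Union>\<C>" "b \<in> \<Union>\<C>"
  then obtain L where L: "a \<in> L" "b \<in> L" "L \<in> \<C>" using C(2) by blast
  then have "a \<oplus>\<^bsub>M\<^esub> b \<in> L" using subgroup.m_closed[OF subm[of L]] by auto
  then show "a \<oplus>\<^bsub>M\<^esub> b \<in> \<Union>\<C>" using L by blast
next
  fix r a assume "r \<in> carrier R" "a \<in> \<Union>\<C>"
  then show "r \<odot>\<^bsub>M\<^esub> a \<in> \<Union>\<C>" using submodule.smult_closed[OF sub] by blast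
qed

text \<open>The union of a chain is spanned by finitely many elements, which lie in one member
  already; so the union is that member, and Zorn's lemma applies within the family.\<close>

lemma noetherian_module_maximal:
  assumes N: "noetherian_module R M" and ne: "\<F> \<noteq> {}" and sub: "\<And>L. L \<in> \<F> \<Longrightarrow> submodule L R M"
  shows "\<exists>L\<in>\<F>. \<forall>L'\<in>\<F>. L \<subseteq> L' \<longrightarrow> L' = L"
proof (rule subset_Zorn_nonempty[OF ne])
  have M: "left_module R M" using N by (simp add: noetherian_module_def)
  fix \<C> assume C: "\<C> \<noteq> {}" "subset.chain \<F> \<C>"
  then have CF: "\<C> \<subseteq> \<F>" by (auto simp: subset.chain_def)
  have "submodule (\<Union>\<C>) R M"
    by (rule submodule_Union_chain[OF M C(1)]) (use C(2) CF sub in \<open>auto simp: subset.chain_def\<close>)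
  then obtain A where A: "A \<subseteq> \<Union>\<C>" "finite A" "module_span R M A = \<Union>\<C>"
    using N unfolding noetherian_module_def by blast
  obtain L where L: "L \<in> \<C>" "A \<subseteq> L"
  proof (rule finite_subset_Union_chain[OF A(2,1) C(1), of \<F>])
    show "subset.chain \<F> \<C>" by (rule C(2))
  qed blast
  have "module_span R M A \<subseteq> L" unfolding module_span_def using sub[of L] L CF by blast
  then have "\<Union>\<C> = L" using A(3) L by blast
  then show "\<Union>\<C> \<in> \<F>" using L CF by auto
qed

section \<open>Associated primes of central ideals\<close>

text \<open>Ideals of the centre as subsets of \<open>R\<close>, so that central and noncentral
  ideals are compared in one ring record.\<close>

definition central_ideal :: "('a, 'm) ring_scheme \<Rightarrow> 'a set \<Rightarrow> bool" where
  "central_ideal R C \<longleftrightarrow> C \<subseteq> centre R \<and> \<zero>\<^bsub>R\<^esub> \<in> C \<and> (\<forall>a\<in>C. \<forall>b\<in>C. a \<oplus>\<^bsub>R\<^esub> b \<in> C) \<and>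
     (\<forall>z\<in>centre R. \<forall>c\<in>C. z \<otimes>\<^bsub>R\<^esub> c \<in> C)"

definition central_prime :: "('a, 'm) ring_scheme \<Rightarrow> 'a set \<Rightarrow> bool" where
  "central_prime R q \<longleftrightarrow> central_ideal R q \<and> \<one>\<^bsub>R\<^esub> \<notin> q \<and>
     (\<forall>a\<in>centre R. \<forall>b\<in>centre R. a \<otimes>\<^bsub>R\<^esub> b \<in> q \<longrightarrow> a \<in> q \<or> b \<in> q)"

text \<open>The elementwise form of primeness: aRb inside \<open>Q\<close> forces \<open>a\<close>
  or \<open>b\<close> into \<open>Q\<close>.\<close>

definition prime_two_sided :: "('a, 'm) ring_scheme \<Rightarrow> 'a set \<Rightarrow> bool" where
  "prime_two_sided R Q \<longleftrightarrow> two_sided R Q \<and> \<one>\<^bsub>R\<^esub> \<notin> Q \<and>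
     (\<forall>a\<in>carrier R. \<forall>b\<in>carrier R. (\<forall>r\<in>carrier R. a \<otimes>\<^bsub>R\<^esub> (r \<otimes>\<^bsub>R\<^esub> b) \<in> Q) \<longrightarrow> a \<in> Q \<or> b \<in> Q)"

text \<open>The annihilator of the whole submodule that \<open>n\<close> generates in R/I, and not
  of \<open>n\<close> alone; this makes it two-sided.\<close>

definition left_annihilator :: "('a, 'm) ring_scheme \<Rightarrow> 'a set \<Rightarrow> 'a \<Rightarrow> 'a set" where
  "left_annihilator R I n = {r \<in> carrier R. \<forall>s\<in>carrier R. r \<otimes>\<^bsub>R\<^esub> (s \<otimes>\<^bsub>R\<^esub> n) \<in> I}"

definition central_annihilator :: "('a, 'm) ring_scheme \<Rightarrow> 'a set \<Rightarrow> 'a \<Rightarrow> 'a set" where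
  "central_annihilator R I n = {z \<in> centre R. z \<otimes>\<^bsub>R\<^esub> n \<in> I}"

definition adjoin :: "('a, 'm) ring_scheme \<Rightarrow> 'a set \<Rightarrow> 'a \<Rightarrow> 'a set" where
  "adjoin R I n = {i \<oplus>\<^bsub>R\<^esub> r \<otimes>\<^bsub>R\<^esub> n | i r. i \<in> I \<and> r \<in> carrier R}"

lemma (in ring) adjoin:
  assumes I: "left_ideal R I" and n: "n \<in> carrier R"
  shows "left_ideal R (adjoin R I n)" "I \<subseteq> adjoin R I n" "n \<in> adjoin R I n"
proof -
  note Id = left_idealD[OF I]
  show sup: "I \<subseteq> adjoin R I n"
  proof
    fix i assume i: "i \<in> I"
    have "i = i \<oplus> \<zero> \<otimes> n" using Id(1)[OF i] n by simp
    then show "i \<in> adjoin R I n" using i unfolding adjoin_def by blast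
  qed
  have "n = \<zero> \<oplus> \<one> \<otimes> n" using n by simp
  then show "n \<in> adjoin R I n" using Id(2) one_closed unfolding adjoin_def by blast
  show "left_ideal R (adjoin R I n)"
    unfolding left_ideal_def
  proof (intro conjI ballI)
    show "adjoin R I n \<subseteq> carrier R" using Id(1) n by (auto simp: adjoin_def)
    show "\<zero> \<in> adjoin R I n" using sup Id(2) by blast
    fix a assume "a \<in> adjoin R I n"
    then obtain i r where a: "i \<in> I" "r \<in> carrier R" "a = i \<oplus> r \<otimes> n" by (auto simp: adjoin_def)
    { fix b assume "b \<in> adjoin R I n"
      then obtain k s where b: "k \<in> I" "s \<in> carrier R" "b = k \<oplus> s \<otimes> n" by (auto simp: adjoin_def)
      have "a \<oplus> b = (i \<oplus> k) \<oplus> (r \<oplus> s) \<otimes> n" using a b n Id(1) by (simp add: l_distr a_ac)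
      then show "a \<oplus> b \<in> adjoin R I n" using a b Id(3) unfolding adjoin_def by blast
    next
      fix s assume s: "s \<in> carrier R"
      have "s \<otimes> a = s \<otimes> i \<oplus> (s \<otimes> r) \<otimes> n" using a s n Id(1) by (simp add: r_distr m_assoc)
      then show "s \<otimes> a \<in> adjoin R I n" using a s Id(4) unfolding adjoin_def by blast }
  qed
qed

lemma central_idealD:
  assumes "central_ideal R C"
  shows "a \<in> C \<Longrightarrow> a \<in> centre R" "\<zero>\<^bsub>R\<^esub> \<in> C" "a \<in> C \<Longrightarrow> b \<in> C \<Longrightarrow> a \<oplus>\<^bsub>R\<^esub> b \<in> C"
    "z \<in> centre R \<Longrightarrow> c \<in> C \<Longrightarrow> z \<otimes>\<^bsub>R\<^esub> c \<in> C"
  using assms by (auto simp: central_ideal_def)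

lemma central_primeD:
  assumes "central_prime R q"
  shows "central_ideal R q" "\<one>\<^bsub>R\<^esub> \<notin> q"
    "a \<in> centre R \<Longrightarrow> b \<in> centre R \<Longrightarrow> a \<otimes>\<^bsub>R\<^esub> b \<in> q \<Longrightarrow> a \<in> q \<or> b \<in> q"
  using assms by (auto simp: central_prime_def)

lemma two_sidedD:
  assumes "two_sided R I"
  shows "left_ideal R I" "a \<in> I \<Longrightarrow> r \<in> carrier R \<Longrightarrow> a \<otimes>\<^bsub>R\<^esub> r \<in> I"
  using assms by (auto simp: two_sided_def)

lemma prime_two_sidedD:
  assumes "prime_two_sided R Q"
  shows "two_sided R Q" "left_ideal R Q" "\<one>\<^bsub>R\<^esub> \<notin> Q"
    "\<lbrakk>a \<in> carrier R; b \<in> carrier R; \<And>r. r \<in> carrier R \<Longrightarrow> a \<otimes>\<^bsub>R\<^esub> (r \<otimes>\<^bsub>R\<^esub> b) \<in> Q\<rbrakk> \<Longrightarrow> a \<in> Q \<or> b \<in> Q"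
  using assms by (auto simp: prime_two_sided_def two_sided_def)

context ring
begin

lemma central_ideal_mult_right:
  assumes "central_ideal R C" "c \<in> C" "z \<in> centre R" shows "c \<otimes> z \<in> C"
  using central_idealD(1,4)[OF assms(1)] assms(2,3) centreD[of z R] centreD(1)[of c R] by metis

lemma central_ideal_uminus:
  assumes "central_ideal R C" "c \<in> C" shows "\<ominus> c \<in> C"
proof -
  have "\<ominus> c = \<ominus> \<one> \<otimes> c" using centreD(1)[OF central_idealD(1)[OF assms]] by (simp add: l_minus)
  then show ?thesis using central_idealD(4)[OF assms(1) centre_uminus[OF centre_one] assms(2)] by simp
qed

lemma two_sided_left_annihilator:
  assumes "left_ideal R I" "n \<in> carrier R" shows "two_sided R (left_annihilator R I n)"
  using left_idealD[OF assms(1)] assms(2)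
  by (auto simp: two_sided_def left_ideal_def left_annihilator_def l_distr m_assoc)
    (metis m_assoc m_closed)

lemma left_annihilator_annihilates:
  assumes "r \<in> left_annihilator R I n" "n \<in> carrier R" shows "r \<otimes> n \<in> I"
  using assms unfolding left_annihilator_def by (metis (mono_tags, lifting) l_one mem_Collect_eq one_closed)

lemma left_annihilator_mult:
  assumes "n \<in> carrier R" "s \<in> carrier R" shows "left_annihilator R I n \<subseteq> left_annihilator R I (s \<otimes> n)"
  using assms unfolding left_annihilator_def by (auto simp: m_assoc[symmetric])

lemma central_annihilator_eq:
  assumes "left_ideal R I" "n \<in> carrier R"
  shows "central_annihilator R I n = centre R \<inter> left_annihilator R I n"
proof -
  have "z \<otimes> (s \<otimes> n) \<in> I" if "z \<in> centre R" "z \<otimes> n \<in> I" "s \<in> carrier R" for z s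
    using central_lcomm[OF that(1,3) assms(2)] left_idealD(4)[OF assms(1) that(3,2)] by simp
  then show ?thesis
    using left_annihilator_annihilates[OF _ assms(2)]
    by (auto simp: central_annihilator_def left_annihilator_def centreD(1))
qed

lemma central_ideal_central_annihilator:
  assumes "left_ideal R I" "n \<in> carrier R" shows "central_ideal R (central_annihilator R I n)"
  using left_idealD[OF assms(1)] assms(2)
  by (auto simp: central_ideal_def central_annihilator_def centreD(1) l_distr m_assoc centre_add centre_mult)

lemma central_ideal_Int_centre:
  assumes "left_ideal R I" shows "central_ideal R (I \<inter> centre R)"
  using left_idealD[OF assms] by (auto simp: central_ideal_def centre_add centre_mult centreD(1))

lemma prime_ideal_iff: "prime_ideal Q R \<longleftrightarrow> prime_two_sided R Q"
proof
  assume P: "prime_ideal Q R"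
  then have T: "two_sided R Q" and L: "left_ideal R Q"
    by (auto simp: prime_ideal_def ideal_iff_two_sided two_sided_def)
  note Qd = left_idealD[OF L]
  have prod: "I \<subseteq> Q \<or> J \<subseteq> Q" if "two_sided R I" "two_sided R J" "\<And>i j. i \<in> I \<Longrightarrow> j \<in> J \<Longrightarrow> i \<otimes> j \<in> Q" for I J
  proof -
    have "x \<in> Q" if "x \<in> ideal_prod R I J" for x
      using that
      by induction (use \<open>\<And>i j. i \<in> I \<Longrightarrow> j \<in> J \<Longrightarrow> i \<otimes> j \<in> Q\<close> Qd(3) in auto)
    then show ?thesis using P that(1,2) by (auto simp: prime_ideal_def ideal_iff_two_sided)
  qed
  have 1: "\<one> \<notin> Q"
  proof
    assume "\<one> \<in> Q"
    then have "r \<in> Q" if "r \<in> carrier R" for r using Qd(4)[OF that] that by fastforce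
    then show False using P Qd(1) by (auto simp: prime_ideal_def)
  qed
  have "a \<in> Q \<or> b \<in> Q" if ab: "a \<in> carrier R" "b \<in> carrier R" "\<forall>r\<in>carrier R. a \<otimes> (r \<otimes> b) \<in> Q" for a b
  proof -
    \<comment> \<open>In place of the ideals generated by \<open>a\<close> and \<open>b\<close>, two
      annihilators modulo \<open>Q\<close> are used: \<open>?I\<close> kills the left ideal
      generated by \<open>b\<close>, and \<open>?J\<close> is everything that \<open>?I\<close>
      kills. They are ideals directly and contain \<open>a\<close> and \<open>b\<close>.\<close>
    let ?I = "left_annihilator R Q b"
    let ?J = "{y \<in> carrier R. \<forall>r\<in>?I. r \<otimes> y \<in> Q}"
    have I: "two_sided R ?I" by (rule two_sided_left_annihilator[OF L ab(2)])
    note Id = left_idealD[OF two_sidedD(1)[OF I]]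
    have "two_sided R ?J"
      unfolding two_sided_def left_ideal_def
    proof (intro conjI ballI)
      show "\<zero> \<in> ?J" using Id(1) Qd(2) by auto
      fix y assume y: "y \<in> ?J"
      { fix x assume "x \<in> ?J" then show "y \<oplus> x \<in> ?J" using y Id(1) Qd(3) by (auto simp: r_distr)
      next
        fix r assume r: "r \<in> carrier R"
        have "s \<otimes> (r \<otimes> y) \<in> Q" if "s \<in> ?I" for s
          using two_sidedD(2)[OF I that r] y m_assoc[OF Id(1)[OF that] r, of y] by auto
        then show "r \<otimes> y \<in> ?J" using y r by simp
        have "s \<otimes> (y \<otimes> r) \<in> Q" if "s \<in> ?I" for s
          using two_sidedD(2)[OF T, of "s \<otimes> y" r] y that r m_assoc[OF Id(1)[OF that], of y r] by auto
        then show "y \<otimes> r \<in> ?J" using y r by simp }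
    qed auto
    then have "?I \<subseteq> Q \<or> ?J \<subseteq> Q" using prod[OF I] by blast
    moreover have "a \<in> ?I" using ab by (simp add: left_annihilator_def)
    moreover have "b \<in> ?J" using ab(2) left_annihilator_annihilates by simp
    ultimately show ?thesis by blast
  qed
  then show "prime_two_sided R Q" using T 1 by (simp add: prime_two_sided_def)
next
  assume P: "prime_two_sided R Q"
  note Pd = prime_two_sidedD[OF P]
  have "I \<subseteq> Q \<or> J \<subseteq> Q" if IJ: "ideal I R" "ideal J R" "ideal_prod R I J \<subseteq> Q" for I J
  proof (rule ccontr)
    assume "\<not> (I \<subseteq> Q \<or> J \<subseteq> Q)"
    then obtain a b where ab: "a \<in> I" "a \<notin> Q" "b \<in> J" "b \<notin> Q" by blast
    interpret I: ideal I R by fact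
    interpret J: ideal J R by fact
    have "a \<otimes> (r \<otimes> b) \<in> Q" if "r \<in> carrier R" for r
      using IJ(3) ideal_prod.prod[OF ab(1), of "r \<otimes> b" J R] J.I_l_closed[OF ab(3) that] by blast
    then show False using Pd(4)[of a b] ab I.Icarr J.Icarr by blast
  qed
  moreover have "Q \<noteq> carrier R" using Pd(3) by auto
  ultimately show "prime_ideal Q R" using Pd(1) by (auto simp: prime_ideal_def ideal_iff_two_sided)
qed

lemma central_prime_Int_centre:
  assumes P: "prime_two_sided R Q" shows "central_prime R (Q \<inter> centre R)"
proof -
  note Pd = prime_two_sidedD[OF P]
  have "a \<in> Q \<or> b \<in> Q" if ab: "a \<in> centre R" "b \<in> centre R" "a \<otimes> b \<in> Q" for a b
  proof (rule Pd(4))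
    show "a \<in> carrier R" "b \<in> carrier R" using centreD(1)[OF ab(1)] centreD(1)[OF ab(2)] by auto
    fix r assume r: "r \<in> carrier R"
    have "a \<otimes> (r \<otimes> b) = r \<otimes> (a \<otimes> b)"
      using central_lcomm[OF ab(1) r centreD(1)[OF ab(2)]] by simp
    then show "a \<otimes> (r \<otimes> b) \<in> Q" using left_idealD(4)[OF Pd(2) r ab(3)] by simp
  qed
  then show ?thesis
    using central_ideal_Int_centre[OF Pd(2)] Pd(3) by (auto simp: central_prime_def)
qed

text \<open>Central elements outside a prime are regular modulo it: \<open>z\<close> can be moved
  past \<open>s\<close> in \<open>z s r\<close>, so the elementwise criterion applies.\<close>

lemma prime_central_mult:
  assumes P: "prime_two_sided R Q" and z: "z \<in> centre R" "z \<notin> Q" and r: "r \<in> carrier R" "z \<otimes> r \<in> Q"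
  shows "r \<in> Q"
proof -
  note Pd = prime_two_sidedD[OF P]
  have "z \<otimes> (s \<otimes> r) \<in> Q" if "s \<in> carrier R" for s
    using central_lcomm[OF z(1) that r(1)] left_idealD(4)[OF Pd(2) that r(2)] by simp
  then show ?thesis using Pd(4)[OF centreD(1)[OF z(1)] r(1)] z(2) by blast
qed

lemma prime_avoidance:
  assumes "finite \<Q>" "\<And>q. q \<in> \<Q> \<Longrightarrow> central_prime R q" "central_ideal R p"
    and "\<And>q. q \<in> \<Q> \<Longrightarrow> \<not> p \<subseteq> q"
  shows "\<exists>x\<in>p. \<forall>q\<in>\<Q>. x \<notin> q"
  using assms(1,2,4)
proof (induction \<Q> rule: finite_psubset_induct)
  case (psubset \<Q>)
  note pd = central_idealD[OF assms(3)]
  show ?case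
  proof (cases "\<exists>q\<in>\<Q>. \<exists>q'\<in>\<Q>. q \<noteq> q' \<and> q' \<subseteq> q")
    \<comment> \<open>A prime contained in another member of the family may be dropped.\<close>
    case True
    then obtain q q' where q: "q \<in> \<Q>" "q' \<in> \<Q>" "q \<noteq> q'" "q' \<subseteq> q" by blast
    then have "\<exists>x\<in>p. \<forall>q\<in>\<Q> - {q'}. x \<notin> q"
      by (intro psubset.IH) (use psubset.prems in auto)
    then show ?thesis using q by blast
  next
    case False
    show ?thesis
    proof (cases "\<Q> = {}")
      case True then show ?thesis using pd(2) by blast
    next
      case ne: False
      then obtain q where q: "q \<in> \<Q>" by blast
      then have "\<exists>x\<in>p. \<forall>q'\<in>\<Q> - {q}. x \<notin> q'"
        by (intro psubset.IH) (use psubset.prems in auto)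
      then obtain x where x: "x \<in> p" "\<forall>q'\<in>\<Q> - {q}. x \<notin> q'" by blast
      have qp: "central_prime R q" using psubset.prems q by blast
      \<comment> \<open>An element of \<open>p\<close> outside \<open>q\<close> is multiplied by
        elements of the other primes outside \<open>q\<close>; the latter exist because the primes
        are now incomparable.\<close>
      have "\<exists>w\<in>p. w \<notin> q \<and> (\<forall>q'\<in>S. w \<in> q')" if "finite S" "S \<subseteq> \<Q> - {q}" for S
        using that
      proof (induction S)
        case empty then show ?case using psubset.prems(2)[OF q] by blast
      next
        case (insert q' S)
        then obtain w where w: "w \<in> p" "w \<notin> q" "\<forall>q'\<in>S. w \<in> q'" by auto
        have q'\<Q>: "q' \<in> \<Q>" "q' \<noteq> q" using insert.prems by auto
        then obtain y where y: "y \<in> q'" "y \<notin> q" using False q by blast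
        have q'p: "central_prime R q'" using psubset.prems q'\<Q> by blast
        have yc: "y \<in> centre R" using central_idealD(1)[OF central_primeD(1)[OF q'p] y(1)] .
        have wc: "w \<in> centre R" using pd(1) w by blast
        have "y \<otimes> w \<in> p" using pd(4)[OF yc w(1)] .
        moreover have "y \<otimes> w \<notin> q" using central_primeD(3)[OF qp yc wc] y w by blast
        moreover have "y \<otimes> w \<in> q'" using central_ideal_mult_right[OF central_primeD(1)[OF q'p] y(1) wc] .
        moreover have "y \<otimes> w \<in> q''" if "q'' \<in> S" for q''
        proof -
          have "q'' \<in> \<Q>" using that insert.prems by auto
          then have "central_ideal R q''" using psubset.prems(1) central_primeD(1) by blast
          from central_idealD(4)[OF this yc] show ?thesis using w(3) that by blast
        qed
        ultimately show ?case by blast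
      qed
      then obtain w where w: "w \<in> p" "w \<notin> q" "\<forall>q'\<in>\<Q> - {q}. w \<in> q'"
        using psubset.hyps by (meson finite_Diff order_refl)
      show ?thesis
      proof (cases "x \<in> q")
        case False then show ?thesis using x by blast
      next
        \<comment> \<open>Here \<open>x\<close> lies in \<open>q\<close> but in no other prime of
          the family, and \<open>w\<close> in all others but not in \<open>q\<close>; so their sum
          lies in none.\<close>
        case True
        have cc: "x \<in> carrier R" "w \<in> carrier R" using centreD(1)[OF pd(1)] x(1) w(1) by auto
        have canc: "b \<in> c" if "central_ideal R c" "a \<in> c" "a \<oplus> b \<in> c" "a \<in> carrier R" "b \<in> carrier R" for a b c
        proof -
          have "b = \<ominus> a \<oplus> (a \<oplus> b)" using that by algebra
          then show ?thesis using central_idealD(3)[OF that(1) central_ideal_uminus[OF that(1,2)] that(3)] by simp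
        qed
        have "x \<oplus> w \<notin> q" using canc[OF central_primeD(1)[OF qp] True] w cc by blast
        moreover have "x \<oplus> w \<notin> q'" if "q' \<in> \<Q> - {q}" for q'
        proof
          assume "x \<oplus> w \<in> q'"
          moreover have "central_ideal R q'" using psubset.prems(1)[of q'] central_primeD(1) that by blast
          ultimately have "x \<in> q'" using canc[of q' w x] that w(3) cc a_comm[of x w] by simp
          then show False using x that by blast
        qed
        ultimately show ?thesis using pd(3)[OF x(1) w(1)] by blast
      qed
    qed
  qed
qed

end

section \<open>Annihilators over a noetherian ring finite over its centre\<close>

locale central_finite = ring R for R :: "('a, 'm) ring_scheme" (structure) +
  assumes noeth: "noetherian R" and fin: "finite_over_centre R"
begin

lemma left_ideal_maximal:
  assumes "\<F> \<noteq> {}" "\<And>L. L \<in> \<F> \<Longrightarrow> left_ideal R L"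
  shows "\<exists>L\<in>\<F>. \<forall>L'\<in>\<F>. L \<subseteq> L' \<longrightarrow> L' = L"
  using noeth assms left_ideal_submodule
  by (intro noetherian_module_maximal[of R "reg_module R"]) (auto simp: noetherian_def)

text \<open>Passing from \<open>n\<close> to a multiple can only enlarge
  \<open>left_annihilator\<close>. If it is maximal at \<open>n\<close> within \<open>S\<close>, it
  stays the same for multiples inside \<open>S\<close>.\<close>

lemma left_annihilator_maximal:
  assumes I: "left_ideal R I" and S: "S \<subseteq> carrier R" "S \<noteq> {}"
  obtains n where "n \<in> S" "\<And>s. s \<in> carrier R \<Longrightarrow> s \<otimes> n \<in> S \<Longrightarrow> left_annihilator R I (s \<otimes> n) = left_annihilator R I n"
proof -
  have "\<exists>L\<in>left_annihilator R I ` S. \<forall>L'\<in>left_annihilator R I ` S. L \<subseteq> L' \<longrightarrow> L' = L"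
    using S two_sidedD(1)[OF two_sided_left_annihilator[OF I]] by (intro left_ideal_maximal) auto
  then obtain n where n: "n \<in> S" "\<forall>m\<in>S. left_annihilator R I n \<subseteq> left_annihilator R I m \<longrightarrow> left_annihilator R I m = left_annihilator R I n"
    by auto
  then show ?thesis using that[of n] left_annihilator_mult[of n] S(1) by blast
qed

text \<open>The maximal annihilators among the nonzero multiples of \<open>n\<close> are prime: if
  \<open>b\<close> does not kill the submodule generated by \<open>m\<close>, then
  \<open>b s m\<close> is nonzero for some \<open>s\<close>, and its annihilator contains
  \<open>a\<close> yet equals that of \<open>m\<close>.\<close>

lemma exists_prime_left_annihilator:
  assumes I: "left_ideal R I" and n: "n \<in> carrier R" "n \<notin> I"
  obtains n' where "n' \<in> carrier R" "n' \<notin> I" "left_annihilator R I n \<subseteq> left_annihilator R I n'"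
    "prime_two_sided R (left_annihilator R I n')"
proof -
  define S where "S = {m. m \<notin> I \<and> (\<exists>s\<in>carrier R. m = s \<otimes> n)}"
  have "n \<in> S" using n by (auto simp: S_def intro!: bexI[of _ \<one>])
  moreover have "S \<subseteq> carrier R" using n by (auto simp: S_def)
  ultimately obtain m where m: "m \<in> S"
    "\<And>s. s \<in> carrier R \<Longrightarrow> s \<otimes> m \<in> S \<Longrightarrow> left_annihilator R I (s \<otimes> m) = left_annihilator R I m"
    using left_annihilator_maximal[OF I, of S] by blast
  have mc: "m \<in> carrier R" using m(1) n by (auto simp: S_def)
  let ?Q = "left_annihilator R I m"
  have T: "two_sided R ?Q" by (rule two_sided_left_annihilator[OF I mc])
  have "a \<in> ?Q \<or> b \<in> ?Q" if ab: "a \<in> carrier R" "b \<in> carrier R" "\<forall>r\<in>carrier R. a \<otimes> (r \<otimes> b) \<in> ?Q" for a b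
  proof (rule disjCI)
    assume "b \<notin> ?Q"
    then obtain s where s: "s \<in> carrier R" "b \<otimes> (s \<otimes> m) \<notin> I" using ab by (auto simp: left_annihilator_def)
    have bs: "(b \<otimes> s) \<otimes> m \<in> S"
    proof -
      obtain u where u: "u \<in> carrier R" "m = u \<otimes> n" using m(1) by (auto simp: S_def)
      have "(b \<otimes> s) \<otimes> m = ((b \<otimes> s) \<otimes> u) \<otimes> n" using u s ab n by (simp add: m_assoc)
      moreover have "(b \<otimes> s) \<otimes> m \<notin> I" using s ab mc by (simp add: m_assoc)
      ultimately show ?thesis using u s ab by (auto simp: S_def)
    qed
    have "a \<otimes> (t \<otimes> ((b \<otimes> s) \<otimes> m)) \<in> I" if t: "t \<in> carrier R" for t
    proof -
      have "(a \<otimes> (t \<otimes> b)) \<otimes> (s \<otimes> m) \<in> I" using ab(3) t s(1) by (auto simp: left_annihilator_def)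
      moreover have "(a \<otimes> (t \<otimes> b)) \<otimes> (s \<otimes> m) = a \<otimes> (t \<otimes> ((b \<otimes> s) \<otimes> m))" using ab t s(1) mc by (simp add: m_assoc)
      ultimately show ?thesis by simp
    qed
    then have "a \<in> left_annihilator R I ((b \<otimes> s) \<otimes> m)" using ab by (simp add: left_annihilator_def)
    then show "a \<in> ?Q" using m(2)[OF _ bs] ab s by simp
  qed
  moreover have "\<one> \<notin> ?Q" using left_annihilator_annihilates[of \<one> I m] m(1) mc by (auto simp: S_def)
  ultimately have "prime_two_sided R ?Q" using T by (simp add: prime_two_sided_def)
  moreover have "left_annihilator R I n \<subseteq> ?Q" using m(1) left_annihilator_mult[OF n(1)] by (auto simp: S_def)
  ultimately show ?thesis using that[of m] m(1) mc by (auto simp: S_def)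
qed

text \<open>Noetherian induction on a left ideal \<open>J\<close> above \<open>I\<close> whose
  central zero divisors modulo \<open>I\<close> are covered by finitely many associated primes. The
  maximal such \<open>J\<close> need not be \<open>R\<close>; it suffices that every nonzero
  submodule of R/I meets J/I.\<close>

lemma finitely_many_associated_primes:
  assumes I: "left_ideal R I"
  obtains \<Q> where "finite \<Q>"
    "\<And>q. q \<in> \<Q> \<Longrightarrow> central_prime R q \<and> (\<exists>n\<in>carrier R. n \<notin> I \<and> q = central_annihilator R I n)"
    "\<And>z n. z \<in> centre R \<Longrightarrow> n \<in> carrier R \<Longrightarrow> n \<notin> I \<Longrightarrow> z \<otimes> n \<in> I \<Longrightarrow> \<exists>q\<in>\<Q>. z \<in> q"
proof -
  note Id = left_idealD[OF I]
  define good where "good J \<Q> \<longleftrightarrow> finite \<Q> \<and>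
    (\<forall>q\<in>\<Q>. central_prime R q \<and> (\<exists>n\<in>carrier R. n \<notin> I \<and> q = central_annihilator R I n)) \<and>
    (\<forall>z\<in>centre R. \<forall>n\<in>J. n \<notin> I \<longrightarrow> z \<otimes> n \<in> I \<longrightarrow> (\<exists>q\<in>\<Q>. z \<in> q))" for J \<Q>
  define \<F> where "\<F> = {J. left_ideal R J \<and> I \<subseteq> J \<and> (\<exists>\<Q>. good J \<Q>)}"
  have "good I {}" by (auto simp: good_def)
  then have "I \<in> \<F>" using I by (auto simp: \<F>_def)
  then have "\<exists>J\<in>\<F>. \<forall>J'\<in>\<F>. J \<subseteq> J' \<longrightarrow> J' = J"
    by (intro left_ideal_maximal) (auto simp: \<F>_def)
  then obtain J where J: "J \<in> \<F>" "\<forall>J'\<in>\<F>. J \<subseteq> J' \<longrightarrow> J' = J" by blast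
  then obtain \<Q> where Q: "good J \<Q>" and JL: "left_ideal R J" and IJ: "I \<subseteq> J" by (auto simp: \<F>_def)
  note Jd = left_idealD[OF JL]
  \<comment> \<open>Elements generating a nonzero submodule of R/I that meets J/I trivially. If
    there are none, each \<open>n\<close> outside \<open>I\<close> has a nonzero multiple in J/I,
    and zero divisors on \<open>n\<close> are seen there.\<close>
  define S where "S = {n \<in> carrier R. n \<notin> I \<and> (\<forall>r\<in>carrier R. r \<otimes> n \<in> J \<longrightarrow> r \<otimes> n \<in> I)}"
  show ?thesis
  proof (cases "S = {}")
    case True
    have "\<exists>q\<in>\<Q>. z \<in> q" if zn: "z \<in> centre R" "n \<in> carrier R" "n \<notin> I" "z \<otimes> n \<in> I" for z n
    proof -
      obtain r where r: "r \<in> carrier R" "r \<otimes> n \<in> J" "r \<otimes> n \<notin> I" using True zn by (auto simp: S_def)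
      have "z \<otimes> (r \<otimes> n) \<in> I" using central_lcomm[OF zn(1) r(1) zn(2)] Id(4)[OF r(1) zn(4)] by simp
      then show ?thesis using Q zn(1) r by (auto simp: good_def)
    qed
    then show ?thesis using that[of \<Q>] Q by (auto simp: good_def)
  next
    case False
    obtain n where n: "n \<in> S"
      "\<And>s. s \<in> carrier R \<Longrightarrow> s \<otimes> n \<in> S \<Longrightarrow> left_annihilator R I (s \<otimes> n) = left_annihilator R I n"
      using left_annihilator_maximal[OF I, of S] False by (auto simp: S_def)
    have nc: "n \<in> carrier R" "n \<notin> I" and nJ: "\<And>r. r \<in> carrier R \<Longrightarrow> r \<otimes> n \<in> J \<Longrightarrow> r \<otimes> n \<in> I"
      using n(1) by (auto simp: S_def)
    let ?q = "central_annihilator R I n"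
    have ann: "central_annihilator R I (s \<otimes> n) = ?q" if s: "s \<in> carrier R" "s \<otimes> n \<notin> I" for s
    proof -
      have "s \<otimes> n \<in> S"
        using s nJ nc m_assoc[symmetric, of _ s n] by (auto simp: S_def)
      then show ?thesis using n(2)[OF s(1)] central_annihilator_eq[OF I] s(1) nc by simp
    qed
    have qp: "central_prime R ?q"
      unfolding central_prime_def
    proof (intro conjI ballI impI)
      show "central_ideal R ?q" by (rule central_ideal_central_annihilator[OF I nc(1)])
      show "\<one> \<notin> ?q" using nc by (simp add: central_annihilator_def)
      fix a b assume ab: "a \<in> centre R" "b \<in> centre R" "a \<otimes> b \<in> ?q"
      show "a \<in> ?q \<or> b \<in> ?q"
      proof (rule disjCI)
        assume "b \<notin> ?q"
        then have bn: "b \<otimes> n \<notin> I" using ab by (simp add: central_annihilator_def)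
        have "a \<in> central_annihilator R I (b \<otimes> n)"
          using ab nc centreD(1)[OF ab(1)] centreD(1)[OF ab(2)] by (simp add: central_annihilator_def m_assoc)
        then show "a \<in> ?q" using ann[OF centreD(1)[OF ab(2)] bn] by simp
      qed
    qed
    define J' where "J' = adjoin R J n"
    note J'L = adjoin(1)[OF JL nc(1), folded J'_def] and JJ' = adjoin(2)[OF JL nc(1), folded J'_def]
    have "good J' (insert ?q \<Q>)"
      unfolding good_def
    proof (intro conjI ballI impI)
      show "finite (insert ?q \<Q>)" using Q by (simp add: good_def)
      fix q assume "q \<in> insert ?q \<Q>"
      then show "central_prime R q" "\<exists>n\<in>carrier R. n \<notin> I \<and> q = central_annihilator R I n"
        using Q qp nc by (auto simp: good_def)
    next
      fix z x assume zx: "z \<in> centre R" "x \<in> J'" "x \<notin> I" "z \<otimes> x \<in> I"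
      note zc = centreD(1)[OF zx(1)]
      obtain j r where x: "j \<in> J" "r \<in> carrier R" "x = j \<oplus> r \<otimes> n" using zx(2) by (auto simp: J'_def adjoin_def)
      have e: "z \<otimes> x = z \<otimes> j \<oplus> (z \<otimes> r) \<otimes> n" using x zc nc Jd(1) by (simp add: r_distr m_assoc)
      have zj: "z \<otimes> j \<in> J" using Jd(4) zc x by blast
      \<comment> \<open>The sum of J/I and the submodule generated by \<open>n\<close> is direct, so
        \<open>z\<close> kills both components of \<open>x\<close> separately. One of the two is
        nonzero and places \<open>z\<close> in a prime of the family.\<close>
      have "(z \<otimes> r) \<otimes> n = z \<otimes> x \<ominus> z \<otimes> j" unfolding e using x zc nc Jd(1)[OF zj] by algebra
      then have "(z \<otimes> r) \<otimes> n \<in> J" using left_ideal_minus[OF JL _ zj] zx(4) IJ by auto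
      then have zrn: "(z \<otimes> r) \<otimes> n \<in> I" using nJ zc x by simp
      have "z \<otimes> j = z \<otimes> x \<ominus> (z \<otimes> r) \<otimes> n" unfolding e using x zc nc Jd(1)[OF zj] by algebra
      then have zjI: "z \<otimes> j \<in> I" using left_ideal_minus[OF I zx(4) zrn] by simp
      show "\<exists>q\<in>insert ?q \<Q>. z \<in> q"
      proof (cases "j \<in> I")
        case False
        then show ?thesis using Q zx(1) x(1) zjI by (auto simp: good_def)
      next
        case True
        then have "r \<otimes> n \<notin> I" using zx(3) x(3) Id(3) by auto
        moreover have "z \<in> central_annihilator R I (r \<otimes> n)"
          using zrn zx(1) zc x nc by (simp add: central_annihilator_def m_assoc)
        ultimately show ?thesis using ann[OF x(2)] by auto
      qed
    qed
    then have "J' \<in> \<F>" using J'L IJ JJ' by (auto simp: \<F>_def)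
    then have "J' = J" using J(2) JJ' by blast
    moreover have "n \<in> J'" using adjoin(3)[OF JL nc(1)] by (simp add: J'_def)
    ultimately have "n \<in> I" using nJ[of \<one>] nc by simp
    then show ?thesis using nc by simp
  qed
qed

text \<open>The elements of \<open>p\<close> are zero divisors on R/I, so \<open>p\<close> lies in
  the union of finitely many associated primes. By prime avoidance it lies in one of them, which is
  the annihilator of a single element.\<close>

lemma common_annihilated_element:
  assumes I: "left_ideal R I" and p: "central_ideal R p"
    and zd: "\<And>z. z \<in> p \<Longrightarrow> \<exists>n\<in>carrier R. n \<notin> I \<and> z \<otimes> n \<in> I"
  obtains n where "n \<in> carrier R" "n \<notin> I" "\<And>z. z \<in> p \<Longrightarrow> z \<otimes> n \<in> I"
proof -
  obtain \<Q> where Q: "finite \<Q>"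
    "\<And>q. q \<in> \<Q> \<Longrightarrow> central_prime R q \<and> (\<exists>n\<in>carrier R. n \<notin> I \<and> q = central_annihilator R I n)"
    "\<And>z n. z \<in> centre R \<Longrightarrow> n \<in> carrier R \<Longrightarrow> n \<notin> I \<Longrightarrow> z \<otimes> n \<in> I \<Longrightarrow> \<exists>q\<in>\<Q>. z \<in> q"
    using finitely_many_associated_primes[OF I] by blast
  have "\<exists>q\<in>\<Q>. p \<subseteq> q"
  proof (rule ccontr)
    assume "\<not> (\<exists>q\<in>\<Q>. p \<subseteq> q)"
    then obtain x where "x \<in> p" "\<forall>q\<in>\<Q>. x \<notin> q" using prime_avoidance[OF Q(1) _ p] Q(2) by blast
    then show False using zd[of x] Q(3)[of x] central_idealD(1)[OF p] by blast
  qed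
  then obtain q where "q \<in> \<Q>" "p \<subseteq> q" by blast
  then show ?thesis using Q(2)[of q] that unfolding central_annihilator_def by blast
qed

end

section \<open>Chains of primes of the centre\<close>

text \<open>The coefficients range over a variable set \<open>C\<close>: the whole centre gives the
  spanned module, an ideal of the centre gives its product with that module, as Nakayama's lemma
  requires.\<close>

inductive_set central_span :: "('a, 'm) ring_scheme \<Rightarrow> 'a set \<Rightarrow> 'a set \<Rightarrow> 'a set"
  for R :: "('a, 'm) ring_scheme" and C G :: "'a set" where
  zero: "\<zero>\<^bsub>R\<^esub> \<in> central_span R C G"
| step: "\<lbrakk>c \<in> C; g \<in> G; y \<in> central_span R C G\<rbrakk> \<Longrightarrow> c \<otimes>\<^bsub>R\<^esub> g \<oplus>\<^bsub>R\<^esub> y \<in> central_span R C G"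

lemma central_span_least:
  assumes "\<zero>\<^bsub>R\<^esub> \<in> L" "\<And>a b. a \<in> L \<Longrightarrow> b \<in> L \<Longrightarrow> a \<oplus>\<^bsub>R\<^esub> b \<in> L"
    "\<And>c g. c \<in> C \<Longrightarrow> g \<in> G \<Longrightarrow> c \<otimes>\<^bsub>R\<^esub> g \<in> L"
  shows "central_span R C G \<subseteq> L"
proof
  fix y assume "y \<in> central_span R C G"
  then show "y \<in> L" by induction (use assms in auto)
qed

context ring
begin

lemma central_ideal_centre: "central_ideal R (centre R)"
  by (simp add: central_ideal_def centre_add centre_mult)

context
  fixes C G assumes C: "central_ideal R C" and G: "G \<subseteq> carrier R"
begin

lemma central_span_closed: "y \<in> central_span R C G \<Longrightarrow> y \<in> carrier R"
  using central_span_least[of R "carrier R" C G] centreD(1)[OF central_idealD(1)[OF C]] G by auto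

lemma central_span_add:
  "y \<in> central_span R C G \<Longrightarrow> y' \<in> central_span R C G \<Longrightarrow> y \<oplus> y' \<in> central_span R C G"
proof (induction rule: central_span.induct)
  case zero
  then show ?case using central_span_closed by simp
next
  case (step c g y)
  have "c \<otimes> g \<oplus> y \<oplus> y' = c \<otimes> g \<oplus> (y \<oplus> y')"
    using step central_span_closed centreD(1)[OF central_idealD(1)[OF C]] G by (simp add: a_assoc subset_iff)
  then show ?case using central_span.step step by metis
qed

lemma central_span_single: "c \<in> C \<Longrightarrow> g \<in> G \<Longrightarrow> c \<otimes> g \<in> central_span R C G"
  using central_span.step[OF _ _ central_span.zero, of c C g G R] centreD(1)[OF central_idealD(1)[OF C]] G
  by auto

lemma central_span_mult:
  assumes "r \<in> carrier R" "\<And>c g. c \<in> C \<Longrightarrow> g \<in> G \<Longrightarrow> r \<otimes> (c \<otimes> g) \<in> central_span R C G"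
    "y \<in> central_span R C G"
  shows "r \<otimes> y \<in> central_span R C G"
  using assms(3)
proof induction
  case zero show ?case using assms(1) central_span.zero by simp
next
  case (step c g y)
  have "r \<otimes> (c \<otimes> g \<oplus> y) = r \<otimes> (c \<otimes> g) \<oplus> r \<otimes> y"
    using step assms(1) central_span_closed centreD(1)[OF central_idealD(1)[OF C]] G by (simp add: r_distr subset_iff)
  then show ?case using central_span_add assms(2) step by simp
qed

lemma central_span_mult_right:
  assumes "r \<in> carrier R" "\<And>c g. c \<in> C \<Longrightarrow> g \<in> G \<Longrightarrow> (c \<otimes> g) \<otimes> r \<in> central_span R C G"
    "y \<in> central_span R C G"
  shows "y \<otimes> r \<in> central_span R C G"
  using assms(3)
proof induction
  case zero show ?case using assms(1) central_span.zero by simp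
next
  case (step c g y)
  have "(c \<otimes> g \<oplus> y) \<otimes> r = (c \<otimes> g) \<otimes> r \<oplus> y \<otimes> r"
    using step assms(1) central_span_closed centreD(1)[OF central_idealD(1)[OF C]] G by (simp add: l_distr subset_iff)
  then show ?case using central_span_add assms(2) step by simp
qed

lemma central_span_centre_mult:
  assumes z: "z \<in> centre R" and y: "y \<in> central_span R C G"
  shows "z \<otimes> y \<in> central_span R C G"
proof (rule central_span_mult[OF centreD(1)[OF z] _ y])
  fix c g assume cg: "c \<in> C" "g \<in> G"
  then have "z \<otimes> (c \<otimes> g) = (z \<otimes> c) \<otimes> g"
    using centreD(1)[OF z] centreD(1)[OF central_idealD(1)[OF C]] G by (simp add: m_assoc subset_iff)
  then show "z \<otimes> (c \<otimes> g) \<in> central_span R C G" using central_span_single central_idealD(4)[OF C z] cg by simp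
qed

end

lemma central_span_insertD:
  assumes C: "central_ideal R C" and G: "insert a G \<subseteq> carrier R" and y: "y \<in> central_span R C (insert a G)"
  obtains c y' where "c \<in> C" "y' \<in> central_span R C G" "y = c \<otimes> a \<oplus> y'"
proof -
  note Cc = centreD(1)[OF central_idealD(1)[OF C]]
  have G': "G \<subseteq> carrier R" "a \<in> carrier R" using G by auto
  have "\<exists>c\<in>C. \<exists>y'\<in>central_span R C G. y = c \<otimes> a \<oplus> y'"
    using y
  proof induction
    case zero
    have "\<zero> = \<zero> \<otimes> a \<oplus> \<zero>" using G' by simp
    then show ?case using central_idealD(2)[OF C] central_span.zero by blast
  next
    case (step c g y)
    then obtain e y' where e: "e \<in> C" "y' \<in> central_span R C G" "y = e \<otimes> a \<oplus> y'" by blast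
    have y'c: "y' \<in> carrier R" using central_span_closed[OF C G'(1) e(2)] .
    show ?case
    proof (cases "g = a")
      case True
      have "c \<otimes> g \<oplus> y = (c \<oplus> e) \<otimes> a \<oplus> y'"
        using True e Cc step.hyps y'c G' by (simp add: l_distr a_assoc)
      then show ?thesis using central_idealD(3)[OF C step.hyps(1) e(1)] e by blast
    next
      case False
      then have g: "g \<in> G" "g \<in> carrier R" using step.hyps G' by auto
      have "c \<otimes> g \<oplus> y = e \<otimes> a \<oplus> (c \<otimes> g \<oplus> y')"
        using e Cc step.hyps y'c G' g by (simp add: a_lcomm)
      then show ?thesis using central_span.step[OF step.hyps(1) g(1) e(2)] e(1) by blast
    qed
  qed
  then show ?thesis using that by blast
qed

text \<open>Nakayama's lemma over the localisation of the centre at \<open>m\<close>, by elimination of generators.\<close>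

lemma central_nakayama:
  assumes m: "central_prime R m" and C: "central_ideal R C" "C \<subseteq> m" and I: "left_ideal R I"
    and "finite G" "G \<subseteq> carrier R" "z \<in> centre R" "z \<notin> m"
    and "\<And>a. a \<in> G \<Longrightarrow> \<exists>y\<in>central_span R C G. z \<otimes> a \<ominus> y \<in> I"
  obtains w where "w \<in> centre R" "w \<notin> m" "\<And>a. a \<in> G \<Longrightarrow> w \<otimes> a \<in> I"
proof -
  note Id = left_idealD[OF I] and md = central_primeD[OF m]
  note Cc = centreD(1)[OF central_idealD(1)[OF C(1)]]
  have "\<exists>w\<in>centre R. w \<notin> m \<and> (\<forall>a\<in>G. w \<otimes> a \<in> I)"
    using assms(5-)
  proof (induction arbitrary: z rule: finite_induct)
    case empty
    then show ?case using centre_one md(2) by blast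
  next
    case (insert a G)
    have G: "G \<subseteq> carrier R" "a \<in> carrier R" using insert.prems by auto
    note sc = central_span_closed[OF C(1) G(1)]
    note zc = centreD(1)[OF insert.prems(2)]
    obtain y where y: "y \<in> central_span R C (insert a G)" "z \<otimes> a \<ominus> y \<in> I" using insert.prems by blast
    obtain c y' where c: "c \<in> C" "y' \<in> central_span R C G" "y = c \<otimes> a \<oplus> y'"
      using central_span_insertD[OF C(1) insert.prems(1) y(1)] .
    \<comment> \<open>The coefficient \<open>c\<close> of \<open>a\<close> lies in \<open>m\<close>
      and is moved to the other side, so the new coefficient is still outside \<open>m\<close>. Thus
      \<open>u a\<close> is congruent to a combination of the remaining generators.\<close>
    define u where "u = z \<ominus> c"
    have uc: "u \<in> centre R"
      unfolding u_def a_minus_def using insert.prems(2) central_idealD(1)[OF C(1) c(1)] centre_add centre_uminus by simp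
    note uc' = centreD(1)[OF uc]
    have um: "u \<notin> m"
    proof
      assume "u \<in> m"
      then have "u \<oplus> c \<in> m" using central_idealD(3)[OF md(1)] c(1) C(2) by blast
      moreover have "u \<oplus> c = z" unfolding u_def using zc Cc[OF c(1)] by algebra
      ultimately show False using insert.prems by simp
    qed
    have y'c: "y' \<in> carrier R" by (rule sc[OF c(2)])
    have ua: "u \<otimes> a \<ominus> y' \<in> I"
    proof -
      have "u \<otimes> a \<ominus> y' = z \<otimes> a \<ominus> y" unfolding u_def c(3) using zc Cc[OF c(1)] G y'c by algebra
      then show ?thesis using y by simp
    qed
    \<comment> \<open>Multiplying the relation for \<open>b\<close> by \<open>u\<close> allows the
      occurrence of \<open>a\<close> in it to be replaced through the relation for
      \<open>u a\<close>.\<close>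
    have step: "\<exists>v\<in>central_span R C G. (u \<otimes> z) \<otimes> b \<ominus> v \<in> I" if b: "b \<in> G" for b
    proof -
      have bc: "b \<in> carrier R" using b G by auto
      obtain v where v: "v \<in> central_span R C (insert a G)" "z \<otimes> b \<ominus> v \<in> I" using insert.prems(4) b by blast
      obtain e v' where e: "e \<in> C" "v' \<in> central_span R C G" "v = e \<otimes> a \<oplus> v'"
        using central_span_insertD[OF C(1) insert.prems(1) v(1)] .
      note ec = Cc[OF e(1)] and v'c = sc[OF e(2)]
      have "e \<otimes> y' \<oplus> u \<otimes> v' \<in> central_span R C G"
        by (intro central_span_add[OF C(1) G(1)] central_span_centre_mult[OF C(1) G(1)]
            central_idealD(1)[OF C(1)] uc e c)
      moreover have "(u \<otimes> z) \<otimes> b \<ominus> (e \<otimes> y' \<oplus> u \<otimes> v') \<in> I"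
      proof -
        have 1: "u \<otimes> (z \<otimes> b \<ominus> v) \<in> I" using Id(4)[OF uc' v(2)] .
        have 2: "e \<otimes> (u \<otimes> a \<ominus> y') \<in> I" using Id(4)[OF ec ua] .
        have "u \<otimes> (e \<otimes> a) = e \<otimes> (u \<otimes> a)"
          using central_lcomm[OF central_idealD(1)[OF C(1) e(1)] uc' G(2)] .
        moreover have "u \<otimes> (z \<otimes> b \<ominus> v) = (u \<otimes> z) \<otimes> b \<ominus> (u \<otimes> (e \<otimes> a) \<oplus> u \<otimes> v')"
          unfolding e(3) using uc' zc bc ec v'c G by algebra
        moreover have "e \<otimes> (u \<otimes> a \<ominus> y') = e \<otimes> (u \<otimes> a) \<ominus> e \<otimes> y'" using ec uc' G y'c by algebra
        moreover have "((u \<otimes> z) \<otimes> b \<ominus> (e \<otimes> (u \<otimes> a) \<oplus> u \<otimes> v')) \<oplus> (e \<otimes> (u \<otimes> a) \<ominus> e \<otimes> y') =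
            (u \<otimes> z) \<otimes> b \<ominus> (e \<otimes> y' \<oplus> u \<otimes> v')"
          using uc' zc bc ec v'c G y'c by algebra
        ultimately show ?thesis using Id(3)[OF 1 2] by simp
      qed
      ultimately show ?thesis by blast
    qed
    have "u \<otimes> z \<notin> m" using md(3)[OF uc insert.prems(2)] um insert.prems(3) by blast
    then obtain w where w: "w \<in> centre R" "w \<notin> m" "\<And>b. b \<in> G \<Longrightarrow> w \<otimes> b \<in> I"
      using insert.IH[OF G(1) centre_mult[OF uc insert.prems(2)] _ step] by blast
    note wc = centreD(1)[OF w(1)]
    have wy: "w \<otimes> v \<in> I" if "v \<in> central_span R C G" for v
      using that
    proof induction
      case zero show ?case using wc Id(2) by simp
    next
      case (step c g v)
      then have gc: "g \<in> carrier R" "c \<in> carrier R" "v \<in> carrier R" using G Cc sc by auto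
      have "w \<otimes> (c \<otimes> g \<oplus> v) = c \<otimes> (w \<otimes> g) \<oplus> w \<otimes> v"
        using central_lcomm[OF w(1) gc(2,1)] gc wc by (simp add: r_distr)
      then show ?case using Id(3,4) w(3) step gc by simp
    qed
    \<comment> \<open>By induction \<open>w\<close> kills the remaining generators, hence also
      \<open>y'\<close>; therefore \<open>w u\<close> kills \<open>a\<close> as well.\<close>
    have "w \<otimes> u \<notin> m" using md(3)[OF w(1) uc] um w(2) by blast
    moreover have "(w \<otimes> u) \<otimes> b \<in> I" if "b \<in> insert a G" for b
    proof (cases "b = a")
      case True
      have "w \<otimes> (u \<otimes> a \<ominus> y') \<in> I" using Id(4)[OF wc ua] .
      moreover have "w \<otimes> (u \<otimes> a \<ominus> y') = (w \<otimes> u) \<otimes> a \<ominus> w \<otimes> y'" using wc uc' G y'c by algebra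
      ultimately have "(w \<otimes> u) \<otimes> a \<ominus> w \<otimes> y' \<in> I" by simp
      then show ?thesis using left_ideal_cancel[OF I, of "(w \<otimes> u) \<otimes> a" "w \<otimes> y'"] wy[OF c(2)] True wc uc' G y'c by simp
    next
      case False
      then have b: "b \<in> G" "b \<in> carrier R" using that G by auto
      have "(w \<otimes> u) \<otimes> b = u \<otimes> (w \<otimes> b)" using central_lcomm[OF w(1) uc' b(2)] wc uc' b centreD(2)[OF w(1) uc'] by (simp add: m_assoc)
      then show ?thesis using Id(4)[OF uc' w(3)[OF b(1)]] by simp
    qed
    ultimately show ?case using centre_mult[OF w(1) uc] by blast
  qed
  then show ?thesis using that by blast
qed

text \<open>An ideal maximal among those that avoid \<open>S\<close> is prime. The maximality is
  exported because \<open>S = {\<one>}\<close> then yields maximal ideals of the centre.\<close>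

lemma prime_disjoint_from_multiplicative:
  assumes C: "central_ideal R C" and S: "S \<subseteq> centre R" "\<one> \<in> S" "\<And>a b. a \<in> S \<Longrightarrow> b \<in> S \<Longrightarrow> a \<otimes> b \<in> S"
    and disj: "C \<inter> S = {}"
  obtains d where "central_prime R d" "C \<subseteq> d" "d \<inter> S = {}"
    "\<And>D. central_ideal R D \<Longrightarrow> d \<subseteq> D \<Longrightarrow> D \<inter> S = {} \<Longrightarrow> D = d"
proof -
  define \<F> where "\<F> = {D. central_ideal R D \<and> C \<subseteq> D \<and> D \<inter> S = {}}"
  have "\<exists>d\<in>\<F>. \<forall>D\<in>\<F>. d \<subseteq> D \<longrightarrow> D = d"
  proof (rule subset_Zorn_nonempty)
    show "\<F> \<noteq> {}" using C disj by (auto simp: \<F>_def)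
    fix \<C> assume ch: "\<C> \<noteq> {}" "subset.chain \<F> \<C>"
    then have sub: "\<And>D. D \<in> \<C> \<Longrightarrow> D \<in> \<F>" by (auto simp: subset.chain_def)
    have "central_ideal R (\<Union>\<C>)"
      unfolding central_ideal_def
    proof (intro conjI ballI)
      show "\<Union>\<C> \<subseteq> centre R" using sub by (auto simp: \<F>_def dest: central_idealD(1))
      obtain A where "A \<in> \<C>" using ch(1) by blast
      moreover from this have "central_ideal R A" using sub by (simp add: \<F>_def)
      ultimately show "\<zero> \<in> \<Union>\<C>" using central_idealD(2) by blast
    next
      fix a assume "a \<in> \<Union>\<C>"
      then obtain A where A: "A \<in> \<C>" "a \<in> A" by blast
      { fix b assume "b \<in> \<Union>\<C>"
        then obtain B where B: "B \<in> \<C>" "b \<in> B" by blast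
        have "A \<subseteq> B \<or> B \<subseteq> A" using ch(2) A B by (auto simp: subset.chain_def)
        then obtain D where D: "D \<in> \<C>" "a \<in> D" "b \<in> D" using A B by blast
        then have "a \<oplus> b \<in> D" using sub[OF D(1)] central_idealD(3)[of R D a b] by (simp add: \<F>_def)
        then show "a \<oplus> b \<in> \<Union>\<C>" using D by blast
      next
        fix z assume "z \<in> centre R"
        then have "z \<otimes> a \<in> A" using sub[OF A(1)] central_idealD(4)[of R A z a] A by (simp add: \<F>_def)
        then show "z \<otimes> a \<in> \<Union>\<C>" using A by blast }
    qed
    then show "\<Union>\<C> \<in> \<F>" using ch(1) sub by (auto simp: \<F>_def)
  qed
  then obtain d where d: "d \<in> \<F>" "\<And>D. D \<in> \<F> \<Longrightarrow> d \<subseteq> D \<Longrightarrow> D = d" by blast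
  have di: "central_ideal R d" and Cd: "C \<subseteq> d" and dS: "d \<inter> S = {}" using d(1) by (auto simp: \<F>_def)
  note dd = central_idealD[OF di]
  \<comment> \<open>Adjoining \<open>a\<close> enlarges \<open>d\<close>, so by maximality the
    result meets \<open>S\<close>. Two such elements for \<open>a\<close> and \<open>b\<close>
    multiply into \<open>d\<close> when \<open>a b\<close> is in \<open>d\<close>.\<close>
  have meet: "\<exists>s\<in>S. \<exists>e\<in>d. \<exists>z\<in>centre R. s = e \<oplus> z \<otimes> a" if a: "a \<in> centre R" "a \<notin> d" for a
  proof -
    note ac = centreD(1)[OF a(1)]
    let ?D = "{e \<oplus> z \<otimes> a | e z. e \<in> d \<and> z \<in> centre R}"
    have cc: "e \<in> d \<Longrightarrow> e \<in> carrier R" "z \<in> centre R \<Longrightarrow> z \<in> carrier R" for e z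
      using centreD(1)[OF dd(1)] centreD(1)[of z R] by auto
    have "central_ideal R ?D"
      unfolding central_ideal_def
    proof (intro conjI ballI)
      show "?D \<subseteq> centre R" using dd(1) a centre_add centre_mult by auto
      have "\<zero> = \<zero> \<oplus> \<zero> \<otimes> a" using ac by simp
      then show "\<zero> \<in> ?D" using dd(2) centre_zero by blast
      fix x assume "x \<in> ?D"
      then obtain e z where x: "e \<in> d" "z \<in> centre R" "x = e \<oplus> z \<otimes> a" by blast
      { fix y assume "y \<in> ?D"
        then obtain e' z' where y: "e' \<in> d" "z' \<in> centre R" "y = e' \<oplus> z' \<otimes> a" by blast
        have "x \<oplus> y = (e \<oplus> e') \<oplus> (z \<oplus> z') \<otimes> a" using x y ac cc by (simp add: l_distr a_ac)
        then show "x \<oplus> y \<in> ?D" using dd(3)[OF x(1) y(1)] centre_add[OF x(2) y(2)] by blast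
      next
        fix w assume w: "w \<in> centre R"
        have "w \<otimes> x = w \<otimes> e \<oplus> (w \<otimes> z) \<otimes> a" using x w ac cc by (simp add: r_distr m_assoc)
        then show "w \<otimes> x \<in> ?D" using dd(4)[OF w x(1)] centre_mult[OF w x(2)] by blast }
    qed
    moreover have "d \<subseteq> ?D"
    proof
      fix e assume e: "e \<in> d"
      then have "e = e \<oplus> \<zero> \<otimes> a" using ac cc by simp
      then show "e \<in> ?D" using e centre_zero by blast
    qed
    moreover have "a \<in> ?D"
    proof -
      have "a = \<zero> \<oplus> \<one> \<otimes> a" using ac by simp
      then show ?thesis using dd(2) centre_one by blast
    qed
    ultimately have "?D \<notin> \<F>" using d(2)[of ?D] a(2) by blast
    then have "?D \<inter> S \<noteq> {}" using \<open>central_ideal R ?D\<close> \<open>d \<subseteq> ?D\<close> Cd unfolding \<F>_def by blast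
    then show ?thesis by blast
  qed
  have "a \<in> d \<or> b \<in> d" if ab: "a \<in> centre R" "b \<in> centre R" "a \<otimes> b \<in> d" for a b
  proof (rule ccontr)
    assume "\<not> (a \<in> d \<or> b \<in> d)"
    then obtain s e z t f w where s: "s \<in> S" "e \<in> d" "z \<in> centre R" "s = e \<oplus> z \<otimes> a"
      and t: "t \<in> S" "f \<in> d" "w \<in> centre R" "t = f \<oplus> w \<otimes> b"
      using meet[OF ab(1)] meet[OF ab(2)] by metis
    have tc: "t \<in> centre R" using t S by auto
    have za: "z \<otimes> a \<in> centre R" and wb: "w \<otimes> b \<in> centre R" using centre_mult s t ab by auto
    note c = centreD(1)[OF ab(1)] centreD(1)[OF ab(2)] centreD(1)[OF s(3)] centreD(1)[OF t(3)]
      centreD(1)[OF dd(1)[OF s(2)]] centreD(1)[OF dd(1)[OF t(2)]] centreD(1)[OF tc]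
    have "s \<otimes> t = e \<otimes> t \<oplus> (z \<otimes> a) \<otimes> t" unfolding s(4) using c by (simp add: l_distr)
    also have "(z \<otimes> a) \<otimes> t = (z \<otimes> a) \<otimes> f \<oplus> (z \<otimes> a) \<otimes> (w \<otimes> b)" unfolding t(4) using c by (simp add: r_distr)
    also have "(z \<otimes> a) \<otimes> (w \<otimes> b) = (z \<otimes> w) \<otimes> (a \<otimes> b)"
      using c central_lcomm[OF t(3) c(1,2)] by (simp add: m_assoc)
    finally have "s \<otimes> t = e \<otimes> t \<oplus> ((z \<otimes> a) \<otimes> f \<oplus> (z \<otimes> w) \<otimes> (a \<otimes> b))" .
    moreover have "e \<otimes> t \<in> d" by (rule central_ideal_mult_right[OF di s(2) tc])
    moreover have "(z \<otimes> a) \<otimes> f \<in> d" by (rule dd(4)[OF za t(2)])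
    moreover have "(z \<otimes> w) \<otimes> (a \<otimes> b) \<in> d" by (rule dd(4)[OF centre_mult[OF s(3) t(3)] ab(3)])
    ultimately have "s \<otimes> t \<in> d" using dd(3) by simp
    then show False using S(3)[OF s(1) t(1)] dS by blast
  qed
  then have "central_prime R d" using di dS S(2) by (auto simp: central_prime_def)
  then show ?thesis
  proof (rule that[OF _ Cd dS])
    fix D assume "central_ideal R D" "d \<subseteq> D" "D \<inter> S = {}"
    then show "D = d" using Cd by (intro d(2)) (auto simp: \<F>_def)
  qed
qed

text \<open>A prime over \<open>I \<inter> centre R\<close> is chosen to avoid all products of a
  power of \<open>x\<close> with an element outside \<open>q\<close>. Avoiding the latter puts it
  inside \<open>q\<close>, avoiding \<open>x\<close> makes it smaller. Such products are outside
  \<open>I\<close>, as \<open>x\<close> is regular modulo \<open>I\<close> and \<open>q\<close>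
  contains \<open>I \<inter> centre R\<close>.\<close>

lemma smaller_central_prime:
  assumes I: "left_ideal R I" and x: "x \<in> centre R" and reg: "\<And>r. r \<in> carrier R \<Longrightarrow> x \<otimes> r \<in> I \<Longrightarrow> r \<in> I"
    and q: "central_prime R q" "x \<in> q" "I \<inter> centre R \<subseteq> q"
  obtains d where "central_prime R d" "d \<subset> q" "I \<inter> centre R \<subseteq> d"
proof -
  note xc = centreD(1)[OF x] and qd = central_primeD[OF q(1)]
  define S where "S = {x [^] i \<otimes> s | (i::nat) s. s \<in> centre R \<and> s \<notin> q}"
  have pc: "x [^] i \<in> centre R" for i :: nat
    by (induction i) (use x in \<open>auto simp: centre_mult\<close>)
  note pcc = centreD(1)[OF pc]
  have dist: "r \<in> I" if "x [^] i \<otimes> r \<in> I" "r \<in> carrier R" for i :: nat and r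
    using that
  proof (induction i arbitrary: r)
    case (Suc i)
    have "x [^] i \<otimes> (x \<otimes> r) \<in> I" using Suc.prems xc pcc by (simp add: m_assoc)
    then show ?case using Suc.IH[of "x \<otimes> r"] reg[of r] Suc.prems xc by simp
  qed simp
  obtain d where d: "central_prime R d" "I \<inter> centre R \<subseteq> d" "d \<inter> S = {}"
  proof (rule prime_disjoint_from_multiplicative[OF central_ideal_Int_centre[OF I], of S])
    show "S \<subseteq> centre R" using pc centre_mult by (auto simp: S_def)
    have "\<one> = x [^] (0::nat) \<otimes> \<one>" by simp
    then show "\<one> \<in> S" unfolding S_def using centre_one qd(2) by blast
    fix a b assume "a \<in> S" "b \<in> S"
    then obtain i j :: nat and s t where ab: "a = x [^] i \<otimes> s" "b = x [^] j \<otimes> t" "s \<in> centre R" "s \<notin> q" "t \<in> centre R" "t \<notin> q"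
      by (auto simp: S_def)
    have "a \<otimes> b = x [^] (i + j) \<otimes> (s \<otimes> t)"
    proof -
      note c = centreD(1)[OF ab(3)] centreD(1)[OF ab(5)]
      have "s \<otimes> (x [^] j \<otimes> t) = x [^] j \<otimes> (s \<otimes> t)" by (rule central_lcomm[OF pc c])
      then show ?thesis using c pcc xc by (simp add: ab m_assoc nat_pow_mult[symmetric])
    qed
    moreover have "s \<otimes> t \<notin> q" using qd(3)[OF ab(3,5)] ab by blast
    ultimately show "a \<otimes> b \<in> S" unfolding S_def using centre_mult ab by blast
  next
    show "I \<inter> centre R \<inter> S = {}"
    proof -
      have False if aI: "a \<in> I" and aS: "a \<in> S" for a
      proof -
        obtain i :: nat and s where s: "a = x [^] i \<otimes> s" "s \<in> centre R" "s \<notin> q" using aS unfolding S_def by blast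
        then have "s \<in> I" using dist[of i s] aI centreD(1)[OF s(2)] by simp
        then show False using s q(3) by blast
      qed
      then show ?thesis by blast
    qed
  qed blast
  note di = central_idealD[OF central_primeD(1)[OF d(1)]]
  have "d \<subseteq> q"
  proof
    fix w assume w: "w \<in> d"
    show "w \<in> q"
    proof (rule ccontr)
      assume "w \<notin> q"
      moreover have "w = x [^] (0::nat) \<otimes> w" using centreD(1)[OF di(1)[OF w]] by simp
      ultimately have "w \<in> S" unfolding S_def using di(1)[OF w] by blast
      then show False using d(3) w by blast
    qed
  qed
  moreover have "x \<in> S"
  proof -
    have "x = x [^] (1::nat) \<otimes> \<one>" using xc by simp
    then show ?thesis unfolding S_def using centre_one qd(2) by blast
  qed
  ultimately show ?thesis using that d q(2) by blast
qed

text \<open>The tail of the sequence provides primes over \<open>I + xR\<close>, all of which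
  contain \<open>x\<close>; below the smallest of them the first term \<open>x\<close> provides one
  more.\<close>

lemma prime_chain_below:
  assumes "left_ideal R I" "regular_sequence R I xs" "central_prime R q" "seq_ideal R I xs \<inter> centre R \<subseteq> q"
  shows "\<exists>ds. length ds = length xs \<and> sorted_wrt (\<subset>) ds \<and>
    (\<forall>d\<in>set ds. central_prime R d \<and> d \<subset> q \<and> I \<inter> centre R \<subseteq> d)"
  using assms
proof (induction xs arbitrary: I)
  case (Cons x xs)
  let ?J = "add_multiples R I x"
  have x: "x \<in> centre R" and reg: "\<And>r. r \<in> carrier R \<Longrightarrow> x \<otimes> r \<in> I \<Longrightarrow> r \<in> I" using Cons.prems(2) by auto
  have J: "left_ideal R ?J" by (rule left_ideal_add_multiples[OF Cons.prems(1) x])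
  have IJ: "I \<subseteq> ?J" using add_multiplesI1[OF Cons.prems(1) centreD(1)[OF x]] by auto
  have xJ: "x \<in> ?J" using add_multiplesI2[OF Cons.prems(1) centreD(1)[OF x] one_closed] centreD(1)[OF x] by simp
  obtain ds where ds: "length ds = length xs" "sorted_wrt (\<subset>) ds"
    "\<forall>d\<in>set ds. central_prime R d \<and> d \<subset> q \<and> ?J \<inter> centre R \<subseteq> d"
    using Cons.IH[OF J] Cons.prems by auto
  have Jq: "?J \<inter> centre R \<subseteq> q"
    using seq_ideal_superset[OF J, of xs] regular_sequence_centre[of R ?J xs] Cons.prems by auto
  \<comment> \<open>The smallest prime of the chain for the tail; if the tail is empty,
    \<open>q\<close> itself takes its place.\<close>
  define e where "e = (case ds of [] \<Rightarrow> q | d # _ \<Rightarrow> d)"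
  have e: "central_prime R e \<and> ?J \<inter> centre R \<subseteq> e \<and> e \<subseteq> q \<and> (\<forall>d\<in>set ds. e \<subseteq> d)"
  proof (cases ds)
    case Nil
    then show ?thesis using Cons.prems(3) Jq by (simp add: e_def)
  next
    case (Cons a as)
    have "a \<in> set ds" using Cons by simp
    moreover have "\<forall>d\<in>set as. a \<subset> d" using ds(2) Cons by simp
    ultimately show ?thesis using ds(3) Cons by (simp add: e_def psubset_imp_subset)
  qed
  have ep: "central_prime R e" and xe: "x \<in> e" and Ie: "I \<inter> centre R \<subseteq> e"
    using e xJ x IJ by auto
  obtain d where d: "central_prime R d" "d \<subset> e" "I \<inter> centre R \<subseteq> d"
    by (rule smaller_central_prime[OF Cons.prems(1) x reg ep xe Ie])
  have "length (d # ds) = length (x # xs) \<and> sorted_wrt (\<subset>) (d # ds) \<and>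
    (\<forall>d\<in>set (d # ds). central_prime R d \<and> d \<subset> q \<and> I \<inter> centre R \<subseteq> d)"
  proof (intro conjI ballI)
    show "length (d # ds) = length (x # xs)" using ds(1) by simp
    show "sorted_wrt (\<subset>) (d # ds)" using ds(2) e d(2) by (simp add: psubset_subset_trans)
    fix c assume "c \<in> set (d # ds)"
    then have c: "c = d \<or> c \<in> set ds" by simp
    show "central_prime R c" using c d(1) ds(3) by blast
    show "c \<subset> q" using c d(2) ds(3) e by blast
    show "I \<inter> centre R \<subseteq> c" using c d(3) ds(3) IJ by blast
  qed
  then show ?case by blast
qed simp

end

section \<open>Comparison of the two forms of central sequences\<close>

lemma (in ring) sum_xR_closed: "set xs \<subseteq> carrier R \<Longrightarrow> sum_xR R xs \<subseteq> carrier R"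
  by (induction xs) auto

lemma (in ring) seq_ideal_sum_xR:
  assumes "left_ideal R I" "set xs \<subseteq> centre R"
  shows "seq_ideal R I xs = {i \<oplus> y | i y. i \<in> I \<and> y \<in> sum_xR R xs}"
  using assms
proof (induction xs arbitrary: I)
  case Nil
  show ?case using left_idealD(1)[OF Nil(1)] by force
next
  case (Cons x xs)
  note Ic = left_idealD(1)[OF Cons.prems(1)]
  have x: "x \<in> centre R" and xs: "set xs \<subseteq> centre R" using Cons.prems by auto
  note xc = centreD(1)[OF x]
  have sc: "y \<in> carrier R" if "y \<in> sum_xR R xs" for y
    using sum_xR_closed[of xs] xs centre_subset that by blast
  have "seq_ideal R I (x # xs) = {i \<oplus> y | i y. i \<in> add_multiples R I x \<and> y \<in> sum_xR R xs}"
    using Cons.IH[OF left_ideal_add_multiples[OF Cons.prems(1) x] xs] by simp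
  also have "\<dots> = {i \<oplus> y | i y. i \<in> I \<and> y \<in> sum_xR R (x # xs)}" (is "?A = ?B")
  proof (intro equalityI subsetI)
    fix w assume "w \<in> ?A"
    then obtain i r y where w: "i \<in> I" "r \<in> carrier R" "y \<in> sum_xR R xs" "w = (i \<oplus> x \<otimes> r) \<oplus> y"
      unfolding add_multiples_def by blast
    have "w = i \<oplus> (x \<otimes> r \<oplus> y)" using w xc Ic sc by (simp add: a_assoc)
    moreover have "x \<otimes> r \<oplus> y \<in> sum_xR R (x # xs)" using w by auto
    ultimately show "w \<in> ?B" using w(1) by blast
  next
    fix w assume "w \<in> ?B"
    then obtain i r y where w: "i \<in> I" "r \<in> carrier R" "y \<in> sum_xR R xs" "w = i \<oplus> (x \<otimes> r \<oplus> y)"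
      by auto
    have "w = (i \<oplus> x \<otimes> r) \<oplus> y" using w xc Ic sc by (simp add: a_assoc)
    moreover have "i \<oplus> x \<otimes> r \<in> add_multiples R I x" using w unfolding add_multiples_def by blast
    ultimately show "w \<in> ?A" using w(3) by blast
  qed
  finally show ?case .
qed

context ring
begin

lemma seq_ideal_eq_sum_xR:
  assumes "set xs \<subseteq> centre R" shows "seq_ideal R {\<zero>} xs = sum_xR R xs"
proof -
  have "left_ideal R {\<zero>}" by (simp add: left_ideal_def)
  moreover have "sum_xR R xs \<subseteq> carrier R" using sum_xR_closed assms centre_subset by blast
  ultimately show ?thesis using seq_ideal_sum_xR[of "{\<zero>}" xs] assms by force
qed

lemma centre_sequence_iff:
  "centre_sequence R xs \<longleftrightarrow> regular_sequence R {\<zero>} xs \<and> seq_ideal R {\<zero>} xs \<noteq> carrier R"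
proof -
  have reg: "set xs \<subseteq> centre R \<and> (\<forall>i<length xs. \<forall>r\<in>carrier R.
        xs ! i \<otimes> r \<in> sum_xR R (take i xs) \<longrightarrow> r \<in> sum_xR R (take i xs)) \<longleftrightarrow> regular_sequence R {\<zero>} xs"
  \<comment> \<open>From the end: appending a term adds one index to the condition of
    \<open>centre_sequence\<close> and leaves the initial segments unchanged.\<close>
  proof (induction xs rule: rev_induct)
    case (snoc x xs)
    show ?case
    proof (cases "set xs \<subseteq> centre R")
      case True
      have "regular_sequence R {\<zero>} (xs @ [x]) \<longleftrightarrow> regular_sequence R {\<zero>} xs \<and> x \<in> centre R \<and>
        (\<forall>r\<in>carrier R. x \<otimes> r \<in> sum_xR R xs \<longrightarrow> r \<in> sum_xR R xs)"
        by (simp add: regular_sequence_append seq_ideal_eq_sum_xR[OF True])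
      then show ?thesis
        unfolding snoc[symmetric] using True by (auto simp: less_Suc_eq nth_append)
    next
      case False
      then show ?thesis using regular_sequence_centre[of R "{\<zero>}" "xs @ [x]"] by auto
    qed
  qed simp
  show ?thesis
    unfolding centre_sequence_def reg[symmetric] using seq_ideal_eq_sum_xR by auto
qed

lemma seq_ideal_subset:
  assumes J: "left_ideal R J" and "I \<subseteq> J" "set xs \<subseteq> J" "set xs \<subseteq> centre R"
  shows "seq_ideal R I xs \<subseteq> J"
  using assms(2-)
proof (induction xs arbitrary: I)
  case (Cons x xs)
  have x: "x \<in> J" "x \<in> centre R" using Cons.prems by auto
  have "add_multiples R I x \<subseteq> J"
  proof
    fix w assume "w \<in> add_multiples R I x"
    then obtain i r where w: "i \<in> I" "r \<in> carrier R" "w = i \<oplus> x \<otimes> r" by (auto simp: add_multiples_def)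
    have "x \<otimes> r = r \<otimes> x" by (rule centreD(2)[OF x(2) w(2)])
    then show "w \<in> J" using left_idealD(3,4)[OF J] w Cons.prems(1) x by auto
  qed
  then show ?case using Cons.IH Cons.prems by auto
qed simp

lemma left_ideal_trivial: "left_ideal R {\<zero>}"
  by (simp add: left_ideal_def)

lemma left_ideal_one: "left_ideal R J \<Longrightarrow> \<one> \<in> J \<longleftrightarrow> J = carrier R"
  using left_idealD(1,4)[of R J] by (auto, metis r_one)

end

definition maximal_regular_sequence :: "('a, 'm) ring_scheme \<Rightarrow> 'a set \<Rightarrow> 'a list \<Rightarrow> bool" where
  "maximal_regular_sequence R p xs \<longleftrightarrow> regular_sequence R {\<zero>\<^bsub>R\<^esub>} xs \<and> set xs \<subseteq> p \<and>
     (\<forall>x\<in>p. \<exists>r\<in>carrier R. r \<notin> seq_ideal R {\<zero>\<^bsub>R\<^esub>} xs \<and> x \<otimes>\<^bsub>R\<^esub> r \<in> seq_ideal R {\<zero>\<^bsub>R\<^esub>} xs)"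

text \<open>Sequences in \<open>p\<close> generate an ideal inside the proper left ideal
  \<open>J\<close>, so they are proper. Hence an extension by \<open>x\<close> fails exactly when
  \<open>x\<close> is a zero divisor modulo the sequence.\<close>

lemma (in ring) maximal_centre_sequence_iff:
  assumes p: "central_ideal R p" and J: "left_ideal R J" "p \<subseteq> J" "\<one> \<notin> J"
  shows "maximal_centre_sequence R p xs \<longleftrightarrow> maximal_regular_sequence R p xs"
proof -
  have proper: "seq_ideal R {\<zero>} ys \<noteq> carrier R" if "set ys \<subseteq> p" for ys
  proof -
    have "seq_ideal R {\<zero>} ys \<subseteq> J"
      by (rule seq_ideal_subset[OF J(1)]) (use that J left_idealD(2)[OF J(1)] central_idealD(1)[OF p] in auto)
    then show ?thesis using J(3) by auto
  qed
  have "centre_sequence R ys \<longleftrightarrow> regular_sequence R {\<zero>} ys" if "set ys \<subseteq> p" for ys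
    using centre_sequence_iff proper[OF that] by blast
  then have "maximal_centre_sequence R p xs \<longleftrightarrow> regular_sequence R {\<zero>} xs \<and> set xs \<subseteq> p \<and>
     (\<forall>x\<in>p. \<not> regular_sequence R {\<zero>} (xs @ [x]))"
    unfolding maximal_centre_sequence_def by auto
  then show ?thesis
    unfolding maximal_regular_sequence_def using central_idealD(1)[OF p]
    by (auto simp: regular_sequence_append)
qed

text \<open>The part of the Macaulay condition that is used: the grade of a maximal ideal of the centre bounds
  the lengths of chains of primes below it.\<close>

definition central_chains_bounded :: "('a, 'm) ring_scheme \<Rightarrow> bool" where
  "central_chains_bounded R \<longleftrightarrow> (\<forall>m cs. central_prime R m \<longrightarrow>
     (\<forall>D. central_ideal R D \<longrightarrow> m \<subseteq> D \<longrightarrow> \<one>\<^bsub>R\<^esub> \<notin> D \<longrightarrow> D = m) \<longrightarrow>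
     sorted_wrt (\<subset>) cs \<longrightarrow> (\<forall>c\<in>set cs. central_prime R c \<and> c \<subseteq> m) \<longrightarrow>
     length cs \<le> Suc (centre_grade m R))"

lemma (in ring) exists_maximal_central_ideal:
  assumes "central_ideal R C" "\<one> \<notin> C"
  obtains m where "central_prime R m" "C \<subseteq> m" "\<And>D. central_ideal R D \<Longrightarrow> m \<subseteq> D \<Longrightarrow> \<one> \<notin> D \<Longrightarrow> D = m"
proof (rule prime_disjoint_from_multiplicative[OF assms(1), of "{\<one>}"])
  show "C \<inter> {\<one>} = {}" using assms(2) by auto
  fix d assume d: "central_prime R d" "C \<subseteq> d"
    "\<And>D. central_ideal R D \<Longrightarrow> d \<subseteq> D \<Longrightarrow> D \<inter> {\<one>} = {} \<Longrightarrow> D = d"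
  have "D = d" if "central_ideal R D" "d \<subseteq> D" "\<one> \<notin> D" for D using d(3) that by auto
  then show thesis by (rule that[OF d(1,2)])
qed auto

section \<open>Generators over the centre and ideals extended from it\<close>

context central_finite
begin

lemma central_generators:
  obtains G where "finite G" "G \<subseteq> carrier R" "carrier R = central_span R (centre R) G"
proof -
  note C = central_ideal_centre
  interpret Z: ring "centre_ring R" by (rule centre_ring_ring)
  have ops: "carrier (centre_ring R) = centre R" "add (centre_ring R) = add R" "mult (centre_ring R) = mult R"
    "one (centre_ring R) = \<one>" "carrier (reg_module R) = carrier R" "add (reg_module R) = add R"
    "smult (reg_module R) = mult R" "zero (reg_module R) = \<zero>"
    by (simp_all add: centre_ring_def reg_module_def)
  interpret N: left_module R "reg_module R" by (rule reg_module_left_module) unfold_locales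
  have L: "left_module (centre_ring R) (reg_module R)"
    by (rule left_moduleI[OF Z.ring_axioms N.M.abelian_group_axioms])
      (auto simp: ops centreD(1) l_distr r_distr m_assoc)
  obtain A where A: "A \<subseteq> carrier R" "finite A" "module_span (centre_ring R) (reg_module R) A = carrier R"
    using fin by (auto simp: finite_over_centre_def finitely_generated_def ops)
  have "submodule (central_span R (centre R) A) (centre_ring R) (reg_module R)"
    by (rule submodule_of_left_moduleI[OF L], unfold ops)
      (use central_span_closed[OF C A(1)] central_span.zero central_span_add[OF C A(1)]
        central_span_centre_mult[OF C A(1)] in auto)
  moreover have "A \<subseteq> central_span R (centre R) A"
    using central_span_single[OF C A(1) centre_one] A(1) by (metis l_one subset_iff)
  ultimately have "carrier R \<subseteq> central_span R (centre R) A" using A(3) unfolding module_span_def by blast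
  then show ?thesis using that[OF A(2,1)] central_span_closed[OF C A(1)] by blast
qed

text \<open>A fixed choice of generators, so that \<open>extension\<close> depends on the ideal
  alone.\<close>

definition gens where "gens = (SOME G. finite G \<and> G \<subseteq> carrier R \<and> carrier R = central_span R (centre R) G)"

lemma gens: "finite gens" "gens \<subseteq> carrier R" "carrier R = central_span R (centre R) gens"
proof -
  have "\<exists>G. finite G \<and> G \<subseteq> carrier R \<and> carrier R = central_span R (centre R) G"
    using central_generators by metis
  then have "finite gens \<and> gens \<subseteq> carrier R \<and> carrier R = central_span R (centre R) gens"
    unfolding gens_def by (rule someI_ex)
  then show "finite gens" "gens \<subseteq> carrier R" "carrier R = central_span R (centre R) gens" by auto
qed

lemma gens_induct:
  assumes "r \<in> carrier R" "Prop \<zero>"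
    "\<And>z g y. z \<in> centre R \<Longrightarrow> g \<in> gens \<Longrightarrow> y \<in> carrier R \<Longrightarrow> Prop y \<Longrightarrow> Prop (z \<otimes> g \<oplus> y)"
  shows "Prop r"
proof -
  have "r \<in> central_span R (centre R) gens" using assms(1) gens(3) by simp
  then show ?thesis
    by induction (use assms(2,3) gens(3) in auto)
qed

text \<open>The ideal CR, since \<open>gens\<close> spans \<open>R\<close> over the centre.\<close>

abbreviation "extension C \<equiv> central_span R C gens"

lemma coefficient_in_extension:
  assumes C: "central_ideal R C" and c: "c \<in> C" and r: "r \<in> carrier R"
  shows "c \<otimes> r \<in> extension C"
proof (rule gens_induct[OF r, of "\<lambda>r. c \<otimes> r \<in> extension C"])
  note cc = centreD(1)[OF central_idealD(1)[OF C c]]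
  show "c \<otimes> \<zero> \<in> extension C" using cc central_span.zero by simp
  fix z g y assume zg: "z \<in> centre R" "g \<in> gens" "y \<in> carrier R" "c \<otimes> y \<in> extension C"
  have gc: "g \<in> carrier R" using zg gens(2) by auto
  have "c \<otimes> (z \<otimes> g \<oplus> y) = (c \<otimes> z) \<otimes> g \<oplus> c \<otimes> y"
    using centreD(1)[OF zg(1)] cc gc zg(3) by (simp add: r_distr m_assoc)
  then show "c \<otimes> (z \<otimes> g \<oplus> y) \<in> extension C"
    using central_span.step[OF central_ideal_mult_right[OF C c zg(1)] zg(2,4)] by simp
qed

lemma two_sided_extension:
  assumes C: "central_ideal R C" shows "two_sided R (extension C)"
proof -
  note Cc = central_idealD(1)[OF C]
  have l: "r \<otimes> y \<in> extension C" if "r \<in> carrier R" "y \<in> extension C" for r y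
  proof (rule central_span_mult[OF C gens(2) that(1) _ that(2)])
    fix c g assume cg: "c \<in> C" "g \<in> gens"
    then have "r \<otimes> (c \<otimes> g) = c \<otimes> (r \<otimes> g)" using central_lcomm[OF Cc that(1)] gens(2) by blast
    then show "r \<otimes> (c \<otimes> g) \<in> extension C" using coefficient_in_extension[OF C cg(1)] that(1) cg(2) gens(2) by auto
  qed
  have r: "y \<otimes> r \<in> extension C" if "r \<in> carrier R" "y \<in> extension C" for r y
  proof (rule central_span_mult_right[OF C gens(2) that(1) _ that(2)])
    fix c g assume cg: "c \<in> C" "g \<in> gens"
    then have "(c \<otimes> g) \<otimes> r = c \<otimes> (g \<otimes> r)" using centreD(1)[OF Cc] gens(2) that(1) by (auto simp: m_assoc)
    then show "(c \<otimes> g) \<otimes> r \<in> extension C" using coefficient_in_extension[OF C cg(1)] that(1) cg(2) gens(2) by auto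
  qed
  show ?thesis
    unfolding two_sided_def left_ideal_def
  proof (intro conjI ballI subsetI)
    show "\<zero> \<in> extension C" by (rule central_span.zero)
    fix a assume a: "a \<in> extension C"
    show "a \<in> carrier R" by (rule central_span_closed[OF C gens(2) a])
    { fix b assume "b \<in> extension C"
      then show "a \<oplus> b \<in> extension C" by (rule central_span_add[OF C gens(2) a]) }
    { fix b assume "b \<in> carrier R"
      then show "b \<otimes> a \<in> extension C" "a \<otimes> b \<in> extension C" using l r a by auto }
  qed
qed

lemma extension_superset:
  assumes C: "central_ideal R C" shows "C \<subseteq> extension C"
proof
  fix c assume c: "c \<in> C"
  then show "c \<in> extension C"
    using coefficient_in_extension[OF C c one_closed] centreD(1)[OF central_idealD(1)[OF C c]] by simp
qed

text \<open>If R/I coincided with its product by \<open>m\<close>, Nakayama's lemma would give a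
  central \<open>w\<close> outside \<open>m\<close> that kills all of R/I. Then \<open>w\<close>
  itself lies in \<open>I\<close>, against \<open>I \<inter> centre R \<subseteq> m\<close>.\<close>

lemma extension_proper:
  assumes m: "central_prime R m" and I: "left_ideal R I" "I \<inter> centre R \<subseteq> m"
  obtains r where "r \<in> carrier R" "\<And>y. y \<in> extension m \<Longrightarrow> r \<ominus> y \<notin> I"
proof (rule ccontr)
  note md = central_primeD[OF m] and Id = left_idealD[OF I(1)]
  assume "\<not> thesis"
  then have all: "\<exists>y\<in>extension m. r \<ominus> y \<in> I" if "r \<in> carrier R" for r
    using that \<open>\<And>r. \<lbrakk>r \<in> carrier R; \<And>y. y \<in> extension m \<Longrightarrow> r \<ominus> y \<notin> I\<rbrakk> \<Longrightarrow> thesis\<close> by blast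
  have "\<exists>y\<in>extension m. \<one> \<otimes> a \<ominus> y \<in> I" if "a \<in> gens" for a
    using all[of a] gens(2) that by auto
  then obtain w where w: "w \<in> centre R" "w \<notin> m" "\<And>a. a \<in> gens \<Longrightarrow> w \<otimes> a \<in> I"
    using central_nakayama[OF m md(1) order_refl I(1) gens(1,2) centre_one md(2)] by blast
  note wc = centreD(1)[OF w(1)]
  have "w \<otimes> \<one> \<in> I"
  proof (rule gens_induct[of _ "\<lambda>r. w \<otimes> r \<in> I"])
    show "w \<otimes> \<zero> \<in> I" using wc Id(2) by simp
    fix z g y assume zg: "z \<in> centre R" "g \<in> gens" "y \<in> carrier R" "w \<otimes> y \<in> I"
    note zc = centreD(1)[OF zg(1)]
    have gc: "g \<in> carrier R" using zg gens(2) by auto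
    have "w \<otimes> (z \<otimes> g \<oplus> y) = z \<otimes> (w \<otimes> g) \<oplus> w \<otimes> y"
      using central_lcomm[OF zg(1) wc gc] zc wc gc zg(3) by (simp add: r_distr)
    then show "w \<otimes> (z \<otimes> g \<oplus> y) \<in> I" using Id(3,4) zc w(3)[OF zg(2)] zg(4) by simp
  qed simp
  then show False using w I(2) wc by auto
qed

text \<open>The centre acts faithfully on \<open>R\<close>: the case of the zero left ideal shows
  that mR is proper.\<close>

lemma one_notin_extension:
  assumes m: "central_prime R m" shows "\<one> \<notin> extension m"
proof
  assume 1: "\<one> \<in> extension m"
  note T = two_sided_extension[OF central_primeD(1)[OF m]]
  have "{\<zero>} \<inter> centre R \<subseteq> m" using central_idealD(2)[OF central_primeD(1)[OF m]] by simp
  then obtain r where r: "r \<in> carrier R" "\<And>y. y \<in> extension m \<Longrightarrow> r \<ominus> y \<notin> {\<zero>}"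
    using extension_proper[OF m left_ideal_trivial] by blast
  have "r \<in> extension m" using left_idealD(4)[OF two_sidedD(1)[OF T] r(1) 1] r(1) by simp
  then show False using r(2)[of r] r(1) minus_self by simp
qed

text \<open>The products of the generators of \<open>R\<close> over its centre with the generators
  of \<open>L\<close> over \<open>R\<close> span \<open>L\<close> over the centre.\<close>

lemma left_ideal_central_generators:
  assumes L: "left_ideal R L"
  obtains B where "finite B" "B \<subseteq> L" "L \<subseteq> central_span R (centre R) B"
proof -
  note C = central_ideal_centre and Ld = left_idealD[OF L]
  have N: "left_module R (reg_module R)" by (rule reg_module_left_module) unfold_locales
  obtain A where A: "A \<subseteq> L" "finite A" "module_span R (reg_module R) A = L"
    using noeth left_ideal_submodule[OF L] unfolding noetherian_def noetherian_module_def by blast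
  define B where "B = (\<lambda>(g, a). g \<otimes> a) ` (gens \<times> A)"
  have BL: "B \<subseteq> L" using A(1) Ld(4) gens(2) by (auto simp: B_def)
  have Bc: "B \<subseteq> carrier R" using BL Ld(1) by auto
  have ra: "r \<otimes> a \<in> central_span R (centre R) B" if "a \<in> A" "r \<in> carrier R" for r a
  proof (rule gens_induct[OF that(2)])
    have ac: "a \<in> carrier R" using that A Ld by auto
    show "\<zero> \<otimes> a \<in> central_span R (centre R) B" using ac central_span.zero by simp
    fix z g y assume zg: "z \<in> centre R" "g \<in> gens" "y \<in> carrier R" "y \<otimes> a \<in> central_span R (centre R) B"
    have gc: "g \<in> carrier R" using zg gens(2) by auto
    have "(z \<otimes> g \<oplus> y) \<otimes> a = z \<otimes> (g \<otimes> a) \<oplus> y \<otimes> a"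
      using centreD(1)[OF zg(1)] gc zg(3) ac by (simp add: l_distr m_assoc)
    moreover have "g \<otimes> a \<in> B" using zg(2) that(1) by (auto simp: B_def)
    ultimately show "(z \<otimes> g \<oplus> y) \<otimes> a \<in> central_span R (centre R) B"
      using central_span.step[OF zg(1) _ zg(4)] by simp
  qed
  have mult: "r \<otimes> y \<in> central_span R (centre R) B" if "r \<in> carrier R" "y \<in> central_span R (centre R) B" for r y
  proof (rule central_span_mult[OF C Bc that(1) _ that(2)])
    fix c b assume c: "c \<in> centre R" and "b \<in> B"
    then obtain g a where ga: "g \<in> gens" "a \<in> A" "b = g \<otimes> a" by (auto simp: B_def)
    have gac: "g \<in> carrier R" "a \<in> carrier R" using ga gens(2) A(1) Ld(1) by auto
    have "r \<otimes> (c \<otimes> b) = (r \<otimes> (c \<otimes> g)) \<otimes> a" using ga gac that(1) centreD(1)[OF c] by (simp add: m_assoc)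
    then show "r \<otimes> (c \<otimes> b) \<in> central_span R (centre R) B"
      using ra[OF ga(2)] that(1) centreD(1)[OF c] gac by simp
  qed
  have "submodule (central_span R (centre R) B) R (reg_module R)"
    by (rule submodule_of_left_moduleI[OF N])
      (use central_span_closed[OF C Bc] central_span.zero central_span_add[OF C Bc] mult
        in \<open>auto simp: reg_module_def\<close>)
  moreover have "A \<subseteq> central_span R (centre R) B"
    using ra[OF _ one_closed] A(1) Ld(1) by (metis l_one subset_iff)
  ultimately have "L \<subseteq> central_span R (centre R) B" using A(3) unfolding module_span_def by blast
  then show ?thesis using that[of B] BL A(2) gens(1) by (auto simp: B_def)
qed

text \<open>An associated prime of the localisation at \<open>m\<close> of the module spanned by the
  class of \<open>a\<close>. Among the central multiples of \<open>a\<close> that survive at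
  \<open>m\<close>, one with maximal annihilator is taken.\<close>

lemma prime_central_annihilator_below:
  assumes I: "left_ideal R I" and m: "central_prime R m" and a: "a \<in> carrier R" "central_annihilator R I a \<subseteq> m"
  obtains n where "n \<in> carrier R" "central_prime R (central_annihilator R I n)"
    "central_annihilator R I a \<subseteq> central_annihilator R I n" "central_annihilator R I n \<subseteq> m"
proof -
  note md = central_primeD[OF m] and Id = left_idealD[OF I]
  define S where "S = {z \<otimes> a | z. z \<in> centre R \<and> central_annihilator R I (z \<otimes> a) \<subseteq> m}"
  have Sc: "S \<subseteq> carrier R" using a centre_subset by (auto simp: S_def)
  have "a = \<one> \<otimes> a \<and> \<one> \<in> centre R \<and> central_annihilator R I (\<one> \<otimes> a) \<subseteq> m" using a by simp
  then have "a \<in> S" unfolding S_def by blast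
  then obtain n where n: "n \<in> S"
    "\<And>s. s \<in> carrier R \<Longrightarrow> s \<otimes> n \<in> S \<Longrightarrow> left_annihilator R I (s \<otimes> n) = left_annihilator R I n"
    using left_annihilator_maximal[OF I Sc] by blast
  have nc: "n \<in> carrier R" using n Sc by auto
  obtain z where z: "z \<in> centre R" "n = z \<otimes> a" "central_annihilator R I n \<subseteq> m" using n(1) by (auto simp: S_def)
  have eq: "central_annihilator R I (s \<otimes> n) = central_annihilator R I n"
    if s: "s \<in> centre R" "central_annihilator R I (s \<otimes> n) \<subseteq> m" for s
  proof -
    note sc = centreD(1)[OF s(1)]
    have "s \<otimes> n = (s \<otimes> z) \<otimes> a" using sc centreD(1)[OF z(1)] a z(2) by (simp add: m_assoc)
    then have "s \<otimes> n \<in> S" unfolding S_def using s(2) centre_mult[OF s(1) z(1)] by auto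
    then show ?thesis using n(2)[OF sc] central_annihilator_eq[OF I] nc sc by simp
  qed
  have "b \<in> central_annihilator R I n \<or> c \<in> central_annihilator R I n"
    if bc: "b \<in> centre R" "c \<in> centre R" "b \<otimes> c \<in> central_annihilator R I n" for b c
  proof (rule ccontr)
    assume no: "\<not> ?thesis"
    note cc = centreD(1)[OF bc(1)] centreD(1)[OF bc(2)]
    have bcn: "b \<otimes> (c \<otimes> n) \<in> I" using bc cc nc by (simp add: central_annihilator_def m_assoc)
    show False
    proof (cases "central_annihilator R I (c \<otimes> n) \<subseteq> m")
      case True
      have "b \<in> central_annihilator R I (c \<otimes> n)" using bcn bc by (simp add: central_annihilator_def)
      then show False using eq[OF bc(2) True] no by simp
    next
      \<comment> \<open>Here \<open>c n\<close> dies at \<open>m\<close> through some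
        \<open>e\<close> outside \<open>m\<close>. Then \<open>e n\<close> still survives and has
        the annihilator of \<open>n\<close>, which would contain \<open>c\<close>.\<close>
      case False
      then obtain e where e: "e \<in> centre R" "e \<otimes> (c \<otimes> n) \<in> I" "e \<notin> m" by (auto simp: central_annihilator_def)
      note ec = centreD(1)[OF e(1)]
      have "central_annihilator R I (e \<otimes> n) \<subseteq> m"
      proof
        fix f assume f: "f \<in> central_annihilator R I (e \<otimes> n)"
        then have fz: "f \<in> centre R" by (simp add: central_annihilator_def)
        have "f \<otimes> e \<in> central_annihilator R I n"
          using f centreD(1)[OF fz] ec nc centre_mult[OF fz e(1)] by (simp add: central_annihilator_def m_assoc)
        then show "f \<in> m" using z(3) md(3)[OF fz e(1)] e(3) by blast
      qed
      moreover have "c \<in> central_annihilator R I (e \<otimes> n)"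
        using central_lcomm[OF bc(2) ec nc] e(2) bc(2) by (simp add: central_annihilator_def)
      ultimately show False using eq[OF e(1)] no by simp
    qed
  qed
  then have "central_prime R (central_annihilator R I n)"
    using central_ideal_central_annihilator[OF I nc] z(3) md(2) by (auto simp: central_prime_def)
  moreover have "central_annihilator R I a \<subseteq> central_annihilator R I n"
  proof
    fix w assume w: "w \<in> central_annihilator R I a"
    then have wz: "w \<in> centre R" "w \<otimes> a \<in> I" by (auto simp: central_annihilator_def)
    have "w \<otimes> n = z \<otimes> (w \<otimes> a)" unfolding z(2) using central_lcomm[OF z(1) centreD(1)[OF wz(1)] a(1)] .
    then show "w \<in> central_annihilator R I n" using Id(4)[OF centreD(1)[OF z(1)] wz(2)] wz(1) by (simp add: central_annihilator_def)
  qed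
  ultimately show ?thesis using that nc z(3) by blast
qed

text \<open>Let A/I be the part of R/I killed by the annihilator of \<open>n\<close>. It is nonzero
  at \<open>m\<close>, so by Nakayama's lemma it is not its own multiple by \<open>x\<close> there.
  As \<open>x\<close> is regular on R/I, some element of \<open>A\<close> therefore survives at
  \<open>m\<close> modulo \<open>I + xR\<close>. It is annihilated by the old annihilator and by
  \<open>x\<close>, which is new.\<close>

lemma larger_associated_prime:
  assumes I: "left_ideal R I" and m: "central_prime R m" and x: "x \<in> m"
    and reg: "\<And>r. r \<in> carrier R \<Longrightarrow> x \<otimes> r \<in> I \<Longrightarrow> r \<in> I"
    and n: "n \<in> carrier R" "central_annihilator R I n \<subseteq> m"
  obtains n' where "n' \<in> carrier R" "central_prime R (central_annihilator R (add_multiples R I x) n')"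
    "central_annihilator R I n \<subset> central_annihilator R (add_multiples R I x) n'"
    "central_annihilator R (add_multiples R I x) n' \<subseteq> m"
proof -
  note md = central_primeD[OF m] and Id = left_idealD[OF I]
  have xz: "x \<in> centre R" using central_idealD(1)[OF md(1) x] .
  note xc = centreD(1)[OF xz]
  let ?J = "add_multiples R I x" and ?q = "central_annihilator R I n"
  have J: "left_ideal R ?J" by (rule left_ideal_add_multiples[OF I xz])
  \<comment> \<open>Taking all elements killed by \<open>?q\<close>, and not only the multiples of
    \<open>n\<close>, makes \<open>A\<close> stable under division by \<open>x\<close> modulo
    \<open>I\<close>.\<close>
  define A where "A = {r \<in> carrier R. \<forall>c\<in>?q. c \<otimes> r \<in> I}"
  have qz: "c \<in> ?q \<Longrightarrow> c \<in> centre R" for c by (simp add: central_annihilator_def)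
  have A: "left_ideal R A"
    unfolding left_ideal_def
  proof (intro conjI ballI)
    show "\<zero> \<in> A" using Id(2) centreD(1)[OF qz] by (auto simp: A_def)
    fix a assume a: "a \<in> A"
    { fix b assume "b \<in> A" then show "a \<oplus> b \<in> A" using a Id(3) centreD(1)[OF qz] by (auto simp: A_def r_distr)
    next
      fix r assume r: "r \<in> carrier R"
      have "c \<otimes> (r \<otimes> a) \<in> I" if c: "c \<in> ?q" for c
      proof -
        have "c \<otimes> a \<in> I" "a \<in> carrier R" using a c by (auto simp: A_def)
        then show ?thesis
          using Id(4)[OF r, of "c \<otimes> a"] central_lcomm[OF qz[OF c] r, of a] by metis
      qed
      then show "r \<otimes> a \<in> A" using a r by (simp add: A_def) }
  qed (auto simp: A_def)
  have nA: "n \<in> A" using n by (simp add: A_def central_annihilator_def)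
  obtain B where B: "finite B" "B \<subseteq> A" "A \<subseteq> central_span R (centre R) B"
    using left_ideal_central_generators[OF A] .
  have Bc: "B \<subseteq> carrier R" using B(2) by (auto simp: A_def)
  \<comment> \<open>Otherwise one \<open>z\<close> outside \<open>m\<close> carries all generators
    of \<open>A\<close> into \<open>I + xR\<close>, and the hypothesis of Nakayama's lemma holds
    with coefficients in \<open>m\<close>.\<close>
  have "\<exists>a\<in>B. central_annihilator R ?J a \<subseteq> m"
  proof (rule ccontr)
    assume "\<not> ?thesis"
    then have bad: "\<exists>z\<in>centre R. z \<notin> m \<and> z \<otimes> a \<in> ?J" if "a \<in> B" for a
      using that by (auto simp: central_annihilator_def)
    have "\<exists>z\<in>centre R. z \<notin> m \<and> (\<forall>a\<in>S. z \<otimes> a \<in> ?J)" if "finite S" "S \<subseteq> B" for S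
      using that
    proof (induction S)
      case empty then show ?case using centre_one md(2) by blast
    next
      case (insert b S)
      then obtain z where z: "z \<in> centre R" "z \<notin> m" "\<forall>a\<in>S. z \<otimes> a \<in> ?J" by auto
      obtain w where w: "w \<in> centre R" "w \<notin> m" "w \<otimes> b \<in> ?J" using bad[of b] insert.prems by auto
      note c = centreD(1)[OF z(1)] centreD(1)[OF w(1)]
      have "z \<otimes> w \<notin> m" using md(3)[OF z(1) w(1)] z w by blast
      moreover have "(z \<otimes> w) \<otimes> b \<in> ?J"
        using left_idealD(4)[OF J c(1) w(3)] c Bc insert.prems by (auto simp: m_assoc)
      moreover have "(z \<otimes> w) \<otimes> a \<in> ?J" if "a \<in> S" for a
      proof -
        have ac: "a \<in> carrier R" using that insert.prems Bc by auto
        have "(z \<otimes> w) \<otimes> a = w \<otimes> (z \<otimes> a)" using central_lcomm[OF z(1) c(2) ac] c ac by (simp add: m_assoc)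
        then show ?thesis using left_idealD(4)[OF J c(2)] z(3) that by simp
      qed
      ultimately show ?case using centre_mult[OF z(1) w(1)] by blast
    qed
    then obtain z where z: "z \<in> centre R" "z \<notin> m" "\<forall>a\<in>B. z \<otimes> a \<in> ?J" using B(1) by blast
    note zc = centreD(1)[OF z(1)]
    have "\<exists>y\<in>central_span R m B. z \<otimes> a \<ominus> y \<in> I" if a: "a \<in> B" for a
    proof -
      have ac: "a \<in> carrier R" and aA: "a \<in> A" using a Bc B by auto
      obtain i r where ir: "i \<in> I" "r \<in> carrier R" "z \<otimes> a = i \<oplus> x \<otimes> r"
        using z(3) a by (auto simp: add_multiples_def)
      have ic: "i \<in> carrier R" using Id(1) ir by blast
      have xr: "x \<otimes> r = z \<otimes> a \<ominus> i" unfolding ir(3) using ic ir(2) xc by algebra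
      \<comment> \<open>For \<open>c\<close> in \<open>?q\<close> the product \<open>x c r\<close>
        is the difference of \<open>z c a\<close> and \<open>c i\<close>, hence in \<open>I\<close>;
        regularity of \<open>x\<close> removes \<open>x\<close>.\<close>
      have "r \<in> A"
      proof -
        have "c \<otimes> r \<in> I" if c: "c \<in> ?q" for c
        proof (rule reg)
          note cc = centreD(1)[OF qz[OF c]]
          show "c \<otimes> r \<in> carrier R" using cc ir by simp
          have "x \<otimes> (c \<otimes> r) = c \<otimes> (x \<otimes> r)" using central_lcomm[OF xz cc ir(2)] by simp
          also have "\<dots> = z \<otimes> (c \<otimes> a) \<ominus> c \<otimes> i"
            unfolding xr using central_lcomm[OF z(1) cc ac] cc zc ac ic
            by (simp add: a_minus_def r_distr r_minus)
          finally show "x \<otimes> (c \<otimes> r) \<in> I"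
            using left_ideal_minus[OF I] Id(4)[OF zc] Id(4)[OF cc ir(1)] aA c by (simp add: A_def)
        qed
        then show ?thesis using ir by (simp add: A_def)
      qed
      then have "r \<in> central_span R (centre R) B" using B by auto
      then have "x \<otimes> r \<in> central_span R m B"
      proof induction
        case zero then show ?case using xc central_span.zero by simp
      next
        case (step c g y)
        have "x \<otimes> (c \<otimes> g \<oplus> y) = (x \<otimes> c) \<otimes> g \<oplus> x \<otimes> y"
          using xc centreD(1)[OF step(1)] Bc step(2) central_span_closed[OF central_ideal_centre Bc step(3)]
          by (auto simp: r_distr m_assoc)
        then show ?case
          using central_span.step[OF central_ideal_mult_right[OF md(1) x step(1)] step(2) step.IH] by simp
      qed
      moreover have "z \<otimes> a \<ominus> x \<otimes> r = i" unfolding xr using zc ac ic by algebra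
      ultimately show ?thesis using ir(1) by force
    qed
    then obtain w where w: "w \<in> centre R" "w \<notin> m" "\<And>a. a \<in> B \<Longrightarrow> w \<otimes> a \<in> I"
      using central_nakayama[OF m md(1) order_refl I B(1) Bc z(1,2)] by blast
    note wc = centreD(1)[OF w(1)]
    have "w \<otimes> y \<in> I" if "y \<in> central_span R (centre R) B" for y
      using that
    proof induction
      case zero then show ?case using wc Id(2) by simp
    next
      case (step c g y)
      have gc: "g \<in> carrier R" "c \<in> carrier R" "y \<in> carrier R"
        using Bc centreD(1)[OF step(1)] step(2) central_span_closed[OF central_ideal_centre Bc step(3)] by auto
      have "w \<otimes> (c \<otimes> g \<oplus> y) = c \<otimes> (w \<otimes> g) \<oplus> w \<otimes> y"
        using central_lcomm[OF w(1) gc(2,1)] gc wc by (simp add: r_distr)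
      then show ?case using Id(3,4) w(3) step gc by simp
    qed
    then have "w \<otimes> n \<in> I" using nA B by auto
    then show False using n(2) w by (auto simp: central_annihilator_def)
  qed
  then obtain a where a: "a \<in> B" "central_annihilator R ?J a \<subseteq> m" by blast
  then have ac: "a \<in> carrier R" and aA: "a \<in> A" using B Bc by auto
  obtain n' where n': "n' \<in> carrier R" "central_prime R (central_annihilator R ?J n')"
    "central_annihilator R ?J a \<subseteq> central_annihilator R ?J n'" "central_annihilator R ?J n' \<subseteq> m"
    using prime_central_annihilator_below[OF J m ac a(2)] .
  have "?q \<subseteq> central_annihilator R ?J a"
  proof
    fix c assume c: "c \<in> ?q"
    then have "c \<otimes> a \<in> ?J" using aA add_multiplesI1[OF I xc] by (simp add: A_def)
    then show "c \<in> central_annihilator R ?J a" using qz[OF c] by (simp add: central_annihilator_def)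
  qed
  moreover have "x \<in> central_annihilator R ?J a"
    using add_multiplesI2[OF I xc ac] xz by (simp add: central_annihilator_def)
  moreover have "x \<notin> ?q"
  proof
    assume "x \<in> ?q"
    then have "n \<in> I" using reg n by (simp add: central_annihilator_def)
    then have "\<one> \<in> ?q" using n by (simp add: central_annihilator_def)
    then show False using n(2) md(2) by blast
  qed
  ultimately have "?q \<subset> central_annihilator R ?J n'" using n'(3) by blast
  then show ?thesis using that n' by blast
qed

lemma prime_chain_above:
  assumes "left_ideal R I" "regular_sequence R I ys" "set ys \<subseteq> m" "central_prime R m"
    "n \<in> carrier R" "central_annihilator R I n \<subseteq> m"
  shows "\<exists>cs. length cs = length ys \<and> sorted_wrt (\<subset>) cs \<and>
    (\<forall>c\<in>set cs. central_prime R c \<and> central_annihilator R I n \<subset> c \<and> c \<subseteq> m)"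
  using assms
proof (induction ys arbitrary: I n)
  case (Cons y ys)
  let ?J = "add_multiples R I y" and ?q = "central_annihilator R I n"
  have y: "y \<in> centre R" "y \<in> m" and reg: "\<And>r. r \<in> carrier R \<Longrightarrow> y \<otimes> r \<in> I \<Longrightarrow> r \<in> I"
    using Cons.prems by auto
  have J: "left_ideal R ?J" by (rule left_ideal_add_multiples[OF Cons.prems(1) y(1)])
  obtain n' where n': "n' \<in> carrier R" "central_prime R (central_annihilator R ?J n')"
    "?q \<subset> central_annihilator R ?J n'" "central_annihilator R ?J n' \<subseteq> m"
    by (rule larger_associated_prime[OF Cons.prems(1,4) y(2) reg Cons.prems(5,6)])
  obtain cs where cs: "length cs = length ys" "sorted_wrt (\<subset>) cs"
    "\<forall>c\<in>set cs. central_prime R c \<and> central_annihilator R ?J n' \<subset> c \<and> c \<subseteq> m"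
    using Cons.IH[OF J _ _ Cons.prems(4) n'(1,4)] Cons.prems by auto
  have "length (central_annihilator R ?J n' # cs) = length (y # ys) \<and>
    sorted_wrt (\<subset>) (central_annihilator R ?J n' # cs) \<and>
    (\<forall>c\<in>set (central_annihilator R ?J n' # cs). central_prime R c \<and> ?q \<subset> c \<and> c \<subseteq> m)"
  proof (intro conjI ballI)
    fix c assume "c \<in> set (central_annihilator R ?J n' # cs)"
    then have c: "c = central_annihilator R ?J n' \<or> c \<in> set cs" by simp
    show "central_prime R c" "?q \<subset> c" "c \<subseteq> m" using c n' cs(3) by (blast, blast, blast)
  qed (use cs in auto)
  then show ?case by blast
qed simp

end

section \<open>Maximal regular sequences and the grade\<close>

lemma (in ring) regular_sequence_left_ideal:
  "regular_sequence R {\<zero>} xs \<Longrightarrow> left_ideal R (seq_ideal R {\<zero>} xs)"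
  by (rule left_ideal_seq_ideal[OF left_ideal_trivial regular_sequence_centre])

context central_finite
begin

text \<open>The ideals generated by regular extensions of \<open>xs\<close> inside \<open>p\<close>
  have a maximal member. A further regular \<open>x\<close> would have to lie in that ideal already,
  which forces 1 into it and contradicts \<open>\<one> \<notin> J\<close>.\<close>

lemma extend_to_maximal_regular_sequence:
  assumes p: "central_ideal R p" and J: "left_ideal R J" "p \<subseteq> J" "\<one> \<notin> J"
    and xs: "regular_sequence R {\<zero>} xs" "set xs \<subseteq> p"
  obtains ys where "maximal_regular_sequence R p (xs @ ys)"
proof -
  let ?I = "\<lambda>ys. seq_ideal R {\<zero>} (xs @ ys)"
  define \<F> where "\<F> = {?I ys | ys. regular_sequence R {\<zero>} (xs @ ys) \<and> set ys \<subseteq> p}"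
  have cent: "set ys \<subseteq> centre R" if "set ys \<subseteq> p" for ys using that central_idealD(1)[OF p] by auto
  have L: "left_ideal R (?I ys)" if "set ys \<subseteq> p" for ys
    using left_ideal_seq_ideal[OF left_ideal_trivial] cent[OF that] cent[OF xs(2)] by simp
  have "?I [] \<in> \<F>" using xs unfolding \<F>_def by fastforce
  then have "\<exists>K\<in>\<F>. \<forall>K'\<in>\<F>. K \<subseteq> K' \<longrightarrow> K' = K"
    using L by (intro left_ideal_maximal) (auto simp: \<F>_def)
  then obtain K where K: "K \<in> \<F>" "\<And>K'. K' \<in> \<F> \<Longrightarrow> K \<subseteq> K' \<Longrightarrow> K' = K" by blast
  then obtain ys where ys: "regular_sequence R {\<zero>} (xs @ ys)" "set ys \<subseteq> p" and Kys: "K = ?I ys"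
    by (auto simp: \<F>_def)
  note max = K(2)[unfolded Kys]
  have "\<exists>r\<in>carrier R. r \<notin> ?I ys \<and> x \<otimes> r \<in> ?I ys" if x: "x \<in> p" for x
  proof (rule ccontr)
    assume "\<not> ?thesis"
    then have reg: "\<And>r. r \<in> carrier R \<Longrightarrow> x \<otimes> r \<in> ?I ys \<Longrightarrow> r \<in> ?I ys" by blast
    have xz: "x \<in> centre R" using central_idealD(1)[OF p x] .
    note xc = centreD(1)[OF xz]
    have eq: "?I (ys @ [x]) = add_multiples R (?I ys) x"
      using seq_ideal_append[of R "{\<zero>}" "xs @ ys" "[x]"] by simp
    have "regular_sequence R {\<zero>} ((xs @ ys) @ [x])"
      unfolding regular_sequence_append[of R _ "xs @ ys" "[x]"] using ys(1) xz reg by simp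
    then have "?I (ys @ [x]) \<in> \<F>" using ys(2) x unfolding \<F>_def by fastforce
    then have "add_multiples R (?I ys) x = ?I ys"
      using max[of "?I (ys @ [x])"] eq add_multiplesI1[OF L[OF ys(2)] xc] by auto
    then have "x \<otimes> \<one> \<in> ?I ys" using add_multiplesI2[OF L[OF ys(2)] xc one_closed] by simp
    then have "\<one> \<in> ?I ys" using reg by simp
    moreover have "?I ys \<subseteq> J"
      by (rule seq_ideal_subset[OF J(1)]) (use left_idealD(2)[OF J(1)] J(2) xs(2) ys(2) cent in auto)
    ultimately show False using J(3) by blast
  qed
  then have "maximal_regular_sequence R p (xs @ ys)"
    using ys xs(2) by (auto simp: maximal_regular_sequence_def)
  then show ?thesis using that by blast
qed

lemma maximal_regular_sequence_annihilated:
  assumes p: "central_ideal R p" and xs: "maximal_regular_sequence R p xs"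
  obtains n where "n \<in> carrier R" "n \<notin> seq_ideal R {\<zero>} xs" "\<And>z. z \<in> p \<Longrightarrow> z \<otimes> n \<in> seq_ideal R {\<zero>} xs"
proof -
  have m: "regular_sequence R {\<zero>} xs" "\<And>x. x \<in> p \<Longrightarrow> \<exists>r\<in>carrier R. r \<notin> seq_ideal R {\<zero>} xs \<and> x \<otimes> r \<in> seq_ideal R {\<zero>} xs"
    using xs by (auto simp: maximal_regular_sequence_def)
  show ?thesis
    by (rule common_annihilated_element[OF regular_sequence_left_ideal[OF m(1)] p m(2)]) (auto intro: that)
qed

lemma left_grade_left_quot_attained:
  assumes Q: "two_sided R Q" and xs: "regular_sequence R {\<zero>} xs" "set xs \<subseteq> Q"
    and n: "n \<in> carrier R" "n \<notin> seq_ideal R {\<zero>} xs" "\<And>c. c \<in> Q \<Longrightarrow> c \<otimes> n \<in> seq_ideal R {\<zero>} xs"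
  shows "left_grade R (left_quot R Q) = enat (length xs)"
proof -
  interpret resolved_module R "left_quot R Q" by (rule left_quot_resolved[OF two_sidedD(1)[OF Q]])
  have I: "left_ideal R (seq_ideal R {\<zero>} xs)"
    by (rule regular_sequence_left_ideal[OF xs(1)])
  have "\<not> Ext_injective 0 (seq_ideal R {\<zero>} xs) \<zero>"
    by (rule left_quot_not_Ext_injective[OF Q I n centre_zero]) (use n(1) left_idealD(2)[OF I] in auto)
  then show ?thesis
    using left_grade_regular_sequence(2)[OF xs(1)] left_quot_annihilated[OF Q] xs(2) by blast
qed

text \<open>The left side does not mention the sequence; this is why maximal sequences in
  \<open>p\<close> all have the same length.\<close>

lemma maximal_regular_sequence_length:
  assumes p: "central_ideal R p" and xs: "maximal_regular_sequence R p xs"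
  shows "left_grade R (left_quot R (extension p)) = enat (length xs)"
proof -
  note T = two_sided_extension[OF p]
  have reg: "regular_sequence R {\<zero>} xs" "set xs \<subseteq> p" using xs by (auto simp: maximal_regular_sequence_def)
  have I: "left_ideal R (seq_ideal R {\<zero>} xs)"
    by (rule regular_sequence_left_ideal[OF reg(1)])
  note Id = left_idealD[OF I]
  obtain n where n: "n \<in> carrier R" "n \<notin> seq_ideal R {\<zero>} xs" "\<And>z. z \<in> p \<Longrightarrow> z \<otimes> n \<in> seq_ideal R {\<zero>} xs"
    using maximal_regular_sequence_annihilated[OF p xs] by blast
  have "extension p \<subseteq> {e \<in> carrier R. e \<otimes> n \<in> seq_ideal R {\<zero>} xs}"
  proof (rule central_span_least)
    fix c g assume cg: "c \<in> p" "g \<in> gens"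
    have gc: "g \<in> carrier R" using cg(2) gens(2) by auto
    have cz: "c \<in> centre R" using central_idealD(1)[OF p cg(1)] .
    have "(c \<otimes> g) \<otimes> n = g \<otimes> (c \<otimes> n)" using central_lcomm[OF cz gc n(1)] centreD(1)[OF cz] gc n(1) by (simp add: m_assoc)
    then show "c \<otimes> g \<in> {e \<in> carrier R. e \<otimes> n \<in> seq_ideal R {\<zero>} xs}"
      using Id(4)[OF gc n(3)[OF cg(1)]] centreD(1)[OF cz] gc by simp
  qed (use n Id(2,3) in \<open>auto simp: l_distr\<close>)
  then show ?thesis
    using extension_superset[OF p] reg n by (intro left_grade_left_quot_attained[OF T, of xs n]) auto
qed

lemma centre_grade_eq:
  assumes p: "central_ideal R p" and J: "left_ideal R J" "p \<subseteq> J" "\<one> \<notin> J"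
    and xs: "maximal_regular_sequence R p xs"
  shows "centre_grade p R = length xs"
  unfolding centre_grade_def
proof (rule the_equality)
  show "\<exists>ys. maximal_centre_sequence R p ys \<and> length ys = length xs"
    using xs maximal_centre_sequence_iff[OF p J] by blast
  fix k assume "\<exists>ys. maximal_centre_sequence R p ys \<and> length ys = k"
  then obtain ys where "maximal_regular_sequence R p ys" "length ys = k"
    using maximal_centre_sequence_iff[OF p J] by blast
  then show "k = length xs"
    using maximal_regular_sequence_length[OF p] xs by (metis enat.inject)
qed

lemma no_embedded_primes:
  assumes cm: "central_chains_bounded R" and xs: "regular_sequence R {\<zero>} xs" "set xs \<subseteq> p"
    and p: "central_prime R p" "seq_ideal R {\<zero>} xs \<inter> centre R \<subseteq> p"
    and n: "n \<in> carrier R" "central_prime R (central_annihilator R (seq_ideal R {\<zero>} xs) n)"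
    and sub: "p \<subseteq> central_annihilator R (seq_ideal R {\<zero>} xs) n"
  shows "central_annihilator R (seq_ideal R {\<zero>} xs) n = p"
proof (rule ccontr)
  let ?I = "seq_ideal R {\<zero>} xs"
  let ?q = "central_annihilator R ?I n"
  assume "?q \<noteq> p"
  then have pq: "p \<subset> ?q" using sub by blast
  have I: "left_ideal R ?I"
    by (rule regular_sequence_left_ideal[OF xs(1)])
  obtain m where m: "central_prime R m" "?q \<subseteq> m"
    "\<And>D. central_ideal R D \<Longrightarrow> m \<subseteq> D \<Longrightarrow> \<one> \<notin> D \<Longrightarrow> D = m"
    using exists_maximal_central_ideal[OF central_primeD(1,2)[OF n(2)]] by blast
  note mi = central_primeD(1)[OF m(1)]
  note J = two_sidedD(1)[OF two_sided_extension[OF mi]] extension_superset[OF mi] one_notin_extension[OF m(1)]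
  have xm: "set xs \<subseteq> m" using xs(2) sub m(2) by blast
  obtain ys where ys: "maximal_regular_sequence R m (xs @ ys)"
    using extend_to_maximal_regular_sequence[OF mi J xs(1) xm] .
  have grade: "centre_grade m R = length xs + length ys" using centre_grade_eq[OF mi J ys] by simp
  have "regular_sequence R ?I ys" "set ys \<subseteq> m"
    using ys by (auto simp: maximal_regular_sequence_def regular_sequence_append)
  then obtain cs where cs: "length cs = length ys" "sorted_wrt (\<subset>) cs"
    "\<forall>c\<in>set cs. central_prime R c \<and> ?q \<subset> c \<and> c \<subseteq> m"
    using prime_chain_above[OF I _ _ m(1) n(1) m(2)] by blast
  obtain ds where ds: "length ds = length xs" "sorted_wrt (\<subset>) ds"
    "\<forall>d\<in>set ds. central_prime R d \<and> d \<subset> p \<and> {\<zero>} \<inter> centre R \<subseteq> d"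
    using prime_chain_below[OF left_ideal_trivial xs(1) p] by blast
  \<comment> \<open>Besides the primes from the two sequences the chain contains \<open>p\<close>
    and \<open>?q\<close>, so it has \<open>length xs + length ys + 2\<close> members, one more than
    the grade of \<open>m\<close> permits.\<close>
  let ?chain = "ds @ p # ?q # cs"
  have "sorted_wrt (\<subset>) ?chain"
    unfolding sorted_wrt_append
  proof (intro conjI ballI)
    show "sorted_wrt (\<subset>) (p # ?q # cs)" using cs(2,3) pq by auto
    fix d c assume d: "d \<in> set ds" and c: "c \<in> set (p # ?q # cs)"
    have "p \<subseteq> c" using c cs(3) pq by auto
    then show "d \<subset> c" using d ds(3) by blast
  qed (rule ds(2))
  moreover have "\<forall>c\<in>set ?chain. central_prime R c \<and> c \<subseteq> m"
  proof
    fix c assume "c \<in> set ?chain"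
    then consider "c \<in> set ds" | "c = p" | "c = ?q" | "c \<in> set cs" by auto
    then show "central_prime R c \<and> c \<subseteq> m"
      using ds(3) cs(3) p(1) n(2) pq m(2) by cases blast+
  qed
  ultimately have "length ?chain \<le> Suc (centre_grade m R)"
    using cm m(1,3) unfolding central_chains_bounded_def by blast
  then show False using grade ds(1) cs(1) by simp
qed

end

section \<open>Grade and Ext for a fixed prime ideal\<close>

locale prime_of_central_finite = central_finite +
  fixes P assumes P: "prime_two_sided R P"
begin

abbreviation "\<pp> \<equiv> P \<inter> centre R"

lemma P_ideal: "left_ideal R P" "\<one> \<notin> P" "two_sided R P" using prime_two_sidedD[OF P] by auto

lemma p_prime: "central_prime R \<pp>" by (rule central_prime_Int_centre[OF P])

lemma p_ideal: "central_ideal R \<pp>" by (rule central_primeD(1)[OF p_prime])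

lemma grade_sequence:
  obtains xs where "maximal_regular_sequence R \<pp> xs" "length xs = centre_grade \<pp> R"
    "regular_sequence R {\<zero>} xs" "set xs \<subseteq> \<pp>" "left_ideal R (seq_ideal R {\<zero>} xs)" "seq_ideal R {\<zero>} xs \<subseteq> P"
proof -
  obtain xs where xs: "maximal_regular_sequence R \<pp> xs"
    using extend_to_maximal_regular_sequence[OF p_ideal P_ideal(1) _ P_ideal(2), of "[]"] by auto
  then have reg: "regular_sequence R {\<zero>} xs" "set xs \<subseteq> \<pp>" by (auto simp: maximal_regular_sequence_def)
  have "seq_ideal R {\<zero>} xs \<subseteq> P"
    by (rule seq_ideal_subset[OF P_ideal(1)]) (use left_idealD(2)[OF P_ideal(1)] reg in auto)
  moreover have "left_ideal R (seq_ideal R {\<zero>} xs)"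
    using left_ideal_seq_ideal[OF left_ideal_trivial] reg(2) by auto
  ultimately show ?thesis
    using that[OF xs] centre_grade_eq[OF p_ideal P_ideal(1) _ P_ideal(2) xs] reg by auto
qed

lemma grade_le_left_grade: "enat (centre_grade \<pp> R) \<le> left_grade R (left_quot R P)"
proof -
  obtain xs where xs: "length xs = centre_grade \<pp> R" "regular_sequence R {\<zero>} xs" "set xs \<subseteq> \<pp>"
    using grade_sequence by metis
  interpret resolved_module R "left_quot R P" by (rule left_quot_resolved[OF P_ideal(1)])
  show ?thesis
    using left_grade_regular_sequence(1)[OF xs(2)] left_quot_annihilated[OF P_ideal(3)] xs by auto
qed

text \<open>The contraction of \<open>Q\<close> is asserted under a condition because it has two
  sources: absence of embedded primes in the Macaulay case, and maximality of \<open>\<pp>\<close>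
  when \<open>P\<close> is maximal.\<close>

lemma exists_prime_with_grade:
  obtains Q where "prime_two_sided R Q" "\<pp> \<subseteq> Q" "left_grade R (left_quot R Q) = enat (centre_grade \<pp> R)"
    "central_chains_bounded R \<Longrightarrow> Q \<inter> centre R = \<pp>"
proof -
  obtain xs where xs: "maximal_regular_sequence R \<pp> xs" "length xs = centre_grade \<pp> R"
    "regular_sequence R {\<zero>} xs" "set xs \<subseteq> \<pp>" "left_ideal R (seq_ideal R {\<zero>} xs)" "seq_ideal R {\<zero>} xs \<subseteq> P"
    using grade_sequence .
  let ?I = "seq_ideal R {\<zero>} xs"
  obtain n where n: "n \<in> carrier R" "n \<notin> ?I" "\<And>z. z \<in> \<pp> \<Longrightarrow> z \<otimes> n \<in> ?I"
    using maximal_regular_sequence_annihilated[OF p_ideal xs(1)] by blast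
  obtain n' where n': "n' \<in> carrier R" "n' \<notin> ?I" "left_annihilator R ?I n \<subseteq> left_annihilator R ?I n'"
    "prime_two_sided R (left_annihilator R ?I n')"
    using exists_prime_left_annihilator[OF xs(5) n(1,2)] .
  let ?Q = "left_annihilator R ?I n'"
  have "\<pp> \<subseteq> central_annihilator R ?I n" using n(3) by (auto simp: central_annihilator_def)
  then have pQ: "\<pp> \<subseteq> ?Q" using n'(3) central_annihilator_eq[OF xs(5) n(1)] by blast
  have QZ: "?Q \<inter> centre R = central_annihilator R ?I n'"
    using central_annihilator_eq[OF xs(5) n'(1)] by blast
  have "left_grade R (left_quot R ?Q) = enat (length xs)"
    using xs(4) pQ n' left_annihilator_annihilates[OF _ n'(1)]
    by (intro left_grade_left_quot_attained[OF prime_two_sidedD(1)[OF n'(4)] xs(3)]) auto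
  moreover have "?Q \<inter> centre R = \<pp>" if "central_chains_bounded R"
    unfolding QZ
  proof (rule no_embedded_primes[OF that xs(3,4) p_prime _ n'(1)])
    show "central_prime R (central_annihilator R ?I n')"
      unfolding QZ[symmetric] by (rule central_prime_Int_centre[OF n'(4)])
    show "\<pp> \<subseteq> central_annihilator R ?I n'" unfolding QZ[symmetric] using pQ by blast
  qed (use xs(6) in blast)
  ultimately show ?thesis using that[OF n'(4) pQ] xs(2) by simp
qed

text \<open>Otherwise some multiple of \<open>n\<close> has a prime annihilator that contains
  \<open>\<pp>\<close> and \<open>z\<close>. Its contraction to the centre would strictly contain
  \<open>\<pp>\<close>, an embedded prime.\<close>

lemma central_cancel:
  assumes cm: "central_chains_bounded R"
    and xs: "regular_sequence R {\<zero>} xs" "set xs \<subseteq> \<pp>"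
    and n: "n \<in> carrier R" "\<And>c. c \<in> \<pp> \<Longrightarrow> c \<otimes> n \<in> seq_ideal R {\<zero>} xs"
    and z: "z \<in> centre R" "z \<notin> P" "z \<otimes> n \<in> seq_ideal R {\<zero>} xs"
  shows "n \<in> seq_ideal R {\<zero>} xs"
proof (rule ccontr)
  let ?I = "seq_ideal R {\<zero>} xs"
  assume "n \<notin> ?I"
  have I: "left_ideal R ?I" using left_ideal_seq_ideal[OF left_ideal_trivial] xs(2) by auto
  have IP: "?I \<subseteq> P"
    by (rule seq_ideal_subset[OF P_ideal(1)]) (use left_idealD(2)[OF P_ideal(1)] xs in auto)
  obtain n' where n': "n' \<in> carrier R" "n' \<notin> ?I" "left_annihilator R ?I n \<subseteq> left_annihilator R ?I n'"
    "prime_two_sided R (left_annihilator R ?I n')"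
    using exists_prime_left_annihilator[OF I n(1) \<open>n \<notin> ?I\<close>] .
  have sub: "central_annihilator R ?I n \<subseteq> central_annihilator R ?I n'"
    using n'(3) central_annihilator_eq[OF I] n(1) n'(1) by auto
  have "central_annihilator R ?I n' = \<pp>"
  proof (rule no_embedded_primes[OF cm xs p_prime _ n'(1)])
    show "central_prime R (central_annihilator R ?I n')"
      using central_prime_Int_centre[OF n'(4)] central_annihilator_eq[OF I n'(1)] by (simp add: Int_commute)
    show "\<pp> \<subseteq> central_annihilator R ?I n'" using sub n(2) by (auto simp: central_annihilator_def)
  qed (use IP in blast)
  moreover have "z \<in> central_annihilator R ?I n'" using sub z by (auto simp: central_annihilator_def)
  ultimately show False using z(2) by blast
qed

lemma p_ideal_centre_ring: "ideal \<pp> (centre_ring R)"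
proof -
  interpret Z: ring "centre_ring R" by (rule centre_ring_ring)
  have "two_sided (centre_ring R) \<pp>"
    using central_idealD[OF p_ideal] central_ideal_mult_right[OF p_ideal]
    unfolding two_sided_def left_ideal_def by (auto simp: centre_ring_def)
  then show ?thesis by (simp add: Z.ideal_iff_two_sided)
qed

lemma Ext_annihilated:
  assumes "z \<in> \<pp>" "e \<in> carrier (Ext R (left_quot R P) (reg_module R) t)"
  shows "z \<odot>\<^bsub>Ext R (left_quot R P) (reg_module R) t\<^esub> e = \<zero>\<^bsub>Ext R (left_quot R P) (reg_module R) t\<^esub>"
proof -
  interpret resolved_module R "left_quot R P" by (rule left_quot_resolved[OF P_ideal(1)])
  show ?thesis
    by (rule annihilator_kills_Ext[OF _ _ assms(2)]) (use assms(1) left_quot_annihilated[OF P_ideal(3)] in auto)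
qed

text \<open>After the shift this is a statement about homomorphisms from R/P to R/I: their values
  are killed by \<open>P\<close>, and \<open>central_cancel\<close> applies to them.\<close>

lemma Ext_torsion_free:
  assumes cm: "central_chains_bounded R" and t: "t = centre_grade \<pp> R"
  shows "torsion_free_module (centre_ring R Quot \<pp>)
    (descend_scalars (Ext R (left_quot R P) (reg_module R) t))"
proof -
  interpret resolved_module R "left_quot R P" by (rule left_quot_resolved[OF P_ideal(1)])
  interpret Z: ring "centre_ring R" by (rule centre_ring_ring)
  interpret q: ideal \<pp> "centre_ring R" by (rule p_ideal_centre_ring)
  interpret ZQ: ring "centre_ring R Quot \<pp>" by (rule q.quotient_is_ring)
  let ?E = "Ext R (left_quot R P) (reg_module R) t"
  obtain xs where xs: "length xs = t" "regular_sequence R {\<zero>} xs" "set xs \<subseteq> \<pp>"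
    "left_ideal R (seq_ideal R {\<zero>} xs)"
    using grade_sequence t by metis
  \<comment> \<open>A failure of injectivity in degree 0 produces a value \<open>n\<close> that is
    killed modulo the sequence by both \<open>z\<close> and \<open>\<pp>\<close>.\<close>
  have inj: "Ext_injective t {\<zero>} z" if z: "z \<in> centre R" "z \<notin> P" for z
  proof -
    have "Ext_injective 0 (seq_ideal R {\<zero>} xs) z"
    proof (rule ccontr)
      assume "\<not> ?thesis"
      then obtain n where n: "n \<in> carrier R" "n \<notin> seq_ideal R {\<zero>} xs" "z \<otimes> n \<in> seq_ideal R {\<zero>} xs"
        "\<And>c. c \<in> carrier R \<Longrightarrow> (\<And>m. m \<in> carrier (left_quot R P) \<Longrightarrow> c \<odot>\<^bsub>left_quot R P\<^esub> m = \<zero>\<^bsub>left_quot R P\<^esub>)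
          \<Longrightarrow> c \<otimes> n \<in> seq_ideal R {\<zero>} xs"
        using not_Ext_injective_0E[OF xs(4) _ z(1)] by blast
      have "c \<otimes> n \<in> seq_ideal R {\<zero>} xs" if "c \<in> \<pp>" for c
        using n(4)[of c] left_quot_annihilated[OF P_ideal(3)] that left_idealD(1)[OF P_ideal(1)] by blast
      then show False using central_cancel[OF cm xs(2,3) n(1) _ z n(3)] n(2) by blast
    qed
    then show ?thesis
      using Ext_injective_regular_sequence[OF left_ideal_zero xs(2) z(1)] left_quot_annihilated[OF P_ideal(3)] xs(1,3)
      by auto
  qed
  note D = descend_scalars_left_module[OF Ext_left_module p_ideal_centre_ring Ext_annihilated]
  have "e = \<zero>\<^bsub>descend_scalars ?E\<^esub>"
    if s: "regular_element (centre_ring R Quot \<pp>) s" and e: "e \<in> carrier (descend_scalars ?E)"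
      and se: "s \<odot>\<^bsub>descend_scalars ?E\<^esub> e = \<zero>\<^bsub>descend_scalars ?E\<^esub>" for s e
  proof -
    have sc: "s \<in> carrier (centre_ring R Quot \<pp>)" using s by (simp add: regular_element_def)
    obtain z where z: "z \<in> s" "z \<in> carrier (centre_ring R)" "s = \<pp> +>\<^bsub>centre_ring R\<^esub> z"
      using Quot_carrier_mem[OF p_ideal_centre_ring sc] .
    have zc: "z \<in> centre R" using z(2) by (simp add: centre_ring_def)
    have ops: "carrier (descend_scalars ?E) = carrier ?E" "zero (descend_scalars ?E) = \<zero>\<^bsub>?E\<^esub>"
      by (simp_all add: descend_scalars_def)
    \<comment> \<open>A regular coset is nonzero because the quotient ring is: 1 is not in
      \<open>P\<close>.\<close>
    have "z \<notin> P"
    proof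
      assume "z \<in> P"
      then have s0: "s = \<zero>\<^bsub>centre_ring R Quot \<pp>\<^esub>"
        using z(3) zc q.a_rcos_const[of z] by (simp add: FactRing_def)
      then have "\<one>\<^bsub>centre_ring R Quot \<pp>\<^esub> = \<zero>\<^bsub>centre_ring R Quot \<pp>\<^esub>"
        using s unfolding regular_element_def by (metis ZQ.l_null ZQ.one_closed)
      then have "\<pp> +>\<^bsub>centre_ring R\<^esub> \<one>\<^bsub>centre_ring R\<^esub> = \<pp>" by (simp add: FactRing_def)
      then have "\<one>\<^bsub>centre_ring R\<^esub> \<in> \<pp>" using q.a_rcos_self[OF Z.one_closed] by simp
      then show False using P_ideal(2) by (simp add: centre_ring_def)
    qed
    have ann: "c \<odot>\<^bsub>?E\<^esub> e' = \<zero>\<^bsub>?E\<^esub>" if "c \<in> \<pp>" "e' \<in> carrier ?E" for c e'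
      using Ext_annihilated that by blast
    have "s \<odot>\<^bsub>descend_scalars ?E\<^esub> e = z \<odot>\<^bsub>?E\<^esub> e"
      by (rule descend_scalars_smult[OF Ext_left_module p_ideal_centre_ring ann sc z(1)]) (use e ops in auto)
    then show ?thesis
      using Ext_injective_smult[OF inj[OF zc \<open>z \<notin> P\<close>] zc] e se ops by simp
  qed
  then show ?thesis unfolding torsion_free_module_def using D by blast
qed

end

section \<open>Essential left ideals modulo a prime\<close>

context ring
begin

lemma left_ideal_residual:
  assumes "left_ideal R I" "c \<in> carrier R" shows "left_ideal R {r \<in> carrier R. r \<otimes> c \<in> I}"
  using left_idealD[OF assms(1)] assms(2) by (auto simp: left_ideal_def l_distr m_assoc)

text \<open>The one place where right ideals are used: Utumi's argument needs the maximal condition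
  for right annihilators.\<close>

lemma right_ideal_residual:
  assumes "two_sided R I" "a \<in> carrier R" shows "left_ideal (opp_ring R) {y \<in> carrier R. a \<otimes> y \<in> I}"
proof -
  note Id = left_idealD[OF two_sidedD(1)[OF assms(1)]]
  have "a \<otimes> (y \<otimes> r) \<in> I" if "a \<otimes> y \<in> I" "y \<in> carrier R" "r \<in> carrier R" for y r
    using two_sidedD(2)[OF assms(1) that(1,3)] that assms(2) by (simp add: m_assoc)
  then show ?thesis
    using Id assms(2) by (auto simp: left_ideal_def opp_ring_def r_distr)
qed

text \<open>Linear dependence over the domain \<open>centre R / (Q \<inter> centre R)\<close>, by elimination.\<close>

lemma central_dependence:
  assumes Q: "prime_two_sided R Q"
    and "finite G" "G \<subseteq> carrier R" "\<And>i::nat. v i \<in> central_span R (centre R) G"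
  shows "\<exists>N\<le>card G. \<exists>z\<in>centre R. z \<notin> Q \<and>
    (\<forall>L. left_ideal R L \<longrightarrow> Q \<subseteq> L \<longrightarrow> (\<forall>i<N. v i \<in> L) \<longrightarrow> z \<otimes> v N \<in> L)"
  using assms(2-)
\<comment> \<open>That every left ideal above \<open>Q\<close> containing the earlier vectors also
  contains \<open>z v N\<close> expresses dependence modulo \<open>Q\<close> without coefficients;
  elimination then consists of membership arguments.\<close>
proof (induction G arbitrary: v rule: finite_induct)
  case empty
  have "v 0 = \<zero>"
    using empty.prems(2)[of 0] by (cases rule: central_span.cases) auto
  then have "\<one> \<otimes> v 0 \<in> L" if "left_ideal R L" for L using left_idealD(2)[OF that] by simp
  then show ?case using centre_one prime_two_sidedD(3)[OF Q] by auto
next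
  case (insert a G)
  note C = central_ideal_centre and Qd = prime_two_sidedD[OF Q] and Ql = left_idealD[OF prime_two_sidedD(2)[OF Q]]
  have G: "G \<subseteq> carrier R" "a \<in> carrier R" using insert.prems by auto
  note sc = central_span_closed[OF C G(1)]
  have "\<forall>i. \<exists>c w. c \<in> centre R \<and> w \<in> central_span R (centre R) G \<and> v i = c \<otimes> a \<oplus> w"
    using central_span_insertD[OF C insert.prems(1) insert.prems(2)] by metis
  then obtain c w where cw: "\<And>i. c i \<in> centre R" "\<And>i. w i \<in> central_span R (centre R) G" "\<And>i. v i = c i \<otimes> a \<oplus> w i"
    by metis
  note cc = centreD(1)[OF cw(1)] and wc = sc[OF cw(2)]
  have vc: "v i \<in> carrier R" for i using cw(3) cc wc G by simp
  show ?case
  proof (cases "\<forall>i\<le>card G. c i \<in> Q")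
    \<comment> \<open>No vector involves \<open>a\<close> modulo \<open>Q\<close>, so the vectors
      may be replaced by their components \<open>w i\<close> in the span of
      \<open>G\<close>.\<close>
    case True
    obtain N z where N: "N \<le> card G" "z \<in> centre R" "z \<notin> Q"
      "\<And>L. left_ideal R L \<Longrightarrow> Q \<subseteq> L \<Longrightarrow> (\<forall>i<N. w i \<in> L) \<Longrightarrow> z \<otimes> w N \<in> L"
      using insert.IH[OF G(1), of w] cw(2) by blast
    have iff: "v i \<in> L \<longleftrightarrow> w i \<in> L" if L: "left_ideal R L" "Q \<subseteq> L" and i: "i \<le> N" for i L
    proof (rule left_ideal_cancel[OF L(1) _ vc wc])
      have "v i \<ominus> w i = c i \<otimes> a" unfolding cw(3) using cc wc G by algebra
      moreover have "c i \<otimes> a \<in> Q" using two_sidedD(2)[OF Qd(1) _ G(2)] True i N(1) by auto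
      ultimately show "v i \<ominus> w i \<in> L" using L(2) by auto
    qed
    have "z \<otimes> v N \<in> L" if L: "left_ideal R L" "Q \<subseteq> L" "\<forall>i<N. v i \<in> L" for L
    proof -
      note zc = centreD(1)[OF N(2)]
      have "z \<otimes> w N \<in> L" using N(4)[OF L(1,2)] L iff by auto
      moreover have "z \<otimes> (c N \<otimes> a) \<in> L"
        using L(2) Ql(4)[OF zc two_sidedD(2)[OF Qd(1) _ G(2)]] True N(1) by blast
      ultimately show ?thesis
        using left_idealD(3)[OF L(1)] zc cc wc G by (simp add: cw(3) r_distr)
    qed
    then show ?thesis using N insert.hyps by (intro exI[of _ N]) auto
  next
    case False
    \<comment> \<open>The pivot: the first vector whose coefficient at \<open>a\<close> is nonzero
      modulo \<open>Q\<close>. Its position is at most \<open>card G\<close>, which keeps the final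
      index within bounds.\<close>
    define j where "j = (LEAST i. c i \<notin> Q)"
    have jQ: "c j \<notin> Q" and jle: "j \<le> card G" and jless: "\<And>i. i < j \<Longrightarrow> c i \<in> Q"
      using False LeastI_ex[of "\<lambda>i. c i \<notin> Q"] Least_le[of "\<lambda>i. c i \<notin> Q"] not_less_Least[of _ "\<lambda>i. c i \<notin> Q"]
      unfolding j_def by (blast, meson order_trans, blast)
    \<comment> \<open>Enumerates the indices other than \<open>j\<close>; the vectors
      \<open>u i\<close> are the remaining ones with \<open>a\<close> eliminated by the
      pivot.\<close>
    define \<sigma> where "\<sigma> i = (if i < j then i else Suc i)" for i
    define u where "u i = c j \<otimes> v (\<sigma> i) \<ominus> c (\<sigma> i) \<otimes> v j" for i
    have "u i \<in> central_span R (centre R) G" for i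
    proof -
      let ?k = "\<sigma> i"
      have comm: "c j \<otimes> (c ?k \<otimes> a) = c ?k \<otimes> (c j \<otimes> a)" using central_lcomm[OF cw(1) cc G(2)] .
      have "u i = c j \<otimes> (c ?k \<otimes> a) \<oplus> c j \<otimes> w ?k \<ominus> (c ?k \<otimes> (c j \<otimes> a) \<oplus> c ?k \<otimes> w j)"
        unfolding u_def cw(3) using cc wc G by (simp add: r_distr)
      also have "\<dots> = c j \<otimes> w ?k \<oplus> (\<ominus> c ?k) \<otimes> w j"
        unfolding comm using cc wc G by algebra
      finally show ?thesis
        using central_span_add[OF C G(1)] central_span_centre_mult[OF C G(1)] cw(1,2) centre_uminus by simp
    qed
    then obtain N z where N: "N \<le> card G" "z \<in> centre R" "z \<notin> Q"
      "\<And>L. left_ideal R L \<Longrightarrow> Q \<subseteq> L \<Longrightarrow> (\<forall>i<N. u i \<in> L) \<Longrightarrow> z \<otimes> u N \<in> L"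
      using insert.IH[OF G(1), of u] by blast
    note zc = centreD(1)[OF N(2)]
    let ?M = "\<sigma> N"
    have "(z \<otimes> c j) \<otimes> v ?M \<in> L" if L: "left_ideal R L" "Q \<subseteq> L" "\<forall>i<?M. v i \<in> L" for L
    proof -
      note Ld = left_idealD[OF L(1)]
      \<comment> \<open>If the dependent index precedes the pivot, all coefficients involved are in
        \<open>Q\<close>; if it comes later, the pivot vector is among the earlier ones and thus in
        \<open>L\<close>.\<close>
      have cv: "c i \<otimes> v j \<in> L" if "i < ?M \<or> i = ?M" for i
      proof (cases "N < j")
        case True
        then have "i < j" using that by (auto simp: \<sigma>_def)
        then have "c i \<otimes> v j \<in> Q" using two_sidedD(2)[OF Qd(1) jless vc] by simp
        then show ?thesis using L(2) by blast
      next
        case False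
        then have "v j \<in> L" using L(3) by (simp add: \<sigma>_def)
        then show ?thesis using Ld(4) cc by simp
      qed
      have "u i \<in> L" if "i < N" for i
      proof -
        have "\<sigma> i < ?M" using that by (auto simp: \<sigma>_def)
        then show ?thesis unfolding u_def using left_ideal_minus[OF L(1)] Ld(4)[OF cc] L(3) cv by simp
      qed
      then have zu: "z \<otimes> u N \<in> L" using N(4)[OF L(1,2)] by simp
      have "(z \<otimes> c j) \<otimes> v ?M = z \<otimes> u N \<oplus> z \<otimes> (c ?M \<otimes> v j)"
        unfolding u_def using zc cc vc by algebra
      then show ?thesis using Ld(3)[OF zu Ld(4)[OF zc cv]] by simp
    qed
    moreover have "z \<otimes> c j \<notin> Q" using prime_central_mult[OF Q N(2,3) cc] jQ by blast
    moreover have "?M \<le> card (insert a G)" using N(1) insert.hyps by (auto simp: \<sigma>_def)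
    ultimately show ?thesis using centre_mult[OF N(2) cw(1)] by blast
  qed
qed

end

section \<open>Levitzki's and Goldie's theorems modulo P\<close>

context prime_of_central_finite
begin

lemma right_ideal_maximal:
  assumes "\<F> \<noteq> {}" "\<And>L. L \<in> \<F> \<Longrightarrow> left_ideal (opp_ring R) L"
  shows "\<exists>L\<in>\<F>. \<forall>L'\<in>\<F>. L \<subseteq> L' \<longrightarrow> L' = L"
proof -
  interpret O: ring "opp_ring R" by (rule ring_opp_ring[OF ring_axioms])
  show ?thesis
    using noeth assms O.left_ideal_submodule
    by (intro noetherian_module_maximal[of "opp_ring R" "reg_module (opp_ring R)"]) (auto simp: noetherian_def)
qed

text \<open>Levitzki's theorem modulo \<open>P\<close>, by Utumi's argument.\<close>

lemma exists_non_nilpotent: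
  assumes L: "left_ideal R L" and b: "b \<in> L" "b \<notin> P"
  shows "\<exists>a\<in>L. \<forall>k::nat. a [^] k \<notin> P"
proof (rule ccontr)
  note Ld = left_idealD[OF L] and Pd = left_idealD[OF P_ideal(1)]
  assume "\<not> ?thesis"
  then have nil: "\<exists>k::nat. a [^] k \<in> P" if "a \<in> L" for a using that by blast
  \<comment> \<open>The right annihilator of \<open>a\<close> modulo \<open>P\<close>. The element
    of \<open>L\<close> outside \<open>P\<close> is chosen with this as large as possible, and then
    aRa is shown to lie in \<open>P\<close>.\<close>
  let ?r = "\<lambda>a. {y \<in> carrier R. a \<otimes> y \<in> P}"
  have "\<exists>K\<in>?r ` (L - P). \<forall>K'\<in>?r ` (L - P). K \<subseteq> K' \<longrightarrow> K' = K"
    using b right_ideal_residual[OF P_ideal(3)] Ld(1) by (intro right_ideal_maximal) auto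
  then obtain a where a: "a \<in> L" "a \<notin> P" and max: "\<And>a'. a' \<in> L \<Longrightarrow> a' \<notin> P \<Longrightarrow> ?r a \<subseteq> ?r a' \<Longrightarrow> ?r a' = ?r a"
    by auto
  have ac: "a \<in> carrier R" using Ld(1) a by blast
  have "a \<otimes> (r \<otimes> a) \<in> P" if r: "r \<in> carrier R" for r
  proof (cases "r \<otimes> a \<in> P")
    case True then show ?thesis using Pd(4)[OF ac] by blast
  next
    case False
    define b where "b = r \<otimes> a"
    have bL: "b \<in> L" and bc: "b \<in> carrier R" using Ld(4)[OF r a(1)] ac r by (auto simp: b_def)
    \<comment> \<open>For the nil element \<open>b = r a\<close>, the power just below the one that
      falls into \<open>P\<close> is a left multiple of \<open>a\<close>. Its right annihilator
      contains that of \<open>a\<close> and also \<open>b\<close>; by maximality \<open>b\<close>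
      annihilates \<open>a\<close> already.\<close>
    define k :: nat where "k = (LEAST k. b [^] k \<in> P)"
    have k: "b [^] k \<in> P" "\<And>i. i < k \<Longrightarrow> b [^] i \<notin> P"
      using LeastI_ex[OF nil[OF bL]] not_less_Least[of _ "\<lambda>k. b [^] k \<in> P"] by (auto simp: k_def)
    have "k \<noteq> 0" using k(1) P_ideal(2) by (intro notI) simp
    moreover have "k \<noteq> 1" using k(1) False bc by (intro notI) (simp add: b_def)
    ultimately obtain i where i: "k = Suc (Suc i)" by (metis One_nat_def not0_implies_Suc)
    define e where "e = b [^] Suc i"
    have e: "e = (b [^] i \<otimes> r) \<otimes> a" using bc r ac by (simp add: e_def b_def m_assoc)
    have eL: "e \<in> L" unfolding e using Ld(4) a(1) bc r by simp
    have eP: "e \<notin> P" using k(2)[of "Suc i"] i by (simp add: e_def)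
    have "?r a \<subseteq> ?r e"
    proof
      fix y assume "y \<in> ?r a"
      then have y: "y \<in> carrier R" "a \<otimes> y \<in> P" by auto
      have "e \<otimes> y = (b [^] i \<otimes> r) \<otimes> (a \<otimes> y)" unfolding e using bc r ac y by (simp add: m_assoc)
      then show "y \<in> ?r e" using Pd(4)[OF _ y(2), of "b [^] i \<otimes> r"] bc r y by simp
    qed
    moreover have "b \<in> ?r e" using k(1) bc by (simp add: i e_def)
    ultimately have "b \<in> ?r a" using max[OF eL eP] by blast
    then show ?thesis by (simp add: b_def)
  qed
  then show False using prime_two_sidedD(4)[OF P ac ac] a(2) by blast
qed

text \<open>The left annihilators of the powers of a non-nilpotent element become stationary; a
  sufficiently high power and its square then have the same left annihilator.\<close>

lemma exists_stable_element:
  assumes L: "left_ideal R L" and b: "b \<in> L" "b \<notin> P"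
  obtains a where "a \<in> L" "a \<notin> P" "\<And>r. r \<in> carrier R \<Longrightarrow> r \<otimes> (a \<otimes> a) \<in> P \<Longrightarrow> r \<otimes> a \<in> P"
proof -
  note Ld = left_idealD[OF L] and Pd = left_idealD[OF P_ideal(1)]
  obtain a where a: "a \<in> L" "\<And>k::nat. a [^] k \<notin> P" using exists_non_nilpotent[OF L b] by blast
  have ac: "a \<in> carrier R" using Ld(1) a by blast
  let ?l = "\<lambda>k::nat. {r \<in> carrier R. r \<otimes> a [^] Suc k \<in> P}"
  have "\<exists>K\<in>range ?l. \<forall>K'\<in>range ?l. K \<subseteq> K' \<longrightarrow> K' = K"
    using left_ideal_residual[OF P_ideal(1)] ac by (intro left_ideal_maximal) auto
  then obtain k where k: "\<And>i. ?l k \<subseteq> ?l i \<Longrightarrow> ?l i = ?l k" by auto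
  define c where "c = a [^] Suc k"
  have cc: "c \<in> carrier R" using ac by (simp add: c_def)
  \<comment> \<open>The exponents in \<open>?l\<close> are shifted by one, so the square of
    \<open>c\<close> has index \<open>Suc k + k\<close>.\<close>
  have cc2: "c \<otimes> c = a [^] Suc (Suc k + k)"
    unfolding c_def using ac nat_pow_mult[of a "Suc k" "Suc k"] by simp
  have "?l k \<subseteq> ?l (Suc k + k)"
  proof
    fix r assume "r \<in> ?l k"
    then have r: "r \<in> carrier R" "r \<otimes> c \<in> P" by (auto simp: c_def)
    have "(r \<otimes> c) \<otimes> c \<in> P" using two_sidedD(2)[OF P_ideal(3) r(2) cc] .
    then have "r \<otimes> (c \<otimes> c) \<in> P" using r cc by (simp add: m_assoc)
    then show "r \<in> ?l (Suc k + k)" using r(1) by (simp only: cc2 mem_Collect_eq simp_thms)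
  qed
  then have eq: "?l (Suc k + k) = ?l k" by (rule k)
  show ?thesis
  proof (rule that)
    have "c = a [^] k \<otimes> a" by (simp add: c_def)
    then show "c \<in> L" using Ld(4) a(1) ac by simp
    show "c \<notin> P" unfolding c_def by (rule a(2))
    fix r assume r: "r \<in> carrier R" "r \<otimes> (c \<otimes> c) \<in> P"
    then have "r \<in> ?l (Suc k + k)" by (simp only: cc2 mem_Collect_eq simp_thms)
    then show "r \<otimes> c \<in> P" unfolding eq by (simp add: c_def)
  qed
qed

text \<open>Goldie's theorem modulo \<open>P\<close>: \<open>c\<close> is a sum of elements \<open>a\<close> such that \<open>a\<close> and \<open>a\<^sup>2\<close> have the same left
  annihilator and the left ideals \<open>Ra\<close> are independent; \<open>W\<close> is the sum of these left ideals.\<close>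

lemma essential_left_regular:
  assumes E: "left_ideal R E" "P \<subseteq> E"
    and ess: "\<And>D. left_ideal R D \<Longrightarrow> P \<subseteq> D \<Longrightarrow> D \<inter> E \<subseteq> P \<Longrightarrow> D \<subseteq> P"
  obtains c where "c \<in> E" "\<And>r. r \<in> carrier R \<Longrightarrow> r \<otimes> c \<in> P \<Longrightarrow> r \<in> P"
proof -
  note Ed = left_idealD[OF E(1)] and Pd = left_idealD[OF P_ideal(1)]
  \<comment> \<open>The partial sums of the construction, each recorded with an element
    \<open>c\<close> that has no left annihilator inside it modulo \<open>P\<close>. The trivial
    start is \<open>P\<close> itself.\<close>
  define \<F> where "\<F> = {W. left_ideal R W \<and> P \<subseteq> W \<and> W \<subseteq> E \<and> (\<exists>c\<in>W. \<forall>w\<in>W. w \<otimes> c \<in> P \<longrightarrow> w \<in> P)}"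
  have "P \<in> \<F>" using P_ideal(1) E(2) Pd(2) unfolding \<F>_def by auto
  then have "\<exists>W\<in>\<F>. \<forall>W'\<in>\<F>. W \<subseteq> W' \<longrightarrow> W' = W"
    by (intro left_ideal_maximal) (auto simp: \<F>_def)
  then obtain W where WF: "W \<in> \<F>" and max: "\<And>W'. W' \<in> \<F> \<Longrightarrow> W \<subseteq> W' \<Longrightarrow> W' = W" by blast
  then obtain c where W: "left_ideal R W" "P \<subseteq> W" "W \<subseteq> E" and c: "c \<in> W" "\<And>w. w \<in> W \<Longrightarrow> w \<otimes> c \<in> P \<Longrightarrow> w \<in> P"
    unfolding \<F>_def by blast
  note Wd = left_idealD[OF W(1)]
  have cc: "c \<in> carrier R" using Wd(1) c(1) .
  let ?l = "{r \<in> carrier R. r \<otimes> c \<in> P}"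
  have l: "left_ideal R ?l" by (rule left_ideal_residual[OF P_ideal(1) cc])
  have Pl: "P \<subseteq> ?l" using two_sidedD(2)[OF P_ideal(3) _ cc] Pd(1) by auto
  have "?l \<inter> E \<subseteq> P"
  proof (rule ccontr)
    assume "\<not> ?thesis"
    then obtain b where b: "b \<in> ?l \<inter> E" "b \<notin> P" by blast
    have lE: "left_ideal R (?l \<inter> E)" using left_idealD[OF l] Ed by (auto simp: left_ideal_def)
    obtain a where a: "a \<in> ?l \<inter> E" "a \<notin> P" "\<And>r. r \<in> carrier R \<Longrightarrow> r \<otimes> (a \<otimes> a) \<in> P \<Longrightarrow> r \<otimes> a \<in> P"
      using exists_stable_element[OF lE b] by blast
    have ac: "a \<in> carrier R" "a \<otimes> c \<in> P" "a \<in> E" using a(1) by auto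
    \<comment> \<open>A nonzero left annihilator of \<open>c\<close> inside \<open>E\<close>
      supplies the next summand Ra, and \<open>c \<oplus> a\<close> takes over the role of
      \<open>c\<close>.\<close>
    define W' where "W' = adjoin R W a"
    note W'L = adjoin(1)[OF W(1) ac(1), folded W'_def] and WW' = adjoin(2)[OF W(1) ac(1), folded W'_def]
      and aW' = adjoin(3)[OF W(1) ac(1), folded W'_def]
    have W'E: "W' \<subseteq> E" using W(3) Ed(3,4) ac by (auto simp: W'_def adjoin_def)
    have "x \<in> P" if x: "x \<in> W'" "x \<otimes> (c \<oplus> a) \<in> P" for x
    proof -
      obtain w r where wr: "w \<in> W" "r \<in> carrier R" "x = w \<oplus> r \<otimes> a" using x(1) by (auto simp: W'_def adjoin_def)
      have wc: "w \<in> carrier R" and xc: "x \<in> carrier R" using wr Wd(1) ac by auto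
      have 1: "x \<otimes> (c \<oplus> a) \<otimes> c \<in> P" using two_sidedD(2)[OF P_ideal(3) x(2) cc] .
      have 2: "x \<otimes> (a \<otimes> c) \<in> P" "r \<otimes> (a \<otimes> c) \<in> P" "(r \<otimes> (a \<otimes> c)) \<otimes> c \<in> P"
        using Pd(4)[OF _ ac(2)] xc wr(2) two_sidedD(2)[OF P_ideal(3) _ cc] by auto
      \<comment> \<open>Multiplying by \<open>c\<close> on the right removes the terms with
        \<open>a c\<close>, which lie in \<open>P\<close>. What is left is \<open>w c c\<close>, and
        the property of \<open>c\<close> is applied twice to obtain \<open>w\<close> in
        \<open>P\<close>; then \<open>r a a\<close> lies in \<open>P\<close>, and \<open>a\<close>
        is stable.\<close>
      have "(w \<otimes> c) \<otimes> c = x \<otimes> (c \<oplus> a) \<otimes> c \<ominus> x \<otimes> (a \<otimes> c) \<ominus> (r \<otimes> (a \<otimes> c)) \<otimes> c"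
        unfolding wr(3) using wc wr(2) cc ac(1) by algebra
      then have "(w \<otimes> c) \<otimes> c \<in> P"
        using left_ideal_minus[OF P_ideal(1) left_ideal_minus[OF P_ideal(1) 1 2(1)] 2(3)] by simp
      then have wP: "w \<in> P" using c(2)[OF wr(1)] c(2)[OF Wd(4)[OF wc c(1)]] by blast
      have 3: "w \<otimes> (c \<oplus> a) \<in> P" using two_sidedD(2)[OF P_ideal(3) wP] cc ac by simp
      have "r \<otimes> (a \<otimes> a) = x \<otimes> (c \<oplus> a) \<ominus> w \<otimes> (c \<oplus> a) \<ominus> r \<otimes> (a \<otimes> c)"
        unfolding wr(3) using wc wr(2) cc ac(1) by algebra
      then have "r \<otimes> (a \<otimes> a) \<in> P"
        using left_ideal_minus[OF P_ideal(1) left_ideal_minus[OF P_ideal(1) x(2) 3] 2(2)] by simp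
      then have "r \<otimes> a \<in> P" using a(3)[OF wr(2)] by simp
      then show ?thesis using Pd(3)[OF wP] wr(3) by simp
    qed
    moreover have "c \<oplus> a \<in> W'" using left_idealD(3)[OF W'L _ aW'] WW' c(1) by blast
    ultimately have "W' \<in> \<F>" using W'L W'E W(2) WW' unfolding \<F>_def by blast
    then have "a \<in> W" using max[OF _ WW'] aW' by blast
    then show False using c(2) ac(2) a(2) by blast
  qed
  then have "?l \<subseteq> P" using ess[OF l Pl] by blast
  then show ?thesis using that[of c] c(1) W(3) by blast
qed

text \<open>The powers of a left regular element are dependent over the centre modulo \<open>P\<close>; cancelling the
  element leaves a central element in the left ideal that it generates.\<close>

lemma essential_contains_central:
  assumes E: "left_ideal R E" "P \<subseteq> E"
    and ess: "\<And>D. left_ideal R D \<Longrightarrow> P \<subseteq> D \<Longrightarrow> D \<inter> E \<subseteq> P \<Longrightarrow> D \<subseteq> P"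
  obtains z where "z \<in> centre R" "z \<in> E" "z \<notin> P"
proof -
  note Ed = left_idealD[OF E(1)] and Pd = left_idealD[OF P_ideal(1)]
  obtain c where c: "c \<in> E" "\<And>r. r \<in> carrier R \<Longrightarrow> r \<otimes> c \<in> P \<Longrightarrow> r \<in> P"
    using essential_left_regular[OF E ess] by blast
  have cc: "c \<in> carrier R" using Ed(1) c(1) .
  have cancel: "r \<in> P" if "r \<in> carrier R" "r \<otimes> c [^] k \<in> P" for r and k :: nat
    using that
  proof (induction k arbitrary: r)
    case (Suc k)
    have "(r \<otimes> c [^] k) \<otimes> c \<in> P" using Suc.prems cc by (simp add: m_assoc)
    then have "r \<otimes> c [^] k \<in> P" using c(2)[of "r \<otimes> c [^] k"] Suc.prems(1) cc by simp
    then show ?case by (rule Suc.IH[OF Suc.prems(1)])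
  qed (use that in simp)
  \<comment> \<open>These are \<open>card gens + 1\<close> powers in a module with
    \<open>card gens\<close> generators. The exponents descend, so a power dependent on earlier ones
    is expressed through higher powers.\<close>
  let ?v = "\<lambda>i. c [^] (card gens - i)"
  have "?v i \<in> central_span R (centre R) gens" for i unfolding gens(3)[symmetric] using cc by simp
  then obtain N z where N: "N \<le> card gens" "z \<in> centre R" "z \<notin> P"
    "\<And>L. left_ideal R L \<Longrightarrow> P \<subseteq> L \<Longrightarrow> (\<forall>i<N. ?v i \<in> L) \<Longrightarrow> z \<otimes> ?v N \<in> L"
    using central_dependence[OF P gens(1,2), of ?v] by blast
  note zc = centreD(1)[OF N(2)]
  define k where "k = card gens - N"
  define L where "L = adjoin R P (c [^] Suc k)"
  have pc: "c [^] i \<in> carrier R" for i :: nat using cc by simp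
  note LL = adjoin(1)[OF P_ideal(1) pc[of "Suc k"], folded L_def] and PL = adjoin(2)[OF P_ideal(1) pc[of "Suc k"], folded L_def]
  have "?v i \<in> L" if "i < N" for i
  proof -
    obtain e where e: "card gens - i = e + Suc k" using \<open>i < N\<close> N(1) unfolding k_def
      by (metis Suc_leI add.commute diff_le_mono2 le_Suc_ex Suc_diff_Suc less_le_trans diff_less_mono2)
    have "?v i = \<zero> \<oplus> c [^] e \<otimes> c [^] Suc k"
      unfolding e using nat_pow_mult[OF cc, of e "Suc k"] pc[of "e + Suc k"] by (simp del: nat_pow_Suc)
    then show ?thesis using Pd(2) pc unfolding L_def adjoin_def by blast
  qed
  then have "z \<otimes> c [^] k \<in> L" using N(4)[OF LL PL] by (simp add: k_def)
  then obtain x r where xr: "x \<in> P" "r \<in> carrier R" "z \<otimes> c [^] k = x \<oplus> r \<otimes> c [^] Suc k" unfolding L_def adjoin_def by blast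
  have xc: "x \<in> carrier R" using Pd(1) xr by blast
  \<comment> \<open>Cancelling \<open>c [^] k\<close> on the right leaves \<open>z\<close> congruent
    to \<open>r c\<close> modulo \<open>P\<close>, and \<open>r c\<close> lies in
    \<open>E\<close>.\<close>
  have "(z \<ominus> r \<otimes> c) \<otimes> c [^] k = x"
  proof -
    have "r \<otimes> c [^] Suc k = (r \<otimes> c) \<otimes> c [^] k"
      using nat_pow_Suc2[OF cc, of k] xr(2) cc pc by (simp add: m_assoc)
    then have "(z \<ominus> r \<otimes> c) \<otimes> c [^] k = (x \<oplus> (r \<otimes> c) \<otimes> c [^] k) \<ominus> (r \<otimes> c) \<otimes> c [^] k"
      using xr zc cc pc[of k] by (metis l_minus l_distr a_minus_def a_inv_closed m_closed)
    also have "\<dots> = x" using xc xr(2) cc pc[of k] by algebra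
    finally show ?thesis .
  qed
  then have "z \<ominus> r \<otimes> c \<in> P" using cancel[of "z \<ominus> r \<otimes> c" k] xr zc cc by simp
  then have "(z \<ominus> r \<otimes> c) \<oplus> r \<otimes> c \<in> E" using Ed(3) Ed(4)[OF xr(2) c(1)] E(2) by blast
  moreover have "(z \<ominus> r \<otimes> c) \<oplus> r \<otimes> c = z" using zc xr(2) cc by algebra
  ultimately have "z \<in> E" by simp
  then show ?thesis using that N(2,3) by blast
qed

text \<open>A nonzero two-sided ideal is essential modulo a prime: eRd lies in the intersection of
  \<open>D\<close> and \<open>E\<close>, so if that is inside \<open>P\<close>, primeness forces
  \<open>d\<close> into \<open>P\<close>.\<close>

lemma two_sided_contains_central:
  assumes E: "two_sided R E" "P \<subseteq> E" "e \<in> E" "e \<notin> P"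
  obtains z where "z \<in> centre R" "z \<in> E" "z \<notin> P"
proof (rule essential_contains_central[OF two_sidedD(1)[OF E(1)] E(2)])
  note Ed = left_idealD[OF two_sidedD(1)[OF E(1)]]
  fix D assume D: "left_ideal R D" "P \<subseteq> D" "D \<inter> E \<subseteq> P"
  note Dd = left_idealD[OF D(1)]
  show "D \<subseteq> P"
  proof
    fix d assume d: "d \<in> D"
    have dc: "d \<in> carrier R" and ec: "e \<in> carrier R" using Dd(1) d Ed(1) E(3) by auto
    have "e \<otimes> (r \<otimes> d) \<in> P" if r: "r \<in> carrier R" for r
    proof -
      have "e \<otimes> (r \<otimes> d) \<in> E" using two_sidedD(2)[OF E(1,3)] r dc by simp
      moreover have "e \<otimes> (r \<otimes> d) \<in> D" using Dd(4)[OF ec Dd(4)[OF r d]] .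
      ultimately show ?thesis using D(3) by blast
    qed
    then show "d \<in> P" using prime_two_sidedD(4)[OF P ec dc] E(4) by blast
  qed
qed (rule that)

text \<open>An ideal strictly above \<open>P\<close> contains a central element outside
  \<open>P\<close>, so its contraction to the centre is strictly larger than
  \<open>\<pp>\<close>.\<close>

lemma maximal_if_centre_maximal:
  assumes "\<And>D. central_ideal R D \<Longrightarrow> \<pp> \<subseteq> D \<Longrightarrow> \<one> \<notin> D \<Longrightarrow> D = \<pp>"
  shows "maximalideal P R"
proof (rule maximalidealI)
  show "ideal P R" using P_ideal(3) by (simp add: ideal_iff_two_sided)
  show "carrier R \<noteq> P" using P_ideal(2) by auto
  fix J assume J: "ideal J R" "P \<subseteq> J" "J \<subseteq> carrier R"
  then have T: "two_sided R J" by (simp add: ideal_iff_two_sided)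
  show "J = P \<or> J = carrier R"
  proof (rule disjCI)
    assume nJ: "J \<noteq> carrier R"
    then have 1: "\<one> \<notin> J" using left_ideal_one[OF two_sidedD(1)[OF T]] by blast
    show "J = P"
    proof (rule ccontr)
      assume "J \<noteq> P"
      then obtain e where "e \<in> J" "e \<notin> P" using J(2) by blast
      then obtain z where z: "z \<in> centre R" "z \<in> J" "z \<notin> P" using two_sided_contains_central[OF T J(2)] by blast
      have "J \<inter> centre R = \<pp>"
        by (rule assms) (use central_ideal_Int_centre[OF two_sidedD(1)[OF T]] J(2) 1 in auto)
      then show False using z by blast
    qed
  qed
qed

text \<open>For a maximal ideal \<open>m\<close> of the centre above \<open>D\<close> the sum P + mR
  is proper by \<open>extension_proper\<close> for the left ideal \<open>P\<close>. Maximality makes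
  it equal to \<open>P\<close>, so \<open>m\<close> contracts into \<open>\<pp>\<close>.\<close>

lemma centre_maximal_if_maximal:
  assumes max: "maximalideal P R" and D: "central_ideal R D" "\<pp> \<subseteq> D" "\<one> \<notin> D"
  shows "D = \<pp>"
proof -
  obtain m where m: "central_prime R m" "D \<subseteq> m" using exists_maximal_central_ideal[OF D(1,3)] by blast
  note mi = central_primeD(1)[OF m(1)]
  note T = two_sided_extension[OF mi]
  note Td = left_idealD[OF two_sidedD(1)[OF T]] and Pd = left_idealD[OF P_ideal(1)]
  define J where "J = {x \<oplus> y | x y. x \<in> P \<and> y \<in> extension m}"
  have "two_sided R J"
    unfolding two_sided_def left_ideal_def
  proof (intro conjI ballI)
    show "J \<subseteq> carrier R" using Pd(1) Td(1) by (auto simp: J_def)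
    have "\<zero> = \<zero> \<oplus> \<zero>" by simp
    then show "\<zero> \<in> J" using Pd(2) Td(2) unfolding J_def by blast
    fix a assume "a \<in> J"
    then obtain x y where a: "x \<in> P" "y \<in> extension m" "a = x \<oplus> y" by (auto simp: J_def)
    note ac = Pd(1)[OF a(1)] Td(1)[OF a(2)]
    { fix b assume "b \<in> J"
      then obtain v w where b: "v \<in> P" "w \<in> extension m" "b = v \<oplus> w" by (auto simp: J_def)
      have "a \<oplus> b = (x \<oplus> v) \<oplus> (y \<oplus> w)" using a b Pd(1) Td(1) by (simp add: a_ac)
      then show "a \<oplus> b \<in> J" using Pd(3)[OF a(1) b(1)] Td(3)[OF a(2) b(2)] unfolding J_def by blast
    next
      fix r assume r: "r \<in> carrier R"
      have "r \<otimes> a = r \<otimes> x \<oplus> r \<otimes> y" using a r ac by (simp add: r_distr)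
      then show "r \<otimes> a \<in> J" using Pd(4)[OF r a(1)] Td(4)[OF r a(2)] unfolding J_def by blast
      have "a \<otimes> r = x \<otimes> r \<oplus> y \<otimes> r" using a r ac by (simp add: l_distr)
      then show "a \<otimes> r \<in> J"
        using two_sidedD(2)[OF P_ideal(3) a(1) r] two_sidedD(2)[OF T a(2) r] unfolding J_def by blast }
  qed
  then have J: "ideal J R" by (simp add: ideal_iff_two_sided)
  obtain r where r: "r \<in> carrier R" "\<And>y. y \<in> extension m \<Longrightarrow> r \<ominus> y \<notin> P"
    using extension_proper[OF m(1) P_ideal(1)] D(2) m(2) by blast
  have "r \<notin> J"
  proof
    assume "r \<in> J"
    then obtain x y where xy: "x \<in> P" "y \<in> extension m" "r = x \<oplus> y" by (auto simp: J_def)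
    have "r \<ominus> y = x" unfolding xy(3) using Pd(1)[OF xy(1)] Td(1)[OF xy(2)] by algebra
    then show False using r(2)[OF xy(2)] xy(1) by simp
  qed
  moreover have PJ: "P \<subseteq> J"
  proof
    fix x assume x: "x \<in> P"
    have "x = x \<oplus> \<zero>" using Pd(1)[OF x] by simp
    then show "x \<in> J" using x Td(2) unfolding J_def by blast
  qed
  moreover have "J \<subseteq> carrier R" using J by (meson additive_subgroup.a_subset ideal.axioms(1))
  ultimately have "J = P" using maximalideal.I_maximal[OF max J] r(1) by blast
  have "extension m \<subseteq> J"
  proof
    fix y assume y: "y \<in> extension m"
    have "y = \<zero> \<oplus> y" using Td(1)[OF y] by simp
    then show "y \<in> J" using y Pd(2) unfolding J_def by blast
  qed
  then have "m \<subseteq> P" using extension_superset[OF mi] \<open>J = P\<close> by blast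
  then show ?thesis using m(2) D(2) central_idealD(1)[OF mi] by blast
qed

text \<open>Since \<open>\<pp>\<close> is maximal in the centre, a prime that contains it contracts
  to it, and every prime over it is maximal.\<close>

lemma exists_maximal_with_grade:
  assumes "maximalideal P R"
  obtains Q where "maximalideal Q R" "Q \<inter> centre R = \<pp>" "left_grade R (left_quot R Q) = enat (centre_grade \<pp> R)"
proof -
  obtain Q where Q: "prime_two_sided R Q" "\<pp> \<subseteq> Q" "left_grade R (left_quot R Q) = enat (centre_grade \<pp> R)"
    using exists_prime_with_grade by blast
  interpret Q: prime_of_central_finite R Q by unfold_locales (rule Q(1))
  have "Q \<inter> centre R = \<pp>"
    by (rule centre_maximal_if_maximal[OF assms Q.p_ideal]) (use Q(2) Q.P_ideal(2) in auto)
  moreover have "maximalideal Q R"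
    using Q.maximal_if_centre_maximal centre_maximal_if_maximal[OF assms] \<open>Q \<inter> centre R = \<pp>\<close> by simp
  ultimately show ?thesis using that Q(3) by blast
qed

end

section \<open>Torsion-free modules\<close>

lemma submoduleD:
  assumes "submodule N R M"
  shows "x \<in> N \<Longrightarrow> x \<in> carrier M" "\<zero>\<^bsub>M\<^esub> \<in> N" "x \<in> N \<Longrightarrow> y \<in> N \<Longrightarrow> x \<oplus>\<^bsub>M\<^esub> y \<in> N"
    "r \<in> carrier R \<Longrightarrow> x \<in> N \<Longrightarrow> r \<odot>\<^bsub>M\<^esub> x \<in> N"
proof -
  interpret submodule N R M by fact
  show "x \<in> N \<Longrightarrow> x \<in> carrier M" "\<zero>\<^bsub>M\<^esub> \<in> N" "x \<in> N \<Longrightarrow> y \<in> N \<Longrightarrow> x \<oplus>\<^bsub>M\<^esub> y \<in> N"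
    "r \<in> carrier R \<Longrightarrow> x \<in> N \<Longrightarrow> r \<odot>\<^bsub>M\<^esub> x \<in> N"
    using subset one_closed m_closed by auto
qed

context prime_of_central_finite
begin

text \<open>The contrapositive of \<open>essential_contains_central\<close>: a left ideal whose
  central elements all lie in \<open>P\<close> is not essential modulo \<open>P\<close>.\<close>

lemma exists_complement:
  assumes E: "left_ideal R E" "P \<subseteq> E" "E \<inter> centre R \<subseteq> P"
  obtains D d where "left_ideal R D" "P \<subseteq> D" "D \<inter> E \<subseteq> P" "d \<in> D" "d \<notin> P"
proof (rule ccontr)
  assume no: "\<not> thesis"
  have ess: "D \<subseteq> P" if "left_ideal R D" "P \<subseteq> D" "D \<inter> E \<subseteq> P" for D
    using no \<open>\<And>D d. \<lbrakk>left_ideal R D; P \<subseteq> D; D \<inter> E \<subseteq> P; d \<in> D; d \<notin> P\<rbrakk> \<Longrightarrow> thesis\<close> that by blast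
  obtain z where "z \<in> centre R" "z \<in> E" "z \<notin> P"
    using essential_contains_central[OF E(1,2) ess] by blast
  then show False using E(3) by blast
qed

lemma central_saturation_submodule:
  assumes M: "left_module R M" and N: "submodule N R M"
  shows "submodule {b \<in> carrier M. \<exists>z\<in>centre R. z \<notin> P \<and> z \<odot>\<^bsub>M\<^esub> b \<in> N} R M"
proof -
  interpret M: left_module R M by fact
  note Nd = submoduleD[OF N]
  show ?thesis
  proof (rule submodule_of_left_moduleI[OF M])
    show "\<zero>\<^bsub>M\<^esub> \<in> {b \<in> carrier M. \<exists>z\<in>centre R. z \<notin> P \<and> z \<odot>\<^bsub>M\<^esub> b \<in> N}"
      using smult_zero_r[OF M one_closed] Nd(2) P_ideal(2) centre_one by auto
    fix a b assume "a \<in> {b \<in> carrier M. \<exists>z\<in>centre R. z \<notin> P \<and> z \<odot>\<^bsub>M\<^esub> b \<in> N}"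
      "b \<in> {b \<in> carrier M. \<exists>z\<in>centre R. z \<notin> P \<and> z \<odot>\<^bsub>M\<^esub> b \<in> N}"
    then obtain z w where z: "z \<in> centre R" "z \<notin> P" "z \<odot>\<^bsub>M\<^esub> a \<in> N" "a \<in> carrier M"
      and w: "w \<in> centre R" "w \<notin> P" "w \<odot>\<^bsub>M\<^esub> b \<in> N" "b \<in> carrier M" by blast
    note c = centreD(1)[OF z(1)] centreD(1)[OF w(1)]
    have "(z \<otimes> w) \<odot>\<^bsub>M\<^esub> (a \<oplus>\<^bsub>M\<^esub> b) = w \<odot>\<^bsub>M\<^esub> (z \<odot>\<^bsub>M\<^esub> a) \<oplus>\<^bsub>M\<^esub> z \<odot>\<^bsub>M\<^esub> (w \<odot>\<^bsub>M\<^esub> b)"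
      using c z(4) w(4) centreD(2)[OF z(1) c(2)] M.smult_assoc1[OF c(1,2) w(4)] M.smult_assoc1[OF c(2,1) z(4)]
      by (simp add: M.smult_r_distr)
    then have "(z \<otimes> w) \<odot>\<^bsub>M\<^esub> (a \<oplus>\<^bsub>M\<^esub> b) \<in> N" using Nd(3,4) c z(3) w(3) by simp
    moreover have "z \<otimes> w \<notin> P" using prime_central_mult[OF P z(1,2) c(2)] w(2) by blast
    ultimately show "a \<oplus>\<^bsub>M\<^esub> b \<in> {b \<in> carrier M. \<exists>z\<in>centre R. z \<notin> P \<and> z \<odot>\<^bsub>M\<^esub> b \<in> N}"
      using centre_mult[OF z(1) w(1)] z(4) w(4) by auto
  next
    fix r b assume r: "r \<in> carrier R" and "b \<in> {b \<in> carrier M. \<exists>z\<in>centre R. z \<notin> P \<and> z \<odot>\<^bsub>M\<^esub> b \<in> N}"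
    then obtain z where z: "z \<in> centre R" "z \<notin> P" "z \<odot>\<^bsub>M\<^esub> b \<in> N" "b \<in> carrier M" by blast
    note c = centreD(1)[OF z(1)]
    have "z \<odot>\<^bsub>M\<^esub> (r \<odot>\<^bsub>M\<^esub> b) = r \<odot>\<^bsub>M\<^esub> (z \<odot>\<^bsub>M\<^esub> b)"
      using M.smult_assoc1[OF c r z(4)] M.smult_assoc1[OF r c z(4)] centreD(2)[OF z(1) r] by simp
    then have "z \<odot>\<^bsub>M\<^esub> (r \<odot>\<^bsub>M\<^esub> b) \<in> N" using Nd(4)[OF r z(3)] by simp
    then show "r \<odot>\<^bsub>M\<^esub> b \<in> {b \<in> carrier M. \<exists>z\<in>centre R. z \<notin> P \<and> z \<odot>\<^bsub>M\<^esub> b \<in> N}"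
      using z r by auto
  qed auto
qed

text \<open>Zorn's lemma for proper submodules closed under division by central elements outside
  \<open>P\<close>; finite generation keeps unions of chains proper. For a maximal \<open>C\<close>
  the quotient M/C becomes simple when those elements are inverted, which the last clause says
  without fractions.\<close>

lemma maximal_saturated_submodule:
  assumes M: "left_module R M" and nz: "carrier M \<noteq> {\<zero>\<^bsub>M\<^esub>}"
    and tf: "\<And>z x. z \<in> centre R \<Longrightarrow> z \<notin> P \<Longrightarrow> x \<in> carrier M \<Longrightarrow> z \<odot>\<^bsub>M\<^esub> x = \<zero>\<^bsub>M\<^esub> \<Longrightarrow> x = \<zero>\<^bsub>M\<^esub>"
    and A: "finite A" "A \<subseteq> carrier M" "\<And>N. submodule N R M \<Longrightarrow> A \<subseteq> N \<Longrightarrow> N = carrier M"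
  shows "\<exists>C. submodule C R M \<and> C \<noteq> carrier M \<and>
    (\<forall>z\<in>centre R. \<forall>x\<in>carrier M. z \<notin> P \<longrightarrow> z \<odot>\<^bsub>M\<^esub> x \<in> C \<longrightarrow> x \<in> C) \<and>
    (\<forall>N. submodule N R M \<longrightarrow> C \<subset> N \<longrightarrow>
      {b \<in> carrier M. \<exists>z\<in>centre R. z \<notin> P \<and> z \<odot>\<^bsub>M\<^esub> b \<in> N} = carrier M)"
proof -
  interpret M: left_module R M by fact
  define sat where "sat C \<longleftrightarrow> (\<forall>z\<in>centre R. \<forall>x\<in>carrier M. z \<notin> P \<longrightarrow> z \<odot>\<^bsub>M\<^esub> x \<in> C \<longrightarrow> x \<in> C)" for C
  define \<F> where "\<F> = {C. submodule C R M \<and> C \<noteq> carrier M \<and> sat C}"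
  have "\<exists>C\<in>\<F>. \<forall>C'\<in>\<F>. C \<subseteq> C' \<longrightarrow> C' = C"
  proof (rule subset_Zorn_nonempty)
    have "submodule {\<zero>\<^bsub>M\<^esub>} R M"
      by (rule submodule_of_left_moduleI[OF M]) (use smult_zero_r[OF M] in auto)
    then have "{\<zero>\<^bsub>M\<^esub>} \<in> \<F>" using nz tf by (auto simp: \<F>_def sat_def)
    then show "\<F> \<noteq> {}" by blast
    fix \<C> assume C: "\<C> \<noteq> {}" "subset.chain \<F> \<C>"
    then have F: "\<And>L. L \<in> \<C> \<Longrightarrow> L \<in> \<F>" and ch: "\<And>A B. A \<in> \<C> \<Longrightarrow> B \<in> \<C> \<Longrightarrow> A \<subseteq> B \<or> B \<subseteq> A"
      by (auto simp: subset.chain_def)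
    have sub: "\<And>L. L \<in> \<C> \<Longrightarrow> submodule L R M" using F by (simp add: \<F>_def)
    have U: "submodule (\<Union>\<C>) R M" by (rule submodule_Union_chain[OF M C(1) ch sub])
    have "\<Union>\<C> \<noteq> carrier M"
    proof
      assume eq: "\<Union>\<C> = carrier M"
      have "A \<subseteq> \<Union>\<C>" using A(2) eq by simp
      then obtain L where L: "L \<in> \<C>" "A \<subseteq> L"
        using finite_subset_Union_chain[OF A(1) _ C] by blast
      then show False using A(3)[OF sub[OF L(1)] L(2)] F[OF L(1)] by (simp add: \<F>_def)
    qed
    moreover have "sat (\<Union>\<C>)" using F by (fastforce simp: \<F>_def sat_def)
    ultimately show "\<Union>\<C> \<in> \<F>" using U by (simp add: \<F>_def)
  qed
  then obtain C where C: "C \<in> \<F>" "\<And>C'. C' \<in> \<F> \<Longrightarrow> C \<subseteq> C' \<Longrightarrow> C' = C" by blast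
  have sub: "submodule C R M" and satC: "sat C" "C \<noteq> carrier M" using C(1) by (auto simp: \<F>_def)
  have "{b \<in> carrier M. \<exists>z\<in>centre R. z \<notin> P \<and> z \<odot>\<^bsub>M\<^esub> b \<in> N} = carrier M" (is "?S = _")
    if N: "submodule N R M" "C \<subset> N" for N
  proof -
    have NS: "N \<subseteq> ?S"
    proof
      fix b assume b: "b \<in> N"
      then have "\<one> \<odot>\<^bsub>M\<^esub> b \<in> N" using submoduleD(1)[OF N(1)] by simp
      then show "b \<in> ?S" using submoduleD(1)[OF N(1) b] P_ideal(2) centre_one by blast
    qed
    have "sat ?S"
      unfolding sat_def
    proof (intro ballI impI)
      fix z x assume z: "z \<in> centre R" "x \<in> carrier M" "z \<notin> P" "z \<odot>\<^bsub>M\<^esub> x \<in> ?S"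
      then obtain w where w: "w \<in> centre R" "w \<notin> P" "w \<odot>\<^bsub>M\<^esub> (z \<odot>\<^bsub>M\<^esub> x) \<in> N" by blast
      note c = centreD(1)[OF z(1)] centreD(1)[OF w(1)]
      have "(w \<otimes> z) \<odot>\<^bsub>M\<^esub> x \<in> N" using w(3) M.smult_assoc1[OF c(2,1) z(2)] by simp
      moreover have "w \<otimes> z \<notin> P" using prime_central_mult[OF P w(1,2) c(1)] z(3) by blast
      ultimately show "x \<in> ?S" using centre_mult[OF w(1) z(1)] z(2) by blast
    qed
    then have "?S \<in> \<F> \<or> ?S = carrier M" using central_saturation_submodule[OF M N(1)] by (simp add: \<F>_def)
    moreover have "?S \<noteq> C" using NS N(2) by blast
    ultimately show "?S = carrier M" using C(2)[of ?S] N(2) NS by blast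
  qed
  then show ?thesis using sub satC unfolding sat_def by blast
qed

text \<open>The homomorphism to R/I sends \<open>m\<close> to \<open>e y\<close>, where
  \<open>z m\<close> is the sum of an element of \<open>C\<close> and \<open>e u\<close> with
  \<open>e\<close> in \<open>D\<close>. If \<open>e u\<close> is in \<open>C\<close>, then
  \<open>e\<close> lies in \<open>P\<close> and kills \<open>y\<close>, so the value is well defined
  modulo the sequence.\<close>

lemma torsion_free_not_Ext_injective:
  assumes cm: "central_chains_bounded R"
    and xs: "regular_sequence R {\<zero>} xs" "set xs \<subseteq> \<pp>"
    and n: "n \<in> carrier R" "n \<notin> seq_ideal R {\<zero>} xs" "\<And>c. c \<in> P \<Longrightarrow> c \<otimes> n \<in> seq_ideal R {\<zero>} xs"
    and M: "left_module R M" and nz: "carrier M \<noteq> {\<zero>\<^bsub>M\<^esub>}"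
    and PM: "\<And>c x. c \<in> P \<Longrightarrow> x \<in> carrier M \<Longrightarrow> c \<odot>\<^bsub>M\<^esub> x = \<zero>\<^bsub>M\<^esub>"
    and tf: "\<And>z x. z \<in> centre R \<Longrightarrow> z \<notin> P \<Longrightarrow> x \<in> carrier M \<Longrightarrow> z \<odot>\<^bsub>M\<^esub> x = \<zero>\<^bsub>M\<^esub> \<Longrightarrow> x = \<zero>\<^bsub>M\<^esub>"
    and A: "finite A" "A \<subseteq> carrier M" "\<And>N. submodule N R M \<Longrightarrow> A \<subseteq> N \<Longrightarrow> N = carrier M"
  shows "\<not> resolved_module.Ext_injective R M 0 (seq_ideal R {\<zero>} xs) \<zero>"
proof -
  interpret resolved_module R M by (simp add: resolved_module_def M)
  let ?I = "seq_ideal R {\<zero>} xs"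
  have I: "left_ideal R ?I" by (rule regular_sequence_left_ideal[OF xs(1)])
  note Id = left_idealD[OF I] and Pd = left_idealD[OF P_ideal(1)]
  have "\<exists>C. submodule C R M \<and> C \<noteq> carrier M \<and>
    (\<forall>z\<in>centre R. \<forall>x\<in>carrier M. z \<notin> P \<longrightarrow> z \<odot>\<^bsub>M\<^esub> x \<in> C \<longrightarrow> x \<in> C) \<and>
    (\<forall>N. submodule N R M \<longrightarrow> C \<subset> N \<longrightarrow>
      {b \<in> carrier M. \<exists>z\<in>centre R. z \<notin> P \<and> z \<odot>\<^bsub>M\<^esub> b \<in> N} = carrier M)"
    by (rule maximal_saturated_submodule[OF M nz _ A(1,2)]) (rule tf A(3); assumption)+
  then obtain C where C: "submodule C R M" "C \<noteq> carrier M"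
    "\<forall>z\<in>centre R. \<forall>x\<in>carrier M. z \<notin> P \<longrightarrow> z \<odot>\<^bsub>M\<^esub> x \<in> C \<longrightarrow> x \<in> C"
    and Cmax: "\<forall>N. submodule N R M \<longrightarrow> C \<subset> N \<longrightarrow>
      {b \<in> carrier M. \<exists>z\<in>centre R. z \<notin> P \<and> z \<odot>\<^bsub>M\<^esub> b \<in> N} = carrier M"
    by blast
  note Cd = submoduleD[OF C(1)]
  obtain u where u: "u \<in> carrier M" "u \<notin> C" using C(2) Cd(1) by blast
  \<comment> \<open>The annihilator of the class of \<open>u\<close> in M/C. As \<open>C\<close> is
    saturated, it has no central elements outside \<open>P\<close>, so a complement \<open>D\<close>
    modulo \<open>P\<close> exists, and D/P is isomorphic to the submodule Du of M/C.\<close>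
  define M0 where "M0 = {r \<in> carrier R. r \<odot>\<^bsub>M\<^esub> u \<in> C}"
  have M0: "left_ideal R M0"
    using Cd u smult_zero_l[OF M u(1)] smult_l_distr smult_assoc1 by (auto simp: left_ideal_def M0_def)
  have PM0: "P \<subseteq> M0" using PM[OF _ u(1)] Cd(2) Pd(1) by (auto simp: M0_def)
  have "M0 \<inter> centre R \<subseteq> P" using C(3) u by (auto simp: M0_def)
  then obtain D d0 where D: "left_ideal R D" "P \<subseteq> D" "D \<inter> M0 \<subseteq> P" and d0: "d0 \<in> D" "d0 \<notin> P"
    using exists_complement[OF M0 PM0] by blast
  note Dd = left_idealD[OF D(1)]
  define N where "N = {c \<oplus>\<^bsub>M\<^esub> d \<odot>\<^bsub>M\<^esub> u | c d. c \<in> C \<and> d \<in> D}"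
  have Nsub: "submodule N R M"
  proof (rule submodule_of_left_moduleI[OF M])
    show "N \<subseteq> carrier M" using Cd(1) Dd(1) u by (auto simp: N_def)
    have "\<zero>\<^bsub>M\<^esub> = \<zero>\<^bsub>M\<^esub> \<oplus>\<^bsub>M\<^esub> \<zero> \<odot>\<^bsub>M\<^esub> u" using smult_zero_l[OF M u(1)] by simp
    then show "\<zero>\<^bsub>M\<^esub> \<in> N" using Cd(2) Dd(2) unfolding N_def by blast
    fix a assume "a \<in> N"
    then obtain c d where a: "c \<in> C" "d \<in> D" "a = c \<oplus>\<^bsub>M\<^esub> d \<odot>\<^bsub>M\<^esub> u" by (auto simp: N_def)
    { fix b assume "b \<in> N"
      then obtain e f where b: "e \<in> C" "f \<in> D" "b = e \<oplus>\<^bsub>M\<^esub> f \<odot>\<^bsub>M\<^esub> u" by (auto simp: N_def)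
      have "a \<oplus>\<^bsub>M\<^esub> b = (c \<oplus>\<^bsub>M\<^esub> e) \<oplus>\<^bsub>M\<^esub> (d \<oplus> f) \<odot>\<^bsub>M\<^esub> u"
        using a b Cd(1) Dd(1) u by (simp add: smult_l_distr M.a_ac)
      then show "a \<oplus>\<^bsub>M\<^esub> b \<in> N" using Cd(3)[OF a(1) b(1)] Dd(3)[OF a(2) b(2)] unfolding N_def by blast
    next
      fix r assume r: "r \<in> carrier R"
      have "r \<odot>\<^bsub>M\<^esub> a = r \<odot>\<^bsub>M\<^esub> c \<oplus>\<^bsub>M\<^esub> (r \<otimes> d) \<odot>\<^bsub>M\<^esub> u"
        using a r Cd(1) Dd(1) u by (simp add: smult_r_distr smult_assoc1)
      then show "r \<odot>\<^bsub>M\<^esub> a \<in> N" using Cd(4)[OF r a(1)] Dd(4)[OF r a(2)] unfolding N_def by blast }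
  qed
  note Nd = submoduleD[OF Nsub]
  have CN: "C \<subseteq> N"
  proof
    fix c assume c: "c \<in> C"
    have "c = c \<oplus>\<^bsub>M\<^esub> \<zero> \<odot>\<^bsub>M\<^esub> u" using smult_zero_l[OF M u(1)] Cd(1)[OF c] by simp
    then show "c \<in> N" using c Dd(2) unfolding N_def by blast
  qed
  have Du: "d \<odot>\<^bsub>M\<^esub> u \<in> N" if "d \<in> D" for d
  proof -
    have "d \<odot>\<^bsub>M\<^esub> u = \<zero>\<^bsub>M\<^esub> \<oplus>\<^bsub>M\<^esub> d \<odot>\<^bsub>M\<^esub> u" using u Dd(1)[OF that] by simp
    then show ?thesis using that Cd(2) unfolding N_def by blast
  qed
  have "d0 \<odot>\<^bsub>M\<^esub> u \<notin> C" using d0 D(3) Dd(1) by (auto simp: M0_def)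
  then have sat: "{b \<in> carrier M. \<exists>z\<in>centre R. z \<notin> P \<and> z \<odot>\<^bsub>M\<^esub> b \<in> N} = carrier M"
    using Cmax Nsub CN Du[OF d0(1)] by blast
  \<comment> \<open>A common denominator for the finitely many generators: each has a central
    multiple in \<open>N\<close>, and the product of the multipliers works for all.\<close>
  have "\<exists>z\<in>centre R. z \<notin> P \<and> (\<forall>a\<in>S. z \<odot>\<^bsub>M\<^esub> a \<in> N)" if "finite S" "S \<subseteq> A" for S
    using that
  proof (induction S)
    case empty then show ?case using centre_one P_ideal(2) by blast
  next
    case (insert b S)
    then obtain z where z: "z \<in> centre R" "z \<notin> P" "\<forall>a\<in>S. z \<odot>\<^bsub>M\<^esub> a \<in> N" by auto
    have bM: "b \<in> carrier M" using insert.prems A(2) by auto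
    then obtain w where w: "w \<in> centre R" "w \<notin> P" "w \<odot>\<^bsub>M\<^esub> b \<in> N" using sat by blast
    note c = centreD(1)[OF z(1)] centreD(1)[OF w(1)]
    have "z \<otimes> w \<notin> P" using prime_central_mult[OF P z(1,2) c(2)] w(2) by blast
    moreover have "(z \<otimes> w) \<odot>\<^bsub>M\<^esub> b \<in> N" using smult_assoc1[OF c bM] Nd(4)[OF c(1) w(3)] by simp
    moreover have "(z \<otimes> w) \<odot>\<^bsub>M\<^esub> a \<in> N" if "a \<in> S" for a
    proof -
      have aM: "a \<in> carrier M" using that insert.prems A(2) by auto
      show ?thesis using centreD(2)[OF z(1) c(2)] smult_assoc1[OF c(2,1) aM] Nd(4)[OF c(2)] z(3) that by simp
    qed
    ultimately show ?case using centre_mult[OF z(1) w(1)] by blast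
  qed
  from this[OF A(1) order_refl]
  obtain z where z: "z \<in> centre R" "z \<notin> P" "\<And>a. a \<in> A \<Longrightarrow> z \<odot>\<^bsub>M\<^esub> a \<in> N" by blast
  note zc = centreD(1)[OF z(1)]
  have "submodule {b \<in> carrier M. z \<odot>\<^bsub>M\<^esub> b \<in> N} R M"
  proof (rule submodule_of_left_moduleI[OF M])
    show "\<zero>\<^bsub>M\<^esub> \<in> {b \<in> carrier M. z \<odot>\<^bsub>M\<^esub> b \<in> N}" using smult_zero_r[OF M zc] Nd(2) by simp
    fix r b assume rb: "r \<in> carrier R" "b \<in> {b \<in> carrier M. z \<odot>\<^bsub>M\<^esub> b \<in> N}"
    have "z \<odot>\<^bsub>M\<^esub> (r \<odot>\<^bsub>M\<^esub> b) = r \<odot>\<^bsub>M\<^esub> (z \<odot>\<^bsub>M\<^esub> b)"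
      using smult_assoc1[OF zc rb(1), of b] smult_assoc1[OF rb(1) zc, of b] centreD(2)[OF z(1) rb(1)] rb(2) by simp
    then show "r \<odot>\<^bsub>M\<^esub> b \<in> {b \<in> carrier M. z \<odot>\<^bsub>M\<^esub> b \<in> N}" using rb Nd(4)[OF rb(1)] by simp
  qed (use zc Nd(3) smult_r_distr in auto)
  then have "{b \<in> carrier M. z \<odot>\<^bsub>M\<^esub> b \<in> N} = carrier M" by (rule A(3)) (use A(2) z(3) in auto)
  then have zM: "z \<odot>\<^bsub>M\<^esub> b \<in> N" if "b \<in> carrier M" for b using that by blast
  have cancel: "y \<in> ?I" if y: "y \<in> carrier R" "\<And>c. c \<in> P \<Longrightarrow> c \<otimes> y \<in> ?I" and w: "w \<in> centre R" "w \<notin> P" "w \<otimes> y \<in> ?I" for y w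
    using central_cancel[OF cm xs y(1) _ w] y(2) by blast
  \<comment> \<open>If \<open>d0\<close> killed the submodule generated by \<open>n\<close>, the
    annihilator of that submodule would exceed \<open>P\<close> and contain a central element
    outside \<open>P\<close>, which could be cancelled from \<open>n\<close>.\<close>
  have "d0 \<notin> left_annihilator R ?I n"
  proof
    assume d0n: "d0 \<in> left_annihilator R ?I n"
    have "P \<subseteq> left_annihilator R ?I n"
    proof
      fix c assume c: "c \<in> P"
      have "c \<otimes> (s \<otimes> n) \<in> ?I" if "s \<in> carrier R" for s
        using n(3)[OF two_sidedD(2)[OF P_ideal(3) c that]] Pd(1)[OF c] that n(1) by (simp add: m_assoc)
      then show "c \<in> left_annihilator R ?I n" using Pd(1)[OF c] by (simp add: left_annihilator_def)
    qed
    then obtain w where "w \<in> centre R" "w \<in> left_annihilator R ?I n" "w \<notin> P"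
      using two_sided_contains_central[OF two_sided_left_annihilator[OF I n(1)] _ d0n d0(2)] by blast
    then show False using cancel[OF n(1,3)] left_annihilator_annihilates n(1,2) by blast
  qed
  then obtain r0 where r0: "r0 \<in> carrier R" "d0 \<otimes> (r0 \<otimes> n) \<notin> ?I"
    using Dd(1)[OF d0(1)] by (auto simp: left_annihilator_def)
  define y where "y = r0 \<otimes> n"
  have yc: "y \<in> carrier R" using r0 n by (simp add: y_def)
  have Py: "c \<otimes> y \<in> ?I" if "c \<in> P" for c
    using n(3)[OF two_sidedD(2)[OF P_ideal(3) that r0(1)]] Pd(1)[OF that] r0(1) n(1) by (simp add: y_def m_assoc)
  \<comment> \<open>The element \<open>e\<close> is unique only modulo \<open>P\<close>, and
    \<open>a\<close> only modulo the sequence, hence a relation.\<close>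
  define Rel where "Rel m a \<longleftrightarrow> (\<exists>c\<in>C. \<exists>e\<in>D. z \<odot>\<^bsub>M\<^esub> m = c \<oplus>\<^bsub>M\<^esub> e \<odot>\<^bsub>M\<^esub> u \<and> a \<ominus> e \<otimes> y \<in> ?I)" for m a
  show ?thesis
  proof (rule not_Ext_injective_0I[OF I, of Rel])
    fix m assume "m \<in> carrier M"
    then obtain c e where ce: "c \<in> C" "e \<in> D" "z \<odot>\<^bsub>M\<^esub> m = c \<oplus>\<^bsub>M\<^esub> e \<odot>\<^bsub>M\<^esub> u" using zM unfolding N_def by blast
    have ec: "e \<otimes> y \<in> carrier R" using Dd(1)[OF ce(2)] yc by simp
    have "e \<otimes> y \<ominus> e \<otimes> y \<in> ?I" using minus_self[OF ec] Id(2) by simp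
    then have "Rel m (e \<otimes> y)" unfolding Rel_def using ce by blast
    then show "\<exists>a\<in>carrier R. Rel m a" using ec by blast
  next
    fix m m' a a' assume m: "m \<in> carrier M" "m' \<in> carrier M" "a \<in> carrier R" "a' \<in> carrier R" "Rel m a" "Rel m' a'"
    then obtain c e c' e' where ce: "c \<in> C" "e \<in> D" "z \<odot>\<^bsub>M\<^esub> m = c \<oplus>\<^bsub>M\<^esub> e \<odot>\<^bsub>M\<^esub> u" "a \<ominus> e \<otimes> y \<in> ?I"
      and ce': "c' \<in> C" "e' \<in> D" "z \<odot>\<^bsub>M\<^esub> m' = c' \<oplus>\<^bsub>M\<^esub> e' \<odot>\<^bsub>M\<^esub> u" "a' \<ominus> e' \<otimes> y \<in> ?I" unfolding Rel_def by blast
    have "z \<odot>\<^bsub>M\<^esub> (m \<oplus>\<^bsub>M\<^esub> m') = (c \<oplus>\<^bsub>M\<^esub> c') \<oplus>\<^bsub>M\<^esub> (e \<oplus> e') \<odot>\<^bsub>M\<^esub> u"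
      using m(1,2) zc ce ce' Cd(1) Dd(1) u by (simp add: smult_r_distr smult_l_distr M.a_ac)
    moreover have "(a \<oplus> a') \<ominus> (e \<oplus> e') \<otimes> y \<in> ?I"
      using diff_add_diff[of a a' "e \<otimes> y" "e' \<otimes> y"] Id(3)[OF ce(4) ce'(4)] m(3,4) Dd(1) ce(2) ce'(2) yc
      by (simp add: l_distr)
    ultimately show "Rel (m \<oplus>\<^bsub>M\<^esub> m') (a \<oplus> a')"
      unfolding Rel_def using Cd(3)[OF ce(1) ce'(1)] Dd(3)[OF ce(2) ce'(2)] by blast
  next
    fix r m a assume m: "r \<in> carrier R" "m \<in> carrier M" "a \<in> carrier R" "Rel m a"
    then obtain c e where ce: "c \<in> C" "e \<in> D" "z \<odot>\<^bsub>M\<^esub> m = c \<oplus>\<^bsub>M\<^esub> e \<odot>\<^bsub>M\<^esub> u" "a \<ominus> e \<otimes> y \<in> ?I" unfolding Rel_def by blast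
    note cec = Cd(1)[OF ce(1)] Dd(1)[OF ce(2)]
    have "z \<odot>\<^bsub>M\<^esub> (r \<odot>\<^bsub>M\<^esub> m) = r \<odot>\<^bsub>M\<^esub> (z \<odot>\<^bsub>M\<^esub> m)"
      using smult_assoc1[OF zc m(1,2)] smult_assoc1[OF m(1) zc m(2)] centreD(2)[OF z(1) m(1)] by simp
    then have "z \<odot>\<^bsub>M\<^esub> (r \<odot>\<^bsub>M\<^esub> m) = r \<odot>\<^bsub>M\<^esub> c \<oplus>\<^bsub>M\<^esub> (r \<otimes> e) \<odot>\<^bsub>M\<^esub> u"
      using ce(3) m(1) cec u by (simp add: smult_r_distr smult_assoc1)
    moreover have "r \<otimes> a \<ominus> (r \<otimes> e) \<otimes> y \<in> ?I"
      using diff_cong_mult[OF I m(3) _ m(1) ce(4)] cec yc m(1) by (simp add: m_assoc)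
    ultimately show "Rel (r \<odot>\<^bsub>M\<^esub> m) (r \<otimes> a)"
      unfolding Rel_def using Cd(4)[OF m(1) ce(1)] Dd(4)[OF m(1) ce(2)] by blast
  next
    fix a assume a: "a \<in> carrier R" "Rel \<zero>\<^bsub>M\<^esub> a"
    then obtain c e where ce: "c \<in> C" "e \<in> D" "\<zero>\<^bsub>M\<^esub> = c \<oplus>\<^bsub>M\<^esub> e \<odot>\<^bsub>M\<^esub> u" "a \<ominus> e \<otimes> y \<in> ?I"
      unfolding Rel_def using smult_zero_r[OF M zc] by auto
    note cec = Cd(1)[OF ce(1)] Dd(1)[OF ce(2)]
    have eu: "e \<odot>\<^bsub>M\<^esub> u \<in> carrier M" using cec u by simp
    have "e \<odot>\<^bsub>M\<^esub> u = \<ominus>\<^bsub>M\<^esub> c"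
      using M.minus_equality[of "e \<odot>\<^bsub>M\<^esub> u" c] ce(3) cec(1) eu M.a_comm by simp
    then have "e \<odot>\<^bsub>M\<^esub> u \<in> C"
      using Cd(4)[OF centreD(1)[OF centre_uminus[OF centre_one]] ce(1)] smult_minus_one[OF M cec(1)] by simp
    then have "e \<in> P" using D(3) ce(2) cec(2) by (auto simp: M0_def)
    then show "a \<in> ?I" using left_ideal_cancel[OF I ce(4) a(1)] Py cec yc by simp
  next
    show "d0 \<odot>\<^bsub>M\<^esub> u \<in> carrier M" using Dd(1)[OF d0(1)] u by simp
    show "(z \<otimes> d0) \<otimes> y \<in> carrier R" using Dd(1)[OF d0(1)] zc yc by simp
    have "z \<odot>\<^bsub>M\<^esub> (d0 \<odot>\<^bsub>M\<^esub> u) = \<zero>\<^bsub>M\<^esub> \<oplus>\<^bsub>M\<^esub> (z \<otimes> d0) \<odot>\<^bsub>M\<^esub> u"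
      using Dd(1)[OF d0(1)] u zc by (simp add: smult_assoc1)
    moreover have "(z \<otimes> d0) \<otimes> y \<ominus> (z \<otimes> d0) \<otimes> y \<in> ?I"
      using minus_self[of "(z \<otimes> d0) \<otimes> y"] Dd(1)[OF d0(1)] zc yc Id(2) by simp
    ultimately show "Rel (d0 \<odot>\<^bsub>M\<^esub> u) ((z \<otimes> d0) \<otimes> y)"
      unfolding Rel_def using Cd(2) Dd(4)[OF zc d0(1)] by blast
    \<comment> \<open>The image of \<open>d0 u\<close>. The element \<open>d0 y\<close> is killed by
      \<open>P\<close> modulo the sequence, so \<open>z\<close> can be cancelled from
      \<open>z d0 y\<close>.\<close>
    show "(z \<otimes> d0) \<otimes> y \<notin> ?I"
    proof
      assume "(z \<otimes> d0) \<otimes> y \<in> ?I"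
      then have "z \<otimes> (d0 \<otimes> y) \<in> ?I" using Dd(1)[OF d0(1)] zc yc by (simp add: m_assoc)
      moreover have "c \<otimes> (d0 \<otimes> y) \<in> ?I" if "c \<in> P" for c
        using Py[OF two_sidedD(2)[OF P_ideal(3) that Dd(1)[OF d0(1)]]] Pd(1)[OF that] Dd(1)[OF d0(1)] yc
        by (simp add: m_assoc)
      ultimately have "d0 \<otimes> y \<in> ?I" using cancel[OF _ _ z(1,2)] Dd(1)[OF d0(1)] yc by simp
      then show False using r0(2) by (simp add: y_def)
    qed
  next
    fix m a assume "a \<in> carrier R"
    then show "\<zero> \<otimes> a \<in> ?I" using Id(2) by simp
  qed
qed

end

section \<open>Localisation of a commutative ring\<close>

locale multiplicative_subset = cring Z for Z :: "('a, 'm) ring_scheme" (structure) +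
  fixes S assumes S: "S \<subseteq> carrier Z" "\<one> \<in> S" "\<And>a b. a \<in> S \<Longrightarrow> b \<in> S \<Longrightarrow> a \<otimes> b \<in> S"
begin

abbreviation "fr a s \<equiv> fraction Z S a s"
abbreviation "L \<equiv> localisation Z S"

lemma Sc: "s \<in> S \<Longrightarrow> s \<in> carrier Z" using S(1) by auto

lemma fr_mem: "(b, t) \<in> fr a s \<longleftrightarrow> b \<in> carrier Z \<and> t \<in> S \<and> (\<exists>u\<in>S. u \<otimes> (t \<otimes> a) = u \<otimes> (s \<otimes> b))"
  by (simp add: fraction_def)

lemma fr_self: "a \<in> carrier Z \<Longrightarrow> s \<in> S \<Longrightarrow> (a, s) \<in> fr a s"
  unfolding fr_mem using S(2) by auto

text \<open>The middle denominator \<open>t\<close> has to be cancelled, hence the factor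
  \<open>t\<close> in the witness \<open>u v t\<close>.\<close>

lemma fr_trans:
  assumes "a \<in> carrier Z" "s \<in> S" "(b, t) \<in> fr a s" "(c, w) \<in> fr b t"
  shows "(c, w) \<in> fr a s"
proof -
  obtain u where u: "b \<in> carrier Z" "t \<in> S" "u \<in> S" "u \<otimes> (t \<otimes> a) = u \<otimes> (s \<otimes> b)" using assms(3) by (auto simp: fr_mem)
  obtain v where v: "c \<in> carrier Z" "w \<in> S" "v \<in> S" "v \<otimes> (w \<otimes> b) = v \<otimes> (t \<otimes> c)" using assms(4) by (auto simp: fr_mem)
  note c = Sc[OF assms(2)] Sc[OF u(2)] Sc[OF u(3)] Sc[OF v(2)] Sc[OF v(3)] assms(1) u(1) v(1)
  have "(u \<otimes> v \<otimes> t) \<otimes> (w \<otimes> a) = (v \<otimes> w) \<otimes> (u \<otimes> (t \<otimes> a))" using c by algebra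
  also have "\<dots> = (u \<otimes> s) \<otimes> (v \<otimes> (w \<otimes> b))" unfolding u(4) using c by algebra
  also have "\<dots> = (u \<otimes> v \<otimes> t) \<otimes> (s \<otimes> c)" unfolding v(4) using c by algebra
  finally show ?thesis using v S(3)[OF S(3)[OF u(3) v(3)] u(2)] by (auto simp: fr_mem)
qed

lemma fr_sym:
  assumes "a \<in> carrier Z" "s \<in> S" "(b, t) \<in> fr a s" shows "(a, s) \<in> fr b t"
  using assms by (auto simp: fr_mem intro: sym)

lemma fr_eqI:
  assumes "a \<in> carrier Z" "s \<in> S" "(b, t) \<in> fr a s" shows "fr b t = fr a s"
proof -
  have bt: "b \<in> carrier Z" "t \<in> S" using assms(3) by (auto simp: fr_mem)
  show ?thesis
  proof (intro equalityI subsetI)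
    fix x assume "x \<in> fr b t"
    then show "x \<in> fr a s" using fr_trans[OF assms] by (cases x) auto
  next
    fix x assume "x \<in> fr a s"
    then show "x \<in> fr b t" using fr_trans[OF bt fr_sym[OF assms]] by (cases x) auto
  qed
qed

lemma fr_eq_of:
  assumes "a \<in> carrier Z" "s \<in> S" "b \<in> carrier Z" "t \<in> S" "t \<otimes> a = s \<otimes> b" shows "fr b t = fr a s"
  by (rule fr_eqI[OF assms(1,2)]) (use assms S(2) in \<open>auto simp: fr_mem\<close>)

lemma L_carrier: "X \<in> carrier L \<longleftrightarrow> (\<exists>a\<in>carrier Z. \<exists>s\<in>S. X = fr a s)"
  by (auto simp: localisation_def)

text \<open>The product is defined as a union over all representatives; each pair of representatives
  contributes the same class.\<close>

lemma L_mult: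
  assumes "a \<in> carrier Z" "s \<in> S" "b \<in> carrier Z" "t \<in> S"
  shows "fr a s \<otimes>\<^bsub>L\<^esub> fr b t = fr (a \<otimes> b) (s \<otimes> t)"
proof -
  have "fr (a' \<otimes> b') (s' \<otimes> t') = fr (a \<otimes> b) (s \<otimes> t)" if a': "(a', s') \<in> fr a s" and b': "(b', t') \<in> fr b t" for a' b' s' t'
  proof (rule fr_eqI)
    obtain u where u: "a' \<in> carrier Z" "s' \<in> S" "u \<in> S" "u \<otimes> (s' \<otimes> a) = u \<otimes> (s \<otimes> a')" using a' by (auto simp: fr_mem)
    obtain v where v: "b' \<in> carrier Z" "t' \<in> S" "v \<in> S" "v \<otimes> (t' \<otimes> b) = v \<otimes> (t \<otimes> b')" using b' by (auto simp: fr_mem)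
    note c = assms(1,3) Sc[OF assms(2)] Sc[OF assms(4)] u(1) v(1) Sc[OF u(2)] Sc[OF u(3)] Sc[OF v(2)] Sc[OF v(3)]
    have "(u \<otimes> v) \<otimes> ((s' \<otimes> t') \<otimes> (a \<otimes> b)) = (u \<otimes> (s' \<otimes> a)) \<otimes> (v \<otimes> (t' \<otimes> b))" using c by algebra
    also have "\<dots> = (u \<otimes> v) \<otimes> ((s \<otimes> t) \<otimes> (a' \<otimes> b'))" unfolding u(4) v(4) using c by algebra
    finally show "(a' \<otimes> b', s' \<otimes> t') \<in> fr (a \<otimes> b) (s \<otimes> t)"
      using c S(3)[OF u(3) v(3)] S(3)[OF u(2) v(2)] by (auto simp: fr_mem)
  qed (use assms S(3) in auto)
  then have "(\<Union>(a', s')\<in>fr a s. \<Union>(b', t')\<in>fr b t. fr (a' \<otimes> b') (s' \<otimes> t')) = fr (a \<otimes> b) (s \<otimes> t)"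
    using fr_self[OF assms(1,2)] fr_self[OF assms(3,4)] by fast
  then show ?thesis by (simp add: localisation_def)
qed

lemma L_add:
  assumes "a \<in> carrier Z" "s \<in> S" "b \<in> carrier Z" "t \<in> S"
  shows "fr a s \<oplus>\<^bsub>L\<^esub> fr b t = fr (t \<otimes> a \<oplus> s \<otimes> b) (s \<otimes> t)"
proof -
  have "fr (t' \<otimes> a' \<oplus> s' \<otimes> b') (s' \<otimes> t') = fr (t \<otimes> a \<oplus> s \<otimes> b) (s \<otimes> t)" if a': "(a', s') \<in> fr a s" and b': "(b', t') \<in> fr b t" for a' b' s' t'
  proof (rule fr_eqI)
    obtain u where u: "a' \<in> carrier Z" "s' \<in> S" "u \<in> S" "u \<otimes> (s' \<otimes> a) = u \<otimes> (s \<otimes> a')" using a' by (auto simp: fr_mem)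
    obtain v where v: "b' \<in> carrier Z" "t' \<in> S" "v \<in> S" "v \<otimes> (t' \<otimes> b) = v \<otimes> (t \<otimes> b')" using b' by (auto simp: fr_mem)
    note c = assms(1,3) Sc[OF assms(2)] Sc[OF assms(4)] u(1) v(1) Sc[OF u(2)] Sc[OF u(3)] Sc[OF v(2)] Sc[OF v(3)]
    have "(u \<otimes> v) \<otimes> ((s' \<otimes> t') \<otimes> (t \<otimes> a \<oplus> s \<otimes> b)) =
        (v \<otimes> t' \<otimes> t) \<otimes> (u \<otimes> (s' \<otimes> a)) \<oplus> (u \<otimes> s' \<otimes> s) \<otimes> (v \<otimes> (t' \<otimes> b))" using c by algebra
    also have "\<dots> = (u \<otimes> v) \<otimes> ((s \<otimes> t) \<otimes> (t' \<otimes> a' \<oplus> s' \<otimes> b'))" unfolding u(4) v(4) using c by algebra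
    finally show "(t' \<otimes> a' \<oplus> s' \<otimes> b', s' \<otimes> t') \<in> fr (t \<otimes> a \<oplus> s \<otimes> b) (s \<otimes> t)"
      using c S(3)[OF u(3) v(3)] S(3)[OF u(2) v(2)] by (auto simp: fr_mem)
  qed (use assms S(3) Sc in auto)
  then have "(\<Union>(a', s')\<in>fr a s. \<Union>(b', t')\<in>fr b t. fr (t' \<otimes> a' \<oplus> s' \<otimes> b') (s' \<otimes> t')) = fr (t \<otimes> a \<oplus> s \<otimes> b) (s \<otimes> t)"
    using fr_self[OF assms(1,2)] fr_self[OF assms(3,4)] by fast
  then show ?thesis by (simp add: localisation_def)
qed

lemma L_zero: "\<zero>\<^bsub>L\<^esub> = fr \<zero> \<one>" and L_one: "\<one>\<^bsub>L\<^esub> = fr \<one> \<one>"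
  by (simp_all add: localisation_def)

lemma fr_closed: "a \<in> carrier Z \<Longrightarrow> s \<in> S \<Longrightarrow> fr a s \<in> carrier L"
  unfolding L_carrier by blast

lemma localisation_ring: "ring L"
proof (rule ringI)
  have St: "s \<otimes> t \<in> S" "s \<in> carrier Z" if "s \<in> S" "t \<in> S" for s t using S(3) Sc that by auto
  note rules = L_add L_mult L_zero L_one fr_closed S(2) S(3) Sc
  show "abelian_group L"
  proof (rule abelian_groupI)
    fix X assume "X \<in> carrier L"
    then obtain a s where X: "a \<in> carrier Z" "s \<in> S" "X = fr a s" by (auto simp: L_carrier)
    note c = X(1) Sc[OF X(2)]
    show "\<zero>\<^bsub>L\<^esub> \<oplus>\<^bsub>L\<^esub> X = X" using X c by (simp add: rules)
    have "fr (\<ominus> a) s \<oplus>\<^bsub>L\<^esub> X = fr (s \<otimes> \<ominus> a \<oplus> s \<otimes> a) (s \<otimes> s)" using X by (simp add: rules)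
    also have "\<dots> = fr \<zero> \<one>"
      by (rule fr_eq_of) (use X c S in \<open>auto simp: r_minus l_neg\<close>)
    finally show "\<exists>Y\<in>carrier L. Y \<oplus>\<^bsub>L\<^esub> X = \<zero>\<^bsub>L\<^esub>" using fr_closed[of "\<ominus> a" s] X by (auto simp: L_zero)
    fix Y assume "Y \<in> carrier L"
    then obtain b t where Y: "b \<in> carrier Z" "t \<in> S" "Y = fr b t" by (auto simp: L_carrier)
    note c = c Y(1) Sc[OF Y(2)]
    show "X \<oplus>\<^bsub>L\<^esub> Y \<in> carrier L" using X Y c by (simp add: rules)
    show "X \<oplus>\<^bsub>L\<^esub> Y = Y \<oplus>\<^bsub>L\<^esub> X" using X Y c by (simp add: rules m_comm a_comm)
    fix W assume "W \<in> carrier L"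
    then obtain d w where W: "d \<in> carrier Z" "w \<in> S" "W = fr d w" by (auto simp: L_carrier)
    note c = c W(1) Sc[OF W(2)]
    have "w \<otimes> (t \<otimes> a \<oplus> s \<otimes> b) \<oplus> (s \<otimes> t) \<otimes> d = (t \<otimes> w) \<otimes> a \<oplus> s \<otimes> (w \<otimes> b \<oplus> t \<otimes> d)" "s \<otimes> t \<otimes> w = s \<otimes> (t \<otimes> w)"
      using c by algebra+
    then show "X \<oplus>\<^bsub>L\<^esub> Y \<oplus>\<^bsub>L\<^esub> W = X \<oplus>\<^bsub>L\<^esub> (Y \<oplus>\<^bsub>L\<^esub> W)" using X Y W c by (simp add: rules)
  qed (simp add: rules)
  show "Group.monoid L"
  proof (rule monoidI)
    fix X assume "X \<in> carrier L"
    then obtain a s where X: "a \<in> carrier Z" "s \<in> S" "X = fr a s" by (auto simp: L_carrier)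
    note c = X(1) Sc[OF X(2)]
    show "\<one>\<^bsub>L\<^esub> \<otimes>\<^bsub>L\<^esub> X = X" "X \<otimes>\<^bsub>L\<^esub> \<one>\<^bsub>L\<^esub> = X" using X c by (simp_all add: rules)
    fix Y assume "Y \<in> carrier L"
    then obtain b t where Y: "b \<in> carrier Z" "t \<in> S" "Y = fr b t" by (auto simp: L_carrier)
    note c = c Y(1) Sc[OF Y(2)]
    show "X \<otimes>\<^bsub>L\<^esub> Y \<in> carrier L" using X Y c by (simp add: rules)
    fix W assume "W \<in> carrier L"
    then obtain d w where W: "d \<in> carrier Z" "w \<in> S" "W = fr d w" by (auto simp: L_carrier)
    show "X \<otimes>\<^bsub>L\<^esub> Y \<otimes>\<^bsub>L\<^esub> W = X \<otimes>\<^bsub>L\<^esub> (Y \<otimes>\<^bsub>L\<^esub> W)" using X Y W c Sc[OF W(2)] by (simp add: rules m_assoc)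
  qed (simp add: rules)
  fix X Y W assume "X \<in> carrier L" "Y \<in> carrier L" "W \<in> carrier L"
  then obtain a s b t d w where X: "a \<in> carrier Z" "s \<in> S" "X = fr a s"
    and Y: "b \<in> carrier Z" "t \<in> S" "Y = fr b t" and W: "d \<in> carrier Z" "w \<in> S" "W = fr d w"
    unfolding L_carrier by blast
  note c = X(1) Y(1) W(1) Sc[OF X(2)] Sc[OF Y(2)] Sc[OF W(2)]
  have "fr ((t \<otimes> a \<oplus> s \<otimes> b) \<otimes> d) (s \<otimes> t \<otimes> w) =
      fr ((t \<otimes> w) \<otimes> (a \<otimes> d) \<oplus> (s \<otimes> w) \<otimes> (b \<otimes> d)) ((s \<otimes> w) \<otimes> (t \<otimes> w))"
    by (rule fr_eq_of) (use c X Y W S(3) in \<open>simp_all\<close>, algebra)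
  then show "(X \<oplus>\<^bsub>L\<^esub> Y) \<otimes>\<^bsub>L\<^esub> W = X \<otimes>\<^bsub>L\<^esub> W \<oplus>\<^bsub>L\<^esub> Y \<otimes>\<^bsub>L\<^esub> W" using X Y W c by (simp add: rules)
  have "fr (d \<otimes> (t \<otimes> a \<oplus> s \<otimes> b)) (w \<otimes> (s \<otimes> t)) =
      fr ((w \<otimes> t) \<otimes> (d \<otimes> a) \<oplus> (w \<otimes> s) \<otimes> (d \<otimes> b)) ((w \<otimes> s) \<otimes> (w \<otimes> t))"
    by (rule fr_eq_of) (use c X Y W S(3) in \<open>simp_all\<close>, algebra)
  then show "W \<otimes>\<^bsub>L\<^esub> (X \<oplus>\<^bsub>L\<^esub> Y) = W \<otimes>\<^bsub>L\<^esub> X \<oplus>\<^bsub>L\<^esub> W \<otimes>\<^bsub>L\<^esub> Y" using X Y W c by (simp add: rules)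
qed

section \<open>Primes of the localisation\<close>

definition extended :: "'a set \<Rightarrow> ('a \<times> 'a) set set" where
  "extended q = {fr a s | a s. a \<in> q \<and> s \<in> S}"

text \<open>Because \<open>q\<close> is prime and avoids \<open>S\<close>, denominators can be
  cancelled modulo \<open>q\<close>, and membership may be tested on any representative.\<close>

lemma extended_iff:
  assumes q: "prime_two_sided Z q" "q \<inter> S = {}" and a: "a \<in> carrier Z" "s \<in> S"
  shows "fr a s \<in> extended q \<longleftrightarrow> a \<in> q"
proof
  note qd = prime_two_sidedD[OF q(1)] and ql = left_idealD[OF prime_two_sidedD(2)[OF q(1)]]
  assume "fr a s \<in> extended q"
  then obtain b t where b: "b \<in> q" "t \<in> S" "fr a s = fr b t" by (auto simp: extended_def)
  have "(a, s) \<in> fr b t" using fr_self[OF a] b(3) by simp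
  then obtain u where u: "u \<in> S" "u \<otimes> (s \<otimes> b) = u \<otimes> (t \<otimes> a)" by (auto simp: fr_mem)
  have "u \<otimes> (t \<otimes> a) \<in> q" unfolding u(2)[symmetric] using ql(4) Sc u(1) a(2) b(1) by simp
  then have ut: "(u \<otimes> t) \<otimes> a \<in> q" using Sc u(1) b(2) a(1) by (simp add: m_assoc)
  have utS: "u \<otimes> t \<in> S" using S(3) u(1) b(2) by blast
  have "(u \<otimes> t) \<otimes> (r \<otimes> a) \<in> q" if "r \<in> carrier Z" for r
  proof -
    have "(u \<otimes> t) \<otimes> (r \<otimes> a) = r \<otimes> ((u \<otimes> t) \<otimes> a)" using Sc[OF utS] that a(1) by (simp add: m_lcomm)
    then show ?thesis using ql(4)[OF that ut] by simp
  qed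
  then show "a \<in> q" using qd(4)[OF Sc[OF utS] a(1)] utS q(2) by blast
next
  assume "a \<in> q" then show "fr a s \<in> extended q" using a by (auto simp: extended_def)
qed

lemma extended_prime:
  assumes q: "prime_two_sided Z q" "q \<inter> S = {}" shows "prime_ideal (extended q) L"
proof -
  interpret L: ring L by (rule localisation_ring)
  note qd = prime_two_sidedD[OF q(1)] and ql = left_idealD[OF prime_two_sidedD(2)[OF q(1)]]
  note iff = extended_iff[OF q]
  have rep: "\<exists>a\<in>q. \<exists>s\<in>S. X = fr a s" if "X \<in> extended q" for X using that by (auto simp: extended_def)
  have "two_sided L (extended q)"
    unfolding two_sided_def left_ideal_def
  proof (intro conjI ballI)
    show "extended q \<subseteq> carrier L" using fr_closed ql(1) by (auto simp: extended_def)
    show "\<zero>\<^bsub>L\<^esub> \<in> extended q" unfolding L_zero using iff S(2) ql(2) by simp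
    fix X assume "X \<in> extended q"
    then obtain a s where X: "a \<in> q" "s \<in> S" "X = fr a s" using rep by blast
    note ac = ql(1)[OF X(1)] Sc[OF X(2)]
    { fix Y assume "Y \<in> extended q"
      then obtain b t where Y: "b \<in> q" "t \<in> S" "Y = fr b t" using rep by blast
      show "X \<oplus>\<^bsub>L\<^esub> Y \<in> extended q"
        using X Y ac ql(1)[OF Y(1)] Sc[OF Y(2)] S(3) ql(3,4) iff by (simp add: L_add)
    next
      fix Y assume "Y \<in> carrier L"
      then obtain b t where Y: "b \<in> carrier Z" "t \<in> S" "Y = fr b t" by (auto simp: L_carrier)
      show "Y \<otimes>\<^bsub>L\<^esub> X \<in> extended q" using X Y ac Sc[OF Y(2)] S(3) ql(4) iff by (simp add: L_mult)
      show "X \<otimes>\<^bsub>L\<^esub> Y \<in> extended q"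
        using X Y ac Sc[OF Y(2)] S(3) ql(4)[OF Y(1) X(1)] iff by (simp add: L_mult m_comm[of a b])
    }
  qed
  moreover have "\<one>\<^bsub>L\<^esub> \<notin> extended q" unfolding L_one using iff S(2) qd(3) by simp
  moreover have "X \<in> extended q \<or> Y \<in> extended q"
    if XY: "X \<in> carrier L" "Y \<in> carrier L" "\<forall>W\<in>carrier L. X \<otimes>\<^bsub>L\<^esub> (W \<otimes>\<^bsub>L\<^esub> Y) \<in> extended q" for X Y
  proof -
    obtain a s where X: "a \<in> carrier Z" "s \<in> S" "X = fr a s" using XY by (auto simp: L_carrier)
    obtain b t where Y: "b \<in> carrier Z" "t \<in> S" "Y = fr b t" using XY by (auto simp: L_carrier)
    have "a \<otimes> (r \<otimes> b) \<in> q" if r: "r \<in> carrier Z" for r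
    proof -
      have "X \<otimes>\<^bsub>L\<^esub> (fr r \<one> \<otimes>\<^bsub>L\<^esub> Y) \<in> extended q" using XY(3) fr_closed[OF r S(2)] by blast
      then show ?thesis using X Y r S Sc iff by (simp add: L_mult)
    qed
    then show ?thesis using qd(4)[OF X(1) Y(1)] iff X Y by auto
  qed
  ultimately have "prime_two_sided L (extended q)" by (simp add: prime_two_sided_def)
  then show ?thesis by (simp add: L.prime_ideal_iff)
qed

text \<open>A strict chain of primes that avoid \<open>S\<close> stays strict in the localisation,
  since the numerators can be recovered from the fractions.\<close>

lemma Kdim_localisation_ge:
  assumes cs: "sorted_wrt (\<subset>) cs" "length cs = Suc n" and q: "\<And>q. q \<in> set cs \<Longrightarrow> prime_two_sided Z q \<and> q \<inter> S = {}"
  shows "enat n \<le> Kdim L"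
proof -
  let ?C = "\<lambda>i. extended (cs ! i)"
  have "prime_ideal (?C i) L" if "i \<le> n" for i using extended_prime q[of "cs ! i"] that cs(2) by simp
  moreover have "?C i \<subset> ?C (Suc i)" if i: "i < n" for i
  proof -
    have sub: "cs ! i \<subset> cs ! Suc i" using sorted_wrt_nth_less[OF cs(1), of i "Suc i"] i cs(2) by simp
    then obtain a where a: "a \<in> cs ! Suc i" "a \<notin> cs ! i" by blast
    have p: "prime_two_sided Z (cs ! i)" "cs ! i \<inter> S = {}" "prime_two_sided Z (cs ! Suc i)" "cs ! Suc i \<inter> S = {}"
      using q[of "cs ! i"] q[of "cs ! Suc i"] i cs(2) by auto
    have ac: "a \<in> carrier Z" using left_idealD(1)[OF prime_two_sidedD(2)[OF p(3)] a(1)] .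
    have "fr a \<one> \<in> ?C (Suc i)" "fr a \<one> \<notin> ?C i"
      using extended_iff[OF p(1,2) ac S(2)] extended_iff[OF p(3,4) ac S(2)] a by auto
    moreover have "?C i \<subseteq> ?C (Suc i)" using sub by (auto simp: extended_def)
    ultimately show ?thesis by blast
  qed
  ultimately have "\<exists>C. (\<forall>i\<le>n. prime_ideal (C i) L) \<and> (\<forall>i<n. C i \<subset> C (Suc i))" by (intro exI[of _ ?C]) blast
  then show ?thesis unfolding Kdim_def by (intro Sup_upper) blast
qed

end

section \<open>From the Macaulay condition to bounded chains\<close>

context ring
begin

lemma centre_ring_cring: "cring (centre_ring R)"
proof -
  interpret Z: ring "centre_ring R" by (rule centre_ring_ring)
  show ?thesis
    by unfold_locales (auto simp: centre_ring_def centreD)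
qed

lemma central_prime_prime_two_sided:
  assumes "central_prime R q" shows "prime_two_sided (centre_ring R) q"
proof -
  note qd = central_primeD[OF assms] and qi = central_idealD[OF central_primeD(1)[OF assms]]
  have "a \<in> q \<or> b \<in> q" if "a \<in> centre R" "b \<in> centre R" "\<forall>r\<in>centre R. a \<otimes> (r \<otimes> b) \<in> q" for a b
    using qd(3)[OF that(1,2)] that(3)[rule_format, OF centre_one] centreD(1)[OF that(2)] by simp
  then show ?thesis
    using qd(2) qi central_ideal_mult_right[OF qd(1)]
    unfolding prime_two_sided_def two_sided_def left_ideal_def by (auto simp: centre_ring_def)
qed

text \<open>Primes below \<open>m\<close> avoid the complement of \<open>m\<close>, so a chain of
  them survives in the localisation of the centre at \<open>m\<close>, whose dimension is the
  grade.\<close>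

lemma centre_Macaulay_chains:
  assumes "centre_Macaulay R" shows "central_chains_bounded R"
  unfolding central_chains_bounded_def
proof (intro allI impI)
  fix m cs assume m: "central_prime R m" and max: "\<forall>D. central_ideal R D \<longrightarrow> m \<subseteq> D \<longrightarrow> \<one> \<notin> D \<longrightarrow> D = m"
    and cs: "sorted_wrt (\<subset>) cs" "\<forall>c\<in>set cs. central_prime R c \<and> c \<subseteq> m"
  note md = central_primeD[OF m] and mi = central_idealD[OF central_primeD(1)[OF m]]
  interpret Z: cring "centre_ring R" by (rule centre_ring_cring)
  have ops: "carrier (centre_ring R) = centre R" "mult (centre_ring R) = mult R" "one (centre_ring R) = \<one>"
    "add (centre_ring R) = add R" "zero (centre_ring R) = \<zero>"
    by (simp_all add: centre_ring_def)
  have two_sided_central: "central_ideal R J" if "two_sided (centre_ring R) J" for J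
    using that unfolding two_sided_def left_ideal_def central_ideal_def ops by auto
  have "maximalideal m (centre_ring R)"
  proof (rule maximalidealI)
    show "ideal m (centre_ring R)"
      using prime_two_sidedD(1)[OF central_prime_prime_two_sided[OF m]] by (simp add: Z.ideal_iff_two_sided)
    show "carrier (centre_ring R) \<noteq> m" unfolding ops using md(2) centre_one by blast
    fix J assume J: "ideal J (centre_ring R)" "m \<subseteq> J" "J \<subseteq> carrier (centre_ring R)"
    then have T: "two_sided (centre_ring R) J" by (simp add: Z.ideal_iff_two_sided)
    show "J = m \<or> J = carrier (centre_ring R)"
      using max two_sided_central[OF T] J(2) Z.left_ideal_one[OF two_sidedD(1)[OF T]]
      unfolding ops by blast
  qed
  then have K: "enat (centre_grade m R) = Kdim (localisation (centre_ring R) (centre R - m))"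
    using assms unfolding centre_Macaulay_def by blast
  interpret S: multiplicative_subset "centre_ring R" "centre R - m"
  proof unfold_locales
    show "centre R - m \<subseteq> carrier (centre_ring R)" "\<one>\<^bsub>centre_ring R\<^esub> \<in> centre R - m" using md(2) by (auto simp: ops)
    fix a b assume "a \<in> centre R - m" "b \<in> centre R - m"
    then show "a \<otimes>\<^bsub>centre_ring R\<^esub> b \<in> centre R - m" using md(3) centre_mult by (auto simp: ops)
  qed
  show "length cs \<le> Suc (centre_grade m R)"
  proof (cases "length cs")
    \<comment> \<open>A chain of \<open>Suc n\<close> primes has \<open>n\<close> inclusions, and
      dimension counts inclusions.\<close>
    case (Suc n)
    have "enat n \<le> Kdim (localisation (centre_ring R) (centre R - m))"
      by (rule S.Kdim_localisation_ge[OF cs(1) Suc]) (use cs(2) central_prime_prime_two_sided in blast)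
    then show ?thesis using K Suc by (metis Suc_le_mono enat_ord_simps(1))
  qed simp
qed

end

section \<open>Grades of torsion-free modules over R/P\<close>

context prime_of_central_finite
begin

text \<open>Both grades equal the grade of \<open>\<pp>\<close> exactly when there is a nonzero
  homomorphism to R/I, and for either module this amounts to a nonzero element of R/I killed by
  \<open>P\<close>.\<close>

lemma torsion_free_left_grade:
  fixes B :: "('a set, 'e) module"
  assumes cm: "central_chains_bounded R" and nz: "carrier B \<noteq> {\<zero>\<^bsub>B\<^esub>}"
    and fg: "finitely_generated (R Quot P) B" and tf: "torsion_free_module (R Quot P) B"
  shows "left_grade R (restrict_scalars (\<lambda>r. P +>\<^bsub>R\<^esub> r) B) = enat (centre_grade \<pp> R) \<longleftrightarrow>
    left_grade R (left_quot R P) = enat (centre_grade \<pp> R)"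
proof -
  let ?M = "restrict_scalars (\<lambda>r. P +>\<^bsub>R\<^esub> r) B"
  interpret P: ideal P R using P_ideal(3) by (simp add: ideal_iff_two_sided)
  interpret Q: ring "R Quot P" by (rule P.quotient_is_ring)
  have B: "left_module (R Quot P) B" using tf by (simp add: torsion_free_module_def)
  interpret B: left_module "R Quot P" B by (rule B)
  have hom: "(\<lambda>r. P +> r) \<in> ring_hom R (R Quot P)" using P.rcos_ring_hom by simp
  note h = ring_hom_closed[OF hom] ring_hom_add[OF hom] ring_hom_mult[OF hom] ring_hom_one[OF hom]
  have ops: "carrier ?M = carrier B" "add ?M = add B" "zero ?M = zero B"
    "\<And>r x. r \<odot>\<^bsub>?M\<^esub> x = (P +> r) \<odot>\<^bsub>B\<^esub> x" by (simp_all add: restrict_scalars_def)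
  have "abelian_group ?M"
  proof (rule abelian_groupI)
    fix x assume "x \<in> carrier ?M"
    then show "\<exists>y\<in>carrier ?M. y \<oplus>\<^bsub>?M\<^esub> x = \<zero>\<^bsub>?M\<^esub>"
      unfolding ops by (intro bexI[of _ "\<ominus>\<^bsub>B\<^esub> x"]) (auto simp: B.M.l_neg)
  qed (auto simp: ops B.M.a_ac)
  then have M: "left_module R ?M"
    by (rule left_moduleI[OF ring_axioms], unfold ops)
      (auto simp: h B.smult_l_distr B.smult_r_distr B.smult_assoc1)
  interpret M: resolved_module R ?M by (simp add: resolved_module_def M)
  have zero: "P +> c = \<zero>\<^bsub>R Quot P\<^esub> \<longleftrightarrow> c \<in> P" if "c \<in> carrier R" for c
    using P.a_rcos_const[of c] P.a_rcos_self[OF that] by (auto simp: FactRing_def)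
  have PM: "c \<odot>\<^bsub>?M\<^esub> x = \<zero>\<^bsub>?M\<^esub>" if "c \<in> P" "x \<in> carrier ?M" for c x
    using zero[OF P.Icarr[OF that(1)]] that smult_zero_l[OF B, of x] by (simp add: ops)
  have tfM: "x = \<zero>\<^bsub>?M\<^esub>" if z: "z \<in> centre R" "z \<notin> P" and x: "x \<in> carrier ?M" "z \<odot>\<^bsub>?M\<^esub> x = \<zero>\<^bsub>?M\<^esub>" for z x
  proof -
    note zc = centreD(1)[OF z(1)]
    \<comment> \<open>Central elements outside the prime \<open>P\<close> are regular in R/P, so
      torsion-freeness over R/P lets them be cancelled on \<open>?M\<close>.\<close>
    have "regular_element (R Quot P) (P +> z)"
      unfolding regular_element_def
    proof (intro conjI ballI)
      fix s assume s: "s \<in> carrier (R Quot P)"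
      obtain r where r: "r \<in> carrier R" "s = P +> r" using Quot_carrier_mem[OF P.ideal_axioms s] by metis
      have eq: "(P +> z) \<otimes>\<^bsub>R Quot P\<^esub> s = P +> (z \<otimes> r)" "s \<otimes>\<^bsub>R Quot P\<^esub> (P +> z) = P +> (z \<otimes> r)"
        using h(3)[OF zc r(1)] h(3)[OF r(1) zc] r(2) centreD(2)[OF z(1) r(1)] by auto
      have "P +> (z \<otimes> r) = \<zero>\<^bsub>R Quot P\<^esub> \<longrightarrow> s = \<zero>\<^bsub>R Quot P\<^esub>"
        using zero[of "z \<otimes> r"] zero[OF r(1)] prime_central_mult[OF P z r(1)] zc r by simp
      then show "(P +> z) \<otimes>\<^bsub>R Quot P\<^esub> s = \<zero>\<^bsub>R Quot P\<^esub> \<longrightarrow> s = \<zero>\<^bsub>R Quot P\<^esub>"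
        "s \<otimes>\<^bsub>R Quot P\<^esub> (P +> z) = \<zero>\<^bsub>R Quot P\<^esub> \<longrightarrow> s = \<zero>\<^bsub>R Quot P\<^esub>" unfolding eq by auto
    qed (rule h(1)[OF zc])
    then show ?thesis using tf x by (simp add: torsion_free_module_def ops)
  qed
  obtain A where A: "A \<subseteq> carrier B" "finite A" "module_span (R Quot P) B A = carrier B"
    using fg by (auto simp: finitely_generated_def)
  have gen: "N = carrier ?M" if N: "submodule N R ?M" "A \<subseteq> N" for N
  proof -
    note Nd = submoduleD[OF N(1), unfolded ops]
    have "submodule N (R Quot P) B"
    proof (rule submodule_of_left_moduleI[OF B])
      fix s x assume s: "s \<in> carrier (R Quot P)" and x: "x \<in> N"
      obtain r where r: "r \<in> carrier R" "s = P +> r" using Quot_carrier_mem[OF P.ideal_axioms s] by metis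
      then show "s \<odot>\<^bsub>B\<^esub> x \<in> N" using Nd(4)[OF r(1) x] by simp
    qed (use Nd in auto)
    then have "carrier B \<subseteq> N" using A(3) N(2) unfolding module_span_def by blast
    then show ?thesis using Nd(1) by (auto simp: ops)
  qed
  obtain xs where xs: "length xs = centre_grade \<pp> R" "regular_sequence R {\<zero>} xs" "set xs \<subseteq> \<pp>"
    "left_ideal R (seq_ideal R {\<zero>} xs)"
    using grade_sequence by metis
  let ?I = "seq_ideal R {\<zero>} xs"
  interpret L: resolved_module R "left_quot R P" by (rule left_quot_resolved[OF P_ideal(1)])
  have gM: "left_grade R ?M = enat (centre_grade \<pp> R) \<longleftrightarrow> \<not> M.Ext_injective 0 ?I \<zero>"
    using M.left_grade_regular_sequence(2)[OF xs(2)] PM xs(1,3) by auto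
  have gL: "left_grade R (left_quot R P) = enat (centre_grade \<pp> R) \<longleftrightarrow> \<not> L.Ext_injective 0 ?I \<zero>"
    using L.left_grade_regular_sequence(2)[OF xs(2)] left_quot_annihilated[OF P_ideal(3)] xs(1,3) by auto
  show ?thesis
  proof
    \<comment> \<open>A nonzero value of a homomorphism on \<open>?M\<close> is killed by
      \<open>P\<close>, so it is also the image of 1 under a homomorphism from R/P.\<close>
    assume "left_grade R ?M = enat (centre_grade \<pp> R)"
    then have "\<not> M.Ext_injective 0 ?I \<zero>" using gM by simp
    then obtain n where n: "n \<in> carrier R" "n \<notin> ?I"
      "\<And>c. c \<in> carrier R \<Longrightarrow> (\<And>m. m \<in> carrier ?M \<Longrightarrow> c \<odot>\<^bsub>?M\<^esub> m = \<zero>\<^bsub>?M\<^esub>) \<Longrightarrow> c \<otimes> n \<in> ?I"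
      using M.not_Ext_injective_0E[OF xs(4) _ centre_zero] by blast
    have "c \<otimes> n \<in> ?I" if "c \<in> P" for c using n(3)[OF P.Icarr[OF that]] PM[OF that] by blast
    then show "left_grade R (left_quot R P) = enat (centre_grade \<pp> R)"
      using left_grade_left_quot_attained[OF P_ideal(3) xs(2) _ n(1,2)] xs(1,3) by auto
  next
    assume "left_grade R (left_quot R P) = enat (centre_grade \<pp> R)"
    then have nL: "\<not> L.Ext_injective 0 ?I \<zero>" using gL by simp
    have "\<exists>n\<in>carrier R. n \<notin> ?I \<and> (\<forall>c\<in>P. c \<otimes> n \<in> ?I)"
    proof (rule L.not_Ext_injective_0E[OF xs(4) nL centre_zero])
      fix n assume n: "n \<in> carrier R" "n \<notin> ?I"
        and ann: "\<And>c. c \<in> carrier R \<Longrightarrow> (\<And>m. m \<in> carrier (left_quot R P) \<Longrightarrow>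
          c \<odot>\<^bsub>left_quot R P\<^esub> m = \<zero>\<^bsub>left_quot R P\<^esub>) \<Longrightarrow> c \<otimes> n \<in> ?I"
      have "c \<otimes> n \<in> ?I" if "c \<in> P" for c
        by (rule ann[OF P.Icarr[OF that] left_quot_annihilated[OF P_ideal(3) that]])
      then show ?thesis using n by blast
    qed
    then obtain n where n: "n \<in> carrier R" "n \<notin> ?I" and Pn: "\<And>c. c \<in> P \<Longrightarrow> c \<otimes> n \<in> ?I" by blast
    have "\<not> M.Ext_injective 0 ?I \<zero>"
    proof (rule torsion_free_not_Ext_injective[OF cm xs(2,3) n(1,2) Pn M _ PM tfM A(2) _ gen])
      show "carrier ?M \<noteq> {\<zero>\<^bsub>?M\<^esub>}" using nz by (simp add: ops)
      show "A \<subseteq> carrier ?M" using A(1) by (simp add: ops)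
    qed
    then show "left_grade R ?M = enat (centre_grade \<pp> R)" using gM by simp
  qed
qed

end

section \<open>The opposite ring\<close>

lemma opp_ring_simps:
  "carrier (opp_ring R) = carrier R" "x \<otimes>\<^bsub>opp_ring R\<^esub> y = y \<otimes>\<^bsub>R\<^esub> x" "\<one>\<^bsub>opp_ring R\<^esub> = \<one>\<^bsub>R\<^esub>"
  "\<zero>\<^bsub>opp_ring R\<^esub> = \<zero>\<^bsub>R\<^esub>" "add (opp_ring R) = add R"
  by (simp_all add: opp_ring_def)

lemma opp_opp_ring [simp]: "opp_ring (opp_ring R) = R"
  by (simp add: opp_ring_def)

lemma centre_opp_ring [simp]: "centre (opp_ring R) = centre R"
  by (auto simp: centre_def opp_ring_simps)

lemma noetherian_opp_ring: "noetherian (opp_ring R) \<longleftrightarrow> noetherian R"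
  by (auto simp: noetherian_def)

text \<open>Right modules over R/Q are modules over \<open>opp_ring (R Quot Q)\<close>, whereas
  results for the opposite ring speak of \<open>opp_ring R Quot Q\<close>.\<close>

lemma opp_ring_Quot: "opp_ring R Quot I = opp_ring (R Quot I)"
proof -
  have "rcoset_mult (opp_ring R) I A B = rcoset_mult R I B A" for A B
    by (auto simp: rcoset_mult_def opp_ring_simps a_r_coset_def')
  then show ?thesis
    by (simp add: FactRing_def opp_ring_def A_RCOSETS_def' a_r_coset_def' set_add_def' fun_eq_iff)
qed

lemma a_r_coset_opp_ring: "I +>\<^bsub>opp_ring R\<^esub> r = I +>\<^bsub>R\<^esub> r"
  by (simp add: a_r_coset_def' opp_ring_simps)

lemma central_ideal_opp_ring [simp]: "central_ideal (opp_ring R) C \<longleftrightarrow> central_ideal R C"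
proof (cases "C \<subseteq> centre R")
  case True
  have "c \<otimes>\<^bsub>R\<^esub> z \<in> C \<longleftrightarrow> z \<otimes>\<^bsub>R\<^esub> c \<in> C" if "z \<in> centre R" "c \<in> C" for z c
    using centreD(2)[OF that(1), of c] centreD(1)[of c R] that(2) True by auto
  then have "(\<forall>z\<in>centre R. \<forall>c\<in>C. c \<otimes>\<^bsub>R\<^esub> z \<in> C) \<longleftrightarrow> (\<forall>z\<in>centre R. \<forall>c\<in>C. z \<otimes>\<^bsub>R\<^esub> c \<in> C)"
    by blast
  then show ?thesis unfolding central_ideal_def centre_opp_ring opp_ring_simps by blast
next
  case False
  then show ?thesis by (simp add: central_ideal_def)
qed

lemma central_prime_opp_ring [simp]: "central_prime (opp_ring R) q \<longleftrightarrow> central_prime R q"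
  unfolding central_prime_def central_ideal_opp_ring centre_opp_ring opp_ring_simps by blast

lemma two_sided_opp_ring [simp]: "two_sided (opp_ring R) I \<longleftrightarrow> two_sided R I"
  unfolding two_sided_def left_ideal_def opp_ring_simps by blast

lemma (in ring) prime_two_sided_opp_ring:
  "prime_two_sided (opp_ring R) Q \<longleftrightarrow> prime_two_sided R Q"
proof -
  have "(\<forall>r\<in>carrier R. (b \<otimes> r) \<otimes> a \<in> Q) \<longleftrightarrow> (\<forall>r\<in>carrier R. b \<otimes> (r \<otimes> a) \<in> Q)"
    if "a \<in> carrier R" "b \<in> carrier R" for a b using that by (simp add: m_assoc)
  then show ?thesis
    unfolding prime_two_sided_def two_sided_opp_ring opp_ring_simps by blast
qed

lemma sum_xR_opp_ring:
  assumes "set xs \<subseteq> centre R" shows "sum_xR (opp_ring R) xs = sum_xR R xs"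
  using assms
proof (induction xs)
  case (Cons x xs)
  have "x \<otimes>\<^bsub>R\<^esub> r = r \<otimes>\<^bsub>R\<^esub> x" if "r \<in> carrier R" for r
    using centreD(2)[of x R r] that Cons.prems by simp
  then have "{x \<otimes>\<^bsub>R\<^esub> r \<oplus>\<^bsub>R\<^esub> y |r y. r \<in> carrier R \<and> y \<in> sum_xR R xs} = {r \<otimes>\<^bsub>R\<^esub> x \<oplus>\<^bsub>R\<^esub> y |r y. r \<in> carrier R \<and> y \<in> sum_xR R xs}"
    by metis
  then show ?case using Cons by (simp add: opp_ring_simps)
qed (simp add: opp_ring_simps)

lemma centre_sequence_opp_ring: "centre_sequence (opp_ring R) xs \<longleftrightarrow> centre_sequence R xs"
proof (cases "set xs \<subseteq> centre R")
  case True
  have s: "sum_xR (opp_ring R) (take i xs) = sum_xR R (take i xs)" for i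
    by (rule sum_xR_opp_ring) (use True set_take_subset[of i xs] in blast)
  have comm: "xs ! i \<otimes>\<^bsub>R\<^esub> r = r \<otimes>\<^bsub>R\<^esub> xs ! i" if "i < length xs" "r \<in> carrier R" for i r
  proof (rule centreD(2)[OF _ that(2)])
    show "xs ! i \<in> centre R" using True nth_mem[OF that(1)] by blast
  qed
  show ?thesis
    unfolding centre_sequence_def s sum_xR_opp_ring[OF True] opp_ring_simps centre_opp_ring
    by (simp add: comm)
next
  case False
  then show ?thesis by (simp add: centre_sequence_def)
qed

lemma centre_grade_opp_ring [simp]: "centre_grade I (opp_ring R) = centre_grade I R"
  by (simp add: centre_grade_def maximal_centre_sequence_def centre_sequence_opp_ring)

lemma central_chains_bounded_opp_ring: "central_chains_bounded (opp_ring R) \<longleftrightarrow> central_chains_bounded R"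
  by (simp add: central_chains_bounded_def opp_ring_simps)

text \<open>The two scalar multiplications differ as functions and agree only for central scalars on
  the carrier; hence the comparison through submodules and spans.\<close>

lemma finite_over_centre_opp_ring:
  assumes "finite_over_centre R" shows "finite_over_centre (opp_ring R)"
proof -
  have "submodule N (centre_ring (opp_ring R)) (reg_module (opp_ring R)) \<longleftrightarrow> submodule N (centre_ring R) (reg_module R)" for N
  proof -
    have add: "add_monoid (reg_module (opp_ring R)) = add_monoid (reg_module R)"
      by (simp add: reg_module_def opp_ring_def)
    have "(z \<odot>\<^bsub>reg_module (opp_ring R)\<^esub> x) = (z \<odot>\<^bsub>reg_module R\<^esub> x)"
      if "z \<in> centre R" "x \<in> carrier R" for z x
      using centreD(2)[OF that] by (simp add: reg_module_def opp_ring_simps)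
    moreover have "N \<subseteq> carrier R" if "subgroup N (add_monoid (reg_module R))"
      using subgroup.subset[OF that] by (simp add: reg_module_def)
    moreover have "carrier (centre_ring (opp_ring R)) = centre R" "carrier (centre_ring R) = centre R"
      by (simp_all add: centre_ring_def)
    ultimately show ?thesis
      unfolding submodule_def submodule_axioms_def add by (metis subsetD)
  qed
  then show ?thesis
    using assms
    unfolding finite_over_centre_def finitely_generated_def module_span_def
    by (simp add: reg_module_def opp_ring_simps)
qed

lemma (in ring) maximalideal_opp_ring: "maximalideal I (opp_ring R) \<longleftrightarrow> maximalideal I R"
proof -
  interpret O: ring "opp_ring R" by (rule ring_opp_ring[OF ring_axioms])
  have "ideal J (opp_ring R) \<longleftrightarrow> ideal J R" for J
    by (simp add: O.ideal_iff_two_sided ideal_iff_two_sided)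
  then show ?thesis
    by (simp add: maximalideal_def maximalideal_axioms_def opp_ring_simps)
qed

lemma (in central_finite) central_finite_opp_ring: "central_finite (opp_ring R)"
proof -
  interpret O: ring "opp_ring R" by (rule ring_opp_ring[OF ring_axioms])
  show ?thesis
    by unfold_locales (use noeth fin noetherian_opp_ring finite_over_centre_opp_ring in auto)
qed

lemma (in prime_of_central_finite) prime_of_central_finite_opp_ring: "prime_of_central_finite (opp_ring R) P"
  using central_finite_opp_ring P prime_two_sided_opp_ring
  by (simp add: prime_of_central_finite_def prime_of_central_finite_axioms_def)

lemma left_quot_opp_ring: "left_quot (opp_ring R) Q = right_quot R Q"
  by (simp add: right_quot_def left_quot_def)

theorem lemma4p5:
  fixes R :: "('a, 'm) ring_scheme" and P \<pp> :: "'a set"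
  assumes "ring R" and "noetherian R" and "finite_over_centre R"
    and "prime_ideal P R" and "\<pp> = P \<inter> centre R"
  shows
    "enat (centre_grade \<pp> R) \<le> min (left_grade R (left_quot R P)) (right_grade R (right_quot R P))
   \<and> (maximalideal P R \<longrightarrow>
        (\<exists>Q. maximalideal Q R \<and> Q \<inter> centre R = \<pp> \<and> enat (centre_grade \<pp> R) = left_grade R (left_quot R Q))
      \<and> (\<exists>Q'. maximalideal Q' R \<and> Q' \<inter> centre R = \<pp> \<and> enat (centre_grade \<pp> R) = right_grade R (right_quot R Q')))
   \<and> (centre_Macaulay R \<longrightarrow>
        ((\<exists>Q. prime_ideal Q R \<and> Q \<inter> centre R = \<pp> \<and> enat (centre_grade \<pp> R) = left_grade R (left_quot R Q))
       \<and> (\<exists>Q'. prime_ideal Q' R \<and> Q' \<inter> centre R = \<pp> \<and> enat (centre_grade \<pp> R) = right_grade R (right_quot R Q')))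
      \<and> (\<forall>Q \<qq> t. prime_ideal Q R \<longrightarrow> \<qq> = Q \<inter> centre R \<longrightarrow> t = centre_grade \<qq> R \<longrightarrow>
           enat t = left_grade R (left_quot R Q) \<longrightarrow>
             (\<forall>z\<in>\<qq>. \<forall>e\<in>carrier (Ext R (left_quot R Q) (reg_module R) t).
                z \<odot>\<^bsub>Ext R (left_quot R Q) (reg_module R) t\<^esub> e = \<zero>\<^bsub>Ext R (left_quot R Q) (reg_module R) t\<^esub>)
           \<and> torsion_free_module (centre_ring R Quot \<qq>)
               (descend_scalars (Ext R (left_quot R Q) (reg_module R) t)))
      \<and> (\<forall>Q \<qq> t. prime_ideal Q R \<longrightarrow> \<qq> = Q \<inter> centre R \<longrightarrow> t = centre_grade \<qq> R \<longrightarrow>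
           (\<forall>B :: ('a set, 'b) module.
              carrier B \<noteq> {\<zero>\<^bsub>B\<^esub>} \<longrightarrow> finitely_generated (R Quot Q) B \<longrightarrow>
              torsion_free_module (R Quot Q) B \<longrightarrow>
                (left_grade R (restrict_scalars (\<lambda>r. Q +>\<^bsub>R\<^esub> r) B) = enat t \<longleftrightarrow>
                 left_grade R (left_quot R Q) = enat t))
         \<and> (\<forall>B :: ('a set, 'c) module.
              carrier B \<noteq> {\<zero>\<^bsub>B\<^esub>} \<longrightarrow> finitely_generated (opp_ring (R Quot Q)) B \<longrightarrow>
              torsion_free_module (opp_ring (R Quot Q)) B \<longrightarrow>
                (right_grade R (restrict_scalars (\<lambda>r. Q +>\<^bsub>R\<^esub> r) B) = enat t \<longleftrightarrow>
                 right_grade R (right_quot R Q) = enat t))))"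
proof -
  interpret ring R by fact
  interpret CF: central_finite R by unfold_locales fact+
  interpret O: central_finite "opp_ring R" by (rule CF.central_finite_opp_ring)
  have prime: "prime_of_central_finite R Q" "prime_of_central_finite (opp_ring R) Q" if "prime_ideal Q R" for Q
  proof -
    show "prime_of_central_finite R Q"
      by unfold_locales (use that in \<open>simp add: prime_ideal_iff\<close>)
    then show "prime_of_central_finite (opp_ring R) Q"
      by (rule prime_of_central_finite.prime_of_central_finite_opp_ring)
  qed
  \<comment> \<open>Turns each right-hand statement into the left-hand one over
    \<open>opp_ring R\<close>, which the second interpretation provides.\<close>
  have right: "right_grade R (right_quot R Q) = left_grade (opp_ring R) (left_quot (opp_ring R) Q)" for Q
    by (simp add: right_grade_def left_quot_opp_ring)
  interpret P: prime_of_central_finite R P by (rule prime(1)[OF assms(4)])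
  interpret PO: prime_of_central_finite "opp_ring R" P by (rule prime(2)[OF assms(4)])
  have cm: "central_chains_bounded R" "central_chains_bounded (opp_ring R)" if "centre_Macaulay R"
    using centre_Macaulay_chains[OF that] by (simp_all add: central_chains_bounded_opp_ring)
  have g1: "enat (centre_grade \<pp> R) \<le> min (left_grade R (left_quot R P)) (right_grade R (right_quot R P))"
    using P.grade_le_left_grade PO.grade_le_left_grade by (simp add: right assms(5))
  have g2: "\<exists>Q. maximalideal Q R \<and> Q \<inter> centre R = \<pp> \<and> enat (centre_grade \<pp> R) = left_grade R (left_quot R Q)"
    if "maximalideal P R"
    using P.exists_maximal_with_grade[OF that] assms(5) by metis
  have g2r: "\<exists>Q. maximalideal Q R \<and> Q \<inter> centre R = \<pp> \<and> enat (centre_grade \<pp> R) = right_grade R (right_quot R Q)"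
    if "maximalideal P R"
    using PO.exists_maximal_with_grade that assms(5) unfolding right maximalideal_opp_ring centre_opp_ring centre_grade_opp_ring
    by metis
  have g3: "\<exists>Q. prime_ideal Q R \<and> Q \<inter> centre R = \<pp> \<and> enat (centre_grade \<pp> R) = left_grade R (left_quot R Q)"
    if "centre_Macaulay R"
    using P.exists_prime_with_grade cm(1)[OF that] assms(5) unfolding prime_ideal_iff by metis
  have g3r: "\<exists>Q. prime_ideal Q R \<and> Q \<inter> centre R = \<pp> \<and> enat (centre_grade \<pp> R) = right_grade R (right_quot R Q)"
    if "centre_Macaulay R"
    using PO.exists_prime_with_grade cm(2)[OF that] assms(5)
    unfolding prime_ideal_iff right prime_two_sided_opp_ring centre_opp_ring centre_grade_opp_ring by metis
  have g5: "left_grade R (restrict_scalars (\<lambda>r. Q +>\<^bsub>R\<^esub> r) B) = enat (centre_grade (Q \<inter> centre R) R) \<longleftrightarrow>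
      left_grade R (left_quot R Q) = enat (centre_grade (Q \<inter> centre R) R)"
    if "centre_Macaulay R" "prime_ideal Q R" "carrier B \<noteq> {\<zero>\<^bsub>B\<^esub>}" "finitely_generated (R Quot Q) B"
      "torsion_free_module (R Quot Q) B" for Q and B :: "('a set, 'b) module"
    by (rule prime_of_central_finite.torsion_free_left_grade[OF prime(1)[OF that(2)] cm(1)[OF that(1)] that(3-5)])
  have g5r: "right_grade R (restrict_scalars (\<lambda>r. Q +>\<^bsub>R\<^esub> r) B) = enat (centre_grade (Q \<inter> centre R) R) \<longleftrightarrow>
      right_grade R (right_quot R Q) = enat (centre_grade (Q \<inter> centre R) R)"
    if "centre_Macaulay R" "prime_ideal Q R" "carrier B \<noteq> {\<zero>\<^bsub>B\<^esub>}" "finitely_generated (opp_ring (R Quot Q)) B"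
      "torsion_free_module (opp_ring (R Quot Q)) B" for Q and B :: "('a set, 'c) module"
    \<comment> \<open>The left-hand result over \<open>opp_ring R\<close>, with quotient, cosets,
      centre and grade of the opposite ring rewritten into those of \<open>R\<close>.\<close>
    unfolding right_grade_def
    by (rule prime_of_central_finite.torsion_free_left_grade[OF prime(2)[OF that(2)] cm(2)[OF that(1)] that(3),
          unfolded opp_ring_Quot a_r_coset_opp_ring centre_opp_ring centre_grade_opp_ring left_quot_opp_ring, OF that(4,5)])
  show ?thesis
  proof (intro conjI impI allI ballI)
    fix Q \<qq> t z e
    assume "prime_ideal Q R" "\<qq> = Q \<inter> centre R" "z \<in> \<qq>" "e \<in> carrier (Ext R (left_quot R Q) (reg_module R) t)"
    then show "z \<odot>\<^bsub>Ext R (left_quot R Q) (reg_module R) t\<^esub> e = \<zero>\<^bsub>Ext R (left_quot R Q) (reg_module R) t\<^esub>"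
      using prime_of_central_finite.Ext_annihilated[OF prime(1)] by blast
  next
    fix Q \<qq> t
    assume "centre_Macaulay R" "prime_ideal Q R" "\<qq> = Q \<inter> centre R" "t = centre_grade \<qq> R"
    then show "torsion_free_module (centre_ring R Quot \<qq>) (descend_scalars (Ext R (left_quot R Q) (reg_module R) t))"
      using prime_of_central_finite.Ext_torsion_free[OF prime(1) cm(1)] by blast
  next
    fix Q \<qq> t and B :: "('a set, 'b) module"
    assume "centre_Macaulay R" "prime_ideal Q R" "\<qq> = Q \<inter> centre R" "t = centre_grade \<qq> R"
      "carrier B \<noteq> {\<zero>\<^bsub>B\<^esub>}" "finitely_generated (R Quot Q) B" "torsion_free_module (R Quot Q) B"
    then show "left_grade R (restrict_scalars (\<lambda>r. Q +>\<^bsub>R\<^esub> r) B) = enat t \<longleftrightarrow> left_grade R (left_quot R Q) = enat t"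
      using g5[of Q B] by simp
  next
    fix Q \<qq> t and B :: "('a set, 'c) module"
    assume "centre_Macaulay R" "prime_ideal Q R" "\<qq> = Q \<inter> centre R" "t = centre_grade \<qq> R"
      "carrier B \<noteq> {\<zero>\<^bsub>B\<^esub>}" "finitely_generated (opp_ring (R Quot Q)) B"
      "torsion_free_module (opp_ring (R Quot Q)) B"
    then show "right_grade R (restrict_scalars (\<lambda>r. Q +>\<^bsub>R\<^esub> r) B) = enat t \<longleftrightarrow> right_grade R (right_quot R Q) = enat t"
      using g5r[of Q B] by simp
  qed (rule g1 g2 g2r g3 g3r; assumption?)+
qed

end
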